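(* Let $n,l\ge 1$ be integers with $2l+n\ge 6$, let $\Omega\subseteq\mathbb{R}^n$ be a bounded domain, and let $\lambda^{(l)}_1\le\lambda^{(l)}_2\le\cdots$ be the eigenvalues of the Dirichlet problem for the poly-Laplacian $(-\Delta)^l$ on $\Omega$. Then for every integer $k\ge 1$ $$\begin{aligned}\sum_{i=1}^k\lambda^{(l)}_i \geq{}&\frac{n}{n+2l}\frac{(2\pi)^{2l}}{(\omega_nV)^{\frac{2l}{n}}}k^{\frac{2l+n}{n}}+\frac{5l}{2 (2l+n)\rho^2}\omega_n^{-\frac{2l-2}{n}}\alpha^{\frac{2n-2l+2}{n}}k^{\frac{2l+n-2}{n}}\\ &-\frac{31l\,\omega_n\alpha^{\frac{3n-2l+3}{n}}}{9(2l+n)\rho^3}\left(\frac{k}{\omega_n} \right)^{\frac{2l+n-3}{n}}+\frac{5l\,\omega_n\alpha^{\frac{4n-2l+4}{n}}}{8(2l+n)\rho^4}\left(\frac{k}{\omega_n} \right)^{\frac{2l+n-4}{n}}\\ &+\frac{38l\,\omega_n\alpha^{\frac{5n-2l+5}{n}}}{25(2l+n)\rho^5}\left(\frac{k}{\omega_n} \right)^{\frac{2l+n-5}{n}}-\frac{317l\,\omega_n\alpha^{\frac{6n-2l+6}{n}}}{420(2l+n)\rho^6}\left(\frac{k}{\omega_n} \right)^{\frac{2l+n-6}{n}}.\end{aligned}$$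
   Context: Eigenvalue problem: $(-\Delta)^l u=\lambda^{(l)}u$ in $\Omega$, $u=\frac{\partial u}{\partial\nu}=\cdots=\frac{\partial^{l-1}u}{\partial\nu^{l-1}}=0$ on $\partial\Omega$ (Dirichlet conditions, understood in the usual weak sense $u\in H^l_0(\Omega)$). The spectrum is real and discrete, $0<\lambda^{(l)}_1\le\lambda^{(l)}_2\le\cdots\to\infty$, each eigenvalue repeated according to its finite multiplicity. Notation: $V=V(\Omega)$ is the volume of $\Omega$; $\omega_n$ is the volume of the unit ball of $\mathbb{R}^n$; $I=I(\Omega)=\int_\Omega|x|^2dx$; $\alpha=(2\pi)^{-n}V$; $\rho=2(2\pi)^{-n}\sqrt{VI}$. *)

theory Defs
  imports "HOL-Analysis.Analysis"
begin

definition partial :: "'n::finite \<Rightarrow> (real^'n \<Rightarrow> real) \<Rightarrow> real^'n \<Rightarrow> real" where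
  "partial i f = (\<lambda>x. frechet_derivative f (at x) (axis i 1))"

text \<open>A partial derivative of order \<open>m\<close> is given by the list of the \<open>m\<close> directions of
  differentiation. Lists of length at most \<open>m\<close> represent every multi-index of order at most \<open>m\<close>,
  some of them several times, which affects Sobolev norms only up to equivalence.\<close>

definition partials :: "'n::finite list \<Rightarrow> (real^'n \<Rightarrow> real) \<Rightarrow> real^'n \<Rightarrow> real" where
  "partials is f = foldr partial is f"

text \<open>Differentiability of all iterated partial derivatives makes each of them continuous, so the
  following is the class of infinitely often continuously differentiable functions.\<close>

definition smooth :: "(real^'n::finite \<Rightarrow> real) \<Rightarrow> bool" where
  "smooth f \<longleftrightarrow> (\<forall>is x. partials is f differentiable (at x))"

definition test_functions :: "(real^'n::finite) set \<Rightarrow> (real^'n \<Rightarrow> real) set" where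
  "test_functions \<Omega> =
     {\<phi>. smooth \<phi> \<and> compact (closure {x. \<phi> x \<noteq> 0}) \<and> closure {x. \<phi> x \<noteq> 0} \<subseteq> \<Omega>}"

definition L2 :: "(real^'n::finite) set \<Rightarrow> (real^'n \<Rightarrow> real) set" where
  "L2 \<Omega> = {u. u \<in> borel_measurable (lebesgue_on \<Omega>) \<and>
              integrable (lebesgue_on \<Omega>) (\<lambda>x. (u x)\<^sup>2)}"

definition weak_partials ::
  "(real^'n::finite) set \<Rightarrow> 'n list \<Rightarrow> (real^'n \<Rightarrow> real) \<Rightarrow> (real^'n \<Rightarrow> real) \<Rightarrow> bool" where
  "weak_partials \<Omega> is u g \<longleftrightarrow>
     (\<forall>\<phi>\<in>test_functions \<Omega>.
        (\<integral>x. u x * partials is \<phi> x \<partial>lebesgue_on \<Omega>)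
          = (-1) ^ length is * (\<integral>x. g x * \<phi> x \<partial>lebesgue_on \<Omega>))"

text \<open>\<open>H0 l \<Omega>\<close> is the closure of the test functions in the Sobolev space of functions in \<open>L2 \<Omega>\<close>
  whose weak derivatives up to order \<open>l\<close> exist in \<open>L2 \<Omega>\<close>. As usual, functions that agree almost
  everywhere on \<open>\<Omega>\<close> represent the same element; values outside \<open>\<Omega>\<close> are irrelevant.\<close>

definition H0 :: "nat \<Rightarrow> (real^'n::finite) set \<Rightarrow> (real^'n \<Rightarrow> real) set" where
  "H0 l \<Omega> = {u \<in> L2 \<Omega>. \<exists>\<phi> :: nat \<Rightarrow> real^'n \<Rightarrow> real. (\<forall>j. \<phi> j \<in> test_functions \<Omega>) \<and>
     (\<forall>is. length is \<le> l \<longrightarrow>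
        (\<exists>g\<in>L2 \<Omega>. weak_partials \<Omega> is u g \<and>
           (\<lambda>j. \<integral>x. (partials is (\<phi> j) x - g x)\<^sup>2 \<partial>lebesgue_on \<Omega>) \<longlonglongrightarrow> 0))}"

definition laplacian :: "(real^'n::finite \<Rightarrow> real) \<Rightarrow> real^'n \<Rightarrow> real" where
  "laplacian f = (\<lambda>x. \<Sum>i\<in>UNIV. partial i (partial i f) x)"

definition poly_laplacian :: "nat \<Rightarrow> (real^'n::finite \<Rightarrow> real) \<Rightarrow> real^'n \<Rightarrow> real" where
  "poly_laplacian l = (\<lambda>f x. - laplacian f x) ^^ l"

text \<open>The solutions (including 0) of the Dirichlet problem: the boundary conditions are expressed by
  membership in \<open>H0 l \<Omega>\<close>, and \<open>(-\<Delta>)\<^sup>l u = \<mu> u\<close> holds in \<open>\<Omega>\<close> in the sense of distributions. The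
  operator on the left is formally self-adjoint, so no sign appears.\<close>

definition eigenspace :: "nat \<Rightarrow> (real^'n::finite) set \<Rightarrow> real \<Rightarrow> (real^'n \<Rightarrow> real) set" where
  "eigenspace l \<Omega> \<mu> = {u \<in> H0 l \<Omega>. \<forall>\<phi>\<in>test_functions \<Omega>.
     (\<integral>x. u x * poly_laplacian l \<phi> x \<partial>lebesgue_on \<Omega>) = \<mu> * (\<integral>x. u x * \<phi> x \<partial>lebesgue_on \<Omega>)}"

text \<open>The linear space \<open>E\<close> has dimension \<open>m\<close> modulo equality almost everywhere on \<open>\<Omega>\<close>:
  there is a basis with \<open>m\<close> elements.\<close>

definition ae_dim :: "(real^'n::finite) set \<Rightarrow> (real^'n \<Rightarrow> real) set \<Rightarrow> nat \<Rightarrow> bool" where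
  "ae_dim \<Omega> E m \<longleftrightarrow>
     (\<exists>b :: nat \<Rightarrow> real^'n \<Rightarrow> real. (\<forall>j<m. b j \<in> E) \<and>
        (\<forall>c :: nat \<Rightarrow> real. (AE x in lebesgue_on \<Omega>. (\<Sum>j<m. c j * b j x) = 0) \<longrightarrow> (\<forall>j<m. c j = 0)) \<and>
        (\<forall>u\<in>E. \<exists>c :: nat \<Rightarrow> real. AE x in lebesgue_on \<Omega>. u x = (\<Sum>j<m. c j * b j x)))"

text \<open>\<open>ev 1 \<le> ev 2 \<le> \<dots>\<close> lists all Dirichlet eigenvalues, each repeated according to its finite
  multiplicity; the numbers that are not eigenvalues are those of multiplicity 0, and they do not
  occur in the list. The value \<open>ev 0\<close> plays no role.\<close>

definition dirichlet_eigenvalues :: "nat \<Rightarrow> (real^'n::finite) set \<Rightarrow> (nat \<Rightarrow> real) \<Rightarrow> bool" where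
  "dirichlet_eigenvalues l \<Omega> ev \<longleftrightarrow>
     mono_on {1..} ev \<and>
     (\<forall>\<mu>. finite {i. 1 \<le> i \<and> ev i = \<mu>} \<and>
          ae_dim \<Omega> (eigenspace l \<Omega> \<mu>) (card {i. 1 \<le> i \<and> ev i = \<mu>}))"

definition bounded_domain :: "(real^'n::finite) set \<Rightarrow> bool" where
  "bounded_domain \<Omega> \<longleftrightarrow> open \<Omega> \<and> connected \<Omega> \<and> \<Omega> \<noteq> {} \<and> bounded \<Omega>"

end

(* Extend orthonormal eigenfunctions u_1, ..., u_k by 0 and let g(xi) be the sum of |u_i^(xi)|^2 / V for
   the unnormalised Fourier transform. By Plancherel g has mass k (2 pi)^n / V, the moment of |xi|^(2l) g
   is at most (2 pi)^n / V times the eigenvalue sum, and 0 <= g <= 1 by Bessel. The indicator of the ball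
   with the mass of g would give the leading (Berezin-Li-Yau) term; the corrections come from
   g being Lipschitz with constant (I / V)^(1/2). No rearrangement is used: by the bathtub principle the
   gain is the integral of ||xi|^(2l) - t^(2l)| |g - 1_B| over xi, B the ball of radius t, which is bounded
   below on each ray separately.

   This is too weak for n = 1 and l = 3. For n = 1 the domain is an interval and exponentials with
   frequencies in a translate of (2 pi / V) Z are orthogonal on it, which compares the eigenvalue sum with
   the one for periodic (k even) or antiperiodic (k odd) boundary conditions. *)
theory Submission
  imports Defs "HOL-Probability.Characteristic_Functions"
begin

section \<open>The Plancherel identity\<close>

text \<open>Let t be the radius of the ball with the mass of g and L = (I/V)^(1/2). Then D =
  \<alpha>/(\<rho> t) equals 1/(2Lt), and the right-hand side of the theorem is \<alpha> \<omega>
  t^(n+2l) (n + l q(D))/(n+2l) with a fixed polynomial q, so that all correction terms together are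
  one number of order D^2. On a ray, a value s of g at radius t forces, by the Lipschitz bound, an
  excess of order s^3 D^2 outside the ball and (1-s)^3 D^2 inside. The two balance for every s only
  if D is small, since the weight inside the ball falls off with the distance from the sphere.
  Smallness of D comes from k >= 1 and from the centred ball having the least second moment among
  sets of its volume; this leads to numerical estimates that differ between n = 2, 3, 4 and n >= 5.
  On the line the lattice argument yields a trapezoidal sum of x^(2l). The excess of such a sum over
  the integral is again of relative order 1/k^2, as is D^2, and its constant is large
  enough.\<close>

lemma integrable_prod_mult:
  fixes f :: "'a \<Rightarrow> real" and g :: "'b \<Rightarrow> real"
  assumes "sigma_finite_measure M" "sigma_finite_measure N" "integrable M f" "integrable N g"
  shows "integrable (M \<Otimes>\<^sub>M N) (\<lambda>z. f (fst z) * g (snd z))"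
proof -
  interpret M: sigma_finite_measure M by fact
  interpret N: sigma_finite_measure N by fact
  interpret pair_sigma_finite M N ..
  have [measurable]: "f \<in> borel_measurable M" "g \<in> borel_measurable N"
    using assms by auto
  show ?thesis
  proof (rule Fubini_integrable)
    show "(\<lambda>z. f (fst z) * g (snd z)) \<in> borel_measurable (M \<Otimes>\<^sub>M N)" by measurable
    show "integrable M (\<lambda>x. \<integral>y. norm (f (fst (x, y)) * g (snd (x, y))) \<partial>N)"
      using integrable_mult_left[OF integrable_abs[OF assms(3)], of "\<integral>y. \<bar>g y\<bar> \<partial>N"]
      by (simp add: abs_mult)
    show "AE x in M. integrable N (\<lambda>y. f (fst (x, y)) * g (snd (x, y)))"
      using assms(4) by simp
  qed
qed

section \<open>Gaussian integrals\<close>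

lemma cis_borel_measurable [measurable]: "cis \<in> borel_measurable borel"
  by (intro borel_measurable_continuous_onI continuous_intros)

text \<open>Substituting \<open>e * t\<close> reduces this to the characteristic function of the
  standard normal distribution.\<close>

lemma gaussian_integral_1d:
  fixes e s :: real
  assumes "e > 0"
  shows "integrable lborel (\<lambda>t. complex_of_real (exp (- (e * t)\<^sup>2 / 2)) * cis (t * s))"
    and "(\<integral>t. complex_of_real (exp (- (e * t)\<^sup>2 / 2)) * cis (t * s) \<partial>lborel)
           = complex_of_real (sqrt (2 * pi) / e * exp (- (s / e)\<^sup>2 / 2))"
proof -
  let ?h = "\<lambda>t. complex_of_real (exp (- t\<^sup>2 / 2)) * cis (t * (s / e))"
  have sq: "sqrt (2 * pi) > 0" by simp
  have int0: "integrable lborel (\<lambda>x. std_normal_density x *\<^sub>R (cis (s / e * x)))"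
  proof (rule Bochner_Integration.integrable_bound)
    show "integrable lborel std_normal_density"
      using integrable_normal_moment[of 1 0 0] by simp
    show "(\<lambda>x. std_normal_density x *\<^sub>R cis (s / e * x)) \<in> borel_measurable lborel"
      by measurable
  qed auto
  have "char std_normal_distribution (s / e) = exp (- (s / e)\<^sup>2 / 2)"
    by (simp add: char_std_normal_distribution)
  moreover have "char std_normal_distribution (s / e)
      = (\<integral>x. std_normal_density x *\<^sub>R (cis (s / e * x)) \<partial>lborel)"
    unfolding char_def by (subst integral_density) (auto simp: cis_conv_exp)
  ultimately have v0: "(\<integral>x. std_normal_density x *\<^sub>R (cis (s / e * x)) \<partial>lborel)
      = complex_of_real (exp (- (s / e)\<^sup>2 / 2))" by simp
  have h_eq: "?h = (\<lambda>x. complex_of_real (sqrt (2 * pi)) * (std_normal_density x *\<^sub>R (cis (s / e * x))))"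
    using sq by (auto simp: std_normal_density_def fun_eq_iff scaleR_conv_of_real mult.commute)
  have int1: "integrable lborel ?h" unfolding h_eq using int0 by (intro integrable_mult_right)
  have v1: "(\<integral>t. ?h t \<partial>lborel) = complex_of_real (sqrt (2 * pi) * exp (- (s / e)\<^sup>2 / 2))"
    unfolding h_eq integral_mult_right_zero v0 by simp
  have eq: "?h (0 + e * t) = complex_of_real (exp (- (e * t)\<^sup>2 / 2)) * cis (t * s)" for t
    using assms by simp
  show "integrable lborel (\<lambda>t. complex_of_real (exp (- (e * t)\<^sup>2 / 2)) * cis (t * s))"
    using lborel_integrable_real_affine[OF int1, of e 0] assms unfolding eq by simp
  have "(\<integral>t. ?h t \<partial>lborel) = \<bar>e\<bar> *\<^sub>R (\<integral>t. complex_of_real (exp (- (e * t)\<^sup>2 / 2)) * cis (t * s) \<partial>lborel)"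
    using lborel_integral_real_affine[of e ?h 0] assms unfolding eq by simp
  then show "(\<integral>t. complex_of_real (exp (- (e * t)\<^sup>2 / 2)) * cis (t * s) \<partial>lborel)
           = complex_of_real (sqrt (2 * pi) / e * exp (- (s / e)\<^sup>2 / 2))"
    using assms v1 by (simp add: field_simps scaleR_conv_of_real)
qed

lemma cis_sum: "finite A \<Longrightarrow> cis (sum f A) = (\<Prod>x\<in>A. cis (f x))"
  by (induction A rule: finite_induct) (auto simp: cis_mult [symmetric])

text \<open>Lebesgue measure is the image of a product of one-dimensional measures, and both the
  Gaussian and \<open>cis (x \<bullet> z)\<close> factor over the coordinates. The complex
  exponential is used for this factorisation; the cosine is its real part.\<close>

lemma gaussian_integral:
  fixes z :: "'a::euclidean_space" and e :: real
  assumes "e > 0"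
  shows "integrable lborel (\<lambda>x::'a. exp (- (e * norm x)\<^sup>2 / 2) * cos (x \<bullet> z))" (is ?th1)
    and "(\<integral>x. exp (- (e * norm x)\<^sup>2 / 2) * cos (x \<bullet> z) \<partial>lborel)
           = (sqrt (2 * pi) / e) ^ DIM('a) * exp (- (norm z / e)\<^sup>2 / 2)" (is ?th2)
proof -
  interpret product_sigma_finite "\<lambda>_::'a. lborel :: real measure" ..
  let ?f = "\<lambda>b t. complex_of_real (exp (- (e * t)\<^sup>2 / 2)) * cis (t * (z \<bullet> b))"
  let ?S = "\<lambda>f. \<Sum>b\<in>Basis. f b *\<^sub>R (b::'a)"
  let ?F = "\<lambda>x::'a. complex_of_real (exp (- (e * norm x)\<^sup>2 / 2)) * cis (x \<bullet> z)"
  have comp: "?S f \<bullet> b = f b" if "b \<in> Basis" for f b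
    using that by simp
  have FS: "?F (?S f) = (\<Prod>b\<in>Basis. ?f b (f b))" for f
  proof -
    have "(norm (?S f))\<^sup>2 = (\<Sum>b\<in>Basis. (f b)\<^sup>2)"
      unfolding power2_norm_eq_inner
      by (subst euclidean_inner) (simp add: power2_eq_square)
    then have a: "exp (- (e * norm (?S f))\<^sup>2 / 2) = (\<Prod>b\<in>Basis. exp (- (e * f b)\<^sup>2 / 2))"
      by (subst exp_sum [symmetric])
        (auto simp: power_mult_distrib sum_distrib_left sum_negf [symmetric] sum_divide_distrib)
    have b: "cis (?S f \<bullet> z) = (\<Prod>b\<in>Basis. cis (f b * (z \<bullet> b)))"
      by (subst cis_sum [symmetric]) (auto simp: inner_sum_left inner_commute[of z])
    show ?thesis unfolding a b by (simp add: prod.distrib)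
  qed
  have [measurable]: "?S \<in> measurable (\<Pi>\<^sub>M b\<in>Basis. lborel) borel" by measurable
  have [measurable]: "?F \<in> borel_measurable borel" by measurable
  have i1: "integrable (\<Pi>\<^sub>M b\<in>Basis. lborel) (\<lambda>f. \<Prod>b\<in>(Basis::'a set). ?f b (f b))"
    by (rule product_integrable_prod) (use gaussian_integral_1d(1)[OF assms] in auto)
  have v1: "(\<integral>f. (\<Prod>b\<in>(Basis::'a set). ?f b (f b)) \<partial>(\<Pi>\<^sub>M b\<in>Basis. lborel)) = (\<Prod>b\<in>Basis. integral\<^sup>L lborel (?f b))"
    by (rule product_integral_prod) (use gaussian_integral_1d(1)[OF assms] in auto)
  have iF: "integrable lborel ?F"
    using i1 by (subst lborel_eq, subst integrable_distr_eq) (simp_all only: FS, measurable)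
  have "integral\<^sup>L lborel ?F = (\<integral>f. ?F (?S f) \<partial>(\<Pi>\<^sub>M b\<in>Basis. lborel))"
    by (subst lborel_eq, subst integral_distr) auto
  also have "\<dots> = (\<Prod>b\<in>Basis. complex_of_real (sqrt (2 * pi) / e * exp (- ((z \<bullet> b) / e)\<^sup>2 / 2)))"
    unfolding FS v1 gaussian_integral_1d(2)[OF assms] ..
  also have "\<dots> = complex_of_real ((sqrt (2 * pi) / e) ^ DIM('a) * exp (\<Sum>b\<in>Basis. - ((z \<bullet> b) / e)\<^sup>2 / 2))"
    by (simp add: exp_sum prod.distrib prod_dividef power_divide)
  also have "(\<Sum>b\<in>Basis. - ((z \<bullet> b) / e)\<^sup>2 / 2) = - (norm z / e)\<^sup>2 / 2"
  proof -
    have "(norm z)\<^sup>2 = (\<Sum>b\<in>Basis. (z \<bullet> b)\<^sup>2)"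
      unfolding power2_norm_eq_inner by (subst euclidean_inner) (simp add: power2_eq_square)
    then show ?thesis by (simp add: power_divide sum_divide_distrib sum_negf)
  qed
  finally have vF: "integral\<^sup>L lborel ?F = complex_of_real ((sqrt (2 * pi) / e) ^ DIM('a) * exp (- (norm z / e)\<^sup>2 / 2))" .
  have re: "(\<lambda>x. Re (?F x)) = (\<lambda>x. exp (- (e * norm x)\<^sup>2 / 2) * cos (x \<bullet> z))"
    by (simp add: fun_eq_iff)
  show ?th1 using integrable_Re[OF iF] unfolding re .
  show ?th2 using integral_Re[OF iF] unfolding re vF by simp
qed

lemma lborel_integral_affine:
  fixes f :: "'a::euclidean_space \<Rightarrow> real"
  assumes [measurable]: "f \<in> borel_measurable borel" and c: "c \<noteq> 0"
  shows "integral\<^sup>L lborel f = \<bar>c\<bar> ^ DIM('a) * (\<integral>x. f (t + c *\<^sub>R x) \<partial>lborel)"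
  by (subst lborel_affine[OF c, of t]) (simp add: integral_density integral_distr)

lemma gaussian_shift_integral:
  fixes x :: "'a::euclidean_space"
  assumes "e > 0"
  shows "integrable lborel (\<lambda>y. exp (- (norm (x - y) / e)\<^sup>2 / 2))"
    and "(\<integral>y. exp (- (norm (x - y) / e)\<^sup>2 / 2) \<partial>lborel) = (sqrt (2 * pi) * e) ^ DIM('a)"
proof -
  have eq: "exp (- (norm (x - (x + (-1) *\<^sub>R y)) / e)\<^sup>2 / 2) = exp (- (1 / e * norm y)\<^sup>2 / 2)" for y
    by simp
  have v: "(\<integral>y. exp (- (norm (x - y) / e)\<^sup>2 / 2) \<partial>lborel) = (sqrt (2 * pi) * e) ^ DIM('a)"
    using gaussian_integral(2)[of "1/e" "0::'a"] assms
    by (subst lborel_integral_affine[of _ "-1" x]) (simp_all add: field_simps)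
  show "(\<integral>y. exp (- (norm (x - y) / e)\<^sup>2 / 2) \<partial>lborel) = (sqrt (2 * pi) * e) ^ DIM('a)" by fact
  \<comment> \<open>A function that is not integrable has integral 0 by convention, so the nonzero
    value proves integrability.\<close>
  have "(sqrt (2 * pi) * e) ^ DIM('a) \<noteq> 0" using assms by simp
  then show "integrable lborel (\<lambda>y. exp (- (norm (x - y) / e)\<^sup>2 / 2))"
    using v not_integrable_integral_eq by fastforce
qed

section \<open>The squared modulus of the Fourier transform\<close>

lemma lborel_pair_integral_mult:
  fixes f g :: "'a::euclidean_space \<Rightarrow> real"
  assumes "integrable lborel f" "integrable lborel g"
  shows "(\<integral>z. f (fst z) * g (snd z) \<partial>(lborel \<Otimes>\<^sub>M lborel)) = integral\<^sup>L lborel f * integral\<^sup>L lborel g"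
proof -
  have "integrable (lborel \<Otimes>\<^sub>M lborel) (\<lambda>z. f (fst z) * g (snd z))"
    by (intro integrable_prod_mult sigma_finite_lborel assms)
  from lborel_pair.integral_fst'[OF this] show ?thesis by simp
qed

text \<open>The squared modulus of the unnormalised Fourier transform of a real function. Only the
  modulus enters the proof, so the real and imaginary parts are kept as real integrals.\<close>

definition ft_pow :: "('a::euclidean_space \<Rightarrow> real) \<Rightarrow> 'a \<Rightarrow> real" where
  "ft_pow u \<xi> = (\<integral>x. u x * cos (x \<bullet> \<xi>) \<partial>lborel)\<^sup>2 + (\<integral>x. u x * sin (x \<bullet> \<xi>) \<partial>lborel)\<^sup>2"

lemma ft_pow_nonneg [simp]: "ft_pow u \<xi> \<ge> 0"
  by (simp add: ft_pow_def)

lemma integrable_mult_cos_sin: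
  fixes u :: "'a::euclidean_space \<Rightarrow> real"
  assumes "integrable lborel u"
  shows "integrable lborel (\<lambda>x. u x * cos (x \<bullet> \<xi>))" "integrable lborel (\<lambda>x. u x * sin (x \<bullet> \<xi>))"
proof -
  have [measurable]: "u \<in> borel_measurable borel" using assms by auto
  show "integrable lborel (\<lambda>x. u x * cos (x \<bullet> \<xi>))" "integrable lborel (\<lambda>x. u x * sin (x \<bullet> \<xi>))"
    by (rule Bochner_Integration.integrable_bound[OF assms],
        auto simp: abs_mult intro!: AE_I2 mult_left_le)+
qed

lemma ft_pow_measurable [measurable]:
  fixes u :: "'a::euclidean_space \<Rightarrow> real"
  assumes "integrable lborel u"
  shows "ft_pow u \<in> borel_measurable borel"
proof -
  have [measurable]: "u \<in> borel_measurable borel" using assms by auto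
  show ?thesis unfolding ft_pow_def[abs_def] by measurable
qed

text \<open>By cos a cos b + sin a sin b = cos (a - b), the frequency occurs only together with the
  difference of the two points, which prepares the Gaussian average over frequencies.\<close>

lemma ft_pow_double_integral:
  fixes u :: "'a::euclidean_space \<Rightarrow> real"
  assumes "integrable lborel u"
  shows "ft_pow u \<xi> = (\<integral>z. u (fst z) * u (snd z) * cos ((fst z - snd z) \<bullet> \<xi>) \<partial>(lborel \<Otimes>\<^sub>M lborel))"
proof -
  note i = integrable_mult_cos_sin[OF assms, of \<xi>]
  note s = sigma_finite_lborel sigma_finite_lborel
  have "ft_pow u \<xi> = (\<integral>z. (u (fst z) * cos (fst z \<bullet> \<xi>)) * (u (snd z) * cos (snd z \<bullet> \<xi>)) \<partial>(lborel \<Otimes>\<^sub>M lborel))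
     + (\<integral>z. (u (fst z) * sin (fst z \<bullet> \<xi>)) * (u (snd z) * sin (snd z \<bullet> \<xi>)) \<partial>(lborel \<Otimes>\<^sub>M lborel))"
    unfolding ft_pow_def using lborel_pair_integral_mult[OF i(1) i(1)] lborel_pair_integral_mult[OF i(2) i(2)]
    by (simp add: power2_eq_square)
  also have "\<dots> = (\<integral>z. (u (fst z) * cos (fst z \<bullet> \<xi>)) * (u (snd z) * cos (snd z \<bullet> \<xi>))
        + (u (fst z) * sin (fst z \<bullet> \<xi>)) * (u (snd z) * sin (snd z \<bullet> \<xi>)) \<partial>(lborel \<Otimes>\<^sub>M lborel))"
    by (rule Bochner_Integration.integral_add[symmetric])
      (intro integrable_prod_mult s i)+
  also have "\<dots> = (\<integral>z. u (fst z) * u (snd z) * cos ((fst z - snd z) \<bullet> \<xi>) \<partial>(lborel \<Otimes>\<^sub>M lborel))"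
    by (intro Bochner_Integration.integral_cong) (auto simp: inner_diff_left cos_diff algebra_simps)
  finally show ?thesis .
qed

text \<open>The Gaussian factor makes the triple integral absolutely convergent, so Fubini applies.
  Integrating over frequencies turns it into a multiple of an approximate identity in the difference
  of the two points.\<close>

lemma gaussian_mean_ft_pow:
  fixes u :: "'a::euclidean_space \<Rightarrow> real"
  assumes u: "integrable lborel u" and e: "e > 0"
  shows "integrable lborel (\<lambda>\<xi>. exp (- (e * norm \<xi>)\<^sup>2 / 2) * ft_pow u \<xi>)"
    and "(\<integral>\<xi>. exp (- (e * norm \<xi>)\<^sup>2 / 2) * ft_pow u \<xi> \<partial>lborel) =
      (sqrt (2 * pi) / e) ^ DIM('a) *
      (\<integral>z. u (fst z) * u (snd z) * exp (- (norm (fst z - snd z) / e)\<^sup>2 / 2) \<partial>(lborel \<Otimes>\<^sub>M lborel))"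
proof -
  let ?N = "lborel \<Otimes>\<^sub>M lborel :: ('a \<times> 'a) measure"
  have [measurable]: "u \<in> borel_measurable borel" using u by auto
  have sN: "sigma_finite_measure ?N"
    unfolding lborel_prod by (rule sigma_finite_lborel)
  then interpret N: sigma_finite_measure ?N .
  interpret P: pair_sigma_finite "lborel :: 'a measure" ?N ..
  let ?h = "\<lambda>\<xi> z. exp (- (e * norm \<xi>)\<^sup>2 / 2) * (u (fst z) * u (snd z) * cos ((fst z - snd z) \<bullet> \<xi>))"
  have i1: "integrable ?N (\<lambda>z. u (fst z) * u (snd z))"
    by (intro integrable_prod_mult sigma_finite_lborel u)
  have i2: "integrable lborel (\<lambda>\<xi>::'a. exp (- (e * norm \<xi>)\<^sup>2 / 2))"
    using gaussian_integral(1)[OF e, of "0::'a"] by simp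
  have "integrable ((lborel :: 'a measure) \<Otimes>\<^sub>M ?N) (\<lambda>w. exp (- (e * norm (fst w))\<^sup>2 / 2) * (u (fst (snd w)) * u (snd (snd w))))"
    using integrable_prod_mult[OF sigma_finite_lborel sN i2 i1] by simp
  then have int: "integrable (lborel \<Otimes>\<^sub>M ?N) (case_prod ?h)"
    by (rule Bochner_Integration.integrable_bound)
      (auto simp: abs_mult case_prod_beta intro!: AE_I2 mult_left_mono mult_left_le)
  have inner: "(\<integral>z. ?h \<xi> z \<partial>?N) = exp (- (e * norm \<xi>)\<^sup>2 / 2) * ft_pow u \<xi>" for \<xi>
    by (simp add: ft_pow_double_integral[OF u])
  show "integrable lborel (\<lambda>\<xi>. exp (- (e * norm \<xi>)\<^sup>2 / 2) * ft_pow u \<xi>)"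
    using P.integrable_fst[OF int] unfolding inner .
  have "(\<integral>\<xi>. exp (- (e * norm \<xi>)\<^sup>2 / 2) * ft_pow u \<xi> \<partial>lborel) = (\<integral>\<xi>. \<integral>z. ?h \<xi> z \<partial>?N \<partial>lborel)"
    unfolding inner ..
  also have "\<dots> = (\<integral>z. \<integral>\<xi>. ?h \<xi> z \<partial>lborel \<partial>?N)"
    by (rule P.Fubini_integral[OF int, symmetric])
  also have "\<dots> = (\<integral>z. (sqrt (2 * pi) / e) ^ DIM('a) *
      (u (fst z) * u (snd z) * exp (- (norm (fst z - snd z) / e)\<^sup>2 / 2)) \<partial>?N)"
  proof (rule Bochner_Integration.integral_cong)
    fix z :: "'a \<times> 'a"
    have "(\<integral>\<xi>. ?h \<xi> z \<partial>lborel) = (\<integral>\<xi>. (u (fst z) * u (snd z)) * (exp (- (e * norm \<xi>)\<^sup>2 / 2) * cos (\<xi> \<bullet> (fst z - snd z))) \<partial>lborel)"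
      by (intro Bochner_Integration.integral_cong) (auto simp: inner_commute)
    then show "(\<integral>\<xi>. ?h \<xi> z \<partial>lborel) = (sqrt (2 * pi) / e) ^ DIM('a) *
      (u (fst z) * u (snd z) * exp (- (norm (fst z - snd z) / e)\<^sup>2 / 2))"
      using gaussian_integral(2)[OF e, of "fst z - snd z"] by simp
  qed simp
  finally show "(\<integral>\<xi>. exp (- (e * norm \<xi>)\<^sup>2 / 2) * ft_pow u \<xi> \<partial>lborel) =
      (sqrt (2 * pi) / e) ^ DIM('a) *
      (\<integral>z. u (fst z) * u (snd z) * exp (- (norm (fst z - snd z) / e)\<^sup>2 / 2) \<partial>?N)"
    by simp
qed

text \<open>Schur's test: |u(x) u(y)| is at most the mean of the two squares, and the kernel has the
  same mass in either variable.\<close>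

lemma gaussian_double_integral_le:
  fixes u :: "'a::euclidean_space \<Rightarrow> real"
  assumes u: "integrable lborel u" and u2: "integrable lborel (\<lambda>x. (u x)\<^sup>2)" and e: "e > 0"
  shows "(\<integral>z. u (fst z) * u (snd z) * exp (- (norm (fst z - snd z) / e)\<^sup>2 / 2) \<partial>(lborel \<Otimes>\<^sub>M lborel))
     \<le> (sqrt (2 * pi) * e) ^ DIM('a) * (\<integral>x. (u x)\<^sup>2 \<partial>lborel)"
proof -
  let ?N = "lborel \<Otimes>\<^sub>M lborel :: ('a \<times> 'a) measure"
  let ?K = "\<lambda>x y::'a. exp (- (norm (x - y) / e)\<^sup>2 / 2)"
  let ?C = "(sqrt (2 * pi) * e) ^ DIM('a)"
  have [measurable]: "u \<in> borel_measurable borel" using u by auto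
  have i1: "integrable ?N (\<lambda>z. (u (fst z))\<^sup>2 * ?K (fst z) (snd z))"
  proof (rule lborel_pair.Fubini_integrable)
    show "integrable lborel (\<lambda>x. \<integral>y. norm ((u (fst (x, y)))\<^sup>2 * ?K (fst (x, y)) (snd (x, y))) \<partial>lborel)"
      using u2 gaussian_shift_integral(2)[where 'a='a, OF e] by simp
  qed (use gaussian_shift_integral(1)[where 'a='a, OF e] in auto)
  have v1: "(\<integral>z. (u (fst z))\<^sup>2 * ?K (fst z) (snd z) \<partial>?N) = ?C * (\<integral>x. (u x)\<^sup>2 \<partial>lborel)"
    using lborel_pair.integral_fst'[OF i1, symmetric] gaussian_shift_integral(2)[where 'a='a, OF e]
    by (simp add: mult.commute)
  have i2: "integrable ?N (\<lambda>z. (u (snd z))\<^sup>2 * ?K (fst z) (snd z))"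
    using lborel_pair.integrable_product_swap[OF i1] by (simp add: case_prod_beta' norm_minus_commute)
  have v2: "(\<integral>z. (u (snd z))\<^sup>2 * ?K (fst z) (snd z) \<partial>?N) = ?C * (\<integral>x. (u x)\<^sup>2 \<partial>lborel)"
    using lborel_pair.integral_product_swap[of "\<lambda>z. (u (fst z))\<^sup>2 * ?K (fst z) (snd z)"] v1
    by (simp add: case_prod_beta' norm_minus_commute)
  have le: "\<bar>u x * u y * ?K x y\<bar> \<le> ((u x)\<^sup>2 * ?K x y + (u y)\<^sup>2 * ?K x y) / 2" for x y
  proof -
    have "\<bar>u x * u y\<bar> \<le> ((u x)\<^sup>2 + (u y)\<^sup>2) / 2"
      using sum_squares_bound[of "\<bar>u x\<bar>" "\<bar>u y\<bar>"] by (simp add: abs_mult)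
    then have "\<bar>u x * u y\<bar> * ?K x y \<le> ((u x)\<^sup>2 + (u y)\<^sup>2) / 2 * ?K x y"
      by (intro mult_right_mono) auto
    then show ?thesis by (simp add: abs_mult algebra_simps)
  qed
  have i3: "integrable ?N (\<lambda>z. ((u (fst z))\<^sup>2 * ?K (fst z) (snd z) + (u (snd z))\<^sup>2 * ?K (fst z) (snd z)) / 2)"
    using i1 i2 by auto
  have "(\<integral>z. u (fst z) * u (snd z) * ?K (fst z) (snd z) \<partial>?N)
     \<le> (\<integral>z. ((u (fst z))\<^sup>2 * ?K (fst z) (snd z) + (u (snd z))\<^sup>2 * ?K (fst z) (snd z)) / 2 \<partial>?N)"
    by (intro integral_mono' i3 order_trans[OF abs_ge_self le] order_trans[OF abs_ge_zero le])
  also have "\<dots> = ?C * (\<integral>x. (u x)\<^sup>2 \<partial>lborel)"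
    using i1 i2 v1 v2 by simp
  finally show ?thesis .
qed

lemma gaussian_mean_le:
  fixes u :: "'a::euclidean_space \<Rightarrow> real"
  assumes u: "integrable lborel u" and u2: "integrable lborel (\<lambda>x. (u x)\<^sup>2)" and e: "e > 0"
  shows "(\<integral>\<xi>. exp (- (e * norm \<xi>)\<^sup>2 / 2) * ft_pow u \<xi> \<partial>lborel) \<le> (2 * pi) ^ DIM('a) * (\<integral>x. (u x)\<^sup>2 \<partial>lborel)"
proof -
  have "(\<integral>\<xi>. exp (- (e * norm \<xi>)\<^sup>2 / 2) * ft_pow u \<xi> \<partial>lborel) \<le> (sqrt (2 * pi) / e) ^ DIM('a) *
     ((sqrt (2 * pi) * e) ^ DIM('a) * (\<integral>x. (u x)\<^sup>2 \<partial>lborel))"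
    unfolding gaussian_mean_ft_pow(2)[OF u e]
    using e by (intro mult_left_mono gaussian_double_integral_le assms) auto
  also have "\<dots> = (sqrt (2 * pi) / e * (sqrt (2 * pi) * e)) ^ DIM('a) * (\<integral>x. (u x)\<^sup>2 \<partial>lborel)"
    by (simp only: power_mult_distrib mult.assoc)
  also have "sqrt (2 * pi) / e * (sqrt (2 * pi) * e) = 2 * pi" using e by simp
  finally show ?thesis .
qed

section \<open>The two halves of Plancherel's identity\<close>

lemma inverse_Suc_LIMSEQ: "(\<lambda>j. 1 / real (Suc j)) \<longlonglongrightarrow> 0"
  using LIMSEQ_inverse_real_of_nat by (simp add: divide_inverse)

text \<open>The bound for Gaussian means is uniform in the damping, so Fatou's lemma removes the
  damping without any regularity of u.\<close>

lemma plancherel_le: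
  fixes u :: "'a::euclidean_space \<Rightarrow> real"
  assumes u: "integrable lborel u" and u2: "integrable lborel (\<lambda>x. (u x)\<^sup>2)"
  shows "(\<integral>\<^sup>+\<xi>. ft_pow u \<xi> \<partial>lborel) \<le> ennreal ((2 * pi) ^ DIM('a) * (\<integral>x. (u x)\<^sup>2 \<partial>lborel))"
proof -
  let ?e = "\<lambda>j. 1 / real (Suc j)"
  let ?h = "\<lambda>j \<xi>. exp (- (?e j * norm \<xi>)\<^sup>2 / 2) * ft_pow u \<xi>"
  note [measurable] = ft_pow_measurable[OF u]
  have lim: "(\<lambda>j. ?h j \<xi>) \<longlonglongrightarrow> ft_pow u \<xi>" for \<xi>
  proof -
    have "(\<lambda>j. ?h j \<xi>) \<longlonglongrightarrow> exp (- (0 * norm \<xi>)\<^sup>2 / 2) * ft_pow u \<xi>"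
      by (intro tendsto_intros inverse_Suc_LIMSEQ) auto
    then show ?thesis by simp
  qed
  have "(\<integral>\<^sup>+\<xi>. ft_pow u \<xi> \<partial>lborel) = (\<integral>\<^sup>+\<xi>. liminf (\<lambda>j. ennreal (?h j \<xi>)) \<partial>lborel)"
    using lim by (intro nn_integral_cong) (auto intro!: lim_imp_Liminf[symmetric] tendsto_ennrealI)
  also have "\<dots> \<le> liminf (\<lambda>j. \<integral>\<^sup>+\<xi>. ennreal (?h j \<xi>) \<partial>lborel)"
    by (rule nn_integral_liminf) measurable
  also have "\<dots> \<le> liminf (\<lambda>j::nat. ennreal ((2 * pi) ^ DIM('a) * (\<integral>x. (u x)\<^sup>2 \<partial>lborel)))"
  proof (intro Liminf_mono always_eventually allI)
    fix j
    have "(\<integral>\<^sup>+\<xi>. ennreal (?h j \<xi>) \<partial>lborel) = ennreal (\<integral>\<xi>. ?h j \<xi> \<partial>lborel)"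
      by (intro nn_integral_eq_integral gaussian_mean_ft_pow(1) u) auto
    also have "\<dots> \<le> ennreal ((2 * pi) ^ DIM('a) * (\<integral>x. (u x)\<^sup>2 \<partial>lborel))"
      by (intro ennreal_leI gaussian_mean_le assms) auto
    finally show "(\<integral>\<^sup>+\<xi>. ennreal (?h j \<xi>) \<partial>lborel) \<le> ennreal ((2 * pi) ^ DIM('a) * (\<integral>x. (u x)\<^sup>2 \<partial>lborel))" .
  qed
  finally show ?thesis by (simp add: Liminf_const)
qed

text \<open>For bounded continuous u the Gaussian kernel really acts as an approximate identity:
  \<open>?H j x\<close> is a Gaussian average of u around x and tends to \<open>?C * u x\<close> by
  dominated convergence.\<close>

lemma plancherel_ge:
  fixes u :: "'a::euclidean_space \<Rightarrow> real"
  assumes u: "integrable lborel u" and u2: "integrable lborel (\<lambda>x. (u x)\<^sup>2)"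
    and cont: "continuous_on UNIV u" and bd: "\<And>x. \<bar>u x\<bar> \<le> B"
  shows "ennreal ((2 * pi) ^ DIM('a) * (\<integral>x. (u x)\<^sup>2 \<partial>lborel)) \<le> (\<integral>\<^sup>+\<xi>. ft_pow u \<xi> \<partial>lborel)"
proof -
  let ?e = "\<lambda>j. 1 / real (Suc j)"
  let ?W = "\<lambda>j. \<integral>\<xi>. exp (- (?e j * norm \<xi>)\<^sup>2 / 2) * ft_pow u \<xi> \<partial>lborel"
  let ?G = "\<lambda>z::'a. exp (- (norm z)\<^sup>2 / 2)"
  let ?H = "\<lambda>j x. \<integral>z. u (x + ?e j *\<^sub>R z) * ?G z \<partial>lborel"
  let ?C = "sqrt (2 * pi) ^ DIM('a)"
  have [measurable]: "u \<in> borel_measurable borel" using u by auto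
  note [measurable] = ft_pow_measurable[OF u]
  have G: "integrable lborel ?G" "integral\<^sup>L lborel ?G = ?C"
    using gaussian_integral[of 1 "0::'a"] by auto
  have B0: "B \<ge> 0" using bd[of 0] by linarith
  \<comment> \<open>The substitution y = x + \<open>?e j\<close> z replaces the shrinking kernel by
    a fixed Gaussian; its Jacobian cancels the power of \<open>?e j\<close> in the
    prefactor.\<close>
  have W: "?W j = ?C * (\<integral>x. u x * ?H j x \<partial>lborel)" for j
  proof -
    let ?K = "\<lambda>x y::'a. exp (- (norm (x - y) / ?e j)\<^sup>2 / 2)"
    have "integrable (lborel \<Otimes>\<^sub>M lborel) (\<lambda>z. u (fst z) * u (snd z))"
      by (intro integrable_prod_mult sigma_finite_lborel u)
    then have i: "integrable (lborel \<Otimes>\<^sub>M lborel) (\<lambda>z. u (fst z) * u (snd z) * ?K (fst z) (snd z))"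
      by (rule Bochner_Integration.integrable_bound) (auto simp: abs_mult intro!: AE_I2 mult_left_le)
    have "(\<integral>z. u (fst z) * u (snd z) * ?K (fst z) (snd z) \<partial>(lborel \<Otimes>\<^sub>M lborel)) =
        (\<integral>x. u x * (\<integral>y. u y * ?K x y \<partial>lborel) \<partial>lborel)"
      unfolding lborel_pair.integral_fst'[OF i, symmetric]
      by (simp add: mult.assoc)
    also have "\<dots> = (\<integral>x. u x * (?e j ^ DIM('a) * ?H j x) \<partial>lborel)"
    proof (intro Bochner_Integration.integral_cong refl arg_cong2[where f="(*)"])
      fix x
      show "(\<integral>y. u y * ?K x y \<partial>lborel) = ?e j ^ DIM('a) * ?H j x"
        by (subst lborel_integral_affine[of _ "?e j" x]) (simp_all del: of_nat_Suc)
    qed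
    also have "\<dots> = (\<integral>x. ?e j ^ DIM('a) * (u x * ?H j x) \<partial>lborel)"
      by (simp only: mult.left_commute)
    also have "\<dots> = ?e j ^ DIM('a) * (\<integral>x. u x * ?H j x \<partial>lborel)"
      by (rule Bochner_Integration.integral_mult_right_zero)
    finally show ?thesis
      by (subst gaussian_mean_ft_pow(2)[OF u]) (simp_all add: power_divide power_mult_distrib del: of_nat_Suc)
  qed
  have Hlim: "(\<lambda>j. ?H j x) \<longlonglongrightarrow> (\<integral>z. u x * ?G z \<partial>lborel)" for x
  proof (rule integral_dominated_convergence[where w="\<lambda>z. B * ?G z"])
    show "AE z in lborel. (\<lambda>j. u (x + ?e j *\<^sub>R z) * ?G z) \<longlonglongrightarrow> u x * ?G z"
    proof (intro AE_I2 tendsto_mult tendsto_const)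
      fix z :: 'a
      have "(\<lambda>j. x + ?e j *\<^sub>R z) \<longlonglongrightarrow> x + 0 *\<^sub>R z"
        by (intro tendsto_intros inverse_Suc_LIMSEQ)
      then have "(\<lambda>j. x + ?e j *\<^sub>R z) \<longlonglongrightarrow> x" by simp
      moreover have "isCont u x" using cont by (simp add: continuous_on_eq_continuous_at)
      ultimately show "(\<lambda>j. u (x + ?e j *\<^sub>R z)) \<longlonglongrightarrow> u x"
        using isCont_tendsto_compose by blast
    qed
    show "AE z in lborel. norm (u (x + ?e j *\<^sub>R z) * ?G z) \<le> B * ?G z" for j
      using bd by (auto simp: abs_mult intro!: AE_I2 mult_right_mono)
  qed (use G in auto)
  have Hbd: "\<bar>?H j x\<bar> \<le> B * ?C" for j x
  proof -
    have "\<bar>?H j x\<bar> \<le> (\<integral>z. B * ?G z \<partial>lborel)"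
      using bd G by (intro order_trans[OF integral_abs_bound] integral_mono')
        (auto simp: abs_mult intro!: mult_right_mono mult_nonneg_nonneg B0)
    then show ?thesis using G by simp
  qed
  have [measurable]: "?H j \<in> borel_measurable borel" for j by measurable
  have "(\<lambda>j. \<integral>x. u x * ?H j x \<partial>lborel) \<longlonglongrightarrow> (\<integral>x. u x * (u x * ?C) \<partial>lborel)"
  proof (rule integral_dominated_convergence[where w="\<lambda>x. \<bar>u x\<bar> * (B * ?C)"])
    show "AE x in lborel. (\<lambda>j. u x * ?H j x) \<longlonglongrightarrow> u x * (u x * ?C)"
      using Hlim G(2) by (intro AE_I2 tendsto_mult tendsto_const) simp
    show "AE x in lborel. norm (u x * ?H j x) \<le> \<bar>u x\<bar> * (B * ?C)" for j
      using Hbd by (auto simp: abs_mult intro!: AE_I2 mult_left_mono)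
  qed (use u in auto)
  then have "?W \<longlonglongrightarrow> ?C * (\<integral>x. u x * (u x * ?C) \<partial>lborel)"
    unfolding W by (intro tendsto_intros)
  moreover have "?C * (\<integral>x. u x * (u x * ?C) \<partial>lborel) = (2 * pi) ^ DIM('a) * (\<integral>x. (u x)\<^sup>2 \<partial>lborel)"
  proof -
    have "(\<integral>x. u x * (u x * ?C) \<partial>lborel) = (\<integral>x. ?C * (u x)\<^sup>2 \<partial>lborel)"
      by (intro Bochner_Integration.integral_cong) (auto simp: power2_eq_square)
    also have "\<dots> = ?C * (\<integral>x. (u x)\<^sup>2 \<partial>lborel)" by simp
    also have "?C * (?C * (\<integral>x. (u x)\<^sup>2 \<partial>lborel)) = (sqrt (2 * pi) * sqrt (2 * pi)) ^ DIM('a) * (\<integral>x. (u x)\<^sup>2 \<partial>lborel)"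
      by (simp only: power_mult_distrib mult.assoc)
    finally show ?thesis by simp
  qed
  ultimately have lim: "(\<lambda>j. ennreal (?W j)) \<longlonglongrightarrow> ennreal ((2 * pi) ^ DIM('a) * (\<integral>x. (u x)\<^sup>2 \<partial>lborel))"
    by (intro tendsto_ennrealI) simp
  have "ennreal (?W j) \<le> (\<integral>\<^sup>+\<xi>. ft_pow u \<xi> \<partial>lborel)" for j
  proof -
    have "ennreal (?W j) = (\<integral>\<^sup>+\<xi>. exp (- (?e j * norm \<xi>)\<^sup>2 / 2) * ft_pow u \<xi> \<partial>lborel)"
      by (intro nn_integral_eq_integral[symmetric] gaussian_mean_ft_pow(1) u) auto
    also have "\<dots> \<le> (\<integral>\<^sup>+\<xi>. ft_pow u \<xi> \<partial>lborel)"
      by (intro nn_integral_mono ennreal_leI mult_left_le_one_le) auto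
    finally show ?thesis .
  qed
  then show ?thesis by (intro LIMSEQ_le_const2[OF lim]) auto
qed

text \<open>The weighted inequality (a + b)^2 <= (1 + h) a^2 + (1 + 1/h) b^2 takes the place of the
  triangle inequality for the norm. It is linear in the squares, hence can be integrated
  directly.\<close>

lemma ft_pow_add_le:
  fixes u v :: "'a::euclidean_space \<Rightarrow> real"
  assumes u: "integrable lborel u" and v: "integrable lborel v" and h: "h > 0"
  shows "ft_pow (\<lambda>x. u x + v x) \<xi> \<le> (1 + h) * ft_pow u \<xi> + (1 + 1 / h) * ft_pow v \<xi>"
proof -
  have sq: "(a + b)\<^sup>2 \<le> (1 + h) * a\<^sup>2 + (1 + 1 / h) * b\<^sup>2" for a b :: real
  proof -
    have "0 \<le> (h * a - b)\<^sup>2 / h" using h by simp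
    also have "\<dots> = (1 + h) * a\<^sup>2 + (1 + 1 / h) * b\<^sup>2 - (a + b)\<^sup>2"
      using h by (simp add: field_simps power2_eq_square)
    finally show ?thesis by simp
  qed
  have "ft_pow (\<lambda>x. u x + v x) \<xi> =
      ((\<integral>x. u x * cos (x \<bullet> \<xi>) \<partial>lborel) + (\<integral>x. v x * cos (x \<bullet> \<xi>) \<partial>lborel))\<^sup>2 +
      ((\<integral>x. u x * sin (x \<bullet> \<xi>) \<partial>lborel) + (\<integral>x. v x * sin (x \<bullet> \<xi>) \<partial>lborel))\<^sup>2"
    unfolding ft_pow_def distrib_right
    by (simp add: Bochner_Integration.integral_add integrable_mult_cos_sin u v)
  also have "\<dots> \<le> (1 + h) * ft_pow u \<xi> + (1 + 1 / h) * ft_pow v \<xi>"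
    using sq[of "\<integral>x. u x * cos (x \<bullet> \<xi>) \<partial>lborel" "\<integral>x. v x * cos (x \<bullet> \<xi>) \<partial>lborel"]
      sq[of "\<integral>x. u x * sin (x \<bullet> \<xi>) \<partial>lborel" "\<integral>x. v x * sin (x \<bullet> \<xi>) \<partial>lborel"]
    unfolding ft_pow_def distrib_left by linarith
  finally show ?thesis .
qed

lemma integral_square_add_le:
  fixes u v :: "'a \<Rightarrow> real"
  assumes [measurable]: "u \<in> borel_measurable M" "v \<in> borel_measurable M"
    and u: "integrable M (\<lambda>x. (u x)\<^sup>2)" and v: "integrable M (\<lambda>x. (v x)\<^sup>2)" and h: "h > 0"
  shows "integrable M (\<lambda>x. (u x + v x)\<^sup>2)"
    and "(\<integral>x. (u x + v x)\<^sup>2 \<partial>M) \<le> (1 + h) * (\<integral>x. (u x)\<^sup>2 \<partial>M) + (1 + 1 / h) * (\<integral>x. (v x)\<^sup>2 \<partial>M)"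
proof -
  have sq: "(a + b)\<^sup>2 \<le> (1 + h) * a\<^sup>2 + (1 + 1 / h) * b\<^sup>2" for a b :: real
  proof -
    have "0 \<le> (h * a - b)\<^sup>2 / h" using h by simp
    also have "\<dots> = (1 + h) * a\<^sup>2 + (1 + 1 / h) * b\<^sup>2 - (a + b)\<^sup>2"
      using h by (simp add: field_simps power2_eq_square)
    finally show ?thesis by simp
  qed
  have i: "integrable M (\<lambda>x. (1 + h) * (u x)\<^sup>2 + (1 + 1 / h) * (v x)\<^sup>2)"
    using u v by auto
  show "integrable M (\<lambda>x. (u x + v x)\<^sup>2)"
    by (rule Bochner_Integration.integrable_bound[OF i])
      (auto intro!: AE_I2 order_trans[OF sq] simp: h less_imp_le)
  have "(\<integral>x. (u x + v x)\<^sup>2 \<partial>M) \<le> (\<integral>x. (1 + h) * (u x)\<^sup>2 + (1 + 1 / h) * (v x)\<^sup>2 \<partial>M)"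
    using h by (intro integral_mono' i sq) (auto intro!: add_nonneg_nonneg mult_nonneg_nonneg)
  also have "\<dots> = (1 + h) * (\<integral>x. (u x)\<^sup>2 \<partial>M) + (1 + 1 / h) * (\<integral>x. (v x)\<^sup>2 \<partial>M)"
    using u v by simp
  finally show "(\<integral>x. (u x + v x)\<^sup>2 \<partial>M) \<le> (1 + h) * (\<integral>x. (u x)\<^sup>2 \<partial>M) + (1 + 1 / h) * (\<integral>x. (v x)\<^sup>2 \<partial>M)" .
qed

text \<open>The lower half is known for the regular functions \<open>f m\<close>. It passes to u
  because the upper half, applied to \<open>f m - u\<close>, controls the transform of the
  error.\<close>

lemma plancherel_limit:
  fixes u :: "'a::euclidean_space \<Rightarrow> real" and f :: "nat \<Rightarrow> 'a \<Rightarrow> real"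
  assumes u: "integrable lborel u" and u2: "integrable lborel (\<lambda>x. (u x)\<^sup>2)"
    and f: "\<And>m. integrable lborel (f m)" and f2: "\<And>m. integrable lborel (\<lambda>x. (f m x)\<^sup>2)"
    and cont: "\<And>m. continuous_on UNIV (f m)" and bd: "\<And>m. \<exists>B. \<forall>x. \<bar>f m x\<bar> \<le> B"
    and lim: "(\<lambda>m. \<integral>x. (f m x - u x)\<^sup>2 \<partial>lborel) \<longlonglongrightarrow> 0"
  shows "(\<integral>\<^sup>+\<xi>. ft_pow u \<xi> \<partial>lborel) = ennreal ((2 * pi) ^ DIM('a) * (\<integral>x. (u x)\<^sup>2 \<partial>lborel))"
proof (rule antisym[OF plancherel_le[OF u u2]])
  let ?c = "(2 * pi) ^ DIM('a)"
  have c: "?c > 0" by simp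
  have [measurable]: "u \<in> borel_measurable borel" using u by auto
  have [measurable]: "f m \<in> borel_measurable borel" for m using f[of m] by auto
  note [measurable] = ft_pow_measurable[OF u]
  obtain a where a: "(\<integral>\<^sup>+\<xi>. ft_pow u \<xi> \<partial>lborel) = ennreal a" "a \<ge> 0"
    using plancherel_le[OF u u2] by (cases "\<integral>\<^sup>+\<xi>. ft_pow u \<xi> \<partial>lborel") (auto simp: top_unique)
  let ?d = "\<lambda>m. \<integral>x. (f m x - u x)\<^sup>2 \<partial>lborel"
  have main: "?c * (\<integral>x. (u x)\<^sup>2 \<partial>lborel) \<le> (1 + h)\<^sup>2 * a" if h: "h > 0" for h
  proof -
    have step: "?c * (\<integral>x. (u x)\<^sup>2 \<partial>lborel) \<le> (1 + h)\<^sup>2 * a + ((1 + h) * (1 + 1 / h) * ?c + (1 + 1 / h) * ?c) * ?d m" for m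
    proof -
      obtain B where B: "\<bar>f m x\<bar> \<le> B" for x using bd by blast
      have d: "integrable lborel (\<lambda>x. f m x - u x)" using f u by auto
      have d2: "integrable lborel (\<lambda>x. (f m x - u x)\<^sup>2)"
        using integral_square_add_le(1)[of "f m" lborel "\<lambda>x. - u x" 1] f2 u2 by simp
      note [measurable] = ft_pow_measurable[OF d]
      have "ennreal (?c * (\<integral>x. (f m x)\<^sup>2 \<partial>lborel)) \<le> (\<integral>\<^sup>+\<xi>. ft_pow (f m) \<xi> \<partial>lborel)"
        by (rule plancherel_ge[OF f f2 cont B])
      also have "\<dots> \<le> (\<integral>\<^sup>+\<xi>. ennreal (1 + h) * ennreal (ft_pow u \<xi>)
          + ennreal (1 + 1 / h) * ennreal (ft_pow (\<lambda>x. f m x - u x) \<xi>) \<partial>lborel)"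
      proof (rule nn_integral_mono)
        fix \<xi>
        have "ft_pow (f m) \<xi> \<le> (1 + h) * ft_pow u \<xi> + (1 + 1 / h) * ft_pow (\<lambda>x. f m x - u x) \<xi>"
          using ft_pow_add_le[OF u d h, of \<xi>] by simp
        then show "ennreal (ft_pow (f m) \<xi>) \<le> ennreal (1 + h) * ennreal (ft_pow u \<xi>)
          + ennreal (1 + 1 / h) * ennreal (ft_pow (\<lambda>x. f m x - u x) \<xi>)"
          using h by (simp add: ennreal_mult'[symmetric] ennreal_plus[symmetric] ennreal_leI del: ennreal_plus)
      qed
      also have "\<dots> = ennreal (1 + h) * ennreal a + ennreal (1 + 1 / h) * (\<integral>\<^sup>+\<xi>. ft_pow (\<lambda>x. f m x - u x) \<xi> \<partial>lborel)"
        by (simp add: nn_integral_add nn_integral_cmult a(1))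
      also have "\<dots> \<le> ennreal (1 + h) * ennreal a + ennreal (1 + 1 / h) * ennreal (?c * ?d m)"
        by (intro add_left_mono mult_left_mono plancherel_le d d2) auto
      also have "\<dots> = ennreal ((1 + h) * a + (1 + 1 / h) * (?c * ?d m))"
        using h a(2) by (simp add: ennreal_mult'[symmetric] ennreal_plus[symmetric] del: ennreal_plus)
      finally have 1: "?c * (\<integral>x. (f m x)\<^sup>2 \<partial>lborel) \<le> (1 + h) * a + (1 + 1 / h) * (?c * ?d m)"
        using h a(2) by (subst (asm) ennreal_le_iff) (auto intro!: add_nonneg_nonneg mult_nonneg_nonneg)
      have "(\<integral>x. (u x)\<^sup>2 \<partial>lborel) \<le> (1 + h) * (\<integral>x. (f m x)\<^sup>2 \<partial>lborel) + (1 + 1 / h) * ?d m"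
        using integral_square_add_le(2)[of "f m" lborel "\<lambda>x. u x - f m x" h] f2[of m] d2 h
        by (simp add: power2_commute)
      then have "?c * (\<integral>x. (u x)\<^sup>2 \<partial>lborel) \<le> ?c * ((1 + h) * (\<integral>x. (f m x)\<^sup>2 \<partial>lborel) + (1 + 1 / h) * ?d m)"
        using c by (intro mult_left_mono) auto
      also have "\<dots> = (1 + h) * (?c * (\<integral>x. (f m x)\<^sup>2 \<partial>lborel)) + (1 + 1 / h) * ?c * ?d m"
        by (simp add: algebra_simps)
      also have "\<dots> \<le> (1 + h) * ((1 + h) * a + (1 + 1 / h) * (?c * ?d m)) + (1 + 1 / h) * ?c * ?d m"
        using h 1 by (intro add_right_mono mult_left_mono) auto
      also have "\<dots> = (1 + h)\<^sup>2 * a + ((1 + h) * (1 + 1 / h) * ?c + (1 + 1 / h) * ?c) * ?d m"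
        by (simp only: power2_eq_square algebra_simps)
      finally show ?thesis .
    qed
    have "(\<lambda>m. (1 + h)\<^sup>2 * a + ((1 + h) * (1 + 1 / h) * ?c + (1 + 1 / h) * ?c) * ?d m) \<longlonglongrightarrow>
        (1 + h)\<^sup>2 * a + ((1 + h) * (1 + 1 / h) * ?c + (1 + 1 / h) * ?c) * 0"
      by (intro tendsto_intros lim)
    then show ?thesis using step by (intro LIMSEQ_le_const) (auto intro: exI[of _ 0])
  qed
  \<comment> \<open>In \<open>main\<close> the limit in m was taken for fixed h, which kills the
    terms with 1/h; only now may h tend to 0.\<close>
  have "(\<lambda>j. (1 + 1 / real (Suc j))\<^sup>2 * a) \<longlonglongrightarrow> (1 + 0)\<^sup>2 * a"
    by (intro tendsto_intros inverse_Suc_LIMSEQ)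
  then have "?c * (\<integral>x. (u x)\<^sup>2 \<partial>lborel) \<le> (1 + 0)\<^sup>2 * a"
    using main by (intro LIMSEQ_le_const) auto
  then show "ennreal (?c * (\<integral>x. (u x)\<^sup>2 \<partial>lborel)) \<le> (\<integral>\<^sup>+\<xi>. ft_pow u \<xi> \<partial>lborel)"
    unfolding a(1) by (intro ennreal_leI) simp
qed

section \<open>Test functions\<close>

lemma partials_Nil [simp]: "partials [] f = f"
  and partials_Cons [simp]: "partials (i # is) f = partial i (partials is f)"
  by (simp_all add: partials_def)

lemma partials_append: "partials (is @ js) f = partials is (partials js f)"
  by (simp add: partials_def)

lemma smooth_partial: "smooth f \<Longrightarrow> smooth (partial i f)"
proof -
  assume "smooth f"
  then have "partials (is @ [i]) f differentiable (at x)" for "is" x unfolding smooth_def by blast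
  then show ?thesis unfolding smooth_def by (simp add: partials_append)
qed

lemma smooth_has_derivative:
  "smooth f \<Longrightarrow> (f has_derivative frechet_derivative f (at x)) (at x)"
  using smooth_def[of f] frechet_derivative_works[of f "at x"] partials_Nil[of f] by metis

lemma smooth_continuous: "smooth f \<Longrightarrow> continuous_on UNIV f"
  by (meson smooth_has_derivative has_derivative_continuous continuous_at_imp_continuous_on)

lemma partial_eqI:
  "(f has_derivative f') (at x) \<Longrightarrow> partial i f x = f' (axis i 1)"
  unfolding partial_def by (simp flip: frechet_derivative_at)

lemma test_functionE:
  assumes "\<phi> \<in> test_functions \<Omega>"
  obtains K where "compact K" "K \<subseteq> \<Omega>" "\<And>x. x \<notin> K \<Longrightarrow> \<phi> x = 0"
  using assms closure_subset[of "{x. \<phi> x \<noteq> 0}"] that[of "closure {x. \<phi> x \<noteq> 0}"]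
  unfolding test_functions_def by blast

lemma test_functionI:
  assumes "smooth \<phi>" "compact K" "K \<subseteq> \<Omega>" "\<And>x. x \<notin> K \<Longrightarrow> \<phi> x = 0"
  shows "\<phi> \<in> test_functions \<Omega>"
proof -
  have "closure {x. \<phi> x \<noteq> 0} \<subseteq> K"
    using assms by (intro closure_minimal compact_imp_closed) auto
  then show ?thesis unfolding test_functions_def
    using assms by (auto simp: compact_closure intro!: bounded_subset[OF compact_imp_bounded[OF assms(2)]])
qed

lemma test_function_smooth: "\<phi> \<in> test_functions \<Omega> \<Longrightarrow> smooth \<phi>"
  by (simp add: test_functions_def)

lemma partial_outside:
  assumes "closed K" "\<And>y. y \<notin> K \<Longrightarrow> f y = 0" "x \<notin> K"
  shows "partial i f x = 0"
proof -
  have "(f has_derivative (\<lambda>_. 0)) (at x)"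
    by (rule has_derivative_transform_within_open[of "\<lambda>_. 0" _ _ _ "- K"]) (use assms in auto)
  then show ?thesis by (simp add: partial_eqI)
qed

lemma partial_test_function: "\<phi> \<in> test_functions \<Omega> \<Longrightarrow> partial i \<phi> \<in> test_functions \<Omega>"
  by (metis test_functionE test_functionI smooth_partial test_function_smooth partial_outside compact_imp_closed)

lemma partials_test_function: "\<phi> \<in> test_functions \<Omega> \<Longrightarrow> partials is \<phi> \<in> test_functions \<Omega>"
  by (induction "is") (auto intro: partial_test_function)

lemma continuous_compact_support:
  fixes f :: "'a::euclidean_space \<Rightarrow> real"
  assumes "continuous_on UNIV f" "compact K" "\<And>x. x \<notin> K \<Longrightarrow> f x = 0"
  shows "\<exists>B. \<forall>x. \<bar>f x\<bar> \<le> B" "integrable lborel f"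
proof -
  have "bounded (f ` K)"
    using assms by (intro compact_imp_bounded compact_continuous_image) (auto intro: continuous_on_subset)
  then obtain B where "\<And>x. x \<in> K \<Longrightarrow> \<bar>f x\<bar> \<le> B" unfolding bounded_iff by auto
  then have "\<bar>f x\<bar> \<le> max B 0" for x using assms(3)[of x] by (cases "x \<in> K") (auto simp: le_max_iff_disj)
  then show "\<exists>B. \<forall>x. \<bar>f x\<bar> \<le> B" by blast
  have "integrable lborel (\<lambda>x. indicator K x *\<^sub>R f x)"
    by (rule borel_integrable_compact) (use assms in \<open>auto intro: continuous_on_subset\<close>)
  moreover have "(\<lambda>x. indicator K x *\<^sub>R f x) = f" using assms(3) by (auto simp: fun_eq_iff indicator_def)
  ultimately show "integrable lborel f" by simp
qed

lemma test_function_facts: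
  assumes "\<phi> \<in> test_functions \<Omega>"
  shows "continuous_on UNIV \<phi>" "\<phi> \<in> borel_measurable borel" "\<exists>B. \<forall>x. \<bar>\<phi> x\<bar> \<le> B"
    "integrable lborel \<phi>" "integrable lborel (\<lambda>x. (\<phi> x)\<^sup>2)" "\<And>x. x \<notin> \<Omega> \<Longrightarrow> \<phi> x = 0"
proof -
  show c: "continuous_on UNIV \<phi>" using assms by (intro smooth_continuous test_function_smooth)
  then show "\<phi> \<in> borel_measurable borel" by (rule borel_measurable_continuous_onI)
  obtain K where K: "compact K" "K \<subseteq> \<Omega>" "\<And>x. x \<notin> K \<Longrightarrow> \<phi> x = 0" by (rule test_functionE[OF assms]) blast
  show "\<exists>B. \<forall>x. \<bar>\<phi> x\<bar> \<le> B" "integrable lborel \<phi>" using continuous_compact_support[OF c K(1,3)] by auto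
  have c2: "continuous_on UNIV (\<lambda>x. (\<phi> x)\<^sup>2)" by (intro continuous_intros c)
  show "integrable lborel (\<lambda>x. (\<phi> x)\<^sup>2)"
    by (rule continuous_compact_support(2)[OF c2 K(1)]) (simp add: K(3))
  show "\<And>x. x \<notin> \<Omega> \<Longrightarrow> \<phi> x = 0" using K by blast
qed

lemma partial_linear:
  assumes "f differentiable (at x)" "g differentiable (at x)"
  shows "partial i (\<lambda>x. c * f x + d * g x) x = c * partial i f x + d * partial i g x"
proof -
  have "(f has_derivative frechet_derivative f (at x)) (at x)"
    "(g has_derivative frechet_derivative g (at x)) (at x)"
    using assms frechet_derivative_works by blast+
  then have "((\<lambda>x. c * f x + d * g x) has_derivative
      (\<lambda>h. c * frechet_derivative f (at x) h + d * frechet_derivative g (at x) h)) (at x)"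
    by (intro derivative_intros)
  from partial_eqI[OF this, of i] show ?thesis by (simp add: partial_def)
qed

lemma partials_linear:
  assumes "smooth f" "smooth g"
  shows "partials is (\<lambda>x. c * f x + d * g x) = (\<lambda>x. c * partials is f x + d * partials is g x)"
proof (induction "is")
  case (Cons i "is")
  show ?case unfolding partials_Cons Cons.IH
    using assms by (auto simp: smooth_def fun_eq_iff intro!: partial_linear)
qed simp

lemma smooth_linear: "smooth f \<Longrightarrow> smooth g \<Longrightarrow> smooth (\<lambda>x. c * f x + d * g x)"
  unfolding smooth_def
proof (intro allI)
  fix "is" x
  assume a: "\<forall>is x. partials is f differentiable at x" "\<forall>is x. partials is g differentiable at x"
  then have "partials is (\<lambda>x. c * f x + d * g x) = (\<lambda>x. c * partials is f x + d * partials is g x)"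
    by (intro partials_linear) (auto simp: smooth_def)
  then show "partials is (\<lambda>x. c * f x + d * g x) differentiable at x"
    using a by (auto intro!: derivative_intros)
qed

lemma test_function_linear:
  assumes "\<phi> \<in> test_functions \<Omega>" "\<psi> \<in> test_functions \<Omega>"
  shows "(\<lambda>x. c * \<phi> x + d * \<psi> x) \<in> test_functions \<Omega>"
proof -
  obtain K where K: "compact K" "K \<subseteq> \<Omega>" "\<And>x. x \<notin> K \<Longrightarrow> \<phi> x = 0" by (rule test_functionE[OF assms(1)]) blast
  obtain L where L: "compact L" "L \<subseteq> \<Omega>" "\<And>x. x \<notin> L \<Longrightarrow> \<psi> x = 0" by (rule test_functionE[OF assms(2)]) blast
  show ?thesis
    by (rule test_functionI[of _ "K \<union> L"])
      (use K L assms[THEN test_function_smooth] in \<open>auto intro!: smooth_linear\<close>)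
qed

lemma partials_zero: "partials is (\<lambda>x. 0) = (\<lambda>x. 0)"
proof (induction "is")
  case (Cons i "is")
  then show ?case by (auto simp: fun_eq_iff intro!: partial_eqI)
qed simp

lemma zero_test_function: "(\<lambda>x. 0) \<in> test_functions \<Omega>"
  by (rule test_functionI[of _ "{}"]) (simp_all add: smooth_def partials_zero)

lemma partials_sum:
  assumes "finite A" "\<And>a. a \<in> A \<Longrightarrow> f a \<in> test_functions \<Omega>"
  shows "(\<lambda>x. \<Sum>a\<in>A. c a * f a x) \<in> test_functions \<Omega>"
    and "partials is (\<lambda>x. \<Sum>a\<in>A. c a * f a x) = (\<lambda>x. \<Sum>a\<in>A. c a * partials is (f a) x)"
proof -
  have "(\<lambda>x. \<Sum>a\<in>A. c a * f a x) \<in> test_functions \<Omega> \<and>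
    partials is (\<lambda>x. \<Sum>a\<in>A. c a * f a x) = (\<lambda>x. \<Sum>a\<in>A. c a * partials is (f a) x)"
    using assms
  proof (induction A rule: finite_induct)
    case empty
    then show ?case by (simp add: zero_test_function partials_zero)
  next
    case (insert a A)
    then have IH: "(\<lambda>x. \<Sum>a\<in>A. c a * f a x) \<in> test_functions \<Omega>"
      "partials is (\<lambda>x. \<Sum>a\<in>A. c a * f a x) = (\<lambda>x. \<Sum>a\<in>A. c a * partials is (f a) x)"
      by auto
    have fa: "f a \<in> test_functions \<Omega>" using insert by auto
    have eq: "(\<lambda>x. \<Sum>a\<in>insert a A. c a * f a x) = (\<lambda>x. c a * f a x + 1 * (\<Sum>a\<in>A. c a * f a x))"
      using insert by simp
    show ?case
      unfolding eq using test_function_linear[OF fa IH(1), of "c a" 1]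
        partials_linear[OF test_function_smooth[OF fa] test_function_smooth[OF IH(1)], of "is" "c a" 1]
        IH(2) insert.hyps by simp
  qed
  then show "(\<lambda>x. \<Sum>a\<in>A. c a * f a x) \<in> test_functions \<Omega>"
    "partials is (\<lambda>x. \<Sum>a\<in>A. c a * f a x) = (\<lambda>x. \<Sum>a\<in>A. c a * partials is (f a) x)" by auto
qed

text \<open>Integration by parts without coordinates: difference quotients along e have integral 0
  by translation invariance. The mean value theorem writes them as values of the derivative at
  nearby points, which gives both their pointwise limit and a common bound.\<close>

lemma integral_directional_derivative_zero:
  fixes F :: "'a::euclidean_space \<Rightarrow> real"
  assumes d: "\<And>x. (F has_derivative F' x) (at x)" and c: "continuous_on UNIV (\<lambda>x. F' x e)"
    and K: "compact K" "\<And>x. x \<notin> K \<Longrightarrow> F x = 0" and out: "\<And>x. x \<notin> K \<Longrightarrow> F' x e = 0"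
  shows "(\<integral>x. F' x e \<partial>lborel) = 0"
proof -
  let ?h = "\<lambda>j. 1 / real (Suc j)"
  let ?q = "\<lambda>j x. (F (x + ?h j *\<^sub>R e) - F x) / ?h j"
  \<comment> \<open>All steps \<open>?h j\<close> are at most 1, so this compact set carries every
    difference quotient and hence the dominating function.\<close>
  let ?L = "{x + y |x y. x \<in> K \<and> y \<in> cball 0 (norm e)}"
  have contF: "continuous_on UNIV F"
    using d by (meson has_derivative_continuous continuous_at_imp_continuous_on)
  then have [measurable]: "F \<in> borel_measurable borel" by (rule borel_measurable_continuous_onI)
  have [measurable]: "(\<lambda>x. F' x e) \<in> borel_measurable borel" using c by (rule borel_measurable_continuous_onI)
  obtain M where M: "\<And>x. \<bar>F' x e\<bar> \<le> M" using continuous_compact_support(1)[OF c K(1) out] by blast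
  have L: "compact ?L" using K(1) by (intro compact_sums) auto
  have q: "\<exists>t\<in>{0..?h j}. ?q j x = F' (x + t *\<^sub>R e) e" for j x
  proof -
    have "\<exists>t. 0 < t \<and> t < ?h j \<and> F (x + ?h j *\<^sub>R e) - F (x + 0 *\<^sub>R e) = (\<lambda>s. F' (x + t *\<^sub>R e) (s *\<^sub>R e)) (?h j - 0)"
    proof -
      have der: "((\<lambda>s. F (x + s *\<^sub>R e)) has_derivative (\<lambda>s. F' (x + t *\<^sub>R e) (s *\<^sub>R e))) (at t)" for t
        by (rule has_derivative_compose[of "\<lambda>s. x + s *\<^sub>R e" "\<lambda>s. s *\<^sub>R e" _ _ F])
          (auto intro!: derivative_eq_intros d)
      then have cs: "continuous_on {0..?h j} (\<lambda>s. F (x + s *\<^sub>R e))"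
        by (meson has_derivative_continuous continuous_at_imp_continuous_on)
      show ?thesis
        using mvt[of 0 "?h j" "\<lambda>s. F (x + s *\<^sub>R e)" "\<lambda>t s. F' (x + t *\<^sub>R e) (s *\<^sub>R e)"] cs der
        by auto
    qed
    then obtain t where t: "0 < t" "t < ?h j" "F (x + ?h j *\<^sub>R e) - F x = F' (x + t *\<^sub>R e) (?h j *\<^sub>R e)"
      by auto
    have "F' (x + t *\<^sub>R e) (?h j *\<^sub>R e) = ?h j * F' (x + t *\<^sub>R e) e"
      using linear_scale[OF has_derivative_linear[OF d[of "x + t *\<^sub>R e"]]] by simp
    then show ?thesis using t by (intro bexI[of _ t]) (auto simp del: of_nat_Suc)
  qed
  have notK: "x + v \<notin> K" if "x \<notin> ?L" "norm v \<le> norm e" for x v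
  proof
    assume "x + v \<in> K"
    moreover have "x = (x + v) + (- v)" "- v \<in> cball 0 (norm e)" using that(2) by auto
    ultimately show False using that(1) by blast
  qed
  have zero: "(\<integral>x. ?q j x \<partial>lborel) = 0" for j
  proof -
    have i: "integrable lborel F" by (rule continuous_compact_support(2)[OF contF K])
    have c': "continuous_on UNIV (\<lambda>x. F (x + ?h j *\<^sub>R e))"
      by (rule continuous_on_compose2[OF contF]) (auto intro!: continuous_intros)
    have i': "integrable lborel (\<lambda>x. F (x + ?h j *\<^sub>R e))"
    proof (rule continuous_compact_support(2)[OF c' L])
      fix x assume x: "x \<notin> ?L"
      have "?h j \<le> 1" by simp
      then have "norm (?h j *\<^sub>R e) \<le> norm e"
        using mult_right_mono[of "?h j" 1 "norm e"] by (simp del: of_nat_Suc)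
      then have "x + ?h j *\<^sub>R e \<notin> K" by (rule notK[OF x])
      then show "F (x + ?h j *\<^sub>R e) = 0" by (rule K(2))
    qed
    have "(\<integral>x. F (x + ?h j *\<^sub>R e) \<partial>lborel) = (\<integral>x. F x \<partial>lborel)"
      by (subst (2) lborel_integral_affine[of _ 1 "?h j *\<^sub>R e"]) (auto simp: add.commute)
    then show ?thesis using i i' by simp
  qed
  have "(\<lambda>j. \<integral>x. ?q j x \<partial>lborel) \<longlonglongrightarrow> (\<integral>x. F' x e \<partial>lborel)"
  proof (rule integral_dominated_convergence[where w="\<lambda>x. M * indicator ?L x"])
    have "emeasure lborel ?L < \<infinity>" using L by (rule emeasure_compact_finite)
    moreover have "?L \<in> sets borel" using L by (simp add: borel_compact)
    ultimately show "integrable lborel (\<lambda>x. M * indicator ?L x)" by simp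
    show "AE x in lborel. (\<lambda>j. ?q j x) \<longlonglongrightarrow> F' x e"
    proof (rule AE_I2)
      fix x
      have "\<forall>j. \<exists>t. 0 \<le> t \<and> t \<le> ?h j \<and> ?q j x = F' (x + t *\<^sub>R e) e" using q by fastforce
      then obtain t where t: "\<And>j. 0 \<le> t j" "\<And>j. t j \<le> ?h j" "\<And>j. ?q j x = F' (x + t j *\<^sub>R e) e"
        by metis
      have "t \<longlonglongrightarrow> 0"
        by (rule tendsto_sandwich[of "\<lambda>_. 0" _ _ ?h]) (use t inverse_Suc_LIMSEQ in auto)
      then have "(\<lambda>j. x + t j *\<^sub>R e) \<longlonglongrightarrow> x + 0 *\<^sub>R e" by (intro tendsto_intros)
      then have "(\<lambda>j. x + t j *\<^sub>R e) \<longlonglongrightarrow> x" by simp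
      moreover have "isCont (\<lambda>x. F' x e) x" using c by (simp add: continuous_on_eq_continuous_at)
      ultimately show "(\<lambda>j. ?q j x) \<longlonglongrightarrow> F' x e"
        unfolding t(3) using isCont_tendsto_compose by blast
    qed
    show "AE x in lborel. norm (?q j x) \<le> M * indicator ?L x" for j
    proof (rule AE_I2)
      fix x
      obtain t where t: "0 \<le> t" "t \<le> ?h j" "?q j x = F' (x + t *\<^sub>R e) e" using q by fastforce
      show "norm (?q j x) \<le> M * indicator ?L x"
      proof (cases "x \<in> ?L")
        case True
        then show ?thesis using t(3) M by simp
      next
        case False
        have "t \<le> 1" using t(2) by (rule order_trans) simp
        then have "norm (t *\<^sub>R e) \<le> norm e" using t(1) by (simp add: mult_left_le_one_le)
        then have "x + t *\<^sub>R e \<notin> K" by (rule notK[OF False])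
        moreover have "M \<ge> 0" using M[of 0] by linarith
        ultimately show ?thesis unfolding t(3) using out by simp
      qed
    qed
  qed (auto)
  then show ?thesis unfolding zero by (simp add: LIMSEQ_const_iff)
qed

section \<open>The Fourier transform of derivatives\<close>

lemma ft_partial:
  fixes \<phi> :: "real^'n \<Rightarrow> real"
  assumes "\<phi> \<in> test_functions \<Omega>"
  shows "(\<integral>x. partial i \<phi> x * cos (x \<bullet> \<xi>) \<partial>lborel) = \<xi> $ i * (\<integral>x. \<phi> x * sin (x \<bullet> \<xi>) \<partial>lborel)"
    and "(\<integral>x. partial i \<phi> x * sin (x \<bullet> \<xi>) \<partial>lborel) = - \<xi> $ i * (\<integral>x. \<phi> x * cos (x \<bullet> \<xi>) \<partial>lborel)"
proof -
  let ?D = "\<lambda>x. frechet_derivative \<phi> (at x)"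
  let ?e = "axis i 1 :: real^'n"
  obtain K where K: "compact K" "K \<subseteq> \<Omega>" "\<And>x. x \<notin> K \<Longrightarrow> \<phi> x = 0" by (rule test_functionE[OF assms]) blast
  have D: "(\<phi> has_derivative ?D x) (at x)" for x
    using assms by (intro smooth_has_derivative test_function_smooth)
  have De: "?D x ?e = partial i \<phi> x" for x by (simp add: partial_def)
  note p = partial_test_function[OF assms, of i]
  have out: "partial i \<phi> x = 0" if "x \<notin> K" for x
    using partial_outside[OF compact_imp_closed[OF K(1)] K(3) that] .
  have ei: "?e \<bullet> \<xi> = \<xi> $ i" by (simp add: inner_axis')
  note i1 = integrable_mult_cos_sin[OF test_function_facts(4)[OF p], of \<xi>]
    and i0 = integrable_mult_cos_sin[OF test_function_facts(4)[OF assms], of \<xi>]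
  have "(\<integral>x. \<phi> x * (- sin (x \<bullet> \<xi>) * (?e \<bullet> \<xi>)) + ?D x ?e * cos (x \<bullet> \<xi>) \<partial>lborel) = 0"
    by (rule integral_directional_derivative_zero[where K=K and F="\<lambda>x. \<phi> x * cos (x \<bullet> \<xi>)" and e="?e"
          and F'="\<lambda>x h. \<phi> x * (- sin (x \<bullet> \<xi>) * (h \<bullet> \<xi>)) + ?D x h * cos (x \<bullet> \<xi>)"])
      (use K out in \<open>auto intro!: derivative_eq_intros D continuous_intros test_function_facts(1)[OF assms]
        test_function_facts(1)[OF p] simp: De fun_eq_iff\<close>)
  also have "(\<integral>x. \<phi> x * (- sin (x \<bullet> \<xi>) * (?e \<bullet> \<xi>)) + ?D x ?e * cos (x \<bullet> \<xi>) \<partial>lborel)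
     = (\<integral>x. partial i \<phi> x * cos (x \<bullet> \<xi>) - \<xi> $ i * (\<phi> x * sin (x \<bullet> \<xi>)) \<partial>lborel)"
    by (intro Bochner_Integration.integral_cong) (auto simp: De ei)
  finally show "(\<integral>x. partial i \<phi> x * cos (x \<bullet> \<xi>) \<partial>lborel) = \<xi> $ i * (\<integral>x. \<phi> x * sin (x \<bullet> \<xi>) \<partial>lborel)"
    using i1 i0 by simp
  have "(\<integral>x. \<phi> x * (cos (x \<bullet> \<xi>) * (?e \<bullet> \<xi>)) + ?D x ?e * sin (x \<bullet> \<xi>) \<partial>lborel) = 0"
    by (rule integral_directional_derivative_zero[where K=K and F="\<lambda>x. \<phi> x * sin (x \<bullet> \<xi>)" and e="?e"
          and F'="\<lambda>x h. \<phi> x * (cos (x \<bullet> \<xi>) * (h \<bullet> \<xi>)) + ?D x h * sin (x \<bullet> \<xi>)"])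
      (use K out in \<open>auto intro!: derivative_eq_intros D continuous_intros test_function_facts(1)[OF assms]
        test_function_facts(1)[OF p] simp: De fun_eq_iff\<close>)
  also have "(\<integral>x. \<phi> x * (cos (x \<bullet> \<xi>) * (?e \<bullet> \<xi>)) + ?D x ?e * sin (x \<bullet> \<xi>) \<partial>lborel)
     = (\<integral>x. partial i \<phi> x * sin (x \<bullet> \<xi>) + \<xi> $ i * (\<phi> x * cos (x \<bullet> \<xi>)) \<partial>lborel)"
    by (intro Bochner_Integration.integral_cong) (auto simp: De ei)
  finally show "(\<integral>x. partial i \<phi> x * sin (x \<bullet> \<xi>) \<partial>lborel) = - \<xi> $ i * (\<integral>x. \<phi> x * cos (x \<bullet> \<xi>) \<partial>lborel)"
    using i1 i0 by simp
qed

lemma ft_pow_partial: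
  assumes "\<phi> \<in> test_functions \<Omega>"
  shows "ft_pow (partial i \<phi>) \<xi> = (\<xi> $ i)\<^sup>2 * ft_pow \<phi> \<xi>"
  unfolding ft_pow_def ft_partial[OF assms] by (simp add: power2_eq_square algebra_simps)

lemma ft_pow_partials:
  assumes "\<phi> \<in> test_functions \<Omega>"
  shows "ft_pow (partials is \<phi>) \<xi> = (\<Prod>i\<leftarrow>is. (\<xi> $ i)\<^sup>2) * ft_pow \<phi> \<xi>"
  by (induction "is") (auto simp: ft_pow_partial[OF partials_test_function[OF assms]])

lemma sum_lists_Suc:
  "(\<Sum>is | length is = Suc l. f is) = (\<Sum>i\<in>UNIV. \<Sum>is | length is = l. f (i # is))"
  for f :: "'n::finite list \<Rightarrow> 'b::comm_monoid_add"
proof -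
  have "{is :: 'n list. length is = Suc l} = (\<lambda>(i, is). i # is) ` (UNIV \<times> {is. length is = l})"
    by (auto simp: length_Suc_conv)
  then show ?thesis
    by (simp add: sum.cartesian_product sum.reindex inj_on_def case_prod_beta)
qed

lemma finite_lists_UNIV: "finite {is :: 'n::finite list. length is = l}"
  using finite_lists_length_eq[of "UNIV :: 'n set" l] by simp

text \<open>The l-th power of the sum of squares is expanded over ordered lists of indices.
  Repetitions among the lists account for the multinomial coefficients, so none appear here or in
  the energies.\<close>

lemma norm_power_eq_sum_lists:
  fixes \<xi> :: "real^'n"
  shows "norm \<xi> ^ (2 * l) = (\<Sum>is | length is = l. \<Prod>i\<leftarrow>is. (\<xi> $ i)\<^sup>2)"
proof (induction l)
  case 0
  have "{is :: 'n list. is = []} = {[]}" by auto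
  then show ?case by simp
next
  case (Suc l)
  have "norm \<xi> ^ 2 = (\<Sum>i\<in>UNIV. (\<xi> $ i)\<^sup>2)"
    unfolding power2_norm_eq_inner inner_vec_def by (simp add: power2_eq_square)
  moreover have "norm \<xi> ^ (2 * Suc l) = norm \<xi> ^ 2 * norm \<xi> ^ (2 * l)"
    by (simp add: power2_eq_square)
  ultimately show ?case
    by (simp only: Suc sum_lists_Suc sum_product list.map prod_list.Cons)
qed

lemma ft_pow_norm_power:
  assumes "\<phi> \<in> test_functions \<Omega>"
  shows "norm \<xi> ^ (2 * l) * ft_pow \<phi> \<xi> = (\<Sum>is | length is = l. ft_pow (partials is \<phi>) \<xi>)"
  by (simp add: ft_pow_partials[OF assms] norm_power_eq_sum_lists sum_distrib_right)

text \<open>The two mixed derivatives have the same Fourier transform.\<close>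

lemma partial_commute:
  assumes \<phi>: "\<phi> \<in> test_functions \<Omega>"
  shows "partial i (partial j \<phi>) = partial j (partial i \<phi>)"
proof -
  let ?f = "partial i (partial j \<phi>)" and ?g = "partial j (partial i \<phi>)"
  let ?w = "\<lambda>x. 1 * ?f x + (-1) * ?g x"
  have f: "?f \<in> test_functions \<Omega>" and g: "?g \<in> test_functions \<Omega>"
    by (intro partial_test_function \<phi>)+
  have w: "?w \<in> test_functions \<Omega>" by (rule test_function_linear[OF f g])
  note if' = integrable_mult_cos_sin[OF test_function_facts(4)[OF f]]
  note ig = integrable_mult_cos_sin[OF test_function_facts(4)[OF g]]
  have "ft_pow ?w \<xi> = 0" for \<xi>
    unfolding ft_pow_def
    using if'[of \<xi>] ig[of \<xi>] \<phi>
    by (simp add: left_diff_distrib ft_partial[OF partial_test_function[OF \<phi>]] ft_partial[OF \<phi>])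
  obtain B where B: "\<And>x. \<bar>?w x\<bar> \<le> B" using test_function_facts(3)[OF w] by blast
  \<comment> \<open>The lower half of Plancherel's identity serves as injectivity of the Fourier
    transform.\<close>
  have "ennreal ((2 * pi) ^ DIM(real^'a) * (\<integral>x. (?w x)\<^sup>2 \<partial>lborel)) \<le> (\<integral>\<^sup>+\<xi>. ft_pow ?w \<xi> \<partial>lborel)"
    by (rule plancherel_ge[OF test_function_facts(4)[OF w] test_function_facts(5)[OF w] test_function_facts(1)[OF w] B])
  also have "\<dots> = 0" by (simp only: \<open>\<And>\<xi>. ft_pow ?w \<xi> = 0\<close>) simp
  finally have "(2 * pi) ^ DIM(real^'a) * (\<integral>x. (?w x)\<^sup>2 \<partial>lborel) \<le> 0" by simp
  then have "(\<integral>x. (?w x)\<^sup>2 \<partial>lborel) \<le> 0"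
    by (meson mult_pos_pos not_le pi_gt_zero zero_less_numeral zero_less_power)
  then have z: "(\<integral>x. (?w x)\<^sup>2 \<partial>lborel) = 0" by (simp add: antisym)
  have "AE x in lborel. (?w x)\<^sup>2 = 0"
    using integral_nonneg_eq_0_iff_AE[of lborel "\<lambda>x. (?w x)\<^sup>2"] test_function_facts(5)[OF w] z by simp
  then have ae: "AE x in lborel. ?w x = 0" by simp
  \<comment> \<open>A continuous function that vanishes almost everywhere vanishes, because nonempty
    open sets are not null.\<close>
  have "?w x = 0" for x
  proof (rule ccontr)
    assume "?w x \<noteq> 0"
    have "open (?w -` (- {0}))"
      using test_function_facts(1)[OF w] by (intro open_vimage) auto
    then have o: "open {x. ?w x \<noteq> 0}" by (simp add: vimage_def Compl_eq)
    moreover have "{x. ?w x \<noteq> 0} \<noteq> {}" using \<open>?w x \<noteq> 0\<close> by blast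
    ultimately have "emeasure lborel {x. ?w x \<noteq> 0} \<noteq> 0"
      using open_not_negligible[of "{x. ?w x \<noteq> 0}"]
      by (auto simp: negligible_iff_null_sets null_sets_def emeasure_completion)
    moreover have "{x. ?w x \<noteq> 0} \<in> sets lborel" using o by simp
    ultimately show False using ae by (simp add: AE_iff_measurable[of "{x. ?w x \<noteq> 0}" lborel])
  qed
  then show ?thesis by (auto simp: fun_eq_iff)
qed

lemma partials_partial_commute:
  assumes "\<phi> \<in> test_functions \<Omega>"
  shows "partials is (partial i \<phi>) = partial i (partials is \<phi>)"
  by (induction "is") (auto simp: partial_commute[OF partials_test_function[OF assms]])

text \<open>Each list of directions occurs twice, so that one copy can later be moved to the other
  factor as a weak derivative. Collecting equal directions in this way rests on the symmetry of
  mixed derivatives.\<close>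

lemma poly_laplacian_eq:
  assumes "\<phi> \<in> test_functions \<Omega>"
  shows "poly_laplacian l \<phi> = (\<lambda>x. (-1) ^ l * (\<Sum>is | length is = l. partials is (partials is \<phi>) x))"
  using assms
proof (induction l arbitrary: \<phi>)
  case 0
  have "{is :: 'a list. is = []} = {[]}" by auto
  then show ?case by (simp add: poly_laplacian_def)
next
  case (Suc l)
  let ?f = "\<lambda>i. partial i (partial i \<phi>)"
  have f: "?f i \<in> test_functions \<Omega>" for i
    using Suc.prems by (intro partial_test_function)
  let ?g = "\<lambda>x. \<Sum>i\<in>UNIV. (-1) * ?f i x"
  have g: "?g \<in> test_functions \<Omega>" using f by (intro partials_sum(1)) auto
  have lg: "(\<lambda>x. - laplacian \<phi> x) = ?g" by (simp add: laplacian_def sum_negf)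
  have "poly_laplacian (Suc l) \<phi> = poly_laplacian l ?g"
    unfolding poly_laplacian_def funpow_Suc_right by (simp only: comp_def lg)
  also have "\<dots> = (\<lambda>x. (-1) ^ l * (\<Sum>is | length is = l. partials is (partials is ?g) x))"
    by (rule Suc.IH[OF g])
  also have "\<dots> = (\<lambda>x. (-1) ^ l * (\<Sum>is | length is = l. \<Sum>i\<in>UNIV. (-1) * partials (i # is) (partials (i # is) \<phi>) x))"
  proof -
    have "partials is (partials is ?g) = (\<lambda>x. \<Sum>i\<in>UNIV. (-1) * partials (i # is) (partials (i # is) \<phi>) x)" for "is" :: "'a list"
    proof -
      have "partials is (partials is ?g) = partials (is @ is) ?g" by (simp only: partials_append)
      also have "\<dots> = (\<lambda>x. \<Sum>i\<in>UNIV. (-1) * partials (is @ is) (?f i) x)"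
        using f by (intro partials_sum(2)) auto
      also have "\<dots> = (\<lambda>x. \<Sum>i\<in>UNIV. (-1) * partials (i # is) (partials (i # is) \<phi>) x)"
        by (simp add: partials_append Suc.prems partials_partial_commute[where \<Omega>=\<Omega>] partial_test_function partials_test_function)
      finally show ?thesis .
    qed
    then show ?thesis by simp
  qed
  also have "\<dots> = (\<lambda>x. (-1) ^ Suc l * (\<Sum>is | length is = Suc l. partials is (partials is \<phi>) x))"
    by (subst sum.swap) (simp add: sum_lists_Suc sum_negf)
  finally show ?case .
qed

section \<open>Square integrable functions\<close>

lemma square_integrable_mult:
  fixes u v :: "'a \<Rightarrow> real"
  assumes [measurable]: "u \<in> borel_measurable M" "v \<in> borel_measurable M"
    and "integrable M (\<lambda>x. (u x)\<^sup>2)" "integrable M (\<lambda>x. (v x)\<^sup>2)"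
  shows "integrable M (\<lambda>x. u x * v x)"
proof (rule Bochner_Integration.integrable_bound)
  show "integrable M (\<lambda>x. (u x)\<^sup>2 + (v x)\<^sup>2)" using assms by auto
  have "\<bar>u x * v x\<bar> \<le> (u x)\<^sup>2 + (v x)\<^sup>2" for x
  proof -
    have "2 * \<bar>u x\<bar> * \<bar>v x\<bar> \<le> (u x)\<^sup>2 + (v x)\<^sup>2"
      using sum_squares_bound[of "\<bar>u x\<bar>" "\<bar>v x\<bar>"] by simp
    moreover have "0 \<le> \<bar>u x\<bar> * \<bar>v x\<bar>" by simp
    ultimately show ?thesis unfolding abs_mult by linarith
  qed
  then show "AE x in M. norm (u x * v x) \<le> norm ((u x)\<^sup>2 + (v x)\<^sup>2)"
    by (auto intro!: AE_I2 order_trans[OF _ abs_ge_self])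
qed measurable

lemma square_integrable_linear:
  fixes u v :: "'a \<Rightarrow> real"
  assumes [measurable]: "u \<in> borel_measurable M" "v \<in> borel_measurable M"
    and "integrable M (\<lambda>x. (u x)\<^sup>2)" "integrable M (\<lambda>x. (v x)\<^sup>2)"
  shows "integrable M (\<lambda>x. (c * u x + d * v x)\<^sup>2)"
  using integral_square_add_le(1)[of "\<lambda>x. c * u x" M "\<lambda>x. d * v x" 1] assms
  by (simp add: power_mult_distrib)

lemma integral_Cauchy_Schwarz:
  fixes u v :: "'a \<Rightarrow> real"
  assumes [measurable]: "u \<in> borel_measurable M" "v \<in> borel_measurable M"
    and u: "integrable M (\<lambda>x. (u x)\<^sup>2)" and v: "integrable M (\<lambda>x. (v x)\<^sup>2)"
  shows "(\<integral>x. u x * v x \<partial>M)\<^sup>2 \<le> (\<integral>x. (u x)\<^sup>2 \<partial>M) * (\<integral>x. (v x)\<^sup>2 \<partial>M)"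
proof -
  let ?A = "\<integral>x. (u x)\<^sup>2 \<partial>M" and ?B = "\<integral>x. u x * v x \<partial>M" and ?C = "\<integral>x. (v x)\<^sup>2 \<partial>M"
  note uv = square_integrable_mult[OF assms]
  have q: "0 \<le> ?A + 2 * t * ?B + t\<^sup>2 * ?C" for t
  proof -
    have "0 \<le> (\<integral>x. (u x + t * v x)\<^sup>2 \<partial>M)" by simp
    also have "\<dots> = (\<integral>x. (u x)\<^sup>2 + 2 * t * (u x * v x) + t\<^sup>2 * (v x)\<^sup>2 \<partial>M)"
      by (intro Bochner_Integration.integral_cong) (auto simp: power2_eq_square algebra_simps)
    also have "\<dots> = ?A + 2 * t * ?B + t\<^sup>2 * ?C" using u v uv by simp
    finally show ?thesis .
  qed
  show ?thesis
  proof (cases "?C = 0")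
    case True
    \<comment> \<open>The quadratic function in \<open>q\<close> is now affine in t. If it were not
      constant, the choice of t below would give it the value -1.\<close>
    have "?B = 0"
    proof (rule ccontr)
      assume "?B \<noteq> 0"
      then have "?A + 2 * (- (?A + 1) / (2 * ?B)) * ?B = - 1" by (simp add: field_simps)
      then show False using q[of "- (?A + 1) / (2 * ?B)"] True by simp
    qed
    then show ?thesis using True by simp
  next
    case False
    then have C: "?C > 0" by (simp add: less_le)
    have "?A + 2 * (- ?B / ?C) * ?B + (- ?B / ?C)\<^sup>2 * ?C = ?A - ?B\<^sup>2 / ?C"
      using False by (simp add: field_simps power2_eq_square)
    then have "0 \<le> ?A - ?B\<^sup>2 / ?C" using q[of "- ?B / ?C"] by simp
    then show ?thesis using C by (simp add: field_simps)
  qed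
qed

lemma L2_limit_mult:
  fixes f :: "nat \<Rightarrow> 'a \<Rightarrow> real"
  assumes f: "\<And>m. f m \<in> borel_measurable M" "\<And>m. integrable M (\<lambda>x. (f m x)\<^sup>2)"
    and g: "g \<in> borel_measurable M" "integrable M (\<lambda>x. (g x)\<^sup>2)"
    and u: "u \<in> borel_measurable M" "integrable M (\<lambda>x. (u x)\<^sup>2)"
    and lim: "(\<lambda>m. \<integral>x. (f m x - g x)\<^sup>2 \<partial>M) \<longlonglongrightarrow> 0"
  shows "(\<lambda>m. \<integral>x. u x * f m x \<partial>M) \<longlonglongrightarrow> (\<integral>x. u x * g x \<partial>M)"
proof -
  have d: "(\<lambda>x. f m x - g x) \<in> borel_measurable M" "integrable M (\<lambda>x. (f m x - g x)\<^sup>2)" for m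
    using f[of m] g square_integrable_linear[of "f m" M g 1 "-1"] by auto
  have "(\<lambda>m. (\<integral>x. u x * (f m x - g x) \<partial>M)\<^sup>2) \<longlonglongrightarrow> 0"
  proof (rule tendsto_sandwich[of "\<lambda>_. 0"])
    show "\<forall>\<^sub>F m in sequentially. (\<integral>x. u x * (f m x - g x) \<partial>M)\<^sup>2 \<le> (\<integral>x. (u x)\<^sup>2 \<partial>M) * (\<integral>x. (f m x - g x)\<^sup>2 \<partial>M)"
      by (intro always_eventually allI integral_Cauchy_Schwarz u d)
    show "(\<lambda>m. (\<integral>x. (u x)\<^sup>2 \<partial>M) * (\<integral>x. (f m x - g x)\<^sup>2 \<partial>M)) \<longlonglongrightarrow> 0"
      using tendsto_mult[OF tendsto_const lim] by simp
  qed auto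
  then have "(\<lambda>m. \<integral>x. u x * (f m x - g x) \<partial>M) \<longlonglongrightarrow> 0"
    using tendsto_real_sqrt[of "\<lambda>m. (\<integral>x. u x * (f m x - g x) \<partial>M)\<^sup>2" 0] by (simp add: tendsto_rabs_zero_iff)
  moreover have "(\<integral>x. u x * (f m x - g x) \<partial>M) = (\<integral>x. u x * f m x \<partial>M) - (\<integral>x. u x * g x \<partial>M)" for m
    using square_integrable_mult[OF u(1) f(1)[of m] u(2) f(2)[of m]] square_integrable_mult[OF u(1) g(1) u(2) g(2)]
    by (simp add: right_diff_distrib)
  ultimately show ?thesis by (simp add: LIM_zero_iff)
qed

lemma L2_limit_square:
  fixes f :: "nat \<Rightarrow> 'a \<Rightarrow> real"
  assumes f: "\<And>m. f m \<in> borel_measurable M" "\<And>m. integrable M (\<lambda>x. (f m x)\<^sup>2)"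
    and g: "g \<in> borel_measurable M" "integrable M (\<lambda>x. (g x)\<^sup>2)"
    and lim: "(\<lambda>m. \<integral>x. (f m x - g x)\<^sup>2 \<partial>M) \<longlonglongrightarrow> 0"
  shows "(\<lambda>m. \<integral>x. (f m x)\<^sup>2 \<partial>M) \<longlonglongrightarrow> (\<integral>x. (g x)\<^sup>2 \<partial>M)"
proof -
  have eq: "(\<integral>x. (f m x)\<^sup>2 \<partial>M) = (\<integral>x. (f m x - g x)\<^sup>2 \<partial>M) + 2 * (\<integral>x. g x * f m x \<partial>M) - (\<integral>x. (g x)\<^sup>2 \<partial>M)" for m
  proof -
    have i: "integrable M (\<lambda>x. (f m x - g x)\<^sup>2)" "integrable M (\<lambda>x. g x * f m x)"
      using square_integrable_linear[OF f(1)[of m] g(1) f(2)[of m] g(2), of 1 "-1"]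
        square_integrable_mult[OF g(1) f(1)[of m] g(2) f(2)[of m]] by auto
    have "(\<integral>x. (f m x)\<^sup>2 \<partial>M) = (\<integral>x. (f m x - g x)\<^sup>2 + 2 * (g x * f m x) - (g x)\<^sup>2 \<partial>M)"
      by (intro Bochner_Integration.integral_cong) (auto simp: power2_eq_square algebra_simps)
    then show ?thesis using i g by simp
  qed
  have "(\<lambda>m. \<integral>x. g x * f m x \<partial>M) \<longlonglongrightarrow> (\<integral>x. g x * g x \<partial>M)"
    by (rule L2_limit_mult[OF f g g lim])
  then have "(\<lambda>m. (\<integral>x. (f m x - g x)\<^sup>2 \<partial>M) + 2 * (\<integral>x. g x * f m x \<partial>M) - (\<integral>x. (g x)\<^sup>2 \<partial>M))
     \<longlonglongrightarrow> 0 + 2 * (\<integral>x. g x * g x \<partial>M) - (\<integral>x. (g x)\<^sup>2 \<partial>M)"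
    by (intro tendsto_intros lim)
  then show ?thesis unfolding eq by (simp add: power2_eq_square)
qed

text \<open>That every \<open>e j\<close> is a combination of the b's is carried along for the
  induction: the remainder of \<open>b m\<close> is then a combination with coefficient 1 at
  \<open>b m\<close>, hence not almost everywhere 0, and can be normalised.\<close>

lemma gram_schmidt:
  fixes b :: "nat \<Rightarrow> 'a \<Rightarrow> real"
  assumes lin: "\<And>u v c d. u \<in> E \<Longrightarrow> v \<in> E \<Longrightarrow> (\<lambda>x. c * u x + d * v x) \<in> E"
    and zero: "(\<lambda>x. 0) \<in> E"
    and E: "\<And>u. u \<in> E \<Longrightarrow> u \<in> borel_measurable M \<and> integrable M (\<lambda>x. (u x)\<^sup>2)"
  shows "\<lbrakk>\<forall>j<m. b j \<in> E; \<forall>c. (AE x in M. (\<Sum>j<m. c j * b j x) = 0) \<longrightarrow> (\<forall>j<m. c j = 0)\<rbrakk> \<Longrightarrow>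
    \<exists>e. (\<forall>j<m. e j \<in> E \<and> (\<exists>c. e j = (\<lambda>x. \<Sum>i<m. c i * b i x))) \<and>
      (\<forall>i<m. \<forall>j<m. (\<integral>x. e i x * e j x \<partial>M) = (if i = j then 1 else 0))"
proof (induction m)
  case 0
  then show ?case by simp
next
  case (Suc m)
  have mult: "integrable M (\<lambda>x. u x * v x)" if "u \<in> E" "v \<in> E" for u v
    using E[OF that(1)] E[OF that(2)] by (intro square_integrable_mult) auto
  have sumE: "(\<lambda>x. \<Sum>j<p. c j * f j x) \<in> E" if "\<forall>j<p. f j \<in> E" for p c and f :: "nat \<Rightarrow> 'a \<Rightarrow> real"
    using that
  proof (induction p)
    case (Suc p)
    then have "(\<lambda>x. c p * f p x + 1 * (\<Sum>j<p. c j * f j x)) \<in> E" by (intro lin) auto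
    then show ?case by (simp add: add.commute)
  qed (simp add: zero)
  have "\<forall>c. (AE x in M. (\<Sum>j<m. c j * b j x) = 0) \<longrightarrow> (\<forall>j<m. c j = 0)"
  proof (intro allI impI)
    fix c :: "nat \<Rightarrow> real" and j assume ae: "AE x in M. (\<Sum>j<m. c j * b j x) = 0" and "j < m"
    have "(\<Sum>j<Suc m. (c(m := 0)) j * b j x) = (\<Sum>j<m. c j * b j x)" for x by simp
    then have "AE x in M. (\<Sum>j<Suc m. (c(m := 0)) j * b j x) = 0" using ae by simp
    then have "(c(m := 0)) j = 0" using Suc.prems(2) \<open>j < m\<close> by (metis less_SucI)
    then show "c j = 0" using \<open>j < m\<close> by simp
  qed
  moreover have "\<forall>j<m. b j \<in> E" using Suc.prems(1) by simp
  ultimately obtain e where e: "\<forall>j<m. e j \<in> E \<and> (\<exists>c. e j = (\<lambda>x. \<Sum>i<m. c i * b i x))"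
      "\<forall>i<m. \<forall>j<m. (\<integral>x. e i x * e j x \<partial>M) = (if i = j then 1 else 0)"
    using Suc.IH by blast
  then have eE: "\<And>j. j < m \<Longrightarrow> e j \<in> E"
    and ec: "\<And>j. j < m \<Longrightarrow> \<exists>c. e j = (\<lambda>x. \<Sum>i<m. c i * b i x)"
    and orth: "\<And>i j. i < m \<Longrightarrow> j < m \<Longrightarrow> (\<integral>x. e i x * e j x \<partial>M) = (if i = j then 1 else 0)"
    by blast+
  from ec obtain C where C: "\<And>j. j < m \<Longrightarrow> e j = (\<lambda>x. \<Sum>i<m. C j i * b i x)" by metis
  have bE: "b m \<in> E" using Suc.prems by simp
  let ?a = "\<lambda>j. \<integral>x. b m x * e j x \<partial>M"
  let ?s = "\<lambda>x. \<Sum>j<m. ?a j * e j x"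
  let ?w = "\<lambda>x. 1 * b m x + (-1) * ?s x"
  have sE: "?s \<in> E" by (intro sumE) (auto intro: eE)
  then have wE: "?w \<in> E" by (intro lin bE)
  \<comment> \<open>The coefficients of the remainder with respect to the b's, with the value 1 at m
    that contradicts dependence.\<close>
  let ?d = "\<lambda>i. if i = m then 1 else - (\<Sum>j<m. ?a j * C j i)"
  have wd: "?w x = (\<Sum>i<Suc m. ?d i * b i x)" for x
  proof -
    have "?s x = (\<Sum>j<m. \<Sum>i<m. ?a j * C j i * b i x)"
      by (intro sum.cong refl) (simp add: C sum_distrib_left mult.assoc)
    also have "\<dots> = (\<Sum>i<m. (\<Sum>j<m. ?a j * C j i) * b i x)"
      by (subst sum.swap) (simp add: sum_distrib_right)
    finally show ?thesis by (simp add: sum_negf)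
  qed
  have we: "(\<integral>x. ?w x * e j x \<partial>M) = 0" if j: "j < m" for j
  proof -
    have "(\<integral>x. ?w x * e j x \<partial>M) = (\<integral>x. b m x * e j x - (\<Sum>i<m. ?a i * (e i x * e j x)) \<partial>M)"
      by (intro Bochner_Integration.integral_cong) (auto simp: left_diff_distrib sum_distrib_right mult.assoc)
    also have "\<dots> = ?a j - (\<Sum>i<m. ?a i * (\<integral>x. e i x * e j x \<partial>M))"
      using mult eE j bE by (subst Bochner_Integration.integral_diff)
        (auto intro!: Bochner_Integration.integrable_sum simp: Bochner_Integration.integral_sum)
    also have "(\<Sum>i<m. ?a i * (\<integral>x. e i x * e j x \<partial>M)) = (\<Sum>i<m. if i = j then ?a i else 0)"
      using orth j by (intro sum.cong) auto
    finally show ?thesis using j by simp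
  qed
  let ?N = "\<integral>x. (?w x)\<^sup>2 \<partial>M"
  have N: "?N > 0"
  proof (rule ccontr)
    assume "\<not> ?N > 0"
    then have "?N = 0" by (simp add: antisym not_less)
    then have "AE x in M. (?w x)\<^sup>2 = 0"
      using integral_nonneg_eq_0_iff_AE[of M "\<lambda>x. (?w x)\<^sup>2"] E[OF wE] by simp
    then have "AE x in M. ?w x = 0" by simp
    then have "AE x in M. (\<Sum>i<Suc m. ?d i * b i x) = 0" unfolding wd .
    from Suc.prems(2)[rule_format, OF this, of m] show False by simp
  qed
  let ?f = "\<lambda>x. (1 / sqrt ?N) * ?w x + 0 * ?w x"
  have fE: "?f \<in> E" by (intro lin wE)
  have ff: "(\<integral>x. ?f x * ?f x \<partial>M) = 1"
  proof -
    have "(\<integral>x. ?f x * ?f x \<partial>M) = (\<integral>x. (1 / sqrt ?N)\<^sup>2 * (?w x)\<^sup>2 \<partial>M)"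
      by (intro Bochner_Integration.integral_cong) (auto simp: power2_eq_square)
    then show ?thesis using N by (simp add: power_divide)
  qed
  have fe: "(\<integral>x. ?f x * e j x \<partial>M) = 0" if j: "j < m" for j
  proof -
    have "(\<integral>x. ?f x * e j x \<partial>M) = (\<integral>x. (1 / sqrt ?N) * (?w x * e j x) \<partial>M)"
      by (intro Bochner_Integration.integral_cong) auto
    also have "\<dots> = (1 / sqrt ?N) * (\<integral>x. ?w x * e j x \<partial>M)"
      by (rule Bochner_Integration.integral_mult_right_zero)
    finally show ?thesis unfolding we[OF j] by simp
  qed
  have fc: "\<exists>c. ?f = (\<lambda>x. \<Sum>i<Suc m. c i * b i x)"
  proof (intro exI)
    show "?f = (\<lambda>x. \<Sum>i<Suc m. (1 / sqrt ?N * ?d i) * b i x)"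
    proof (rule ext)
      fix x
      have "?f x = (1 / sqrt ?N) * ?w x" by simp
      also have "\<dots> = (1 / sqrt ?N) * (\<Sum>i<Suc m. ?d i * b i x)" by (simp only: wd[of x])
      also have "\<dots> = (\<Sum>i<Suc m. (1 / sqrt ?N * ?d i) * b i x)" by (simp only: sum_distrib_left mult.assoc)
      finally show "?f x = (\<Sum>i<Suc m. (1 / sqrt ?N * ?d i) * b i x)" .
    qed
  qed
  let ?e = "e(m := ?f)"
  show ?case
  proof (intro exI[of _ ?e] conjI allI impI)
    fix j assume j: "j < Suc m"
    show "?e j \<in> E" using j eE fE by (auto simp: less_Suc_eq)
    show "\<exists>c. ?e j = (\<lambda>x. \<Sum>i<Suc m. c i * b i x)"
    proof (cases "j = m")
      case False
      then have "?e j = (\<lambda>x. \<Sum>i<Suc m. ((C j)(m := 0)) i * b i x)" using C j by (simp add: less_Suc_eq)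
      then show ?thesis by blast
    qed (use fc in simp)
  next
    fix i j assume ij: "i < Suc m" "j < Suc m"
    consider "i = m" "j = m" | "i = m" "j < m" | "i < m" "j = m" | "i < m" "j < m"
      using ij by (auto simp: less_Suc_eq)
    then show "(\<integral>x. ?e i x * ?e j x \<partial>M) = (if i = j then 1 else 0)"
    proof cases
      case 1 then show ?thesis using ff by simp
    next
      case 2 then show ?thesis using fe[of j] by simp
    next
      case 3 then show ?thesis using fe[of i] by (simp add: mult.commute)
    next
      case 4 then show ?thesis using orth[of i j] by simp
    qed
  qed
qed

section \<open>Orthonormal eigenfunctions\<close>

lemma bounded_domain_lmeasurable: "bounded_domain \<Omega> \<Longrightarrow> \<Omega> \<in> lmeasurable"
  unfolding bounded_domain_def by (simp add: lmeasurable_open)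

lemma borel_measurable_lebesgue_on_if_borel:
  fixes f :: "'a::euclidean_space \<Rightarrow> real"
  assumes "f \<in> borel_measurable borel"
  shows "f \<in> borel_measurable (lebesgue_on \<Omega>)"
  by (rule measurable_restrict_space1, rule measurable_completion) (simp add: assms)

lemma test_function_L2:
  assumes "bounded_domain \<Omega>" "\<phi> \<in> test_functions \<Omega>"
  shows "\<phi> \<in> L2 \<Omega>"
proof -
  interpret finite_measure "lebesgue_on \<Omega>"
    by (rule finite_measure_lebesgue_on[OF bounded_domain_lmeasurable[OF assms(1)]])
  obtain B where B: "\<And>x. \<bar>\<phi> x\<bar> \<le> B" using test_function_facts(3)[OF assms(2)] by blast
  have m[measurable]: "\<phi> \<in> borel_measurable (lebesgue_on \<Omega>)"
    by (rule borel_measurable_lebesgue_on_if_borel[OF test_function_facts(2)[OF assms(2)]])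
  have "(\<phi> x)\<^sup>2 \<le> B\<^sup>2" for x
    using power_mono[OF B[of x], of 2] by simp
  then have "integrable (lebesgue_on \<Omega>) (\<lambda>x. (\<phi> x)\<^sup>2)"
    by (intro integrable_const_bound[of _ "B\<^sup>2"]) auto
  then show ?thesis using m by (simp add: L2_def)
qed

lemma L2_mult: "u \<in> L2 \<Omega> \<Longrightarrow> v \<in> L2 \<Omega> \<Longrightarrow> integrable (lebesgue_on \<Omega>) (\<lambda>x. u x * v x)"
  unfolding L2_def by (simp add: square_integrable_mult)

lemma L2_linear: "u \<in> L2 \<Omega> \<Longrightarrow> v \<in> L2 \<Omega> \<Longrightarrow> (\<lambda>x. c * u x + d * v x) \<in> L2 \<Omega>"
  unfolding L2_def by (simp add: square_integrable_linear borel_measurable_add borel_measurable_times borel_measurable_const)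

text \<open>Gives names to the witnesses of membership in \<open>H0 l \<Omega>\<close>, with the
  weak derivatives as one function of the list of directions. The derivative \<open>g []\<close> of
  order 0 is not literally u; \<open>H0_seq_AE_eq\<close> identifies the two almost
  everywhere.\<close>

definition H0_seq :: "nat \<Rightarrow> (real^'n::finite) set \<Rightarrow> (real^'n \<Rightarrow> real) \<Rightarrow> (nat \<Rightarrow> real^'n \<Rightarrow> real)
    \<Rightarrow> ('n list \<Rightarrow> real^'n \<Rightarrow> real) \<Rightarrow> bool" where
  "H0_seq l \<Omega> u \<phi> g \<longleftrightarrow> u \<in> L2 \<Omega> \<and> (\<forall>j. \<phi> j \<in> test_functions \<Omega>) \<and>
     (\<forall>is. length is \<le> l \<longrightarrow> g is \<in> L2 \<Omega> \<and> weak_partials \<Omega> is u (g is) \<and>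
        (\<lambda>j. \<integral>x. (partials is (\<phi> j) x - g is x)\<^sup>2 \<partial>lebesgue_on \<Omega>) \<longlonglongrightarrow> 0)"

lemma H0_iff_H0_seq: "u \<in> H0 l \<Omega> \<longleftrightarrow> (\<exists>\<phi> g. H0_seq l \<Omega> u \<phi> g)"
proof
  assume "u \<in> H0 l \<Omega>"
  then obtain \<phi> where u: "u \<in> L2 \<Omega>" "\<forall>j. \<phi> j \<in> test_functions \<Omega>"
    and g: "\<forall>is. length is \<le> l \<longrightarrow> (\<exists>g. g \<in> L2 \<Omega> \<and> weak_partials \<Omega> is u g \<and>
           (\<lambda>j. \<integral>x. (partials is (\<phi> j) x - g x)\<^sup>2 \<partial>lebesgue_on \<Omega>) \<longlonglongrightarrow> 0)"
    unfolding H0_def by blast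
  let ?P = "\<lambda>is g. g \<in> L2 \<Omega> \<and> weak_partials \<Omega> is u g \<and>
           (\<lambda>j. \<integral>x. (partials is (\<phi> j) x - g x)\<^sup>2 \<partial>lebesgue_on \<Omega>) \<longlonglongrightarrow> 0"
  have "length is \<le> l \<longrightarrow> ?P is (SOME g. ?P is g)" for "is"
    using g someI_ex[of "?P is"] by simp
  then have "H0_seq l \<Omega> u \<phi> (\<lambda>is. SOME g. ?P is g)"
    using u unfolding H0_seq_def by simp
  then show "\<exists>\<phi> g. H0_seq l \<Omega> u \<phi> g" by (intro exI)
next
  assume "\<exists>\<phi> g. H0_seq l \<Omega> u \<phi> g"
  then obtain \<phi> g where "H0_seq l \<Omega> u \<phi> g" by (elim exE)
  then have "u \<in> L2 \<Omega>" and *: "\<forall>j. \<phi> j \<in> test_functions \<Omega>"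
    "length is \<le> l \<longrightarrow> (\<exists>g\<in>L2 \<Omega>. weak_partials \<Omega> is u g \<and>
           (\<lambda>j. \<integral>x. (partials is (\<phi> j) x - g x)\<^sup>2 \<partial>lebesgue_on \<Omega>) \<longlonglongrightarrow> 0)" for "is"
    unfolding H0_seq_def by auto
  show "u \<in> H0 l \<Omega>" unfolding H0_def
  proof (intro CollectI conjI exI[of _ \<phi>] allI)
    show "u \<in> L2 \<Omega>" by fact
    show "\<phi> j \<in> test_functions \<Omega>" for j using *(1) by simp
  qed (rule *(2))
qed

lemma weak_partials_linear:
  assumes dom: "bounded_domain \<Omega>" and "u \<in> L2 \<Omega>" "v \<in> L2 \<Omega>" "g \<in> L2 \<Omega>" "h \<in> L2 \<Omega>"
    and "weak_partials \<Omega> is u g" "weak_partials \<Omega> is v h"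
  shows "weak_partials \<Omega> is (\<lambda>x. c * u x + d * v x) (\<lambda>x. c * g x + d * h x)"
  unfolding weak_partials_def
proof
  fix \<phi> assume \<phi>: "\<phi> \<in> test_functions \<Omega>"
  have p: "partials is \<phi> \<in> L2 \<Omega>" "\<phi> \<in> L2 \<Omega>"
    using \<phi> dom by (auto intro: test_function_L2 partials_test_function)
  have "(\<integral>x. (c * u x + d * v x) * partials is \<phi> x \<partial>lebesgue_on \<Omega>) =
      c * (\<integral>x. u x * partials is \<phi> x \<partial>lebesgue_on \<Omega>) + d * (\<integral>x. v x * partials is \<phi> x \<partial>lebesgue_on \<Omega>)"
    using L2_mult[OF assms(2) p(1)] L2_mult[OF assms(3) p(1)] by (simp add: distrib_right mult.assoc)
  also have "\<dots> = (- 1) ^ length is * (\<integral>x. (c * g x + d * h x) * \<phi> x \<partial>lebesgue_on \<Omega>)"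
    using L2_mult[OF assms(4) p(2)] L2_mult[OF assms(5) p(2)] assms(6,7) \<phi>
    by (simp add: distrib_right distrib_left mult.assoc weak_partials_def)
  finally show "(\<integral>x. (c * u x + d * v x) * partials is \<phi> x \<partial>lebesgue_on \<Omega>)
      = (- 1) ^ length is * (\<integral>x. (c * g x + d * h x) * \<phi> x \<partial>lebesgue_on \<Omega>)" .
qed

lemma H0_linear:
  assumes dom: "bounded_domain \<Omega>" and "u \<in> H0 l \<Omega>" "v \<in> H0 l \<Omega>"
  shows "(\<lambda>x. c * u x + d * v x) \<in> H0 l \<Omega>"
proof -
  obtain \<phi> g where u: "H0_seq l \<Omega> u \<phi> g" using assms H0_iff_H0_seq by blast
  obtain \<psi> h where v: "H0_seq l \<Omega> v \<psi> h" using assms H0_iff_H0_seq by blast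
  have "H0_seq l \<Omega> (\<lambda>x. c * u x + d * v x) (\<lambda>j x. c * \<phi> j x + d * \<psi> j x) (\<lambda>is x. c * g is x + d * h is x)"
    unfolding H0_seq_def
  proof (intro conjI allI impI)
    show "(\<lambda>x. c * u x + d * v x) \<in> L2 \<Omega>" using u v by (auto simp: H0_seq_def intro: L2_linear)
    show "(\<lambda>x. c * \<phi> j x + d * \<psi> j x) \<in> test_functions \<Omega>" for j
      using u v by (auto simp: H0_seq_def intro: test_function_linear)
    fix "is" :: "'a list" assume l: "length is \<le> l"
    have gh: "g is \<in> L2 \<Omega>" "h is \<in> L2 \<Omega>" using u v l by (auto simp: H0_seq_def)
    show "(\<lambda>x. c * g is x + d * h is x) \<in> L2 \<Omega>" by (rule L2_linear[OF gh])
    show "weak_partials \<Omega> is (\<lambda>x. c * u x + d * v x) (\<lambda>x. c * g is x + d * h is x)"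
      using u v l by (intro weak_partials_linear dom gh) (auto simp: H0_seq_def)
    let ?a = "\<lambda>j x. partials is (\<phi> j) x - g is x" and ?b = "\<lambda>j x. partials is (\<psi> j) x - h is x"
    have \<phi>\<psi>: "\<phi> j \<in> test_functions \<Omega>" "\<psi> j \<in> test_functions \<Omega>" for j
      using u v by (auto simp: H0_seq_def)
    have ab: "?a j \<in> L2 \<Omega>" "?b j \<in> L2 \<Omega>" for j
      using L2_linear[OF test_function_L2[OF dom partials_test_function[OF \<phi>\<psi>(1)[of j], of "is"]] gh(1), of 1 "-1"]
       L2_linear[OF test_function_L2[OF dom partials_test_function[OF \<phi>\<psi>(2)[of j], of "is"]] gh(2), of 1 "-1"] by auto
    show "(\<lambda>j. \<integral>x. (partials is (\<lambda>x. c * \<phi> j x + d * \<psi> j x) x - (c * g is x + d * h is x))\<^sup>2 \<partial>lebesgue_on \<Omega>) \<longlonglongrightarrow> 0"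
    proof (rule tendsto_sandwich[of "\<lambda>_. 0"])
      show "\<forall>\<^sub>F j in sequentially. (\<integral>x. (partials is (\<lambda>x. c * \<phi> j x + d * \<psi> j x) x - (c * g is x + d * h is x))\<^sup>2 \<partial>lebesgue_on \<Omega>)
         \<le> 2 * c\<^sup>2 * (\<integral>x. (?a j x)\<^sup>2 \<partial>lebesgue_on \<Omega>) + 2 * d\<^sup>2 * (\<integral>x. (?b j x)\<^sup>2 \<partial>lebesgue_on \<Omega>)"
      proof (intro always_eventually allI)
        fix j
        have "(\<integral>x. (partials is (\<lambda>x. c * \<phi> j x + d * \<psi> j x) x - (c * g is x + d * h is x))\<^sup>2 \<partial>lebesgue_on \<Omega>)
          = (\<integral>x. (c * ?a j x + d * ?b j x)\<^sup>2 \<partial>lebesgue_on \<Omega>)"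
          by (simp add: partials_linear test_function_smooth[OF \<phi>\<psi>(1)] test_function_smooth[OF \<phi>\<psi>(2)] algebra_simps)
        also have "\<dots> \<le> (1 + 1) * (\<integral>x. (c * ?a j x)\<^sup>2 \<partial>lebesgue_on \<Omega>) + (1 + 1 / 1) * (\<integral>x. (d * ?b j x)\<^sup>2 \<partial>lebesgue_on \<Omega>)"
          using ab[of j] by (intro integral_square_add_le(2)) (auto simp: L2_def power_mult_distrib)
        also have "\<dots> = 2 * c\<^sup>2 * (\<integral>x. (?a j x)\<^sup>2 \<partial>lebesgue_on \<Omega>) + 2 * d\<^sup>2 * (\<integral>x. (?b j x)\<^sup>2 \<partial>lebesgue_on \<Omega>)"
          by (simp add: power_mult_distrib)
        finally show "(\<integral>x. (partials is (\<lambda>x. c * \<phi> j x + d * \<psi> j x) x - (c * g is x + d * h is x))\<^sup>2 \<partial>lebesgue_on \<Omega>)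
         \<le> 2 * c\<^sup>2 * (\<integral>x. (?a j x)\<^sup>2 \<partial>lebesgue_on \<Omega>) + 2 * d\<^sup>2 * (\<integral>x. (?b j x)\<^sup>2 \<partial>lebesgue_on \<Omega>)" .
      qed
      have "(\<lambda>j. 2 * c\<^sup>2 * (\<integral>x. (?a j x)\<^sup>2 \<partial>lebesgue_on \<Omega>) + 2 * d\<^sup>2 * (\<integral>x. (?b j x)\<^sup>2 \<partial>lebesgue_on \<Omega>))
         \<longlonglongrightarrow> 2 * c\<^sup>2 * 0 + 2 * d\<^sup>2 * 0"
        using u v l by (intro tendsto_intros) (auto simp: H0_seq_def)
      then show "(\<lambda>j. 2 * c\<^sup>2 * (\<integral>x. (?a j x)\<^sup>2 \<partial>lebesgue_on \<Omega>) + 2 * d\<^sup>2 * (\<integral>x. (?b j x)\<^sup>2 \<partial>lebesgue_on \<Omega>))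
         \<longlonglongrightarrow> 0" by simp
    qed auto
  qed
  then show ?thesis using H0_iff_H0_seq by blast
qed

lemma poly_laplacian_test_function:
  assumes "\<phi> \<in> test_functions \<Omega>"
  shows "poly_laplacian l \<phi> \<in> test_functions \<Omega>"
proof -
  have "(\<lambda>x. \<Sum>is | length is = l. (-1) ^ l * partials is (partials is \<phi>) x) \<in> test_functions \<Omega>"
    by (intro partials_sum(1) finite_lists_UNIV partials_test_function assms)
  then show ?thesis by (simp add: poly_laplacian_eq[OF assms] sum_distrib_left)
qed

lemma eigenspace_linear:
  assumes dom: "bounded_domain \<Omega>" and u: "u \<in> eigenspace l \<Omega> \<mu>" and v: "v \<in> eigenspace l \<Omega> \<mu>"
  shows "(\<lambda>x. c * u x + d * v x) \<in> eigenspace l \<Omega> \<mu>"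
proof -
  have uv: "u \<in> L2 \<Omega>" "v \<in> L2 \<Omega>" using u v by (auto simp: eigenspace_def H0_def)
  have "(\<integral>x. (c * u x + d * v x) * poly_laplacian l \<phi> x \<partial>lebesgue_on \<Omega>) = \<mu> * (\<integral>x. (c * u x + d * v x) * \<phi> x \<partial>lebesgue_on \<Omega>)"
    if \<phi>: "\<phi> \<in> test_functions \<Omega>" for \<phi>
  proof -
    have p: "poly_laplacian l \<phi> \<in> L2 \<Omega>" "\<phi> \<in> L2 \<Omega>"
      using \<phi> dom by (auto intro: test_function_L2 poly_laplacian_test_function)
    show ?thesis
      using L2_mult[OF uv(1) p(1)] L2_mult[OF uv(2) p(1)] L2_mult[OF uv(1) p(2)] L2_mult[OF uv(2) p(2)] u v \<phi>
      by (simp add: distrib_right distrib_left mult.assoc eigenspace_def)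
  qed
  then show ?thesis using u v by (auto simp: eigenspace_def intro: H0_linear[OF dom])
qed

text \<open>Half of the 2l derivatives move from the test function to u. The sign (-1)^l of the weak
  derivative cancels the one of the operator.\<close>

lemma integral_poly_laplacian:
  assumes dom: "bounded_domain \<Omega>" and u: "u \<in> L2 \<Omega>" and \<psi>: "\<psi> \<in> test_functions \<Omega>"
    and g: "\<And>is. length is = l \<Longrightarrow> weak_partials \<Omega> is u (g is)"
  shows "(\<integral>x. u x * poly_laplacian l \<psi> x \<partial>lebesgue_on \<Omega>) =
     (\<Sum>is | length is = l. \<integral>x. g is x * partials is \<psi> x \<partial>lebesgue_on \<Omega>)"
proof -
  have i: "integrable (lebesgue_on \<Omega>) (\<lambda>x. u x * partials is (partials is \<psi>) x)" for "is"
    by (intro L2_mult u test_function_L2 dom partials_test_function \<psi>)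
  have "(\<integral>x. u x * poly_laplacian l \<psi> x \<partial>lebesgue_on \<Omega>) =
      (\<integral>x. (\<Sum>is | length is = l. (-1) ^ l * (u x * partials is (partials is \<psi>) x)) \<partial>lebesgue_on \<Omega>)"
    by (simp add: poly_laplacian_eq[OF \<psi>] sum_distrib_left mult.left_commute)
  also have "\<dots> = (\<Sum>is | length is = l. (-1) ^ l * (\<integral>x. u x * partials is (partials is \<psi>) x \<partial>lebesgue_on \<Omega>))"
    using i by (subst Bochner_Integration.integral_sum) auto
  also have "\<dots> = (\<Sum>is | length is = l. \<integral>x. g is x * partials is \<psi> x \<partial>lebesgue_on \<Omega>)"
  proof (intro sum.cong refl)
    fix "is" :: "'a list" assume "is \<in> {is. length is = l}"
    then have l: "length is = l" by simp
    have "(\<integral>x. u x * partials is (partials is \<psi>) x \<partial>lebesgue_on \<Omega>) = (-1) ^ l * (\<integral>x. g is x * partials is \<psi> x \<partial>lebesgue_on \<Omega>)"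
      using g[OF l] partials_test_function[OF \<psi>, of "is"] l unfolding weak_partials_def by simp
    then show "(-1) ^ l * (\<integral>x. u x * partials is (partials is \<psi>) x \<partial>lebesgue_on \<Omega>) = (\<integral>x. g is x * partials is \<psi> x \<partial>lebesgue_on \<Omega>)"
      by (simp add: power_mult_distrib[symmetric] mult.assoc[symmetric])
  qed
  finally show ?thesis .
qed

text \<open>The equation is given for test functions only; taking the test functions that
  approximate v and passing to the limit extends it to v. The right-hand side is symmetric in u and
  v, which yields orthogonality for different eigenvalues, and for v = u the energy of an
  eigenfunction.\<close>

lemma eigenfunction_weak_form:
  assumes dom: "bounded_domain \<Omega>" and u: "u \<in> eigenspace l \<Omega> \<mu>"
    and gu: "H0_seq l \<Omega> u \<phi> g" and gv: "H0_seq l \<Omega> v \<psi> h"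
  shows "\<mu> * (\<integral>x. u x * h [] x \<partial>lebesgue_on \<Omega>) = (\<Sum>is | length is = l. \<integral>x. g is x * h is x \<partial>lebesgue_on \<Omega>)"
proof -
  have \<psi>: "\<psi> m \<in> test_functions \<Omega>" for m using gv by (simp add: H0_seq_def)
  have uL: "u \<in> L2 \<Omega>" using gu by (simp add: H0_seq_def)
  have lim: "(\<lambda>m. \<integral>x. w x * partials is (\<psi> m) x \<partial>lebesgue_on \<Omega>) \<longlonglongrightarrow> (\<integral>x. w x * h is x \<partial>lebesgue_on \<Omega>)"
    if "w \<in> L2 \<Omega>" "length is \<le> l" for w "is"
  proof -
    have "partials is (\<psi> m) \<in> L2 \<Omega>" for m by (intro test_function_L2 dom partials_test_function \<psi>)
    moreover have "h is \<in> L2 \<Omega>" using gv that by (simp add: H0_seq_def)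
    ultimately show ?thesis using that gv
      by (intro L2_limit_mult) (auto simp: L2_def H0_seq_def)
  qed
  have eq: "\<mu> * (\<integral>x. u x * partials [] (\<psi> m) x \<partial>lebesgue_on \<Omega>) =
      (\<Sum>is | length is = l. \<integral>x. g is x * partials is (\<psi> m) x \<partial>lebesgue_on \<Omega>)" for m
    using u \<psi>[of m] integral_poly_laplacian[OF dom uL \<psi>, of l g m] gu
    by (simp add: eigenspace_def H0_seq_def)
  have "(\<lambda>m. \<mu> * (\<integral>x. u x * partials [] (\<psi> m) x \<partial>lebesgue_on \<Omega>)) \<longlonglongrightarrow> \<mu> * (\<integral>x. u x * h [] x \<partial>lebesgue_on \<Omega>)"
    by (intro tendsto_intros lim uL) simp
  moreover have "(\<lambda>m. \<mu> * (\<integral>x. u x * partials [] (\<psi> m) x \<partial>lebesgue_on \<Omega>)) \<longlonglongrightarrow>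
      (\<Sum>is | length is = l. \<integral>x. g is x * h is x \<partial>lebesgue_on \<Omega>)"
    unfolding eq using gu by (intro tendsto_sum lim) (auto simp: H0_seq_def)
  ultimately show ?thesis by (rule LIMSEQ_unique)
qed

text \<open>A function orthogonal to all test functions would be an eigenfunction for every real number,
  but only countably many numbers are eigenvalues.\<close>

lemma orthogonal_to_test_functions_AE_zero:
  assumes dom: "bounded_domain \<Omega>" and ev: "dirichlet_eigenvalues l \<Omega> ev" and w: "w \<in> L2 \<Omega>"
    and orth: "\<And>\<phi>. \<phi> \<in> test_functions \<Omega> \<Longrightarrow> (\<integral>x. w x * \<phi> x \<partial>lebesgue_on \<Omega>) = 0"
  shows "AE x in lebesgue_on \<Omega>. w x = 0"
proof (rule ccontr)
  assume nz: "\<not> (AE x in lebesgue_on \<Omega>. w x = 0)"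
  \<comment> \<open>The conditions relating w to its derivatives only involve integrals against test
    functions, all of which vanish. So zero serves as every weak derivative and as the approximating
    sequence.\<close>
  have "H0_seq l \<Omega> w (\<lambda>j x. 0) (\<lambda>is x. 0)"
    unfolding H0_seq_def
  proof (intro conjI allI impI)
    show "(\<lambda>x. 0) \<in> L2 \<Omega>" by (simp add: L2_def)
    show "weak_partials \<Omega> is w (\<lambda>x. 0)" for "is"
      by (simp add: weak_partials_def orth[OF partials_test_function])
  qed (simp_all add: w zero_test_function partials_zero)
  then have "w \<in> H0 l \<Omega>" using H0_iff_H0_seq by blast
  then have "w \<in> eigenspace l \<Omega> \<mu>" for \<mu>
    by (auto simp: eigenspace_def orth poly_laplacian_test_function)
  have "\<exists>i. ev i = \<mu>" for \<mu>
  proof (rule ccontr)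
    assume "\<nexists>i. ev i = \<mu>"
    then have "card {i. 1 \<le> i \<and> ev i = \<mu>} = 0" by simp
    then have "ae_dim \<Omega> (eigenspace l \<Omega> \<mu>) 0" using ev unfolding dirichlet_eigenvalues_def by metis
    with \<open>w \<in> eigenspace l \<Omega> \<mu>\<close> nz show False by (auto simp: ae_dim_def)
  qed
  then have "surj ev" by (metis surjI)
  then have "countable (UNIV :: real set)" by (metis countable_image countableI_type)
  then show False using uncountable_UNIV_real by blast
qed

text \<open>A weak derivative of order 0 has the same integrals against test functions, so the
  difference is orthogonal to all of them.\<close>

lemma H0_seq_AE_eq:
  assumes dom: "bounded_domain \<Omega>" and ev: "dirichlet_eigenvalues l \<Omega> ev" and v: "H0_seq l' \<Omega> v \<psi> h"
  shows "AE x in lebesgue_on \<Omega>. h [] x = v x"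
proof -
  have vh: "v \<in> L2 \<Omega>" "h [] \<in> L2 \<Omega>" "weak_partials \<Omega> [] v (h [])" using v by (auto simp: H0_seq_def)
  have "AE x in lebesgue_on \<Omega>. 1 * v x + (-1) * h [] x = 0"
  proof (rule orthogonal_to_test_functions_AE_zero[OF dom ev])
    show "(\<lambda>x. 1 * v x + (-1) * h [] x) \<in> L2 \<Omega>" by (rule L2_linear[OF vh(1,2)])
    fix \<phi> assume \<phi>: "\<phi> \<in> test_functions \<Omega>"
    note \<phi>2 = test_function_L2[OF dom \<phi>]
    show "(\<integral>x. (1 * v x + (-1) * h [] x) * \<phi> x \<partial>lebesgue_on \<Omega>) = 0"
      using L2_mult[OF vh(1) \<phi>2] L2_mult[OF vh(2) \<phi>2] vh(3) \<phi> by (simp add: left_diff_distrib weak_partials_def)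
  qed
  then show ?thesis by eventually_elim simp
qed

lemma integral_mult_cong_AE:
  fixes u v h :: "'a \<Rightarrow> real"
  assumes "AE x in M. h x = v x" "h \<in> borel_measurable M" "v \<in> borel_measurable M" "u \<in> borel_measurable M"
  shows "(\<integral>x. u x * h x \<partial>M) = (\<integral>x. u x * v x \<partial>M)"
proof (rule integral_cong_AE)
  show "AE x in M. u x * h x = u x * v x" using assms(1) by eventually_elim simp
qed (use assms in measurable)

text \<open>Within one eigenspace, Gram-Schmidt is applied to a basis with as many elements as there
  are indices carrying the eigenvalue. Between different eigenvalues, evaluating the symmetric weak
  form both ways gives orthogonality.\<close>

lemma orthonormal_eigenfunctions:
  fixes \<Omega> :: "(real^'n) set"
  assumes dom: "bounded_domain \<Omega>" and ev: "dirichlet_eigenvalues l \<Omega> ev"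
  obtains u where "\<And>i. i \<ge> 1 \<Longrightarrow> u i \<in> eigenspace l \<Omega> (ev i)"
    "\<And>i j. i \<ge> 1 \<Longrightarrow> j \<ge> 1 \<Longrightarrow> (\<integral>x. u i x * u j x \<partial>lebesgue_on \<Omega>) = (if i = j then 1 else 0)"
proof -
  have "\<exists>f. \<forall>i\<in>{i. 1 \<le> i \<and> ev i = \<mu>}. f i \<in> eigenspace l \<Omega> \<mu> \<and>
     (\<forall>j\<in>{i. 1 \<le> i \<and> ev i = \<mu>}. (\<integral>x. f i x * f j x \<partial>lebesgue_on \<Omega>) = (if i = j then 1 else 0))" for \<mu>
  proof -
    let ?S = "{i. 1 \<le> i \<and> ev i = \<mu>}" and ?E = "eigenspace l \<Omega> \<mu>"
    have "\<forall>\<mu>. finite {i. 1 \<le> i \<and> ev i = \<mu>} \<and>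
          ae_dim \<Omega> (eigenspace l \<Omega> \<mu>) (card {i. 1 \<le> i \<and> ev i = \<mu>})"
      using ev unfolding dirichlet_eigenvalues_def by (rule conjunct2)
    note * = spec[OF this, of \<mu>]
    note fin = conjunct1[OF *] and dim = conjunct2[OF *]
    obtain b where b: "\<forall>j<card ?S. b j \<in> ?E"
      "\<forall>c. (AE x in lebesgue_on \<Omega>. (\<Sum>j<card ?S. c j * b j x) = 0) \<longrightarrow> (\<forall>j<card ?S. c j = 0)"
      using dim unfolding ae_dim_def by (elim exE conjE) (rule that)
    have zero: "(\<lambda>x. 0) \<in> ?E"
    proof -
      have "H0_seq l \<Omega> (\<lambda>x. 0) (\<lambda>j x. 0) (\<lambda>is x. 0)"
        by (simp add: H0_seq_def zero_test_function partials_zero weak_partials_def L2_def)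
      then have "(\<lambda>x. 0) \<in> H0 l \<Omega>" using H0_iff_H0_seq by blast
      then show ?thesis by (auto simp: eigenspace_def)
    qed
    have L2: "u \<in> borel_measurable (lebesgue_on \<Omega>) \<and> integrable (lebesgue_on \<Omega>) (\<lambda>x. (u x)\<^sup>2)" if "u \<in> ?E" for u
      using that by (simp add: eigenspace_def H0_def L2_def)
    obtain e where e: "\<forall>j<card ?S. e j \<in> ?E"
      "\<forall>i<card ?S. \<forall>j<card ?S. (\<integral>x. e i x * e j x \<partial>lebesgue_on \<Omega>) = (if i = j then 1 else 0)"
    proof -
      have "\<exists>e. (\<forall>j<card ?S. e j \<in> ?E \<and> (\<exists>c. e j = (\<lambda>x. \<Sum>i<card ?S. c i * b i x))) \<and>
        (\<forall>i<card ?S. \<forall>j<card ?S. (\<integral>x. e i x * e j x \<partial>lebesgue_on \<Omega>) = (if i = j then 1 else 0))"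
        by (rule gram_schmidt[where E="?E", OF _ zero L2 b]) (rule eigenspace_linear[OF dom])
      then obtain e where *: "\<forall>j<card ?S. e j \<in> ?E \<and> (\<exists>c. e j = (\<lambda>x. \<Sum>i<card ?S. c i * b i x))"
        "\<forall>i<card ?S. \<forall>j<card ?S. (\<integral>x. e i x * e j x \<partial>lebesgue_on \<Omega>) = (if i = j then 1 else 0)"
        by (elim exE conjE) (rule that)
      from *(1) have "\<forall>j<card ?S. e j \<in> ?E" by simp
      then show ?thesis by (rule that[OF _ *(2)])
    qed
    obtain t where t: "bij_betw t ?S {0..<card ?S}"
      using ex_bij_betw_finite_nat[OF fin] by (elim exE) (rule that)
    have tl: "t i < card ?S" if "i \<in> ?S" for i using bij_betw_apply[OF t that] by simp
    have ti: "t i = t j \<longleftrightarrow> i = j" if "i \<in> ?S" "j \<in> ?S" for i j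
      by (rule inj_on_eq_iff[OF bij_betw_imp_inj_on[OF t] that])
    show ?thesis
    proof (intro exI[of _ "\<lambda>i. e (t i)"] ballI conjI)
      fix i assume i: "i \<in> ?S"
      show "e (t i) \<in> ?E" by (rule e(1)[rule_format, OF tl[OF i]])
      fix j assume j: "j \<in> ?S"
      show "(\<integral>x. e (t i) x * e (t j) x \<partial>lebesgue_on \<Omega>) = (if i = j then 1 else 0)"
        using e(2)[rule_format, OF tl[OF i] tl[OF j]] ti[OF i j] by simp
    qed
  qed
  note ex = this
  \<comment> \<open>The orthonormal families are chosen for all \<mu> at once; index i takes its
    member from the family of \<open>ev i\<close>.\<close>
  define F where "F = (\<lambda>\<mu>. SOME f. \<forall>i\<in>{i. 1 \<le> i \<and> ev i = \<mu>}. f i \<in> eigenspace l \<Omega> \<mu> \<and>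
     (\<forall>j\<in>{i. 1 \<le> i \<and> ev i = \<mu>}. (\<integral>x. f i x * f j x \<partial>lebesgue_on \<Omega>) = (if i = j then 1 else 0)))"
  have FF: "\<forall>i\<in>{i. 1 \<le> i \<and> ev i = \<mu>}. F \<mu> i \<in> eigenspace l \<Omega> \<mu> \<and>
     (\<forall>j\<in>{i. 1 \<le> i \<and> ev i = \<mu>}. (\<integral>x. F \<mu> i x * F \<mu> j x \<partial>lebesgue_on \<Omega>) = (if i = j then 1 else 0))" for \<mu>
    unfolding F_def by (rule someI_ex[OF ex])
  have F: "F \<mu> i \<in> eigenspace l \<Omega> \<mu>" if "i \<ge> 1" "ev i = \<mu>" for \<mu> i
    using bspec[OF FF[of \<mu>], of i] that by simp
  have F': "(\<integral>x. F \<mu> i x * F \<mu> j x \<partial>lebesgue_on \<Omega>) = (if i = j then 1 else 0)"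
    if "i \<ge> 1" "ev i = \<mu>" "j \<ge> 1" "ev j = \<mu>" for \<mu> i j
    using bspec[OF FF[of \<mu>], of i] that by simp
  let ?u = "\<lambda>i. F (ev i) i"
  show ?thesis
  proof (rule that[of ?u])
    show E: "?u i \<in> eigenspace l \<Omega> (ev i)" if "i \<ge> 1" for i by (rule F[OF that refl])
    fix i j :: nat assume ij: "i \<ge> 1" "j \<ge> 1"
    show "(\<integral>x. ?u i x * ?u j x \<partial>lebesgue_on \<Omega>) = (if i = j then 1 else 0)"
    proof (cases "ev i = ev j")
      case True
      then show ?thesis using F'[OF ij(1) True ij(2) refl] by simp
    next
      case False
      obtain \<phi> g where g: "H0_seq l \<Omega> (?u i) \<phi> g"
        using E[OF ij(1)] unfolding eigenspace_def H0_iff_H0_seq by (elim CollectE conjE exE) (rule that)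
      obtain \<psi> h where h: "H0_seq l \<Omega> (?u j) \<psi> h"
        using E[OF ij(2)] unfolding eigenspace_def H0_iff_H0_seq by (elim CollectE conjE exE) (rule that)
      have L: "?u i \<in> L2 \<Omega>" "?u j \<in> L2 \<Omega>" "g [] \<in> L2 \<Omega>" "h [] \<in> L2 \<Omega>" using g h by (auto simp: H0_seq_def)
      have "ev i * (\<integral>x. ?u i x * ?u j x \<partial>lebesgue_on \<Omega>) = (\<Sum>is | length is = l. \<integral>x. g is x * h is x \<partial>lebesgue_on \<Omega>)"
        using eigenfunction_weak_form[OF dom E[OF ij(1)] g h]
          integral_mult_cong_AE[OF H0_seq_AE_eq[OF dom ev h], of "?u i"] L by (simp add: L2_def)
      moreover have "ev j * (\<integral>x. ?u j x * ?u i x \<partial>lebesgue_on \<Omega>) = (\<Sum>is | length is = l. \<integral>x. h is x * g is x \<partial>lebesgue_on \<Omega>)"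
        using eigenfunction_weak_form[OF dom E[OF ij(2)] h g]
          integral_mult_cong_AE[OF H0_seq_AE_eq[OF dom ev g], of "?u j"] L by (simp add: L2_def)
      ultimately have "(ev i - ev j) * (\<integral>x. ?u i x * ?u j x \<partial>lebesgue_on \<Omega>) = 0"
        by (simp add: left_diff_distrib mult.commute)
      then show ?thesis using False by auto
    qed
  qed
qed

section \<open>Borel representatives on the whole space\<close>

lemma integral_lebesgue_on_lborel:
  fixes f :: "'a::euclidean_space \<Rightarrow> real"
  assumes "f \<in> borel_measurable borel" "\<Omega> \<in> sets lebesgue" "\<And>x. x \<notin> \<Omega> \<Longrightarrow> f x = 0"
  shows "(\<integral>x. f x \<partial>lebesgue_on \<Omega>) = (\<integral>x. f x \<partial>lborel)"
    and "integrable (lebesgue_on \<Omega>) f \<longleftrightarrow> integrable lborel f"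
proof -
  have eq: "(\<lambda>x. indicator \<Omega> x * f x) = f" using assms(3) by (auto simp: fun_eq_iff indicator_def)
  show "(\<integral>x. f x \<partial>lebesgue_on \<Omega>) = (\<integral>x. f x \<partial>lborel)"
    using assms by (subst integral_restrict_space) (auto simp: eq integral_completion)
  show "integrable (lebesgue_on \<Omega>) f \<longleftrightarrow> integrable lborel f"
    using assms by (subst integrable_restrict_space) (auto simp: eq integrable_completion)
qed

text \<open>Eigenfunctions are merely Lebesgue measurable on \<Omega>, whereas the Fourier integrals
  are taken over the whole space with respect to \<open>lborel\<close>. This is the extension by 0
  in a Borel version.\<close>

lemma L2_borel_representative:
  fixes u :: "real^'n \<Rightarrow> real"
  assumes dom: "bounded_domain \<Omega>" and u: "u \<in> L2 \<Omega>"
  obtains U where "U \<in> borel_measurable borel" "\<And>x. x \<notin> \<Omega> \<Longrightarrow> U x = 0" "AE x in lebesgue_on \<Omega>. U x = u x"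
proof -
  have o: "open \<Omega>" using dom by (simp add: bounded_domain_def)
  have s: "\<Omega> \<in> sets lebesgue" using o by simp
  have "(\<lambda>x. if x \<in> \<Omega> then u x else 0) \<in> borel_measurable lebesgue"
    using u s borel_measurable_if[of \<Omega> u] by (simp add: L2_def)
  then obtain g where g: "g \<in> borel_measurable lborel" "AE x in lborel. (if x \<in> \<Omega> then u x else 0) = g x"
    using completion_ex_borel_measurable_real by blast
  show ?thesis
  proof (rule that[of "\<lambda>x. indicator \<Omega> x * g x"])
    show "(\<lambda>x. indicator \<Omega> x * g x) \<in> borel_measurable borel" 
    proof -
      have [measurable]: "g \<in> borel_measurable borel" "\<Omega> \<in> sets borel" using g(1) o by simp_all
      show ?thesis by measurable
    qed
    have "AE x in lebesgue. (if x \<in> \<Omega> then u x else 0) = g x" using g(2) by (rule AE_completion)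
    then have "AE x in lebesgue. x \<in> \<Omega> \<longrightarrow> indicator \<Omega> x * g x = u x" by eventually_elim auto
    then show "AE x in lebesgue_on \<Omega>. indicator \<Omega> x * g x = u x" using s by (simp add: AE_restrict_space_iff)
  qed simp
qed

text \<open>The interface between the spectral problem and Fourier analysis: the eigenvalues survive
  only as limits of energies of test functions, so no derivative of an eigenfunction has to be
  transformed.\<close>

lemma spectral_data:
  fixes \<Omega> :: "(real^'n) set"
  assumes dom: "bounded_domain \<Omega>" and ev: "dirichlet_eigenvalues l \<Omega> ev"
  obtains U \<Phi> where
    "\<And>i. i \<ge> 1 \<Longrightarrow> U i \<in> borel_measurable borel" "\<And>i x. i \<ge> 1 \<Longrightarrow> x \<notin> \<Omega> \<Longrightarrow> U i x = 0"
    "\<And>i. i \<ge> 1 \<Longrightarrow> integrable lborel (\<lambda>x. (U i x)\<^sup>2)"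
    "\<And>i j. i \<ge> 1 \<Longrightarrow> j \<ge> 1 \<Longrightarrow> (\<integral>x. U i x * U j x \<partial>lborel) = (if i = j then 1 else 0)"
    "\<And>i m. i \<ge> 1 \<Longrightarrow> \<Phi> i m \<in> test_functions \<Omega>"
    "\<And>i. i \<ge> 1 \<Longrightarrow> (\<lambda>m. \<integral>x. (\<Phi> i m x - U i x)\<^sup>2 \<partial>lborel) \<longlonglongrightarrow> 0"
    "\<And>i. i \<ge> 1 \<Longrightarrow> (\<lambda>m. \<Sum>is | length is = l. \<integral>x. (partials is (\<Phi> i m) x)\<^sup>2 \<partial>lborel) \<longlonglongrightarrow> ev i"
proof -
  have s: "\<Omega> \<in> sets lebesgue" using dom by (simp add: bounded_domain_def)
  obtain u where uE: "\<And>i. i \<ge> 1 \<Longrightarrow> u i \<in> eigenspace l \<Omega> (ev i)"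
    and orth: "\<And>i j. i \<ge> 1 \<Longrightarrow> j \<ge> 1 \<Longrightarrow> (\<integral>x. u i x * u j x \<partial>lebesgue_on \<Omega>) = (if i = j then 1 else 0)"
    by (rule orthonormal_eigenfunctions[OF dom ev]) blast
  have uL: "u i \<in> L2 \<Omega>" if "i \<ge> 1" for i using uE[OF that] by (simp add: eigenspace_def H0_def)
  let ?PU = "\<lambda>i U. U \<in> borel_measurable borel \<and> (\<forall>x. x \<notin> \<Omega> \<longrightarrow> U x = 0) \<and> (AE x in lebesgue_on \<Omega>. U x = u i x)"
  define U where "U = (\<lambda>i. SOME U. ?PU i U)"
  have UU: "?PU i (U i)" if i: "i \<ge> 1" for i
  proof -
    obtain W where "W \<in> borel_measurable borel" "\<And>x. x \<notin> \<Omega> \<Longrightarrow> W x = 0" "AE x in lebesgue_on \<Omega>. W x = u i x"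
      by (rule L2_borel_representative[OF dom uL[OF i]]) (rule that)
    then have "?PU i W" by simp
    then have "\<exists>U. ?PU i U" by - (rule exI[of _ W])
    then show ?thesis unfolding U_def by (rule someI_ex)
  qed
  have U: "U i \<in> borel_measurable borel" "\<And>x. x \<notin> \<Omega> \<Longrightarrow> U i x = 0"
    "AE x in lebesgue_on \<Omega>. U i x = u i x" if "i \<ge> 1" for i
    using UU[OF that] by simp_all
  define \<Phi> where "\<Phi> = (\<lambda>i. SOME \<phi>. \<exists>g. H0_seq l \<Omega> (u i) \<phi> g)"
  define G where "G = (\<lambda>i. SOME g. H0_seq l \<Omega> (u i) (\<Phi> i) g)"
  have H: "H0_seq l \<Omega> (u i) (\<Phi> i) (G i)" if "i \<ge> 1" for i
  proof -
    have "u i \<in> H0 l \<Omega>" using uE[OF that] by (simp add: eigenspace_def)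
    then have "\<exists>\<phi> g. H0_seq l \<Omega> (u i) \<phi> g" by (simp only: H0_iff_H0_seq)
    then have "\<exists>g. H0_seq l \<Omega> (u i) (\<Phi> i) g" unfolding \<Phi>_def by (rule someI_ex)
    then show ?thesis unfolding G_def by (rule someI_ex)
  qed
  have m: "U i \<in> borel_measurable (lebesgue_on \<Omega>)" "u i \<in> borel_measurable (lebesgue_on \<Omega>)" if "i \<ge> 1" for i
    using U(1)[OF that] uL[OF that] by (auto intro: borel_measurable_lebesgue_on_if_borel simp: L2_def)
  show ?thesis
  proof (rule that[of U \<Phi>])
    fix i :: nat assume i: "i \<ge> 1"
    show "U i \<in> borel_measurable borel" by (rule U(1)[OF i])
    show "\<And>x. x \<notin> \<Omega> \<Longrightarrow> U i x = 0" by (rule U(2)[OF i])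
    have "integrable (lebesgue_on \<Omega>) (\<lambda>x. (U i x)\<^sup>2)"
    proof (subst integrable_cong_AE)
      show "AE x in lebesgue_on \<Omega>. (U i x)\<^sup>2 = (u i x)\<^sup>2" using U(3)[OF i] by eventually_elim simp
      show "integrable (lebesgue_on \<Omega>) (\<lambda>x. (u i x)\<^sup>2)" using uL[OF i] by (simp add: L2_def)
      note [measurable] = m[OF i]
      show "(\<lambda>x. (U i x)\<^sup>2) \<in> borel_measurable (lebesgue_on \<Omega>)"
        "(\<lambda>x. (u i x)\<^sup>2) \<in> borel_measurable (lebesgue_on \<Omega>)" by measurable
    qed
    then show "integrable lborel (\<lambda>x. (U i x)\<^sup>2)"
      using U(1,2)[OF i] s by (subst (asm) integral_lebesgue_on_lborel(2)) auto
    have \<Phi>: "\<Phi> i m \<in> test_functions \<Omega>" for m using H[OF i] by (simp add: H0_seq_def)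
    then show "\<And>m. \<Phi> i m \<in> test_functions \<Omega>" .
    have p: "partials is (\<Phi> i m) \<in> test_functions \<Omega>" for "is" m by (rule partials_test_function[OF \<Phi>])
    note Hi = conjunct2[OF conjunct2[OF H[OF i, unfolded H0_seq_def]]]
    have GL: "G i is \<in> L2 \<Omega>" if "length is \<le> l" for "is"
      by (rule conjunct1[OF mp[OF spec[OF Hi] that]])
    have Glim: "(\<lambda>j. \<integral>x. (partials is (\<Phi> i j) x - G i is x)\<^sup>2 \<partial>lebesgue_on \<Omega>) \<longlonglongrightarrow> 0"
      if "length is \<le> l" for "is"
      by (rule conjunct2[OF conjunct2[OF mp[OF spec[OF Hi] that]]])
    note GL2 = GL[unfolded L2_def, simplified]
    have G0: "G i [] \<in> borel_measurable (lebesgue_on \<Omega>)" using GL2[of "[]"] by simp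
    note pm = test_function_facts(2)[OF p]
    note pL = test_function_L2[OF dom p]
    show "(\<lambda>m. \<integral>x. (\<Phi> i m x - U i x)\<^sup>2 \<partial>lborel) \<longlonglongrightarrow> 0"
    proof -
      have "(\<integral>x. (\<Phi> i m x - U i x)\<^sup>2 \<partial>lborel) = (\<integral>x. (partials [] (\<Phi> i m) x - G i [] x)\<^sup>2 \<partial>lebesgue_on \<Omega>)" for m
      proof -
        have "(\<integral>x. (\<Phi> i m x - U i x)\<^sup>2 \<partial>lborel) = (\<integral>x. (\<Phi> i m x - U i x)\<^sup>2 \<partial>lebesgue_on \<Omega>)"
          using U(1,2)[OF i] test_function_facts(2,6)[OF \<Phi>] s
          by (subst integral_lebesgue_on_lborel(1)) auto
        also have "\<dots> = (\<integral>x. (partials [] (\<Phi> i m) x - G i [] x)\<^sup>2 \<partial>lebesgue_on \<Omega>)"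
        proof (rule integral_cong_AE)
          show "AE x in lebesgue_on \<Omega>. (\<Phi> i m x - U i x)\<^sup>2 = (partials [] (\<Phi> i m) x - G i [] x)\<^sup>2"
            using U(3)[OF i] H0_seq_AE_eq[OF dom ev H[OF i]] by eventually_elim simp
          have [measurable]: "\<Phi> i m \<in> borel_measurable (lebesgue_on \<Omega>)"
            using pL[of "[]" m] by (simp add: L2_def)
          note [measurable] = m[OF i] G0
          show "(\<lambda>x. (\<Phi> i m x - U i x)\<^sup>2) \<in> borel_measurable (lebesgue_on \<Omega>)" by measurable
          show "(\<lambda>x. (partials [] (\<Phi> i m) x - G i [] x)\<^sup>2) \<in> borel_measurable (lebesgue_on \<Omega>)"
            unfolding partials_Nil by measurable
        qed
        finally show ?thesis .
      qed
      then show ?thesis using Glim[of "[]"] by simp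
    qed
    show "(\<lambda>m. \<Sum>is | length is = l. \<integral>x. (partials is (\<Phi> i m) x)\<^sup>2 \<partial>lborel) \<longlonglongrightarrow> ev i"
    proof -
      have eq: "(\<integral>x. (partials is (\<Phi> i m) x)\<^sup>2 \<partial>lborel) = (\<integral>x. (partials is (\<Phi> i m) x)\<^sup>2 \<partial>lebesgue_on \<Omega>)" for "is" m
        using pm[of "is" m] test_function_facts(6)[OF p[of "is" m]] s
        by (subst integral_lebesgue_on_lborel(1)) auto
      have "(\<lambda>m. \<Sum>is | length is = l. \<integral>x. (partials is (\<Phi> i m) x)\<^sup>2 \<partial>lborel) \<longlonglongrightarrow>
          (\<Sum>is | length is = l. \<integral>x. (G i is x)\<^sup>2 \<partial>lebesgue_on \<Omega>)"
        unfolding eq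
      proof (intro tendsto_sum L2_limit_square)
        fix "is" :: "'n list" assume "is \<in> {is. length is = l}"
        then have l: "length is \<le> l" by simp
        show "(\<lambda>m. \<integral>x. (partials is (\<Phi> i m) x - G i is x)\<^sup>2 \<partial>lebesgue_on \<Omega>) \<longlonglongrightarrow> 0" by (rule Glim[OF l])
        show "G i is \<in> borel_measurable (lebesgue_on \<Omega>)" "integrable (lebesgue_on \<Omega>) (\<lambda>x. (G i is x)\<^sup>2)"
          using GL2[OF l] by simp_all
        show "partials is (\<Phi> i m) \<in> borel_measurable (lebesgue_on \<Omega>)"
          "integrable (lebesgue_on \<Omega>) (\<lambda>x. (partials is (\<Phi> i m) x)\<^sup>2)" for m
          using pL[of "is" m] by (simp_all add: L2_def)
      qed
      \<comment> \<open>The weak form of the eigenvalue equation tested with the eigenfunction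
        itself.\<close>
      also have "(\<Sum>is | length is = l. \<integral>x. (G i is x)\<^sup>2 \<partial>lebesgue_on \<Omega>) = ev i * (\<integral>x. u i x * G i [] x \<partial>lebesgue_on \<Omega>)"
        using eigenfunction_weak_form[OF dom uE[OF i] H[OF i] H[OF i]] by (simp add: power2_eq_square)
      also have "(\<integral>x. u i x * G i [] x \<partial>lebesgue_on \<Omega>) = (\<integral>x. u i x * u i x \<partial>lebesgue_on \<Omega>)"
        by (rule integral_mult_cong_AE[OF H0_seq_AE_eq[OF dom ev H[OF i]] G0 m(2)[OF i] m(2)[OF i]])
      finally show ?thesis using orth[OF i i] by simp
    qed
    fix j :: nat assume j: "j \<ge> 1"
    have "(\<integral>x. U i x * U j x \<partial>lborel) = (\<integral>x. U i x * U j x \<partial>lebesgue_on \<Omega>)"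
      using U(1,2)[OF i] U(1)[OF j] s by (subst integral_lebesgue_on_lborel(1)) auto
    also have "\<dots> = (\<integral>x. u i x * u j x \<partial>lebesgue_on \<Omega>)"
    proof (rule integral_cong_AE)
      show "AE x in lebesgue_on \<Omega>. U i x * U j x = u i x * u j x"
        using U(3)[OF i] U(3)[OF j] by eventually_elim simp
      note [measurable] = m[OF i] m[OF j]
      show "(\<lambda>x. U i x * U j x) \<in> borel_measurable (lebesgue_on \<Omega>)"
        "(\<lambda>x. u i x * u j x) \<in> borel_measurable (lebesgue_on \<Omega>)" by measurable
    qed
    finally show "(\<integral>x. U i x * U j x \<partial>lborel) = (if i = j then 1 else 0)" using orth[OF i j] by simp
  qed
qed

section \<open>The one-dimensional inequality\<close>

lemma integral_le_nn_integral:
  fixes f :: "'a \<Rightarrow> real"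
  assumes "integrable M f"
  shows "ennreal (\<integral>x. f x \<partial>M) \<le> (\<integral>\<^sup>+x. ennreal (f x) \<partial>M)"
proof -
  have i: "integrable M (\<lambda>x. max 0 (f x))" using assms by simp
  have "ennreal (\<integral>x. f x \<partial>M) \<le> ennreal (\<integral>x. max 0 (f x) \<partial>M)"
    using assms i by (intro ennreal_leI integral_mono) auto
  also have "\<dots> = (\<integral>\<^sup>+x. ennreal (max 0 (f x)) \<partial>M)"
    using i by (intro nn_integral_eq_integral[symmetric]) auto
  also have "\<dots> = (\<integral>\<^sup>+x. ennreal (f x) \<partial>M)"
    by (intro nn_integral_cong) (auto simp: max_def ennreal_neg)
  finally show ?thesis .
qed

text \<open>An inequality because \<open>ennreal\<close> cuts off negative values of f. This allows
  polynomial minorants that change sign.\<close>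

lemma FTC_le_nn_integral:
  fixes f F :: "real \<Rightarrow> real"
  assumes "a \<le> b" and F: "\<And>x. (F has_real_derivative f x) (at x)" and f: "continuous_on UNIV f"
  shows "ennreal (F b - F a) \<le> (\<integral>\<^sup>+x. ennreal (indicator {a..b} x * f x) \<partial>lborel)"
proof -
  have c: "continuous_on {a..b} f" using f by (rule continuous_on_subset) simp
  have v: "(\<integral>x. indicator {a..b} x *\<^sub>R f x \<partial>lborel) = F b - F a"
    by (rule integral_FTC_atLeastAtMost[OF assms(1) _ c])
      (use F in \<open>auto simp: has_real_derivative_iff_has_vector_derivative intro: has_vector_derivative_at_within\<close>)
  have i: "integrable lborel (\<lambda>x. indicator {a..b} x *\<^sub>R f x)"
    using borel_integrable_atLeastAtMost'[OF c] unfolding set_integrable_def .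
  show ?thesis using integral_le_nn_integral[OF i] unfolding v by simp
qed

lemma power_diff_ge_tangent:
  fixes r t :: real
  assumes "0 < t" "t \<le> r" "1 \<le> m"
  shows "real m * t ^ (m - 1) * (r - t) \<le> r ^ m - t ^ m"
proof -
  have "1 + real m * ((r - t) / t) \<le> (1 + (r - t) / t) ^ m"
    using assms by (intro Bernoulli_inequality) (auto intro: order_trans[of _ 0])
  also have "1 + (r - t) / t = r / t" using assms by (simp add: field_simps)
  finally have "t ^ m * (1 + real m * ((r - t) / t)) \<le> t ^ m * (r / t) ^ m"
    using assms by (intro mult_left_mono) auto
  moreover have "t ^ m * (r / t) ^ m = r ^ m" using assms by (simp add: power_divide)
  moreover have "t ^ m * (1 + real m * ((r - t) / t)) = t ^ m + real m * t ^ (m - 1) * (r - t)"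
  proof -
    have "t ^ m = t * t ^ (m - 1)" using assms by (cases m) auto
    then have "t ^ m * ((r - t) / t) = t ^ (m - 1) * (r - t)" using assms by simp
    moreover have "t ^ m * (1 + real m * ((r - t) / t)) = t ^ m + real m * (t ^ m * ((r - t) / t))"
      by (simp only: distrib_left mult_1_right mult.left_commute)
    ultimately show ?thesis by (simp only: mult.assoc)
  qed
  ultimately show ?thesis by linarith
qed

text \<open>The contribution outside the ball. The power r^(2l) is replaced by its tangent at t, the
  factor r^(n-1) by its value at t, and \<open>\<phi>\<close> by the Lipschitz minorant; the
  integral of x (s - Lx) over [0, s/L] is s^3 / (6 L^2).\<close>

lemma ray_upper:
  fixes \<phi> :: "real \<Rightarrow> real"
  assumes n: "1 \<le> n" and l: "1 \<le> l" and t: "0 < t" and L: "0 < L" and s: "0 \<le> s"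
    and \<phi>: "\<And>r. t \<le> r \<Longrightarrow> s - L * (r - t) \<le> \<phi> r"
    and \<phi>0: "\<And>r. t \<le> r \<Longrightarrow> 0 \<le> \<phi> r"
  shows "ennreal (t ^ (2 * l - 1) * t ^ (n - 1) * (real l * s ^ 3 / (3 * L\<^sup>2)))
    \<le> (\<integral>\<^sup>+r. ennreal (indicator {t..} r * (r ^ (n - 1) * (r ^ (2 * l) - t ^ (2 * l)) * \<phi> r)) \<partial>lborel)"
proof -
  define c where "c = real (2 * l) * t ^ (2 * l - 1) * t ^ (n - 1)"
  have c: "c \<ge> 0" using t by (simp add: c_def)
  define F where "F = (\<lambda>r. c * (s * (r - t)\<^sup>2 / 2 - L * (r - t) ^ 3 / 3))"
  define f where "f = (\<lambda>r. c * ((r - t) * (s - L * (r - t))))"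
  \<comment> \<open>The radius at which the Lipschitz minorant reaches 0.\<close>
  let ?b = "t + s / L"
  have "ennreal (F ?b - F t) \<le> (\<integral>\<^sup>+r. ennreal (indicator {t..?b} r * f r) \<partial>lborel)"
  proof (rule FTC_le_nn_integral)
    show "t \<le> ?b" using s L by simp
    show "(F has_real_derivative f r) (at r)" for r
      unfolding F_def f_def
      by (rule derivative_eq_intros refl | simp)+ (simp add: power2_eq_square field_simps)
    show "continuous_on UNIV f" unfolding f_def by (intro continuous_intros)
  qed
  also have "F ?b - F t = t ^ (2 * l - 1) * t ^ (n - 1) * (real l * s ^ 3 / (3 * L\<^sup>2))"
    using L by (simp add: F_def c_def power2_eq_square power3_eq_cube field_simps)
  also have "(\<integral>\<^sup>+r. ennreal (indicator {t..?b} r * f r) \<partial>lborel) \<le>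
     (\<integral>\<^sup>+r. ennreal (indicator {t..} r * (r ^ (n - 1) * (r ^ (2 * l) - t ^ (2 * l)) * \<phi> r)) \<partial>lborel)"
  proof (intro nn_integral_mono ennreal_leI)
    fix r
    show "indicator {t..?b} r * f r \<le> indicator {t..} r * (r ^ (n - 1) * (r ^ (2 * l) - t ^ (2 * l)) * \<phi> r)"
    proof (cases "r \<in> {t..?b}")
      case True
      then have r: "t \<le> r" and nn: "0 \<le> s - L * (r - t)" using L by (auto simp: field_simps)
      have "f r = (t ^ (n - 1) * (real (2 * l) * t ^ (2 * l - 1) * (r - t))) * (s - L * (r - t))"
        by (simp add: f_def c_def)
      also have "\<dots> \<le> (r ^ (n - 1) * (r ^ (2 * l) - t ^ (2 * l))) * \<phi> r"
        using r nn t l by (intro mult_mono power_diff_ge_tangent \<phi> power_mono mult_nonneg_nonneg)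
          (auto intro: power_mono)
      finally show ?thesis using True by simp
    next
      case False
      then show ?thesis using t \<phi>0 by (auto simp: indicator_def intro!: mult_nonneg_nonneg power_mono)
    qed
  qed
  finally show ?thesis .
qed

text \<open>The contribution inside the ball, in the relative depth y = (t - r)/t. The weight
  decreases towards the centre, so a tangent at the sphere is no minorant; a parabola on [0, Y]
  takes its place, where Y covers the depths at which the Lipschitz minorant of
  \<open>1 - \<phi>\<close> is positive.\<close>

lemma ray_lower:
  fixes \<phi> :: "real \<Rightarrow> real"
  assumes t: "0 < t" and L: "0 < L" and \<sigma>: "0 \<le> \<sigma>" "\<sigma> / (L * t) \<le> Y" "Y \<le> 1"
    and \<phi>: "\<And>r. 0 \<le> r \<Longrightarrow> r \<le> t \<Longrightarrow> \<sigma> - L * (t - r) \<le> 1 - \<phi> r"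
    and \<phi>1: "\<And>r. 0 \<le> r \<Longrightarrow> \<phi> r \<le> 1"
    and W: "\<And>y. 0 \<le> y \<Longrightarrow> y \<le> Y \<Longrightarrow> c\<^sub>1 * y - c\<^sub>2 * y\<^sup>2 \<le> (1 - (1 - y) ^ (2 * l)) * (1 - y) ^ m"
  shows "ennreal (t * t ^ m * t ^ (2 * l) * (c\<^sub>1 * \<sigma> ^ 3 / (6 * (L * t)\<^sup>2) - c\<^sub>2 * \<sigma> ^ 4 / (12 * (L * t) ^ 3)))
    \<le> (\<integral>\<^sup>+r. ennreal (indicator {0..<t} r * (r ^ m * (t ^ (2 * l) - r ^ (2 * l)) * (1 - \<phi> r))) \<partial>lborel)"
proof -
  define c where "c = t ^ m * t ^ (2 * l)"
  have c: "c > 0" using t by (simp add: c_def)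
  define \<Lambda> where "\<Lambda> = L * t"
  have \<Lambda>: "\<Lambda> > 0" using t L by (simp add: \<Lambda>_def)
  \<comment> \<open>An antiderivative of \<open>p\<close>, the product of the parabola and the
    Lipschitz minorant. It vanishes at 0, so its value at \<open>\<sigma> / \<Lambda>\<close>, where
    the minorant reaches 0, is the whole integral.\<close>
  define P where "P = (\<lambda>y. c\<^sub>1 * \<sigma> * y\<^sup>2 / 2 - (c\<^sub>1 * \<Lambda> + c\<^sub>2 * \<sigma>) * y ^ 3 / 3 + c\<^sub>2 * \<Lambda> * y ^ 4 / 4)"
  define p where "p = (\<lambda>y. (c\<^sub>1 * y - c\<^sub>2 * y\<^sup>2) * (\<sigma> - \<Lambda> * y))"
  have dP: "(P has_real_derivative p y) (at y)" for y
    unfolding P_def p_def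
    by (rule derivative_eq_intros refl | simp)+ (simp add: power2_eq_square power3_eq_cube algebra_simps)
  define F where "F = (\<lambda>r. - (t * c) * P ((t - r) / t))"
  define f where "f = (\<lambda>r. c * p ((t - r) / t))"
  let ?a = "t - \<sigma> / L"
  have a0: "0 \<le> ?a"
  proof -
    have "\<sigma> / (L * t) \<le> 1" using \<sigma> by linarith
    then have "\<sigma> \<le> L * t" using \<Lambda> by (simp add: \<Lambda>_def divide_le_eq)
    then show ?thesis using L by (simp add: field_simps)
  qed
  have "ennreal (F t - F ?a) \<le> (\<integral>\<^sup>+r. ennreal (indicator {?a..t} r * f r) \<partial>lborel)"
  proof (rule FTC_le_nn_integral)
    show "?a \<le> t" using \<sigma> L by simp
    show "(F has_real_derivative f r) (at r)" for r
    proof -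
      have "((\<lambda>r. (t - r) / t) has_real_derivative - 1 / t) (at r)"
        by (rule derivative_eq_intros refl | simp add: t[THEN less_imp_neq, symmetric])+
      from DERIV_chain2[OF dP this] have "((\<lambda>r. P ((t - r) / t)) has_real_derivative p ((t - r) / t) * (- 1 / t)) (at r)" .
      from DERIV_cmult[OF this, of "- (t * c)"] show ?thesis
        using t by (simp add: F_def f_def mult.commute)
    qed
    show "continuous_on UNIV f" unfolding f_def p_def using t by (intro continuous_intros) auto
  qed
  also have "F t - F ?a = t * t ^ m * t ^ (2 * l) * (c\<^sub>1 * \<sigma> ^ 3 / (6 * (L * t)\<^sup>2) - c\<^sub>2 * \<sigma> ^ 4 / (12 * (L * t) ^ 3))"
  proof -
    have "(t - ?a) / t = \<sigma> / \<Lambda>" using t L by (simp add: \<Lambda>_def)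
    then have "F ?a = - (t * c) * P (\<sigma> / \<Lambda>)" by (simp only: F_def)
    moreover have "F t = 0" by (simp add: F_def P_def)
    ultimately have "F t - F ?a = t * c * P (\<sigma> / \<Lambda>)" by simp
    also have "P (\<sigma> / \<Lambda>) = c\<^sub>1 * \<sigma> ^ 3 / (6 * \<Lambda>\<^sup>2) - c\<^sub>2 * \<sigma> ^ 4 / (12 * \<Lambda> ^ 3)"
      using \<Lambda> by (simp add: P_def power2_eq_square power3_eq_cube power4_eq_xxxx field_simps)
    finally show ?thesis by (simp add: c_def \<Lambda>_def mult.assoc)
  qed
  also have "(\<integral>\<^sup>+r. ennreal (indicator {?a..t} r * f r) \<partial>lborel) \<le>
    (\<integral>\<^sup>+r. ennreal (indicator {0..<t} r * (r ^ m * (t ^ (2 * l) - r ^ (2 * l)) * (1 - \<phi> r))) \<partial>lborel)"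
  proof (intro nn_integral_mono ennreal_leI)
    fix r
    have nn: "0 \<le> r ^ m * (t ^ (2 * l) - r ^ (2 * l)) * (1 - \<phi> r)" if "0 \<le> r" "r < t"
      using that \<phi>1[of r] by (intro mult_nonneg_nonneg) (auto intro!: power_mono)
    show "indicator {?a..t} r * f r \<le> indicator {0..<t} r * (r ^ m * (t ^ (2 * l) - r ^ (2 * l)) * (1 - \<phi> r))"
    proof (cases "r \<in> {?a..<t}")
      case True
      then have r: "0 \<le> r" "r < t" "?a \<le> r" using a0 by auto
      let ?y = "(t - r) / t"
      have y1: "1 - ?y = r / t" using t by (simp add: field_simps)
      have \<Lambda>y: "\<Lambda> * ?y = L * (t - r)" using t by (simp add: \<Lambda>_def)
      have nn2: "0 \<le> \<sigma> - L * (t - r)" using r L by (simp add: field_simps)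
      have yY: "0 \<le> ?y" "?y \<le> Y"
      proof -
        show "0 \<le> ?y" using r t by simp
        have "t - r \<le> \<sigma> / L" using nn2 L by (simp add: field_simps)
        then have "?y \<le> \<sigma> / L / t" using t by (intro divide_right_mono) auto
        then have "?y \<le> \<sigma> / (L * t)" by simp
        then show "?y \<le> Y" using \<sigma> by linarith
      qed
      have "f r = c * ((c\<^sub>1 * ?y - c\<^sub>2 * ?y\<^sup>2) * (\<sigma> - L * (t - r)))"
        unfolding f_def p_def \<Lambda>y ..
      also have "\<dots> \<le> c * (((1 - (1 - ?y) ^ (2 * l)) * (1 - ?y) ^ m) * (\<sigma> - L * (t - r)))"
        using W[OF yY] nn2 c by (intro mult_left_mono mult_right_mono) auto
      also have "\<dots> = r ^ m * (t ^ (2 * l) - r ^ (2 * l)) * (\<sigma> - L * (t - r))"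
        unfolding y1 using t by (simp add: c_def power_divide field_simps)
      also have "\<dots> \<le> r ^ m * (t ^ (2 * l) - r ^ (2 * l)) * (1 - \<phi> r)"
        using r \<phi>[of r] by (intro mult_left_mono mult_nonneg_nonneg) (auto intro!: power_mono)
      finally show ?thesis using True r by simp
    next
      case False
      moreover have "f t = 0" by (simp add: f_def p_def)
      ultimately show ?thesis using nn by (auto simp: indicator_def)
    qed
  qed
  finally show ?thesis .
qed

text \<open>The correction terms of the claimed bound divided by \<alpha> \<omega> t^(n+2l)
  l/(n+2l), as a polynomial in D = \<alpha>/(\<rho> t); \<open>bound_eq\<close> makes this
  precise.\<close>

definition q_poly :: "real \<Rightarrow> real" where
  "q_poly D = 5/2 * D^2 - 31/9 * D^3 + 5/8 * D^4 + 38/25 * D^5 - 317/420 * D^6"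

text \<open>All that is ever used about the coefficients. For D <= 2/5 the cubic term is strong
  enough to absorb the positive higher ones and still leave -29/10.\<close>

lemma q_poly_le:
  assumes "0 \<le> D" "D \<le> 1"
  shows "q_poly D \<le> 5/2 * D\<^sup>2"
    and "D \<le> 2/5 \<Longrightarrow> q_poly D \<le> (5/2 - 29/10 * D) * D\<^sup>2"
proof -
  have eq: "q_poly D = (5/2 + D * (- 31/9 + 5/8 * D + 38/25 * D^2 - 317/420 * D^3)) * D\<^sup>2"
    by (simp add: q_poly_def power2_eq_square power3_eq_cube power4_eq_xxxx algebra_simps eval_nat_numeral)
  have D2: "D\<^sup>2 \<le> D" using assms by (simp add: power2_eq_square mult_left_le)
  have D3: "0 \<le> D^3" using assms by simp
  have "- 31/9 + 5/8 * D + 38/25 * D^2 - 317/420 * D^3 \<le> 0" using D2 D3 assms by linarith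
  then have "D * (- 31/9 + 5/8 * D + 38/25 * D^2 - 317/420 * D^3) \<le> 0" using assms by (simp add: mult_nonneg_nonpos)
  then show "q_poly D \<le> 5/2 * D\<^sup>2" unfolding eq by (intro mult_right_mono) auto
  assume D: "D \<le> 2/5"
  have "D\<^sup>2 \<le> 2/5 * D" using mult_right_mono[OF D assms(1)] by (simp add: power2_eq_square)
  then have "- 31/9 + 5/8 * D + 38/25 * D^2 - 317/420 * D^3 \<le> - 29/10" using D D3 assms by linarith
  then have "D * (- 31/9 + 5/8 * D + 38/25 * D^2 - 317/420 * D^3) \<le> D * (- 29/10)" using assms by (intro mult_left_mono) auto
  then show "q_poly D \<le> (5/2 - 29/10 * D) * D\<^sup>2" unfolding eq by (intro mult_right_mono) auto
qed

text \<open>Since (1 - y)^(2l) (1 + y)^(2l) <= 1, Bernoulli gives (1 - y)^(2l) <= 1/(1 + 2ly). The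
  resulting bound 2(n + 2l)y/(1 + 2ly) increases with l as long as ny <= 1, so l may be replaced by
  a fixed smaller \<open>l\<^sub>0\<close>. This frees the numerical estimates from l.\<close>

lemma one_minus_power_ge:
  fixes y :: real
  assumes y: "0 \<le> y" "y \<le> 1" and l: "l\<^sub>0 \<le> l" "1 \<le> l" and ny: "real n * y \<le> 1"
  shows "2 * (real n + 2 * real l\<^sub>0) * y / (1 + 2 * real l\<^sub>0 * y) \<le> (real n + 2 * real l) / real l * (1 - (1 - y) ^ (2 * l))"
proof -
  have b: "1 + real (2 * l) * y \<le> (1 + y) ^ (2 * l)" using y by (intro Bernoulli_inequality) auto
  have "(1 - y) ^ (2 * l) * (1 + real (2 * l) * y) \<le> (1 - y) ^ (2 * l) * (1 + y) ^ (2 * l)"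
    using b y by (intro mult_left_mono) auto
  also have "\<dots> = (1 - y\<^sup>2) ^ (2 * l)" by (simp add: power_mult_distrib[symmetric] power2_eq_square algebra_simps)
  also have "\<dots> \<le> 1" using y by (intro power_le_one) (auto simp: power_le_one)
  finally have 1: "(1 - y) ^ (2 * l) * (1 + 2 * real l * y) \<le> 1" by simp
  have pos: "0 < 1 + 2 * real l * y" "0 < 1 + 2 * real l\<^sub>0 * y" using y by (auto intro: add_pos_nonneg)
  have "(1 - y) ^ (2 * l) \<le> 1 / (1 + 2 * real l * y)" using 1 pos by (simp add: field_simps)
  then have 2: "2 * real l * y / (1 + 2 * real l * y) \<le> 1 - (1 - y) ^ (2 * l)"
    using pos by (simp add: field_simps)
  have "(real n + 2 * real l\<^sub>0) * (1 + 2 * real l * y) \<le> (real n + 2 * real l) * (1 + 2 * real l\<^sub>0 * y)"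
  proof -
    have "0 \<le> 2 * (real l - real l\<^sub>0) * (1 - real n * y)" using l ny by (intro mult_nonneg_nonneg) auto
    then show ?thesis by (simp add: algebra_simps)
  qed
  then have "(real n + 2 * real l\<^sub>0) / (1 + 2 * real l\<^sub>0 * y) \<le> (real n + 2 * real l) / (1 + 2 * real l * y)"
    using pos by (simp add: field_simps)
  then have "2 * y * ((real n + 2 * real l\<^sub>0) / (1 + 2 * real l\<^sub>0 * y)) \<le> 2 * y * ((real n + 2 * real l) / (1 + 2 * real l * y))"
    using y by (intro mult_left_mono) auto
  also have "\<dots> = (real n + 2 * real l) / real l * (2 * real l * y / (1 + 2 * real l * y))"
    using l by simp
  also have "\<dots> \<le> (real n + 2 * real l) / real l * (1 - (1 - y) ^ (2 * l))"
    using 2 by (intro mult_left_mono) auto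
  finally show ?thesis by (simp add: mult_ac)
qed

text \<open>Bernoulli's inequality for the factor (1 - y)^(n-1) leaves a rational function of y, for
  which it suffices to supply one linear minorant a - by.\<close>

lemma weight_ge:
  fixes y :: real
  assumes y: "0 \<le> y" "real n * y \<le> 1" and n: "1 \<le> n" and l: "l\<^sub>0 \<le> l" "1 \<le> l"
    and poly: "a - b * y \<le> (1 - (real n - 1) * y) / (1 + 2 * real l\<^sub>0 * y)"
  shows "2 * (real n + 2 * real l\<^sub>0) * (a * y - b * y\<^sup>2)
    \<le> (real n + 2 * real l) / real l * ((1 - (1 - y) ^ (2 * l)) * (1 - y) ^ (n - 1))"
proof -
  have y1: "y \<le> 1" using mult_right_mono[of 1 "real n" y] y n by simp
  have bern: "1 - (real n - 1) * y \<le> (1 - y) ^ (n - 1)"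
    using Bernoulli_inequality[of "- y" "n - 1"] y1 n by (simp add: of_nat_diff)
  let ?K = "2 * (real n + 2 * real l\<^sub>0) * y / (1 + 2 * real l\<^sub>0 * y)"
  have K: "0 \<le> ?K" using y by (intro divide_nonneg_nonneg mult_nonneg_nonneg add_nonneg_nonneg) auto
  have nn: "0 \<le> 2 * (real n + 2 * real l\<^sub>0) * y" using y by simp
  have "2 * (real n + 2 * real l\<^sub>0) * (a * y - b * y\<^sup>2) = 2 * (real n + 2 * real l\<^sub>0) * y * (a - b * y)"
    by (simp add: power2_eq_square algebra_simps)
  also have "\<dots> \<le> 2 * (real n + 2 * real l\<^sub>0) * y * ((1 - (real n - 1) * y) / (1 + 2 * real l\<^sub>0 * y))"
    by (rule mult_left_mono[OF poly nn])
  also have "\<dots> = ?K * (1 - (real n - 1) * y)" by simp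
  also have "\<dots> \<le> ?K * (1 - y) ^ (n - 1)" by (rule mult_left_mono[OF bern K])
  also have "\<dots> \<le> ((real n + 2 * real l) / real l * (1 - (1 - y) ^ (2 * l))) * (1 - y) ^ (n - 1)"
    using y y1 by (intro mult_right_mono one_minus_power_ge l) auto
  finally show ?thesis by (simp add: mult.assoc)
qed

text \<open>Adds both sides of the radius t. Choosing D' below D means using a larger Lipschitz
  constant inside the ball only; it shortens the range of depths, so that the parabola needs to be
  valid on [0, Y] for a smaller Y. Choosing \<sigma> below \<open>1 - \<phi> t\<close> has the same
  effect.\<close>

lemma ray_combined:
  fixes \<phi> :: "real \<Rightarrow> real"
  assumes n: "1 \<le> n" and l: "1 \<le> l" and t: "0 < t" and L: "0 < L"
    and \<phi>01: "\<And>r. 0 \<le> r \<Longrightarrow> 0 \<le> \<phi> r \<and> \<phi> r \<le> 1"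
    and lip: "\<And>r s. 0 \<le> r \<Longrightarrow> 0 \<le> s \<Longrightarrow> \<bar>\<phi> r - \<phi> s\<bar> \<le> L * \<bar>r - s\<bar>"
    and [measurable]: "\<phi> \<in> borel_measurable borel"
    and D: "D = 1 / (2 * L * t)" and D': "0 < D'" "D' \<le> D"
    and \<sigma>: "0 \<le> \<sigma>" "\<sigma> \<le> 1 - \<phi> t" "2 * D' * \<sigma> \<le> Y" "Y \<le> 1"
    and W: "\<And>y. 0 \<le> y \<Longrightarrow> y \<le> Y \<Longrightarrow> C\<^sub>1 * y - C\<^sub>2 * y\<^sup>2 \<le> (real n + 2 * real l) / real l * ((1 - (1 - y) ^ (2 * l)) * (1 - y) ^ (n - 1))"
  shows "ennreal (t ^ (n + 2 * l) * (real l / (real n * (real n + 2 * real l))) *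
      (4 / 3 * real n * (real n + 2 * real l) * D\<^sup>2 * (\<phi> t) ^ 3 + 2 / 3 * real n * (C\<^sub>1 * D'\<^sup>2 * \<sigma> ^ 3 - C\<^sub>2 * D' ^ 3 * \<sigma> ^ 4)))
    \<le> (\<integral>\<^sup>+r. ennreal (indicator {0..} r * (r ^ (n - 1) * \<bar>r ^ (2 * l) - t ^ (2 * l)\<bar> * \<bar>\<phi> r - indicator {..<t} r\<bar>)) \<partial>lborel)"
proof -
  let ?p = "real n + 2 * real l"
  let ?\<kappa> = "real l / ?p"
  have p: "?p > 0" and \<kappa>: "?\<kappa> > 0" using n l by auto
  define L' where "L' = 1 / (2 * D' * t)"
  have L': "L' > 0" using D' t by (simp add: L'_def)
  have D0: "0 < D" using D' by simp
  have Lt: "L * t = 1 / (2 * D)" using D L t by simp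
  have L't: "L' * t = 1 / (2 * D')" using t by (simp add: L'_def)
  have LL': "L \<le> L'"
  proof -
    have "1 / (2 * D) \<le> 1 / (2 * D')" using D' by (intro divide_left_mono) auto
    then have "L * t \<le> L' * t" using Lt L't by simp
    then show ?thesis using t by simp
  qed
  let ?A = "t ^ (2 * l - 1) * t ^ (n - 1) * (real l * (\<phi> t) ^ 3 / (3 * L\<^sup>2))"
  let ?B = "t * t ^ (n - 1) * t ^ (2 * l) * (?\<kappa> * C\<^sub>1 * \<sigma> ^ 3 / (6 * (L' * t)\<^sup>2) - ?\<kappa> * C\<^sub>2 * \<sigma> ^ 4 / (12 * (L' * t) ^ 3))"
  let ?up = "\<lambda>r. indicator {t..} r * (r ^ (n - 1) * (r ^ (2 * l) - t ^ (2 * l)) * \<phi> r)"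
  let ?lo = "\<lambda>r. indicator {0..<t} r * (r ^ (n - 1) * (t ^ (2 * l) - r ^ (2 * l)) * (1 - \<phi> r))"
  have up: "ennreal ?A \<le> (\<integral>\<^sup>+r. ennreal (?up r) \<partial>lborel)"
  proof (rule ray_upper[OF n l t L])
    show "0 \<le> \<phi> t" using \<phi>01[of t] t by simp
    show "\<phi> t - L * (r - t) \<le> \<phi> r" if "t \<le> r" for r using lip[of r t] t that by simp
    show "0 \<le> \<phi> r" if "t \<le> r" for r using \<phi>01[of r] t that by simp
  qed
  have lo: "ennreal ?B \<le> (\<integral>\<^sup>+r. ennreal (?lo r) \<partial>lborel)"
  proof (rule ray_lower[OF t L' \<sigma>(1) _ \<sigma>(4)])
    show "\<sigma> / (L' * t) \<le> Y" using \<sigma>(3) unfolding L't by (simp add: mult_ac)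
    show "\<phi> r \<le> 1" if "0 \<le> r" for r using \<phi>01 that by blast
    show "\<sigma> - L' * (t - r) \<le> 1 - \<phi> r" if "0 \<le> r" "r \<le> t" for r
    proof -
      have "\<phi> r \<le> \<phi> t + L * (t - r)" using lip[of r t] that by simp
      moreover have "L * (t - r) \<le> L' * (t - r)" using LL' that by (intro mult_right_mono) auto
      ultimately show ?thesis using \<sigma>(2) by linarith
    qed
    show "?\<kappa> * C\<^sub>1 * y - ?\<kappa> * C\<^sub>2 * y\<^sup>2 \<le> (1 - (1 - y) ^ (2 * l)) * (1 - y) ^ (n - 1)" if "0 \<le> y" "y \<le> Y" for y
    proof -
      have "?\<kappa> * (C\<^sub>1 * y - C\<^sub>2 * y\<^sup>2) \<le> ?\<kappa> * (?p / real l * ((1 - (1 - y) ^ (2 * l)) * (1 - y) ^ (n - 1)))"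
        using W[OF that] \<kappa> by (intro mult_left_mono) auto
      also have "\<dots> = (1 - (1 - y) ^ (2 * l)) * (1 - y) ^ (n - 1)" using p l by simp
      finally show ?thesis by (simp add: right_diff_distrib mult.assoc)
    qed
  qed
  have tp: "t ^ (n + 2 * l) = t * t ^ (n - 1) * t ^ (2 * l)"
    using n by (cases n) (auto simp: power_add)
  have A: "?A = t ^ (n + 2 * l) * (real l / (real n * ?p)) * (4 / 3 * real n * ?p * D\<^sup>2 * (\<phi> t) ^ 3)"
  proof -
    have "t ^ (2 * l) = t * t ^ (2 * l - 1)" using l by (cases "2 * l") auto
    then have tX: "t ^ (n + 2 * l) = t\<^sup>2 * (t ^ (2 * l - 1) * t ^ (n - 1))" (is "_ = t\<^sup>2 * ?X")
      unfolding tp by (simp add: power2_eq_square)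
    have tD: "t\<^sup>2 * D\<^sup>2 = 1 / (4 * L\<^sup>2)"
      unfolding D using t L by (simp add: power_divide power_mult_distrib)
    have np: "(real l / (real n * ?p)) * (4 / 3 * real n * ?p * D\<^sup>2 * (\<phi> t) ^ 3) = 4 / 3 * real l * (\<phi> t) ^ 3 * D\<^sup>2"
      using n p by (simp add: divide_simps del: of_nat_add)
    have "t ^ (n + 2 * l) * (real l / (real n * ?p)) * (4 / 3 * real n * ?p * D\<^sup>2 * (\<phi> t) ^ 3)
      = t\<^sup>2 * ?X * (4 / 3 * real l * (\<phi> t) ^ 3 * D\<^sup>2)"
      unfolding tX np[symmetric] by (simp only: mult.assoc)
    also have "\<dots> = ?X * (4 / 3 * real l * (\<phi> t) ^ 3 * (t\<^sup>2 * D\<^sup>2))"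
      by (simp only: mult_ac)
    also have "\<dots> = ?A" unfolding tD by simp
    finally show ?thesis by (rule sym)
  qed
  have B: "?B = t ^ (n + 2 * l) * (real l / (real n * ?p)) * (2 / 3 * real n * (C\<^sub>1 * D'\<^sup>2 * \<sigma> ^ 3 - C\<^sub>2 * D' ^ 3 * \<sigma> ^ 4))"
  proof -
    have "?\<kappa> * C\<^sub>1 * \<sigma> ^ 3 / (6 * (L' * t)\<^sup>2) - ?\<kappa> * C\<^sub>2 * \<sigma> ^ 4 / (12 * (L' * t) ^ 3)
      = ?\<kappa> * (2 / 3 * (C\<^sub>1 * D'\<^sup>2 * \<sigma> ^ 3 - C\<^sub>2 * D' ^ 3 * \<sigma> ^ 4))"
      unfolding L't by (simp add: power_divide power_mult_distrib algebra_simps)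
    also have "\<dots> = (real l / (real n * ?p)) * (2 / 3 * real n * (C\<^sub>1 * D'\<^sup>2 * \<sigma> ^ 3 - C\<^sub>2 * D' ^ 3 * \<sigma> ^ 4))"
      using n by simp
    finally show ?thesis unfolding tp by (simp only: mult.assoc)
  qed
  have A0: "0 \<le> ?A" using t \<phi>01[of t] by (intro mult_nonneg_nonneg divide_nonneg_nonneg) auto
  have "ennreal (t ^ (n + 2 * l) * (real l / (real n * ?p)) *
      (4 / 3 * real n * ?p * D\<^sup>2 * (\<phi> t) ^ 3 + 2 / 3 * real n * (C\<^sub>1 * D'\<^sup>2 * \<sigma> ^ 3 - C\<^sub>2 * D' ^ 3 * \<sigma> ^ 4)))
      = ennreal (?A + ?B)" unfolding A B by (simp only: distrib_left)
  \<comment> \<open>The inner bound can be negative; then it is simply dropped, because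
    \<open>ennreal\<close> maps it to 0.\<close>
  also have "\<dots> \<le> ennreal ?A + ennreal ?B"
  proof (cases "0 \<le> ?B")
    case True
    then show ?thesis using A0 by (simp only: ennreal_plus order_refl)
  next
    case False
    then have "ennreal (?A + ?B) \<le> ennreal ?A" by (intro ennreal_leI) linarith
    then show ?thesis by (rule order_trans) simp
  qed
  also have "\<dots> \<le> (\<integral>\<^sup>+r. ennreal (?up r) \<partial>lborel) + (\<integral>\<^sup>+r. ennreal (?lo r) \<partial>lborel)"
    by (rule add_mono[OF up lo])
  also have "\<dots> = (\<integral>\<^sup>+r. ennreal (?up r) + ennreal (?lo r) \<partial>lborel)"
    by (intro nn_integral_add[symmetric]) measurable
  also have "\<dots> \<le> (\<integral>\<^sup>+r. ennreal (indicator {0..} r * (r ^ (n - 1) * \<bar>r ^ (2 * l) - t ^ (2 * l)\<bar> * \<bar>\<phi> r - indicator {..<t} r\<bar>)) \<partial>lborel)"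
  proof (rule nn_integral_mono)
    fix r
    consider "r < 0" | "0 \<le> r" "r < t" | "t \<le> r" by linarith
    then show "ennreal (?up r) + ennreal (?lo r) \<le>
      ennreal (indicator {0..} r * (r ^ (n - 1) * \<bar>r ^ (2 * l) - t ^ (2 * l)\<bar> * \<bar>\<phi> r - indicator {..<t} r\<bar>))"
    proof cases
      case 1
      then show ?thesis using t by simp
    next
      case 2
      then have "\<bar>r ^ (2 * l) - t ^ (2 * l)\<bar> = t ^ (2 * l) - r ^ (2 * l)"
        using power_mono[of r t "2 * l"] by simp
      then show ?thesis using 2 \<phi>01[of r] by simp
    next
      case 3
      then have "\<bar>r ^ (2 * l) - t ^ (2 * l)\<bar> = r ^ (2 * l) - t ^ (2 * l)"
        using power_mono[of t r "2 * l"] t by simp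
      then show ?thesis using 3 t \<phi>01[of r] by simp
    qed
  qed
  finally show ?thesis .
qed

text \<open>The second moment of \<open>\<Omega>\<close> is at least that of a ball of the same volume, so \<open>D\<^sup>2\<close> is at most
  \<open>(n + 2) \<omega>\<^sup>4\<^sup>/\<^sup>n / (16 \<pi>\<^sup>2 n)\<close>. The values are rounded up from this, uniformly for \<open>n \<ge> 5\<close>.\<close>

definition D_bound :: "nat \<Rightarrow> real" where
  "D_bound n = (if n = 2 then 1/8 else if n = 3 then (143/2000) else if n = 4 then (473/10000) else (1/25))"

text \<open>The value of \<open>\<phi>\<close> at the threshold decides which side of it contributes enough.
  The weight bounds are tangents of the rational lower bound of \<open>one_minus_power_ge\<close>.\<close>

lemma ray_excess:
  fixes \<phi> :: "real \<Rightarrow> real"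
  assumes n: "2 \<le> n" and l: "1 \<le> l" and nl: "6 \<le> 2 * l + n" and t: "0 < t" and L: "0 < L"
    and \<phi>01: "\<And>r. 0 \<le> r \<Longrightarrow> 0 \<le> \<phi> r \<and> \<phi> r \<le> 1"
    and lip: "\<And>r s. 0 \<le> r \<Longrightarrow> 0 \<le> s \<Longrightarrow> \<bar>\<phi> r - \<phi> s\<bar> \<le> L * \<bar>r - s\<bar>"
    and m: "\<phi> \<in> borel_measurable borel"
    and D: "D = 1 / (2 * L * t)" and Db: "D\<^sup>2 \<le> D_bound n"
  shows "ennreal (t ^ (n + 2 * l) * (real l / (real n * (real n + 2 * real l))) * q_poly D)
    \<le> (\<integral>\<^sup>+r. ennreal (indicator {0..} r * (r ^ (n - 1) * \<bar>r ^ (2 * l) - t ^ (2 * l)\<bar> * \<bar>\<phi> r - indicator {..<t} r\<bar>)) \<partial>lborel)"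
    (is "_ \<le> ?X")
proof -
  let ?p = "real n + 2 * real l"
  let ?c = "t ^ (n + 2 * l) * (real l / (real n * ?p))"
  define s where "s = \<phi> t"
  have s01: "0 \<le> s" "s \<le> 1" using \<phi>01[of t] t by (auto simp: s_def)
  have c0: "0 \<le> ?c" using t by simp
  have D0: "0 < D" using t L D by simp
  have "D\<^sup>2 \<le> 1 / 8" using Db by (simp add: D_bound_def split: if_splits)
  then have "D\<^sup>2 \<le> (2/5)\<^sup>2" by (simp add: power2_eq_square)
  then have D25: "D \<le> 2/5" by (rule power2_le_imp_le) simp
  have qA: "q_poly D \<le> 5/2 * D\<^sup>2" and qB: "q_poly D \<le> (5/2 - 29/10 * D) * D\<^sup>2"
    using q_poly_le[of D] D0 D25 by auto
  \<comment> \<open>The outer side alone: \<open>\<sigma> = 0\<close> switches the inner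
    contribution off.\<close>
  have up: "ennreal (?c * q_poly D) \<le> ?X" if h: "5/2 \<le> 4/3 * (real n * ?p) * s ^ 3"
  proof -
    have "ennreal (?c * (4 / 3 * real n * ?p * D\<^sup>2 * (\<phi> t) ^ 3 + 2 / 3 * real n * (0 * D\<^sup>2 * 0 ^ 3 - 0 * D ^ 3 * 0 ^ 4))) \<le> ?X"
      by (rule ray_combined[OF _ l t L \<phi>01 lip m D D0, where Y=0]) (use n s01 in \<open>auto simp: s_def\<close>)
    moreover have "4 / 3 * real n * ?p * D\<^sup>2 * (\<phi> t) ^ 3 + 2 / 3 * real n * (0 * D\<^sup>2 * 0 ^ 3 - 0 * D ^ 3 * 0 ^ 4) = 4 / 3 * real n * ?p * D\<^sup>2 * s ^ 3"
      by (simp add: s_def)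
    ultimately have 1: "ennreal (?c * (4 / 3 * real n * ?p * D\<^sup>2 * s ^ 3)) \<le> ?X" by (simp only:)
    have "q_poly D \<le> 4 / 3 * real n * ?p * D\<^sup>2 * s ^ 3"
      using mult_right_mono[OF h, of "D\<^sup>2"] qA by (simp add: mult_ac)
    then have "?c * q_poly D \<le> ?c * (4 / 3 * real n * ?p * D\<^sup>2 * s ^ 3)" by (rule mult_left_mono[OF _ c0])
    from order_trans[OF ennreal_leI[OF this] 1] show ?thesis .
  qed
  \<comment> \<open>Both sides, with the weight bound turned into the constants of
    \<open>ray_combined\<close>; the parabola is 2(n + 2\<open>l\<^sub>0\<close>)(ay -
    by^2).\<close>
  have both: "ennreal (?c * q_poly D) \<le> ?X"
    if "0 < D'" "D' \<le> D" "0 \<le> \<sigma>" "\<sigma> \<le> 1 - s" "2 * D' * \<sigma> \<le> Y" "Y \<le> 1" "real n * Y \<le> 1" "l\<^sub>0 \<le> l"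
      and poly: "\<And>y. 0 \<le> y \<Longrightarrow> y \<le> Y \<Longrightarrow> a - b * y \<le> (1 - (real n - 1) * y) / (1 + 2 * real l\<^sub>0 * y)"
      and q: "q_poly D \<le> 4 / 3 * real n * ?p * D\<^sup>2 * s ^ 3 +
        4 / 3 * (real n * (real n + 2 * real l\<^sub>0)) * (a * D'\<^sup>2 * \<sigma> ^ 3 - b * D' ^ 3 * \<sigma> ^ 4)"
    for D' \<sigma> Y a b l\<^sub>0
  proof -
    let ?C = "2 * (real n + 2 * real l\<^sub>0)"
    have "ennreal (?c * (4 / 3 * real n * ?p * D\<^sup>2 * (\<phi> t) ^ 3 + 2 / 3 * real n * (?C * a * D'\<^sup>2 * \<sigma> ^ 3 - ?C * b * D' ^ 3 * \<sigma> ^ 4))) \<le> ?X"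
    proof (rule ray_combined[OF _ l t L \<phi>01 lip m D that(1,2,3) _ that(5,6)])
      show "1 \<le> n" using n by simp
      show "\<sigma> \<le> 1 - \<phi> t" using that(4) by (simp add: s_def)
      fix y assume y: "0 \<le> y" "y \<le> Y"
      have "real n * y \<le> real n * Y" using y by (intro mult_left_mono) auto
      then have "real n * y \<le> 1" using that(7) by linarith
      from weight_ge[OF y(1) this _ that(8) l poly[OF y]] n
      show "?C * a * y - ?C * b * y\<^sup>2 \<le> ?p / real l * ((1 - (1 - y) ^ (2 * l)) * (1 - y) ^ (n - 1))"
        by (simp add: right_diff_distrib mult.assoc)
    qed
    note 1 = this[folded s_def]
    have "?c * q_poly D \<le> ?c * (4 / 3 * real n * ?p * D\<^sup>2 * s ^ 3 + 2 / 3 * real n * (?C * a * D'\<^sup>2 * \<sigma> ^ 3 - ?C * b * D' ^ 3 * \<sigma> ^ 4))"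
    proof (rule mult_left_mono[OF _ c0])
      have eq: "4 / 3 * (real n * (real n + 2 * real l\<^sub>0)) * (a * D'\<^sup>2 * \<sigma> ^ 3 - b * D' ^ 3 * \<sigma> ^ 4) =
        2 / 3 * real n * (?C * a * D'\<^sup>2 * \<sigma> ^ 3 - ?C * b * D' ^ 3 * \<sigma> ^ 4)" by (simp add: algebra_simps)
      show "q_poly D \<le> 4 / 3 * real n * ?p * D\<^sup>2 * s ^ 3 + 2 / 3 * real n * (?C * a * D'\<^sup>2 * \<sigma> ^ 3 - ?C * b * D' ^ 3 * \<sigma> ^ 4)"
        using q unfolding eq .
    qed
    from order_trans[OF ennreal_leI[OF this] 1] show ?thesis .
  qed
  text \<open>The case \<open>D' = D\<close>, with the factor \<open>D\<^sup>2\<close> cancelled.\<close>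
  have bothD: "ennreal (?c * q_poly D) \<le> ?X"
    if "0 \<le> \<sigma>" "\<sigma> \<le> 1 - s" "2 * D * \<sigma> \<le> Y" "Y \<le> 1" "real n * Y \<le> 1" "l\<^sub>0 \<le> l"
      and "\<And>y. 0 \<le> y \<Longrightarrow> y \<le> Y \<Longrightarrow> a - b * y \<le> (1 - (real n - 1) * y) / (1 + 2 * real l\<^sub>0 * y)"
      and q: "5/2 - 29/10 * D \<le> 4 / 3 * real n * ?p * s ^ 3 +
        4 / 3 * (real n * (real n + 2 * real l\<^sub>0)) * (a * \<sigma> ^ 3 - b * D * \<sigma> ^ 4)"
    for \<sigma> Y a b l\<^sub>0
  proof (rule both[OF D0 order_refl that(1-7)])
    have "q_poly D \<le> (4 / 3 * real n * ?p * s ^ 3 +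
        4 / 3 * (real n * (real n + 2 * real l\<^sub>0)) * (a * \<sigma> ^ 3 - b * D * \<sigma> ^ 4)) * D\<^sup>2"
      using mult_right_mono[OF q, of "D\<^sup>2"] qB by simp
    also have "\<dots> = 4 / 3 * real n * ?p * D\<^sup>2 * s ^ 3 +
        4 / 3 * (real n * (real n + 2 * real l\<^sub>0)) * (a * D\<^sup>2 * \<sigma> ^ 3 - b * D ^ 3 * \<sigma> ^ 4)"
      by (simp add: power2_eq_square power3_eq_cube algebra_simps)
    finally show "q_poly D \<le> 4 / 3 * real n * ?p * D\<^sup>2 * s ^ 3 +
        4 / 3 * (real n * (real n + 2 * real l\<^sub>0)) * (a * D\<^sup>2 * \<sigma> ^ 3 - b * D ^ 3 * \<sigma> ^ 4)" .
  qed
  have s3: "x ^ 3 \<le> s ^ 3" if "0 \<le> x" "x \<le> s" for x using that by (intro power_mono)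
  have up': "ennreal (?c * q_poly D) \<le> ?X" if "0 \<le> N" "N \<le> real n * ?p" "0 \<le> x" "x \<le> s" "5/2 \<le> 4/3 * (N * x ^ 3)" for N x
  proof (rule up)
    have "N * x ^ 3 \<le> (real n * ?p) * s ^ 3" using that s3[OF that(3,4)] by (intro mult_mono) auto
    then have "4/3 * (N * x ^ 3) \<le> 4/3 * ((real n * ?p) * s ^ 3)" by linarith
    then show "5/2 \<le> 4 / 3 * (real n * ?p) * s ^ 3" using that(5) by (simp only: mult.assoc)
  qed
  consider "n = 2" | "n = 3" | "n = 4" | "5 \<le> n" using n by linarith
  then show ?thesis
  proof cases
    case 1
    then have l2: "2 \<le> l" using nl by simp
    have "D\<^sup>2 \<le> (221/625)\<^sup>2" using Db 1 by (simp add: D_bound_def power2_eq_square)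
    then have D: "D \<le> (221/625)" by (rule power2_le_imp_le) simp
    have np: "12 \<le> real n * ?p" using 1 l2 by simp
    \<comment> \<open>The tangent of the convex function (1 - y)/(1 + 4y) at y = 3/20, with rounded
      coefficients. The square expresses convexity.\<close>
    have tangent: "(103/125) - (1953/1000) * y \<le> (1 - (real n - 1) * y) / (1 + 2 * real 2 * y)" if "0 \<le> y" for y :: real
    proof -
      have "0 \<le> (y - (3/20))\<^sup>2" by simp
      then have "0 \<le> y * y - (3/10) * y + (9/400)" by (simp add: power2_eq_square algebra_simps)
      moreover have "((103/125) - (1953/1000) * y) * (1 + 4 * y) = (103/125) + (1343/1000) * y - (1953/250) * (y * y)" by (simp add: field_simps)
      ultimately have "((103/125) - (1953/1000) * y) * (1 + 4 * y) \<le> 1 - y" using that by linarith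
      then show ?thesis using that 1 by (simp add: pos_le_divide_eq)
    qed
    have two: "ennreal (?c * q_poly D) \<le> ?X"
      if "0 \<le> x" "x \<le> s" "0 \<le> \<sigma>" "\<sigma> \<le> 1 - s" "\<sigma> \<le> (7/10)"
        and q: "5/2 - 29/10 * D \<le> 16 * x ^ 3 + 16 * ((103/125) * \<sigma> ^ 3 - (1953/1000) * D * \<sigma> ^ 4)" for x \<sigma>
    proof (rule bothD[where l\<^sub>0=2 and Y="1/2", OF that(3,4)])
      have "D * \<sigma> \<le> (221/625) * (7/10)" using D0 D that by (intro mult_mono) auto
      then show "2 * D * \<sigma> \<le> 1/2" by simp
      have "12 * x ^ 3 \<le> (real n * ?p) * s ^ 3" using np that s3[OF that(1,2)] by (intro mult_mono) auto
      then have *: "16 * x ^ 3 \<le> 4 / 3 * (real n * ?p * s ^ 3)" by linarith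
      have e: "4 / 3 * (real n * (real n + 2 * real 2)) = 16" using 1 by simp
      show "5/2 - 29/10 * D \<le> 4 / 3 * real n * ?p * s ^ 3 +
        4 / 3 * (real n * (real n + 2 * real 2)) * ((103/125) * \<sigma> ^ 3 - (1953/1000) * D * \<sigma> ^ 4)"
        using q * unfolding e by (simp only: mult.assoc)
    qed (use 1 l2 tangent in auto)
    \<comment> \<open>For n = 2 neither side suffices alone for all s. On each interval the outer
      contribution is evaluated at the left end of s and the inner one at 1 minus the right end,
      except that for the smallest s the outer one is dropped and for the largest s the inner
      one.\<close>
    consider "(27/50) \<le> s" | "(47/100) \<le> s" "s \<le> (27/50)" | "(2/5) \<le> s" "s \<le> (47/100)" | "(7/20) \<le> s" "s \<le> (2/5)" | "s \<le> (7/20)"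
      by linarith
    then show ?thesis
    proof cases
      case 1
      then show ?thesis using np by (intro up'[of 12 "27/50"]) (simp_all add: power3_eq_cube)
    next
      case 2
      then show ?thesis using D D0 by (intro two[of "(47/100)" "(23/50)"]) (auto simp: power3_eq_cube power4_eq_xxxx)
    next
      case 3
      then show ?thesis using D D0 by (intro two[of "(2/5)" "(53/100)"]) (auto simp: power3_eq_cube power4_eq_xxxx)
    next
      case 4
      then show ?thesis using D D0 by (intro two[of "(7/20)" "(3/5)"]) (auto simp: power3_eq_cube power4_eq_xxxx)
    next
      case 5
      then show ?thesis using D D0 s01 by (intro two[of 0 "(13/20)"]) (auto simp: power3_eq_cube power4_eq_xxxx)
    qed
  next
    case 2
    then have l2: "2 \<le> l" using nl by simp
    have "D\<^sup>2 \<le> (107/400)\<^sup>2" using Db 2 by (simp add: D_bound_def power2_eq_square)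
    then have D: "D \<le> (107/400)" by (rule power2_le_imp_le) simp
    have np: "21 \<le> real n * ?p" using 2 l2 by simp
    \<comment> \<open>From n = 3 on, a single threshold suffices: above it the outer side is enough,
      below it the inner side with \<sigma> equal to 1 minus the threshold.\<close>
    show ?thesis
    proof (cases "(9/20) \<le> s")
      case True
      then show ?thesis using np by (intro up'[of 21 "9/20"]) (simp_all add: power3_eq_cube)
    next
      case False
      show ?thesis
      proof (rule bothD[where l\<^sub>0=2 and Y="1/3" and \<sigma>="(11/20)" and a="(351/400)" and b="(1531/500)"])
        show "2 * D * (11/20) \<le> 1/3" using D by simp
        \<comment> \<open>The rounded tangent of (1 - 2y)/(1 + 4y) at y = 1/10.\<close>
        show "(351/400) - (1531/500) * y \<le> (1 - (real n - 1) * y) / (1 + 2 * real 2 * y)" if "0 \<le> y" for y :: real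
        proof -
          have "0 \<le> (y - (1/10))\<^sup>2" by simp
          then have "0 \<le> y * y - (1/5) * y + (1/100)" by (simp add: power2_eq_square algebra_simps)
          moreover have "((351/400) - (1531/500) * y) * (1 + 4 * y) = (351/400) + (448/1000) * y - (3062/250) * (y * y)" by (simp add: field_simps)
          ultimately have "((351/400) - (1531/500) * y) * (1 + 4 * y) \<le> 1 - 2 * y" using that by linarith
          then show ?thesis using that 2 by (simp add: pos_le_divide_eq)
        qed
        have e: "4 / 3 * (real n * (real n + 2 * real 2)) = 28" using 2 by simp
        have "0 \<le> 4 / 3 * real n * ?p * s ^ 3" using s01 by simp
        moreover have "5/2 - 29/10 * D \<le> 28 * ((351/400) * (11/20) ^ 3 - (1531/500) * D * (11/20) ^ 4)"
          using D D0 by (simp add: power3_eq_cube power4_eq_xxxx)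
        ultimately show "5/2 - 29/10 * D \<le> 4 / 3 * real n * ?p * s ^ 3 +
          4 / 3 * (real n * (real n + 2 * real 2)) * ((351/400) * (11/20) ^ 3 - (1531/500) * D * (11/20) ^ 4)"
          unfolding e by linarith
      qed (use 2 l2 False in auto)
    qed
  next
    case 3
    have "D\<^sup>2 \<le> (87/400)\<^sup>2" using Db 3 by (simp add: D_bound_def power2_eq_square)
    then have D: "D \<le> (87/400)" by (rule power2_le_imp_le) simp
    have np: "24 \<le> real n * ?p" using 3 l by simp
    show ?thesis
    proof (cases "(43/100) \<le> s")
      case True
      then show ?thesis using np by (intro up'[of 24 "43/100"]) (simp_all add: power3_eq_cube)
    next
      case False
      show ?thesis
      \<comment> \<open>With \<open>l\<^sub>0 = 0\<close> the rational factor disappears and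
        Bernoulli's 1 - 3y is itself the linear minorant.\<close>
      proof (rule bothD[where l\<^sub>0=0 and Y="1/4" and \<sigma>="(57/100)" and a="1" and b="3"])
        show "2 * D * (57/100) \<le> 1/4" using D by simp
        have e: "4 / 3 * (real n * (real n + 2 * real 0)) = 64 / 3" using 3 by simp
        have "0 \<le> 4 / 3 * real n * ?p * s ^ 3" using s01 by simp
        moreover have "5/2 - 29/10 * D \<le> 64 / 3 * (1 * (57/100) ^ 3 - 3 * D * (57/100) ^ 4)"
          using D D0 by (simp add: power3_eq_cube power4_eq_xxxx)
        ultimately show "5/2 - 29/10 * D \<le> 4 / 3 * real n * ?p * s ^ 3 +
          4 / 3 * (real n * (real n + 2 * real 0)) * (1 * (57/100) ^ 3 - 3 * D * (57/100) ^ 4)"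
          unfolding e by linarith
      qed (use 3 False in auto)
    qed
  next
    case 4
    have DD: "D\<^sup>2 \<le> (1/25)" using Db 4 by (simp add: D_bound_def)
    have np: "35 \<le> real n * ?p"
    proof -
      have "5 * 7 \<le> real n * ?p" using 4 l by (intro mult_mono) auto
      then show ?thesis by simp
    qed
    show ?thesis
    proof (cases "(2/5) \<le> s")
      case True
      then show ?thesis using np by (intro up'[of 35 "2/5"]) (simp_all add: power3_eq_cube)
    next
      case False
      \<comment> \<open>D is bounded uniformly in n, but the weight bound is restricted to depths up
        to 1/n. The cut at 5/(6n) is what 2 D' (3/5) <= 1/n requires.\<close>
      define D' where "D' = min D (5 / (6 * real n))"
      have n0: "0 < real n" using n by simp
      have D': "0 < D'" "D' \<le> D" "D' \<le> 5 / (6 * real n)" using D0 n0 by (auto simp: D'_def)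
      then have nD': "real n * D' \<le> 5/6" using n0 by (simp add: field_simps)
      have n2: "25 \<le> (real n)\<^sup>2" using power_mono[of 5 "real n" 2] 4 by simp
      show ?thesis
      proof (rule both[where l\<^sub>0=0 and Y="1 / real n" and \<sigma>="(3/5)" and a="1" and b="real n", OF D'(1,2)])
        show "2 * D' * (3/5) \<le> 1 / real n" using nD' n0 by (simp add: field_simps)
        \<comment> \<open>With b = n the inner contribution is a function of x = n D' alone:
          (36/125) x^2 (1 - 3x/5), where 36/125 = (4/3)(3/5)^3. As x <= 5/6, the last factor is at
          least 1/2.\<close>
        have "q_poly D \<le> (36/125) * ((real n * D')\<^sup>2 * (1 - (3/5) * (real n * D')))"
        proof -
          have *: "(1/2) \<le> 1 - (3/5) * (real n * D')" using nD' by simp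
          have "(18/125) * (real n * D')\<^sup>2 \<le> (36/125) * ((real n * D')\<^sup>2 * (1 - (3/5) * (real n * D')))"
          proof -
            have gen: "18/125 * x \<le> 36/125 * y" if "x * (1/2) \<le> y" for x y :: real using that by simp
            show ?thesis by (rule gen[OF mult_left_mono[OF * zero_le_power2]])
          qed
          \<comment> \<open>Without the cut, n^2 >= 25 gives a margin. With the cut, (5/2)(1/25) =
            (18/125)(5/6)^2 = 1/10 holds with equality, so the value 1/25 in \<open>D_bound\<close>
            fits exactly.\<close>
          moreover have "q_poly D \<le> (18/125) * (real n * D')\<^sup>2"
          proof (cases "D \<le> 5 / (6 * real n)")
            case True
            then have eq: "D' = D" by (simp add: D'_def)
            have "25 * D\<^sup>2 \<le> (real n)\<^sup>2 * D\<^sup>2" using n2 by (intro mult_right_mono) auto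
            then have "q_poly D \<le> (18/125) * ((real n)\<^sup>2 * D\<^sup>2)" using qA zero_le_power2[of D] by linarith
            then show ?thesis by (simp only: eq power_mult_distrib)
          next
            case False
            then have eq: "real n * D' = 5/6" using n0 by (simp add: D'_def)
            have "q_poly D \<le> (18/125) * (5/6)\<^sup>2" using qA DD by (simp add: power2_eq_square)
            then show ?thesis by (simp only: eq)
          qed
          ultimately show ?thesis by linarith
        qed
        also have "\<dots> = 4 / 3 * (real n * (real n + 2 * real 0)) * (1 * D'\<^sup>2 * (3/5) ^ 3 - real n * D' ^ 3 * (3/5) ^ 4)"
          by (simp add: power2_eq_square power3_eq_cube power4_eq_xxxx algebra_simps)
        also have "\<dots> \<le> 4 / 3 * real n * ?p * D\<^sup>2 * s ^ 3 + 4 / 3 * (real n * (real n + 2 * real 0)) * (1 * D'\<^sup>2 * (3/5) ^ 3 - real n * D' ^ 3 * (3/5) ^ 4)"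
          using s01 by simp
        finally show "q_poly D \<le> 4 / 3 * real n * ?p * D\<^sup>2 * s ^ 3 + 4 / 3 * (real n * (real n + 2 * real 0)) * (1 * D'\<^sup>2 * (3/5) ^ 3 - real n * D' ^ 3 * (3/5) ^ 4)" .
        show "1 - real n * y \<le> (1 - (real n - 1) * y) / (1 + 2 * real 0 * y)" if "0 \<le> y" for y
          using that by (simp add: algebra_simps)
      qed (use n False in auto)
    qed
  qed
qed

section \<open>Integration along rays\<close>

text \<open>Every ray from the origin meets this shell in a segment of length ln e = 1 for the
  measure ds/s, hence the outer radius e.\<close>

definition shell :: "'a::euclidean_space set" where
  "shell = {x. 1 \<le> norm x \<and> norm x \<le> exp 1}"

lemma shell_borel [measurable]: "shell \<in> sets borel"
  unfolding shell_def by measurable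

lemma ball_borel [measurable]: "ball a r \<in> sets borel"
  by simp

lemma lborel_nn_integral_scale:
  fixes F :: "'a::euclidean_space \<Rightarrow> ennreal"
  assumes [measurable]: "F \<in> borel_measurable borel" and c: "c \<noteq> 0"
  shows "(\<integral>\<^sup>+x. F x \<partial>lborel) = ennreal (\<bar>c\<bar> ^ DIM('a)) * (\<integral>\<^sup>+x. F (c *\<^sub>R x) \<partial>lborel)"
  by (subst lborel_affine[OF c, of 0]) (simp add: nn_integral_density nn_integral_distr nn_integral_cmult)

text \<open>The average of a function over the dilations by factors between \<open>1\<close> and \<open>e\<close> with respect
  to the measure \<open>ds / s\<close> replaces polar coordinates.\<close>

lemma nn_integral_rays:
  fixes F :: "'a::euclidean_space \<Rightarrow> ennreal"
  assumes [measurable]: "F \<in> borel_measurable borel"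
  shows "(\<integral>\<^sup>+x. F x \<partial>lborel) = (\<integral>\<^sup>+y. indicator shell y *
    (\<integral>\<^sup>+s. ennreal (indicator {0..} s * s ^ (DIM('a) - 1)) * F (s *\<^sub>R y) \<partial>lborel) \<partial>lborel)"
proof -
  let ?n = "DIM('a)"
  have n: "?n \<ge> 1" by (simp add: Suc_leI)
  \<comment> \<open>After the substitution x = s y, this is the density with which x is reached by
    dilation factor s. Its integral over s is 1 for every nonzero x.\<close>
  let ?J = "\<lambda>s x. (if 0 < s then indicator shell ((1 / s) *\<^sub>R (x::'a)) * ennreal (1 / s) else 0) :: ennreal"
  have J: "(\<integral>\<^sup>+s. ?J s x \<partial>lborel) = 1" if "x \<noteq> 0" for x
  proof -
    have x: "0 < norm x" using that by simp
    have "?J s x = ennreal (1 / s) * indicator {norm x / exp 1..norm x} s" for s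
    proof (cases "0 < s")
      case True
      have "(1 / s) *\<^sub>R x \<in> shell \<longleftrightarrow> s \<in> {norm x / exp 1..norm x}"
        using True by (auto simp: shell_def field_simps)
      then show ?thesis using True by (simp add: indicator_def mult.commute)
    next
      case False
      moreover have "0 < norm x / exp 1" using x by simp
      ultimately have "s \<notin> {norm x / exp 1..norm x}" by auto
      then show ?thesis using False by simp
    qed
    then have "(\<integral>\<^sup>+s. ?J s x \<partial>lborel) = (\<integral>\<^sup>+s. ennreal (1 / s) * indicator {norm x / exp 1..norm x} s \<partial>lborel)"
      by simp
    also have "\<dots> = ennreal (ln (norm x) - ln (norm x / exp 1))"
    proof (rule nn_integral_FTC_Icc[where F=ln])
      fix s assume "s \<in> {norm x / exp 1..norm x}"
      moreover have "0 < norm x / exp 1" using x by simp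
      ultimately have s: "0 < s" by simp
      show "DERIV ln s :> 1 / s" using s by (auto intro!: derivative_eq_intros)
      show "0 \<le> 1 / s" using s by simp
    next
      have "norm x \<le> norm x * exp 1" using x by (simp add: mult_le_cancel_left1)
      then show "norm x / exp 1 \<le> norm x" by (simp add: field_simps)
    qed measurable
    also have "ln (norm x) - ln (norm x / exp 1) = 1" using x by (simp add: ln_div)
    finally show ?thesis by simp
  qed
  have "(\<integral>\<^sup>+y. indicator shell y * (\<integral>\<^sup>+s. ennreal (indicator {0..} s * s ^ (?n - 1)) * F (s *\<^sub>R y) \<partial>lborel) \<partial>lborel)
    = (\<integral>\<^sup>+y. \<integral>\<^sup>+s. indicator shell y * (ennreal (indicator {0..} s * s ^ (?n - 1)) * F (s *\<^sub>R y)) \<partial>lborel \<partial>lborel)"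
    by (intro nn_integral_cong nn_integral_cmult[symmetric]) measurable
  also have "\<dots> = (\<integral>\<^sup>+s. \<integral>\<^sup>+y. indicator shell y * (ennreal (indicator {0..} s * s ^ (?n - 1)) * F (s *\<^sub>R y)) \<partial>lborel \<partial>lborel)"
    by (rule lborel_pair.Fubini') measurable
  also have "\<dots> = (\<integral>\<^sup>+s. \<integral>\<^sup>+x. ?J s x * F x \<partial>lborel \<partial>lborel)"
  proof (intro nn_integral_cong_AE)
    have "AE s in lborel. s \<noteq> (0::real)" by (rule AE_lborel_singleton)
    then show "AE s in lborel. (\<integral>\<^sup>+y. indicator shell y * (ennreal (indicator {0..} s * s ^ (?n - 1)) * F (s *\<^sub>R y)) \<partial>lborel)
       = (\<integral>\<^sup>+x. ?J s x * F x \<partial>lborel)"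
    proof eventually_elim
      fix s :: real assume s0: "s \<noteq> 0"
      show "(\<integral>\<^sup>+y. indicator shell y * (ennreal (indicator {0..} s * s ^ (?n - 1)) * F (s *\<^sub>R y)) \<partial>lborel)
       = (\<integral>\<^sup>+x. ?J s x * F x \<partial>lborel)"
      proof (cases "0 < s")
        case True
        have "(\<integral>\<^sup>+x. ?J s x * F x \<partial>lborel) = ennreal (\<bar>s\<bar> ^ ?n) * (\<integral>\<^sup>+y. ?J s (s *\<^sub>R y) * F (s *\<^sub>R y) \<partial>lborel)"
          by (rule lborel_nn_integral_scale[OF _ s0]) measurable
        also have "\<dots> = (\<integral>\<^sup>+y. ennreal (s ^ ?n) * (ennreal (1 / s) * (indicator shell y * F (s *\<^sub>R y))) \<partial>lborel)"
          using True by (subst nn_integral_cmult[symmetric]) (auto simp: mult_ac intro!: nn_integral_cong)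
        also have "\<dots> = (\<integral>\<^sup>+y. indicator shell y * (ennreal (indicator {0..} s * s ^ (?n - 1)) * F (s *\<^sub>R y)) \<partial>lborel)"
        proof -
          have "s ^ ?n * (1 / s) = s ^ (?n - 1)" using True n by (cases ?n) auto
          then have "ennreal (s ^ ?n) * ennreal (1 / s) = ennreal (s ^ (?n - 1))"
            using True by (simp add: ennreal_mult'[symmetric])
          then show ?thesis using True by (simp add: mult.assoc[symmetric]) (simp add: mult.commute)
        qed
        finally show ?thesis ..
      next
        case False
        then have "indicator {0..} s = (0::real)" using s0 by simp
        then show ?thesis using False by simp
      qed
    qed
  qed
  also have "\<dots> = (\<integral>\<^sup>+x. \<integral>\<^sup>+s. ?J s x * F x \<partial>lborel \<partial>lborel)"
    by (rule lborel_pair.Fubini') measurable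
  also have "\<dots> = (\<integral>\<^sup>+x. F x \<partial>lborel)"
  proof (intro nn_integral_cong_AE)
    have "AE x in lborel. x \<noteq> (0::'a)" by (rule AE_lborel_singleton)
    then show "AE x in lborel. (\<integral>\<^sup>+s. ?J s x * F x \<partial>lborel) = F x"
    proof eventually_elim
      fix x :: 'a assume "x \<noteq> 0"
      have "(\<integral>\<^sup>+s. ?J s x * F x \<partial>lborel) = (\<integral>\<^sup>+s. ?J s x \<partial>lborel) * F x"
        by (rule nn_integral_multc) measurable
      then show "(\<integral>\<^sup>+s. ?J s x * F x \<partial>lborel) = F x" using J[OF \<open>x \<noteq> 0\<close>] by simp
    qed
  qed
  finally show ?thesis ..
qed

text \<open>The left-hand side is a volume for \<open>m = 0\<close>, which determines the integral over the shell.\<close>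

lemma nn_integral_ball_radial:
  fixes t :: real
  assumes t: "0 < t"
  shows "(\<integral>\<^sup>+x. ennreal (indicator (ball 0 t) x * norm x ^ m) \<partial>(lborel :: 'a::euclidean_space measure))
    = ennreal (t ^ (DIM('a) + m) / (DIM('a) + m)) * (\<integral>\<^sup>+y. indicator shell y * ennreal (1 / norm y ^ DIM('a)) \<partial>(lborel :: 'a measure))"
proof -
  let ?n = "DIM('a)"
  have n: "?n \<ge> 1" by (simp add: Suc_leI)
  have inner: "(\<integral>\<^sup>+s. ennreal (indicator {0..} s * s ^ (?n - 1)) * ennreal (indicator (ball 0 t) (s *\<^sub>R y) * norm (s *\<^sub>R y) ^ m) \<partial>lborel)
      = ennreal (t ^ (?n + m) / (?n + m)) * ennreal (1 / norm y ^ ?n)" if "y \<in> shell" for y :: 'a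
  proof -
    have y: "0 < norm y" using that by (auto simp: shell_def)
    let ?a = "t / norm y"
    have a: "0 < ?a" using t y by simp
    let ?f = "\<lambda>s. norm y ^ m * s ^ (?n - 1 + m)"
    have "(\<integral>\<^sup>+s. ennreal (indicator {0..} s * s ^ (?n - 1)) * ennreal (indicator (ball 0 t) (s *\<^sub>R y) * norm (s *\<^sub>R y) ^ m) \<partial>lborel)
      = (\<integral>\<^sup>+s. ennreal (?f s) * indicator {0..?a} s \<partial>lborel)"
    proof (intro nn_integral_cong_AE)
      have "AE s in lborel. s \<noteq> ?a" by (rule AE_lborel_singleton)
      then show "AE s in lborel. ennreal (indicator {0..} s * s ^ (?n - 1)) * ennreal (indicator (ball 0 t) (s *\<^sub>R y) * norm (s *\<^sub>R y) ^ m)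
        = ennreal (?f s) * indicator {0..?a} s"
      proof eventually_elim
        fix s assume s: "s \<noteq> ?a"
        consider "s < 0" | "0 \<le> s" "s < ?a" | "?a < s" using s by linarith
        then show "ennreal (indicator {0..} s * s ^ (?n - 1)) * ennreal (indicator (ball 0 t) (s *\<^sub>R y) * norm (s *\<^sub>R y) ^ m)
          = ennreal (?f s) * indicator {0..?a} s"
        proof cases
          case 1 then show ?thesis by simp
        next
          case 2
          then have "s *\<^sub>R y \<in> ball 0 t" using y by (simp add: pos_less_divide_eq)
          then have L: "indicator {0..} s * s ^ (?n - 1) = s ^ (?n - 1)"
            "indicator (ball 0 t) (s *\<^sub>R y) * norm (s *\<^sub>R y) ^ m = (s * norm y) ^ m"
            using 2 by simp_all
          have e: "s ^ (?n - 1) * (s * norm y) ^ m = ?f s" by (simp only: power_mult_distrib power_add mult_ac)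
          have "ennreal (s ^ (?n - 1)) * ennreal ((s * norm y) ^ m) = ennreal (s ^ (?n - 1) * (s * norm y) ^ m)"
            using 2 by (intro ennreal_mult'[symmetric]) simp
          moreover have "indicator {0..?a} s = (1 :: ennreal)" using 2 by simp
          ultimately show ?thesis unfolding L e by (simp only: mult_1_right)
        next
          case 3
          moreover have "0 < s" using 3 a by linarith
          ultimately have "\<not> s *\<^sub>R y \<in> ball 0 t" using y by (simp add: pos_divide_less_eq)
          then show ?thesis using 3 a by simp
        qed
      qed
    qed
    also have "\<dots> = ennreal (norm y ^ m * (?a ^ (?n + m) / (?n + m)) - norm y ^ m * (0 ^ (?n + m) / (?n + m)))"
    proof (rule nn_integral_FTC_Icc)
      show "DERIV (\<lambda>s. norm y ^ m * (s ^ (?n + m) / (?n + m))) s :> ?f s" for s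
      proof -
        define N where "N = ?n + m"
        have N: "N \<noteq> 0" "N - 1 = ?n - 1 + m" using n by (auto simp: N_def)
        have "DERIV (\<lambda>s. norm y ^ m * (s ^ N / N)) s :> norm y ^ m * s ^ (N - 1)"
          by (auto intro!: derivative_eq_intros simp: N(1))
        then show ?thesis unfolding N(2) unfolding N_def .
      qed
    qed (use a in auto)
    also have "norm y ^ m * (?a ^ (?n + m) / (?n + m)) - norm y ^ m * (0 ^ (?n + m) / (?n + m)) = t ^ (?n + m) / (?n + m) * (1 / norm y ^ ?n)"
    proof -
      have z: "(0::real) ^ (?n + m) = 0" using n by (intro zero_power) simp
      have "?a ^ (?n + m) = t ^ (?n + m) / (norm y ^ ?n * norm y ^ m)"
        by (simp only: power_divide power_add[of "norm y"])
      moreover have "norm y ^ m * (T / (A * norm y ^ m) / K) = T / K * (1 / A)" for T A K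
        using y by simp
      ultimately show ?thesis unfolding z by simp
    qed
    finally show ?thesis using t by (simp add: ennreal_mult'[symmetric])
  qed
  have "(\<integral>\<^sup>+x. ennreal (indicator (ball 0 t) x * norm x ^ m) \<partial>(lborel :: 'a measure)) =
    (\<integral>\<^sup>+y. indicator shell y * (ennreal (t ^ (?n + m) / (?n + m)) * ennreal (1 / norm y ^ ?n)) \<partial>(lborel :: 'a measure))"
  proof (subst nn_integral_rays)
    show "(\<integral>\<^sup>+y. indicator shell y * (\<integral>\<^sup>+s. ennreal (indicator {0..} s * s ^ (?n - 1)) * ennreal (indicator (ball 0 t) (s *\<^sub>R y) * norm (s *\<^sub>R y) ^ m) \<partial>lborel) \<partial>(lborel :: 'a measure))
      = (\<integral>\<^sup>+y. indicator shell y * (ennreal (t ^ (?n + m) / (?n + m)) * ennreal (1 / norm y ^ ?n)) \<partial>(lborel :: 'a measure))"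
      using inner by (intro nn_integral_cong) (auto simp: indicator_def)
  qed measurable
  also have "\<dots> = (\<integral>\<^sup>+y. ennreal (t ^ (?n + m) / (?n + m)) * (indicator shell y * ennreal (1 / norm y ^ ?n)) \<partial>(lborel :: 'a measure))"
    by (simp only: mult.left_commute)
  also have "\<dots> = ennreal (t ^ (?n + m) / (?n + m)) * (\<integral>\<^sup>+y. indicator shell y * ennreal (1 / norm y ^ ?n) \<partial>(lborel :: 'a measure))"
    by (rule nn_integral_cmult) measurable
  finally show ?thesis .
qed

lemma shell_integral:
  "(\<integral>\<^sup>+y. indicator shell y * ennreal (1 / norm y ^ DIM('a)) \<partial>(lborel :: 'a::euclidean_space measure))
    = ennreal (DIM('a) * measure lborel (ball (0::'a) 1))"
proof -
  let ?n = "DIM('a)"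
  have n: "?n \<ge> 1" by (simp add: Suc_leI)
  let ?S = "\<integral>\<^sup>+y. indicator shell y * ennreal (1 / norm y ^ ?n) \<partial>(lborel :: 'a measure)"
  have "(\<integral>\<^sup>+x. ennreal (indicator (ball 0 1) x * norm x ^ 0) \<partial>(lborel :: 'a measure)) = ennreal (1 / ?n) * ?S"
    using nn_integral_ball_radial[of 1 0, where 'a='a] by simp
  moreover have "(\<integral>\<^sup>+x. ennreal (indicator (ball 0 1) x * norm x ^ 0) \<partial>(lborel :: 'a measure)) = emeasure lborel (ball (0::'a) 1)"
    by (simp add: ennreal_indicator)
  moreover have "emeasure lborel (ball (0::'a) 1) = ennreal (measure lborel (ball (0::'a) 1))"
    using emeasure_lborel_ball_finite[of "0::'a" 1] by (intro emeasure_eq_ennreal_measure) auto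
  ultimately have *: "ennreal (measure lborel (ball (0::'a) 1)) = ennreal (1 / ?n) * ?S" by simp
  have "ennreal ?n * ennreal (measure lborel (ball (0::'a) 1)) = ennreal (real ?n) * ennreal (1 / ?n) * ?S"
    unfolding * by (simp add: mult.assoc)
  also have "ennreal (real ?n) * ennreal (1 / ?n) = 1" using n by (simp add: ennreal_mult'[symmetric])
  finally show ?thesis by (simp add: ennreal_mult' ennreal_of_nat_eq_real_of_nat)
qed

lemma ball_radial_integral:
  fixes t \<omega> :: real
  defines "\<omega> \<equiv> measure lborel (ball (0::'a::euclidean_space) 1)"
  assumes t: "0 < t"
  shows "(\<integral>\<^sup>+x. ennreal (indicator (ball 0 t) x * norm x ^ m) \<partial>(lborel :: 'a measure))
    = ennreal (DIM('a) * \<omega> * (t ^ (DIM('a) + m) / (DIM('a) + m)))"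
    and "integrable lborel (\<lambda>x::'a. indicator (ball 0 t) x * norm x ^ m)"
    and "(\<integral>x. indicator (ball 0 t) x * norm x ^ m \<partial>(lborel :: 'a measure)) = DIM('a) * \<omega> * (t ^ (DIM('a) + m) / (DIM('a) + m))"
proof -
  have w: "0 \<le> DIM('a) * \<omega> * (t ^ (DIM('a) + m) / (DIM('a) + m))" using t by (simp add: \<omega>_def)
  show 1: "(\<integral>\<^sup>+x. ennreal (indicator (ball 0 t) x * norm x ^ m) \<partial>(lborel :: 'a measure))
    = ennreal (DIM('a) * \<omega> * (t ^ (DIM('a) + m) / (DIM('a) + m)))"
    unfolding nn_integral_ball_radial[OF t] shell_integral \<omega>_def[symmetric]
    using t by (subst ennreal_mult'[symmetric]) (auto simp: mult_ac)
  have m: "(\<lambda>x::'a. indicator (ball 0 t) x * norm x ^ m) \<in> borel_measurable lborel" by measurable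
  show "integrable lborel (\<lambda>x::'a. indicator (ball 0 t) x * norm x ^ m)"
    by (rule integrableI_nonneg[OF m]) (simp_all add: 1)
  show "(\<integral>x. indicator (ball 0 t) x * norm x ^ m \<partial>(lborel :: 'a measure)) = DIM('a) * \<omega> * (t ^ (DIM('a) + m) / (DIM('a) + m))"
    using w by (subst integral_eq_nn_integral[OF m]) (simp_all add: 1)
qed

text \<open>On the ray through y, the radius becomes t/|y| and the Lipschitz constant L|y|. Their
  product is unchanged, so D is the same on all rays and the ray estimate holds with one
  constant.\<close>

lemma excess_ge:
  fixes g :: "'a::euclidean_space \<Rightarrow> real" and l :: nat and \<omega> :: real
  defines "n \<equiv> DIM('a)" and "\<omega> \<equiv> measure lborel (ball (0::'a) 1)"
  assumes n: "2 \<le> n" and l: "1 \<le> l" and nl: "6 \<le> 2 * l + n" and t: "0 < t" and L: "0 < L"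
    and g01: "\<And>x. 0 \<le> g x \<and> g x \<le> 1"
    and lip: "\<And>x y. \<bar>g x - g y\<bar> \<le> L * norm (x - y)"
    and [measurable]: "g \<in> borel_measurable borel"
    and D: "D = 1 / (2 * L * t)" and Db: "D\<^sup>2 \<le> D_bound n"
  shows "ennreal (\<omega> * t ^ (n + 2 * l) * (real l / (real n + 2 * real l)) * q_poly D)
    \<le> (\<integral>\<^sup>+x. ennreal (\<bar>norm x ^ (2 * l) - t ^ (2 * l)\<bar> * \<bar>g x - indicator (ball 0 t) x\<bar>) \<partial>lborel)"
proof -
  let ?c = "t ^ (n + 2 * l) * (real l / (real n * (real n + 2 * real l))) * q_poly D"
  let ?F = "\<lambda>x. ennreal (\<bar>norm x ^ (2 * l) - t ^ (2 * l)\<bar> * \<bar>g x - indicator (ball 0 t) x\<bar>)"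
  have inner: "ennreal (1 / norm y ^ n) * ennreal ?c \<le> (\<integral>\<^sup>+s. ennreal (indicator {0..} s * s ^ (n - 1)) * ?F (s *\<^sub>R y) \<partial>lborel)"
    if "y \<in> shell" for y
  proof -
    have y: "0 < norm y" using that by (auto simp: shell_def)
    let ?t = "t / norm y" and ?L = "L * norm y"
    let ?G = "\<lambda>s. indicator {0..} s * (s ^ (n - 1) * \<bar>s ^ (2 * l) - ?t ^ (2 * l)\<bar> * \<bar>g (s *\<^sub>R y) - indicator {..<?t} s\<bar>)"
    have "ennreal (?t ^ (n + 2 * l) * (real l / (real n * (real n + 2 * real l))) * q_poly D) \<le> (\<integral>\<^sup>+s. ennreal (?G s) \<partial>lborel)"
    proof (rule ray_excess[OF n l nl])
      show "0 < ?t" "0 < ?L" using t L y by simp_all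
      show "0 \<le> g (r *\<^sub>R y) \<and> g (r *\<^sub>R y) \<le> 1" for r using g01 by simp
      show "\<bar>g (r *\<^sub>R y) - g (s *\<^sub>R y)\<bar> \<le> ?L * \<bar>r - s\<bar>" for r s
        using lip[of "r *\<^sub>R y" "s *\<^sub>R y"] by (simp add: scaleR_left_diff_distrib[symmetric] mult_ac)
      show "(\<lambda>s. g (s *\<^sub>R y)) \<in> borel_measurable borel" by measurable
      show "D = 1 / (2 * ?L * ?t)" using D y by simp
    qed (rule Db)
    then have "ennreal (norm y ^ (2 * l)) * ennreal (?t ^ (n + 2 * l) * (real l / (real n * (real n + 2 * real l))) * q_poly D)
       \<le> ennreal (norm y ^ (2 * l)) * (\<integral>\<^sup>+s. ennreal (?G s) \<partial>lborel)" by (rule mult_left_mono) simp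
    also have "\<dots> = (\<integral>\<^sup>+s. ennreal (norm y ^ (2 * l)) * ennreal (?G s) \<partial>lborel)"
      by (rule nn_integral_cmult[symmetric]) measurable
    also have "\<dots> = (\<integral>\<^sup>+s. ennreal (indicator {0..} s * s ^ (n - 1)) * ?F (s *\<^sub>R y) \<partial>lborel)"
    proof (rule nn_integral_cong)
      fix s
      show "ennreal (norm y ^ (2 * l)) * ennreal (?G s) = ennreal (indicator {0..} s * s ^ (n - 1)) * ?F (s *\<^sub>R y)"
      proof (cases "0 \<le> s")
        case True
        have a: "norm y ^ (2 * l) * \<bar>s ^ (2 * l) - ?t ^ (2 * l)\<bar> = \<bar>norm (s *\<^sub>R y) ^ (2 * l) - t ^ (2 * l)\<bar>"
        proof -
          have "norm y ^ (2 * l) * \<bar>s ^ (2 * l) - ?t ^ (2 * l)\<bar> = \<bar>norm y ^ (2 * l) * (s ^ (2 * l) - ?t ^ (2 * l))\<bar>"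
            by (simp add: abs_mult)
          also have "norm y ^ (2 * l) * (s ^ (2 * l) - ?t ^ (2 * l)) = norm (s *\<^sub>R y) ^ (2 * l) - t ^ (2 * l)"
            using y True by (simp add: power_mult_distrib power_divide right_diff_distrib mult.commute)
          finally show ?thesis .
        qed
        have b: "indicator {..<?t} s = (indicator (ball 0 t) (s *\<^sub>R y) :: real)"
          using y True by (simp add: indicator_def pos_less_divide_eq)
        have "norm y ^ (2 * l) * ?G s = s ^ (n - 1) * ((norm y ^ (2 * l) * \<bar>s ^ (2 * l) - ?t ^ (2 * l)\<bar>) * \<bar>g (s *\<^sub>R y) - indicator (ball 0 t) (s *\<^sub>R y)\<bar>)"
          using True unfolding b by (simp add: mult_ac)
        note eq = this[unfolded a]
        have "ennreal (norm y ^ (2 * l)) * ennreal (?G s) = ennreal (norm y ^ (2 * l) * ?G s)"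
          by (rule ennreal_mult'[symmetric]) simp
        also have "\<dots> = ennreal (s ^ (n - 1)) * ?F (s *\<^sub>R y)"
          unfolding eq using True by (intro ennreal_mult') simp
        finally show ?thesis using True by simp
      qed simp
    qed
    also have "ennreal (norm y ^ (2 * l)) * ennreal (?t ^ (n + 2 * l) * (real l / (real n * (real n + 2 * real l))) * q_poly D) = ennreal (1 / norm y ^ n) * ennreal ?c"
    proof -
      have "norm y ^ (2 * l) * (?t ^ (n + 2 * l) * (real l / (real n * (real n + 2 * real l))) * q_poly D) = 1 / norm y ^ n * ?c"
        using y by (simp add: power_divide power_add)
      then show ?thesis by (simp add: ennreal_mult'[symmetric])
    qed
    finally show ?thesis .
  qed
  have "ennreal (\<omega> * t ^ (n + 2 * l) * (real l / (real n + 2 * real l)) * q_poly D) = ennreal (real n * \<omega>) * ennreal ?c"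
    using n by (simp add: ennreal_mult'[symmetric] \<omega>_def mult_ac)
  also have "\<dots> = (\<integral>\<^sup>+y. indicator shell y * ennreal (1 / norm y ^ n) \<partial>(lborel :: 'a measure)) * ennreal ?c"
    unfolding n_def \<omega>_def shell_integral ..
  also have "\<dots> = (\<integral>\<^sup>+y. indicator shell y * ennreal (1 / norm y ^ n) * ennreal ?c \<partial>(lborel :: 'a measure))"
    by (rule nn_integral_multc[symmetric]) measurable
  also have "\<dots> \<le> (\<integral>\<^sup>+y. indicator shell y * (\<integral>\<^sup>+s. ennreal (indicator {0..} s * s ^ (n - 1)) * ?F (s *\<^sub>R y) \<partial>lborel) \<partial>lborel)"
    using inner by (intro nn_integral_mono) (auto simp: indicator_def)
  also have "\<dots> = (\<integral>\<^sup>+x. ?F x \<partial>lborel)"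
    unfolding n_def by (rule nn_integral_rays[symmetric]) measurable
  finally show ?thesis .
qed

text \<open>The bathtub principle with its remainder kept: the moment of g exceeds that of the ball
  of equal mass by exactly the integral estimated in \<open>excess_ge\<close>.\<close>

lemma moment_ge:
  fixes g :: "'a::euclidean_space \<Rightarrow> real" and l :: nat and \<omega> :: real
  defines "n \<equiv> DIM('a)" and "\<omega> \<equiv> measure lborel (ball (0::'a) 1)"
  assumes n: "2 \<le> n" and l: "1 \<le> l" and nl: "6 \<le> 2 * l + n" and t: "0 < t" and L: "0 < L"
    and g01: "\<And>x. 0 \<le> g x \<and> g x \<le> 1"
    and lip: "\<And>x y. \<bar>g x - g y\<bar> \<le> L * norm (x - y)"
    and [measurable]: "g \<in> borel_measurable borel"
    and D: "D = 1 / (2 * L * t)" and Db: "D\<^sup>2 \<le> D_bound n"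
    and mass: "(\<integral>\<^sup>+x. ennreal (g x) \<partial>lborel) = ennreal (\<omega> * t ^ n)"
    and M: "(\<integral>\<^sup>+x. ennreal (norm x ^ (2 * l) * g x) \<partial>lborel) \<le> ennreal M" "0 \<le> M"
  shows "\<omega> * t ^ (n + 2 * l) * ((real n + real l * q_poly D) / (real n + 2 * real l)) \<le> M"
proof -
  let ?p = "real n + 2 * real l"
  let ?X = "\<omega> * t ^ (n + 2 * l) * (real l / ?p) * q_poly D"
  let ?T = "t ^ (2 * l)"
  let ?b = "\<lambda>x::'a. indicator (ball 0 t) x * (?T - norm x ^ (2 * l))"
  have p: "?p > 0" using n by simp
  have \<omega>0: "0 \<le> \<omega>" by (simp add: \<omega>_def)
  have b0: "0 \<le> ?b x" for x
    using power_mono[of "norm x" t "2 * l"] by (auto simp: indicator_def)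
  note r0 = ball_radial_integral[OF t, where 'a='a and m=0, folded n_def \<omega>_def]
    and rl = ball_radial_integral[OF t, where 'a='a and m="2 * l", folded n_def \<omega>_def]
  have bi: "integrable lborel ?b" "(\<integral>x. ?b x \<partial>lborel) = \<omega> * t ^ (n + 2 * l) * (2 * real l / ?p)"
  proof -
    have eq: "?b = (\<lambda>x. ?T * (indicator (ball 0 t) x * norm x ^ 0) - indicator (ball 0 t) x * norm x ^ (2 * l))"
      by (auto simp: fun_eq_iff algebra_simps)
    show "integrable lborel ?b" unfolding eq using r0(2) rl(2) by (intro Bochner_Integration.integrable_diff integrable_mult_right)
    have "(\<integral>x. ?b x \<partial>lborel) = ?T * (real n * \<omega> * (t ^ n / n)) - real n * \<omega> * (t ^ (n + 2 * l) / ?p)"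
      unfolding eq using r0 rl by (subst Bochner_Integration.integral_diff) auto
    also have "\<dots> = \<omega> * t ^ (n + 2 * l) * (1 - real n / ?p)"
      using n by (simp add: power_add algebra_simps)
    also have "1 - real n / ?p = 2 * real l / ?p" using p by (simp add: field_simps)
    finally show "(\<integral>x. ?b x \<partial>lborel) = \<omega> * t ^ (n + 2 * l) * (2 * real l / ?p)" .
  qed
  \<comment> \<open>The bathtub identity, arranged with nonnegative terms on both sides so that it
    can be integrated in \<open>ennreal\<close> without knowing the moment of g to be
    finite.\<close>
  have key: "ennreal (norm x ^ (2 * l) * g x) + ennreal (?b x) = ennreal ?T * ennreal (g x) +
     ennreal (\<bar>norm x ^ (2 * l) - ?T\<bar> * \<bar>g x - indicator (ball 0 t) x\<bar>)" for x
  proof -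
    have "norm x ^ (2 * l) * g x + ?b x = ?T * g x + \<bar>norm x ^ (2 * l) - ?T\<bar> * \<bar>g x - indicator (ball 0 t) x\<bar>"
    proof (cases "x \<in> ball 0 t")
      case True
      then have "norm x ^ (2 * l) \<le> ?T" by (intro power_mono) auto
      then show ?thesis using True g01[of x] by (simp add: algebra_simps)
    next
      case False
      then have "?T \<le> norm x ^ (2 * l)" using t by (intro power_mono) auto
      then show ?thesis using False g01[of x] by (simp add: algebra_simps)
    qed
    then show ?thesis
      using g01[of x] b0[of x] t by (simp add: ennreal_plus[symmetric] ennreal_mult'[symmetric] del: ennreal_plus)
  qed
  have "ennreal (?T * (\<omega> * t ^ n) + ?X) \<le> ennreal (?T * (\<omega> * t ^ n)) + ennreal ?X"
  proof (cases "0 \<le> ?X")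
    case True
    then show ?thesis using t \<omega>0 by (simp only: ennreal_plus mult_nonneg_nonneg zero_le_power less_imp_le order_refl)
  next
    case False
    then have "ennreal (?T * (\<omega> * t ^ n) + ?X) \<le> ennreal (?T * (\<omega> * t ^ n))" by (intro ennreal_leI) linarith
    then show ?thesis by (rule order_trans) simp
  qed
  also have "\<dots> \<le> ennreal ?T * (\<integral>\<^sup>+x. ennreal (g x) \<partial>lborel) +
     (\<integral>\<^sup>+x. ennreal (\<bar>norm x ^ (2 * l) - ?T\<bar> * \<bar>g x - indicator (ball 0 t) x\<bar>) \<partial>lborel)"
  proof (rule add_mono)
    show "ennreal (?T * (\<omega> * t ^ n)) \<le> ennreal ?T * (\<integral>\<^sup>+x. ennreal (g x) \<partial>lborel)"
      unfolding mass using t \<omega>0 by (simp add: ennreal_mult'[symmetric])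
    show "ennreal ?X \<le> (\<integral>\<^sup>+x. ennreal (\<bar>norm x ^ (2 * l) - ?T\<bar> * \<bar>g x - indicator (ball 0 t) x\<bar>) \<partial>lborel)"
      using excess_ge[OF n[unfolded n_def] l nl[unfolded n_def] t L g01 lip _ D Db[unfolded n_def]]
      unfolding n_def \<omega>_def by simp
  qed
  also have "\<dots> = (\<integral>\<^sup>+x. ennreal ?T * ennreal (g x) + ennreal (\<bar>norm x ^ (2 * l) - ?T\<bar> * \<bar>g x - indicator (ball 0 t) x\<bar>) \<partial>lborel)"
  proof -
    have m: "(\<lambda>x. ennreal (g x)) \<in> borel_measurable lborel"
      "(\<lambda>x. ennreal (\<bar>norm x ^ (2 * l) - ?T\<bar> * \<bar>g x - indicator (ball 0 t) x\<bar>)) \<in> borel_measurable lborel"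
      by measurable
    show ?thesis by (simp add: nn_integral_add nn_integral_cmult m)
  qed
  also have "\<dots> = (\<integral>\<^sup>+x. ennreal (norm x ^ (2 * l) * g x) + ennreal (?b x) \<partial>lborel)"
    unfolding key ..
  also have "\<dots> = (\<integral>\<^sup>+x. ennreal (norm x ^ (2 * l) * g x) \<partial>lborel) + (\<integral>\<^sup>+x. ennreal (?b x) \<partial>lborel)"
    by (intro nn_integral_add) measurable
  also have "\<dots> \<le> ennreal M + ennreal (\<integral>x. ?b x \<partial>lborel)"
    using bi(1) b0 by (intro add_mono M(1)) (simp add: nn_integral_eq_integral)
  also have "\<dots> = ennreal (M + \<omega> * t ^ (n + 2 * l) * (2 * real l / ?p))"
    unfolding bi(2) using M(2) \<omega>0 t p by (intro ennreal_plus[symmetric]) auto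
  finally have "?T * (\<omega> * t ^ n) + ?X \<le> M + \<omega> * t ^ (n + 2 * l) * (2 * real l / ?p)"
    using M(2) \<omega>0 t p by (subst (asm) ennreal_le_iff) (auto intro!: add_nonneg_nonneg mult_nonneg_nonneg)
  moreover have "?T * (\<omega> * t ^ n) = \<omega> * t ^ (n + 2 * l)" by (simp add: power_add)
  moreover have "\<omega> * t ^ (n + 2 * l) * ((real n + real l * q_poly D) / ?p) =
     \<omega> * t ^ (n + 2 * l) + ?X - \<omega> * t ^ (n + 2 * l) * (2 * real l / ?p)"
  proof -
    have "real n + real l * q_poly D = ?p + real l * q_poly D - 2 * real l" by simp
    then have "(real n + real l * q_poly D) / ?p = 1 + real l / ?p * q_poly D - 2 * real l / ?p"
      using p by (simp only: diff_divide_distrib add_divide_distrib) (simp add: field_simps)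
    then show ?thesis by (simp only: right_diff_distrib distrib_left mult_1_right mult.assoc)
  qed
  ultimately show ?thesis by linarith
qed

text \<open>The function |x|^2 - R^2 is negative exactly on the ball of radius R, so the ball
  minimises its integral; equal volumes cancel the constant R^2.\<close>

lemma second_moment_ge:
  fixes \<Omega> :: "'a::euclidean_space set"
  assumes [measurable]: "\<Omega> \<in> sets borel" and fin: "emeasure lborel \<Omega> < \<infinity>"
    and int: "integrable lborel (\<lambda>x. indicator \<Omega> x * (norm x)\<^sup>2)"
    and R: "0 < R" and vol: "measure lborel \<Omega> = measure lborel (ball (0::'a) 1) * R ^ DIM('a)"
  shows "real DIM('a) / (real DIM('a) + 2) * R\<^sup>2 * measure lborel \<Omega> \<le> (\<integral>x. indicator \<Omega> x * (norm x)\<^sup>2 \<partial>lborel)"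
proof -
  let ?n = "DIM('a)" and ?\<omega> = "measure lborel (ball (0::'a) 1)"
  note r0 = ball_radial_integral[OF R, where 'a='a and m=0]
    and r2 = ball_radial_integral[OF R, where 'a='a and m=2]
  have i0: "integrable lborel (indicator \<Omega> :: 'a \<Rightarrow> real)" using fin by simp
  have v0: "(\<integral>x. indicator \<Omega> x \<partial>lborel) = measure lborel \<Omega>" by simp
  let ?d = "\<lambda>x::'a. indicator (ball 0 R) x * norm x ^ 2 - R\<^sup>2 * (indicator (ball 0 R) x * norm x ^ 0)"
  have "(\<integral>x. ?d x \<partial>lborel) \<le> (\<integral>x. indicator \<Omega> x * (norm x)\<^sup>2 - R\<^sup>2 * indicator \<Omega> x \<partial>lborel)"
  proof (rule integral_mono)
    show "integrable lborel ?d" using r0 r2 by (intro Bochner_Integration.integrable_diff integrable_mult_right)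
    show "integrable lborel (\<lambda>x. indicator \<Omega> x * (norm x)\<^sup>2 - R\<^sup>2 * indicator \<Omega> x)"
      using int i0 by (intro Bochner_Integration.integrable_diff integrable_mult_right)
    fix x :: 'a
    have "(norm x)\<^sup>2 \<le> R\<^sup>2" if "x \<in> ball 0 R" using that by (intro power_mono) auto
    moreover have "R\<^sup>2 \<le> (norm x)\<^sup>2" if "x \<notin> ball 0 R" using that R by (intro power_mono) auto
    ultimately show "?d x \<le> indicator \<Omega> x * (norm x)\<^sup>2 - R\<^sup>2 * indicator \<Omega> x"
      by (auto simp: indicator_def)
  qed
  moreover have "(\<integral>x. ?d x \<partial>lborel) = ?n * ?\<omega> * (R ^ (?n + 2) / (?n + 2)) - R\<^sup>2 * (?n * ?\<omega> * (R ^ ?n / ?n))"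
    using r0 r2 by (subst Bochner_Integration.integral_diff) auto
  moreover have "?n * ?\<omega> * (R ^ (?n + 2) / (?n + 2)) = real ?n / (real ?n + 2) * R\<^sup>2 * measure lborel \<Omega>"
    unfolding vol by (simp add: power_add power2_eq_square add.commute[of 2] mult_ac)
  moreover have "R\<^sup>2 * (?n * ?\<omega> * (R ^ ?n / ?n)) = R\<^sup>2 * measure lborel \<Omega>"
    unfolding vol by simp
  moreover have "(\<integral>x. indicator \<Omega> x * (norm x)\<^sup>2 - R\<^sup>2 * indicator \<Omega> x \<partial>lborel) = (\<integral>x. indicator \<Omega> x * (norm x)\<^sup>2 \<partial>lborel) - R\<^sup>2 * measure lborel \<Omega>"
    using int i0 v0 by (subst Bochner_Integration.integral_diff) auto
  ultimately show ?thesis by linarith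
qed

section \<open>The spectral density\<close>

text \<open>Let P be the orthogonal projection onto the span of the U i. The first claim is Bessel's
  inequality. The second is Cauchy-Schwarz for \<langle>(2P - 1) f, h\<rangle>, where the reflection
  2P - 1 preserves the norm of f because \<langle>Pf, f\<rangle> is the squared norm of Pf.\<close>

lemma orthonormal_projection:
  fixes U :: "'i \<Rightarrow> 'a \<Rightarrow> real"
  assumes J: "finite J"
    and m: "\<And>i. i \<in> J \<Longrightarrow> U i \<in> borel_measurable M" "\<And>i. i \<in> J \<Longrightarrow> integrable M (\<lambda>x. (U i x)\<^sup>2)"
    and orth: "\<And>i j. i \<in> J \<Longrightarrow> j \<in> J \<Longrightarrow> (\<integral>x. U i x * U j x \<partial>M) = (if i = j then 1 else 0)"
    and f: "f \<in> borel_measurable M" "integrable M (\<lambda>x. (f x)\<^sup>2)"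
    and h: "h \<in> borel_measurable M" "integrable M (\<lambda>x. (h x)\<^sup>2)"
  shows "(\<Sum>i\<in>J. (\<integral>x. U i x * f x \<partial>M)\<^sup>2) \<le> (\<integral>x. (f x)\<^sup>2 \<partial>M)"
    and "\<bar>2 * (\<Sum>i\<in>J. (\<integral>x. U i x * f x \<partial>M) * (\<integral>x. U i x * h x \<partial>M)) - (\<integral>x. f x * h x \<partial>M)\<bar>
      \<le> sqrt (\<integral>x. (f x)\<^sup>2 \<partial>M) * sqrt (\<integral>x. (h x)\<^sup>2 \<partial>M)"
proof -
  let ?a = "\<lambda>i. \<integral>x. U i x * f x \<partial>M"
  let ?P = "\<lambda>x. \<Sum>i\<in>J. ?a i * U i x"
  let ?A = "\<Sum>i\<in>J. (?a i)\<^sup>2"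
  have Ph: "(\<integral>x. ?P x * w x \<partial>M) = (\<Sum>i\<in>J. ?a i * (\<integral>x. U i x * w x \<partial>M))" "integrable M (\<lambda>x. ?P x * w x)"
    if w: "w \<in> borel_measurable M" "integrable M (\<lambda>x. (w x)\<^sup>2)" for w
  proof -
    have i: "integrable M (\<lambda>x. ?a i * (U i x * w x))" if "i \<in> J" for i
      using square_integrable_mult[OF m(1)[OF that] w(1) m(2)[OF that] w(2)] by simp
    have eq: "(\<lambda>x. ?P x * w x) = (\<lambda>x. \<Sum>i\<in>J. ?a i * (U i x * w x))"
      by (simp add: sum_distrib_right mult.assoc)
    show "integrable M (\<lambda>x. ?P x * w x)" unfolding eq using i by (rule Bochner_Integration.integrable_sum)
    show "(\<integral>x. ?P x * w x \<partial>M) = (\<Sum>i\<in>J. ?a i * (\<integral>x. U i x * w x \<partial>M))"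
      unfolding eq using i by (subst Bochner_Integration.integral_sum) auto
  qed
  have PU: "(\<integral>x. ?P x * U i x \<partial>M) = ?a i" if i: "i \<in> J" for i
  proof -
    have "(\<integral>x. ?P x * U i x \<partial>M) = (\<Sum>j\<in>J. ?a j * (\<integral>x. U j x * U i x \<partial>M))" by (rule Ph(1)[OF m[OF i]])
    also have "\<dots> = (\<Sum>j\<in>J. if j = i then ?a j else 0)" by (intro sum.cong refl) (simp add: orth i)
    finally show ?thesis using J i by simp
  qed
  have mP: "?P \<in> borel_measurable M" using m(1) by (intro borel_measurable_sum borel_measurable_times borel_measurable_const)
  have eqPP: "(\<lambda>x. (?P x)\<^sup>2) = (\<lambda>x. \<Sum>i\<in>J. ?a i * (?P x * U i x))"
  proof
    fix x
    have "(?P x)\<^sup>2 = (\<Sum>i\<in>J. ?P x * (?a i * U i x))" by (simp only: power2_eq_square sum_distrib_left)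
    then show "(?P x)\<^sup>2 = (\<Sum>i\<in>J. ?a i * (?P x * U i x))" by (simp only: mult.left_commute)
  qed
  have iPU: "integrable M (\<lambda>x. ?a i * (?P x * U i x))" if "i \<in> J" for i
    using Ph(2)[OF m[OF that]] by (rule integrable_mult_right)
  have iP: "integrable M (\<lambda>x. (?P x)\<^sup>2)"
    unfolding eqPP using iPU by (rule Bochner_Integration.integrable_sum)
  have PP: "(\<integral>x. (?P x)\<^sup>2 \<partial>M) = ?A"
  proof -
    have "(\<integral>x. (?P x)\<^sup>2 \<partial>M) = (\<Sum>i\<in>J. \<integral>x. ?a i * (?P x * U i x) \<partial>M)"
      unfolding eqPP using iPU by (rule Bochner_Integration.integral_sum)
    also have "\<dots> = (\<Sum>i\<in>J. ?a i * ?a i)"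
      by (intro sum.cong refl) (simp only: Bochner_Integration.integral_mult_right_zero PU)
    finally show ?thesis by (simp only: power2_eq_square)
  qed
  have Pf: "(\<integral>x. ?P x * f x \<partial>M) = ?A" "integrable M (\<lambda>x. ?P x * f x)"
    using Ph[OF f] by (simp_all only: power2_eq_square)
  let ?R = "\<lambda>x. 2 * ?P x + (-1) * f x"
  have mR: "?R \<in> borel_measurable M"
    using mP f(1) by (intro borel_measurable_add borel_measurable_times borel_measurable_const)
  have iR: "integrable M (\<lambda>x. (?R x)\<^sup>2)" by (rule square_integrable_linear[OF mP f(1) iP f(2)])
  have RR: "(\<integral>x. (?R x)\<^sup>2 \<partial>M) = (\<integral>x. (f x)\<^sup>2 \<partial>M)"
  proof -
    have "(\<integral>x. (?R x)\<^sup>2 \<partial>M) = (\<integral>x. 4 * (?P x)\<^sup>2 - 4 * (?P x * f x) + (f x)\<^sup>2 \<partial>M)"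
      by (intro Bochner_Integration.integral_cong refl) (simp add: power2_eq_square algebra_simps)
    also have "\<dots> = 4 * ?A - 4 * ?A + (\<integral>x. (f x)\<^sup>2 \<partial>M)"
      using iP Pf f(2) by (simp add: PP)
    finally show ?thesis by simp
  qed
  have "0 \<le> (\<integral>x. (1 * f x + (-1) * ?P x)\<^sup>2 \<partial>M)" by simp
  also have "\<dots> = (\<integral>x. (f x)\<^sup>2 - 2 * (?P x * f x) + (?P x)\<^sup>2 \<partial>M)"
    by (intro Bochner_Integration.integral_cong refl) (simp add: power2_eq_square algebra_simps)
  also have "\<dots> = (\<integral>x. (f x)\<^sup>2 \<partial>M) - ?A"
    using iP Pf f(2) by (simp add: PP)
  finally show "?A \<le> (\<integral>x. (f x)\<^sup>2 \<partial>M)" by simp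
  have fh: "integrable M (\<lambda>x. f x * h x)" by (rule square_integrable_mult[OF f(1) h(1) f(2) h(2)])
  have "(\<integral>x. ?R x * h x \<partial>M) = (\<integral>x. 2 * (?P x * h x) - f x * h x \<partial>M)"
    by (intro Bochner_Integration.integral_cong refl) (simp add: algebra_simps)
  also have "\<dots> = 2 * (\<Sum>i\<in>J. ?a i * (\<integral>x. U i x * h x \<partial>M)) - (\<integral>x. f x * h x \<partial>M)"
    using Ph[OF h] fh by simp
  finally have Rh: "(\<integral>x. ?R x * h x \<partial>M) = 2 * (\<Sum>i\<in>J. ?a i * (\<integral>x. U i x * h x \<partial>M)) - (\<integral>x. f x * h x \<partial>M)" .
  have "\<bar>\<integral>x. ?R x * h x \<partial>M\<bar> = sqrt ((\<integral>x. ?R x * h x \<partial>M)\<^sup>2)" by simp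
  also have "\<dots> \<le> sqrt ((\<integral>x. (?R x)\<^sup>2 \<partial>M) * (\<integral>x. (h x)\<^sup>2 \<partial>M))"
    by (intro real_sqrt_le_mono integral_Cauchy_Schwarz mR h iR)
  also have "\<dots> = sqrt (\<integral>x. (f x)\<^sup>2 \<partial>M) * sqrt (\<integral>x. (h x)\<^sup>2 \<partial>M)" unfolding RR by (rule real_sqrt_mult)
  finally show "\<bar>2 * (\<Sum>i\<in>J. ?a i * (\<integral>x. U i x * h x \<partial>M)) - (\<integral>x. f x * h x \<partial>M)\<bar>
      \<le> sqrt (\<integral>x. (f x)\<^sup>2 \<partial>M) * sqrt (\<integral>x. (h x)\<^sup>2 \<partial>M)" unfolding Rh .
qed

text \<open>Cauchy-Schwarz in the plane; it recombines estimates made separately for the cosine and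
  the sine part of an exponential.\<close>

lemma sqrt_mult_add_le:
  assumes "0 \<le> a" "0 \<le> b" "0 \<le> c" "0 \<le> d"
  shows "sqrt a * sqrt b + sqrt c * sqrt d \<le> sqrt ((a + c) * (b + d))"
proof (rule real_le_rsqrt)
  have "(sqrt a * sqrt b + sqrt c * sqrt d)\<^sup>2 + (sqrt a * sqrt d - sqrt c * sqrt b)\<^sup>2
      = (sqrt a)\<^sup>2 * (sqrt b)\<^sup>2 + (sqrt c)\<^sup>2 * (sqrt d)\<^sup>2 + (sqrt a)\<^sup>2 * (sqrt d)\<^sup>2 + (sqrt c)\<^sup>2 * (sqrt b)\<^sup>2"
    by (simp only: power2_eq_square) (simp add: algebra_simps)
  also have "\<dots> = (a + c) * (b + d)" using assms by (simp add: algebra_simps)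
  finally show "(sqrt a * sqrt b + sqrt c * sqrt d)\<^sup>2 \<le> (a + c) * (b + d)"
    using zero_le_power2[of "sqrt a * sqrt d - sqrt c * sqrt b"] by linarith
qed

text \<open>An exponential restricted to \<Omega> has squared norm V, so division by V turns
  Bessel's inequality into the bound 1.\<close>

definition density :: "'a::euclidean_space set \<Rightarrow> (nat \<Rightarrow> 'a \<Rightarrow> real) \<Rightarrow> nat \<Rightarrow> 'a \<Rightarrow> real" where
  "density \<Omega> U k \<xi> = (\<Sum>i=1..k. ft_pow (U i) \<xi>) / measure lborel \<Omega>"

locale spectral_family =
  fixes \<Omega> :: "(real^'n) set" and l :: nat and \<Lambda> :: "nat \<Rightarrow> real" and U :: "nat \<Rightarrow> real^'n \<Rightarrow> real"
    and \<Phi> :: "nat \<Rightarrow> nat \<Rightarrow> real^'n \<Rightarrow> real"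
  assumes dom: "bounded_domain \<Omega>"
    and U_measurable: "\<And>i. i \<ge> 1 \<Longrightarrow> U i \<in> borel_measurable borel"
    and U_outside: "\<And>i x. i \<ge> 1 \<Longrightarrow> x \<notin> \<Omega> \<Longrightarrow> U i x = 0"
    and U_square: "\<And>i. i \<ge> 1 \<Longrightarrow> integrable lborel (\<lambda>x. (U i x)\<^sup>2)"
    and U_orth: "\<And>i j. i \<ge> 1 \<Longrightarrow> j \<ge> 1 \<Longrightarrow> (\<integral>x. U i x * U j x \<partial>lborel) = (if i = j then 1 else 0)"
    and \<Phi>_test: "\<And>i m. i \<ge> 1 \<Longrightarrow> \<Phi> i m \<in> test_functions \<Omega>"
    and \<Phi>_lim: "\<And>i. i \<ge> 1 \<Longrightarrow> (\<lambda>m. \<integral>x. (\<Phi> i m x - U i x)\<^sup>2 \<partial>lborel) \<longlonglongrightarrow> 0"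
    and \<Phi>_energy: "\<And>i. i \<ge> 1 \<Longrightarrow> (\<lambda>m. \<Sum>is | length is = l. \<integral>x. (partials is (\<Phi> i m) x)\<^sup>2 \<partial>lborel) \<longlonglongrightarrow> \<Lambda> i"
begin

abbreviation V :: real where "V \<equiv> measure lborel \<Omega>"
abbreviation I :: real where "I \<equiv> \<integral>x. indicator \<Omega> x * (norm x)\<^sup>2 \<partial>lborel"

lemma \<Omega>_borel [measurable]: "\<Omega> \<in> sets borel"
  using dom by (simp add: bounded_domain_def)

lemma \<Omega>_finite: "emeasure lborel \<Omega> < \<infinity>"
  using dom emeasure_bounded_finite[of \<Omega>] by (simp add: bounded_domain_def)

lemma indicator_bounded_integrable:
  fixes f :: "real^'n \<Rightarrow> real"
  assumes "f \<in> borel_measurable borel" "\<And>x. x \<in> \<Omega> \<Longrightarrow> \<bar>f x\<bar> \<le> B"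
  shows "integrable lborel (\<lambda>x. indicator \<Omega> x * f x)"
proof (rule Bochner_Integration.integrable_bound[where f="\<lambda>x. B * indicator \<Omega> x"])
  show "integrable lborel (\<lambda>x. B * indicator \<Omega> x)" using \<Omega>_finite by simp
  show "(\<lambda>x. indicator \<Omega> x * f x) \<in> borel_measurable lborel" using assms(1) by measurable
  have "\<bar>indicator \<Omega> x * f x\<bar> \<le> \<bar>B * indicator \<Omega> x\<bar>" for x
    using assms(2)[of x] by (cases "x \<in> \<Omega>") auto
  then show "AE x in lborel. norm (indicator \<Omega> x * f x) \<le> norm (B * indicator \<Omega> x)" by simp
qed

lemma V_pos: "0 < V"
proof -
  have "open \<Omega>" "\<Omega> \<noteq> {}" using dom by (auto simp: bounded_domain_def)
  then have "\<not> negligible \<Omega>" by (rule open_not_negligible)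
  then have "emeasure lborel \<Omega> \<noteq> 0" by (auto simp: negligible_iff_null_sets null_sets_def emeasure_completion)
  then show ?thesis using \<Omega>_finite by (simp add: measure_def enn2real_positive_iff top.not_eq_extremum zero_less_iff_neq_zero)
qed

lemma U_integrable: "i \<ge> 1 \<Longrightarrow> integrable lborel (U i)"
proof -
  assume i: "i \<ge> 1"
  have "integrable lborel (\<lambda>x. indicator \<Omega> x * U i x)"
  proof (rule square_integrable_mult)
    show "integrable lborel (\<lambda>x. (indicator \<Omega> x :: real)\<^sup>2)"
    proof -
      have "(\<lambda>x. (indicator \<Omega> x :: real)\<^sup>2) = (\<lambda>x. indicator \<Omega> x * 1)"
        by (auto simp: fun_eq_iff indicator_def)
      then show ?thesis using indicator_bounded_integrable[of "\<lambda>x. 1" 1] by simp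
    qed
  qed (use U_measurable[OF i] U_square[OF i] in auto)
  moreover have "(\<lambda>x. indicator \<Omega> x * U i x) = U i" using U_outside[OF i] by (auto simp: fun_eq_iff indicator_def)
  ultimately show ?thesis by simp
qed

lemma norm_square_integrable: "integrable lborel (\<lambda>x. indicator \<Omega> x * (norm x)\<^sup>2)"
proof -
  obtain B where "\<And>x. x \<in> \<Omega> \<Longrightarrow> norm x \<le> B" using dom by (auto simp: bounded_domain_def bounded_iff)
  then have "\<bar>(norm x)\<^sup>2\<bar> \<le> B\<^sup>2" if "x \<in> \<Omega>" for x using that by (simp add: power_mono)
  then show ?thesis by (intro indicator_bounded_integrable) auto
qed

abbreviation "C \<xi> \<equiv> \<lambda>x::real^'n. indicator \<Omega> x * cos (x \<bullet> \<xi>) :: real"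
abbreviation "S \<xi> \<equiv> \<lambda>x::real^'n. indicator \<Omega> x * sin (x \<bullet> \<xi>) :: real"

lemma CS_square_integrable:
  "C \<xi> \<in> borel_measurable lborel" "S \<xi> \<in> borel_measurable lborel"
  "integrable lborel (\<lambda>x. (C \<xi> x)\<^sup>2)" "integrable lborel (\<lambda>x. (S \<xi> x)\<^sup>2)"
proof -
  show "C \<xi> \<in> borel_measurable lborel" "S \<xi> \<in> borel_measurable lborel" by measurable
  have "(\<lambda>x. (C \<xi> x)\<^sup>2) = (\<lambda>x. indicator \<Omega> x * (cos (x \<bullet> \<xi>))\<^sup>2)" "(\<lambda>x. (S \<xi> x)\<^sup>2) = (\<lambda>x. indicator \<Omega> x * (sin (x \<bullet> \<xi>))\<^sup>2)"
    by (auto simp: fun_eq_iff indicator_def)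
  moreover have "integrable lborel (\<lambda>x. indicator \<Omega> x * (cos (x \<bullet> \<xi>))\<^sup>2)"
  proof (rule indicator_bounded_integrable[where B=1])
    show "\<bar>(cos (x \<bullet> \<xi>))\<^sup>2\<bar> \<le> 1" for x by (simp add: abs_square_le_1)
  qed measurable
  moreover have "integrable lborel (\<lambda>x. indicator \<Omega> x * (sin (x \<bullet> \<xi>))\<^sup>2)"
  proof (rule indicator_bounded_integrable[where B=1])
    show "\<bar>(sin (x \<bullet> \<xi>))\<^sup>2\<bar> \<le> 1" for x by (simp add: abs_square_le_1)
  qed measurable
  ultimately show "integrable lborel (\<lambda>x. (C \<xi> x)\<^sup>2)" "integrable lborel (\<lambda>x. (S \<xi> x)\<^sup>2)"
    by (simp_all only:)
qed

lemma integral_CS: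
  assumes "\<And>x. x \<notin> \<Omega> \<Longrightarrow> f x = 0"
  shows "(\<integral>x. f x * cos (x \<bullet> \<xi>) \<partial>lborel) = (\<integral>x. f x * C \<xi> x \<partial>lborel)"
    "(\<integral>x. f x * sin (x \<bullet> \<xi>) \<partial>lborel) = (\<integral>x. f x * S \<xi> x \<partial>lborel)"
  using assms by (auto intro!: Bochner_Integration.integral_cong simp: indicator_def)

lemma density_eq:
  "V * density \<Omega> U k \<xi> = (\<Sum>i=1..k. (\<integral>x. U i x * C \<xi> x \<partial>lborel)\<^sup>2) + (\<Sum>i=1..k. (\<integral>x. U i x * S \<xi> x \<partial>lborel)\<^sup>2)"
proof -
  have "ft_pow (U i) \<xi> = (\<integral>x. U i x * C \<xi> x \<partial>lborel)\<^sup>2 + (\<integral>x. U i x * S \<xi> x \<partial>lborel)\<^sup>2" if "i \<in> {1..k}" for i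
    unfolding ft_pow_def using integral_CS[OF U_outside[of i]] that by simp
  then show ?thesis using V_pos by (simp add: density_def sum.distrib)
qed

lemma density_bounds: "0 \<le> density \<Omega> U k \<xi> \<and> density \<Omega> U k \<xi> \<le> 1"
proof
  show "0 \<le> density \<Omega> U k \<xi>" by (auto simp: density_def intro!: divide_nonneg_nonneg sum_nonneg)
  have "V * density \<Omega> U k \<xi> \<le> (\<integral>x. (C \<xi> x)\<^sup>2 \<partial>lborel) + (\<integral>x. (S \<xi> x)\<^sup>2 \<partial>lborel)"
    unfolding density_eq
  proof (rule add_mono)
    show "(\<Sum>i=1..k. (\<integral>x. U i x * C \<xi> x \<partial>lborel)\<^sup>2) \<le> (\<integral>x. (C \<xi> x)\<^sup>2 \<partial>lborel)"
      by (rule orthonormal_projection(1)[OF _ _ _ _ CS_square_integrable(1,3) CS_square_integrable(1,3)])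
        (simp_all add: U_measurable U_square U_orth)
    show "(\<Sum>i=1..k. (\<integral>x. U i x * S \<xi> x \<partial>lborel)\<^sup>2) \<le> (\<integral>x. (S \<xi> x)\<^sup>2 \<partial>lborel)"
      by (rule orthonormal_projection(1)[OF _ _ _ _ CS_square_integrable(2,4) CS_square_integrable(2,4)])
        (simp_all add: U_measurable U_square U_orth)
  qed
  also have "\<dots> = (\<integral>x. (C \<xi> x)\<^sup>2 + (S \<xi> x)\<^sup>2 \<partial>lborel)"
    using CS_square_integrable by simp
  also have "\<dots> = (\<integral>x. indicator \<Omega> x \<partial>lborel)"
    by (intro Bochner_Integration.integral_cong) (auto simp: indicator_def)
  finally have "V * density \<Omega> U k \<xi> \<le> V * 1" by simp
  then show "density \<Omega> U k \<xi> \<le> 1" using V_pos by (simp only: mult_le_cancel_left_pos)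
qed

lemma density_measurable [measurable]: "density \<Omega> U k \<in> borel_measurable borel"
  unfolding density_def[abs_def]
  using ft_pow_measurable[OF U_integrable] by (intro borel_measurable_divide borel_measurable_sum) auto

text \<open>Writing \<open>P\<close> for the projection onto the span of the eigenfunctions and \<open>e\<^sub>\<xi>\<close> for the exponential
  restricted to \<open>\<Omega>\<close>, the density is \<open>\<parallel>P e\<^sub>\<xi>\<parallel>\<^sup>2 / V\<close>. As all \<open>e\<^sub>\<xi>\<close> have the same norm, its increments are
  \<open>\<langle>(2P - 1)(e\<^sub>\<eta> - e\<^sub>\<xi>), e\<^sub>\<eta> + e\<^sub>\<xi>\<rangle> / 2V\<close>, and the reflection \<open>2P - 1\<close> is an isometry. This halves the
  obvious Lipschitz constant.\<close>

lemma density_lipschitz: "\<bar>density \<Omega> U k \<eta> - density \<Omega> U k \<xi>\<bar> \<le> sqrt (I / V) * norm (\<eta> - \<xi>)"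
proof -
  note sq = CS_square_integrable
  let ?dC = "\<lambda>x. 1 * C \<eta> x + (-1) * C \<xi> x" and ?sC = "\<lambda>x. 1 * C \<eta> x + 1 * C \<xi> x"
  let ?dS = "\<lambda>x. 1 * S \<eta> x + (-1) * S \<xi> x" and ?sS = "\<lambda>x. 1 * S \<eta> x + 1 * S \<xi> x"
  have mm: "?dC \<in> borel_measurable lborel" "?sC \<in> borel_measurable lborel"
    "?dS \<in> borel_measurable lborel" "?sS \<in> borel_measurable lborel" by measurable
  have ii: "integrable lborel (\<lambda>x. (?dC x)\<^sup>2)" "integrable lborel (\<lambda>x. (?sC x)\<^sup>2)"
    "integrable lborel (\<lambda>x. (?dS x)\<^sup>2)" "integrable lborel (\<lambda>x. (?sS x)\<^sup>2)"
    by (intro square_integrable_linear sq)+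
  have Uint: "integrable lborel (\<lambda>x. U i x * C \<zeta> x)" "integrable lborel (\<lambda>x. U i x * S \<zeta> x)" if "i \<in> {1..k}" for i \<zeta>
    using that by (auto intro!: square_integrable_mult sq simp: U_square U_measurable)
  let ?X = "\<Sum>i=1..k. (\<integral>x. U i x * ?dC x \<partial>lborel) * (\<integral>x. U i x * ?sC x \<partial>lborel)"
  let ?Y = "\<Sum>i=1..k. (\<integral>x. U i x * ?dS x \<partial>lborel) * (\<integral>x. U i x * ?sS x \<partial>lborel)"
  \<comment> \<open>Polarisation of a difference of squares, (a - b)(a + b), for each
    coefficient.\<close>
  have X: "?X = (\<Sum>i=1..k. (\<integral>x. U i x * C \<eta> x \<partial>lborel)\<^sup>2) - (\<Sum>i=1..k. (\<integral>x. U i x * C \<xi> x \<partial>lborel)\<^sup>2)"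
    unfolding sum_subtractf[symmetric]
  proof (intro sum.cong refl)
    fix i assume i: "i \<in> {1..k}"
    have "(\<integral>x. U i x * ?dC x \<partial>lborel) = (\<integral>x. U i x * C \<eta> x - U i x * C \<xi> x \<partial>lborel)"
      by (intro Bochner_Integration.integral_cong refl) (simp add: right_diff_distrib)
    moreover have "(\<integral>x. U i x * ?sC x \<partial>lborel) = (\<integral>x. U i x * C \<eta> x + U i x * C \<xi> x \<partial>lborel)"
      by (intro Bochner_Integration.integral_cong refl) (simp add: distrib_left)
    ultimately show "(\<integral>x. U i x * ?dC x \<partial>lborel) * (\<integral>x. U i x * ?sC x \<partial>lborel)
      = (\<integral>x. U i x * C \<eta> x \<partial>lborel)\<^sup>2 - (\<integral>x. U i x * C \<xi> x \<partial>lborel)\<^sup>2"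
      using Uint[OF i] by (simp add: power2_eq_square algebra_simps)
  qed
  have Y: "?Y = (\<Sum>i=1..k. (\<integral>x. U i x * S \<eta> x \<partial>lborel)\<^sup>2) - (\<Sum>i=1..k. (\<integral>x. U i x * S \<xi> x \<partial>lborel)\<^sup>2)"
    unfolding sum_subtractf[symmetric]
  proof (intro sum.cong refl)
    fix i assume i: "i \<in> {1..k}"
    have "(\<integral>x. U i x * ?dS x \<partial>lborel) = (\<integral>x. U i x * S \<eta> x - U i x * S \<xi> x \<partial>lborel)"
      by (intro Bochner_Integration.integral_cong refl) (simp add: right_diff_distrib)
    moreover have "(\<integral>x. U i x * ?sS x \<partial>lborel) = (\<integral>x. U i x * S \<eta> x + U i x * S \<xi> x \<partial>lborel)"
      by (intro Bochner_Integration.integral_cong refl) (simp add: distrib_left)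
    ultimately show "(\<integral>x. U i x * ?dS x \<partial>lborel) * (\<integral>x. U i x * ?sS x \<partial>lborel)
      = (\<integral>x. U i x * S \<eta> x \<partial>lborel)\<^sup>2 - (\<integral>x. U i x * S \<xi> x \<partial>lborel)\<^sup>2"
      using Uint[OF i] by (simp add: power2_eq_square algebra_simps)
  qed
  \<comment> \<open>The real part of the inner product of difference and sum of two exponentials is
    the difference of their squared norms, both equal to V.\<close>
  have zero: "(\<integral>x. ?dC x * ?sC x \<partial>lborel) + (\<integral>x. ?dS x * ?sS x \<partial>lborel) = 0"
  proof -
    have "(\<integral>x. ?dC x * ?sC x \<partial>lborel) + (\<integral>x. ?dS x * ?sS x \<partial>lborel) = (\<integral>x. ?dC x * ?sC x + ?dS x * ?sS x \<partial>lborel)"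
      by (intro Bochner_Integration.integral_add[symmetric] square_integrable_mult mm ii)
    also have "\<dots> = (\<integral>x. 0 \<partial>(lborel :: (real^'n) measure))"
    proof (intro Bochner_Integration.integral_cong refl)
      fix x
      have "(cos (x \<bullet> \<eta>) - cos (x \<bullet> \<xi>)) * (cos (x \<bullet> \<eta>) + cos (x \<bullet> \<xi>)) + (sin (x \<bullet> \<eta>) - sin (x \<bullet> \<xi>)) * (sin (x \<bullet> \<eta>) + sin (x \<bullet> \<xi>))
        = ((sin (x \<bullet> \<eta>))\<^sup>2 + (cos (x \<bullet> \<eta>))\<^sup>2) - ((sin (x \<bullet> \<xi>))\<^sup>2 + (cos (x \<bullet> \<xi>))\<^sup>2)"
        by (simp only: power2_eq_square) (simp add: algebra_simps)
      then show "?dC x * ?sC x + ?dS x * ?sS x = 0" by (cases "x \<in> \<Omega>") (simp_all only: sin_cos_squared_add diff_self indicator_simps, simp_all)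
    qed
    finally show ?thesis by simp
  qed
  have "\<bar>2 * (V * density \<Omega> U k \<eta> - V * density \<Omega> U k \<xi>)\<bar> =
     \<bar>(2 * ?X - (\<integral>x. ?dC x * ?sC x \<partial>lborel)) + (2 * ?Y - (\<integral>x. ?dS x * ?sS x \<partial>lborel))\<bar>"
  proof (rule arg_cong[where f=abs])
    have gen: "2 * ((a + b) - (c + d)) = (2 * (a - c) - x) + (2 * (b - d) - y)" if "x + y = 0" for a b c d x y :: real
      using that by simp
    show "2 * (V * density \<Omega> U k \<eta> - V * density \<Omega> U k \<xi>) =
      (2 * ?X - (\<integral>x. ?dC x * ?sC x \<partial>lborel)) + (2 * ?Y - (\<integral>x. ?dS x * ?sS x \<partial>lborel))"
      unfolding density_eq X Y by (rule gen[OF zero])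
  qed
  also have "\<dots> \<le> sqrt (\<integral>x. (?dC x)\<^sup>2 \<partial>lborel) * sqrt (\<integral>x. (?sC x)\<^sup>2 \<partial>lborel) + sqrt (\<integral>x. (?dS x)\<^sup>2 \<partial>lborel) * sqrt (\<integral>x. (?sS x)\<^sup>2 \<partial>lborel)"
  proof (rule order_trans[OF abs_triangle_ineq add_mono])
    show "\<bar>2 * ?X - (\<integral>x. ?dC x * ?sC x \<partial>lborel)\<bar> \<le> sqrt (\<integral>x. (?dC x)\<^sup>2 \<partial>lborel) * sqrt (\<integral>x. (?sC x)\<^sup>2 \<partial>lborel)"
      by (rule orthonormal_projection(2)[OF _ _ _ _ mm(1) ii(1) mm(2) ii(2)]) (simp_all add: U_measurable U_square U_orth)
    show "\<bar>2 * ?Y - (\<integral>x. ?dS x * ?sS x \<partial>lborel)\<bar> \<le> sqrt (\<integral>x. (?dS x)\<^sup>2 \<partial>lborel) * sqrt (\<integral>x. (?sS x)\<^sup>2 \<partial>lborel)"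
      by (rule orthonormal_projection(2)[OF _ _ _ _ mm(3) ii(3) mm(4) ii(4)]) (simp_all add: U_measurable U_square U_orth)
  qed
  also have "\<dots> \<le> sqrt (((\<integral>x. (?dC x)\<^sup>2 \<partial>lborel) + (\<integral>x. (?dS x)\<^sup>2 \<partial>lborel)) * ((\<integral>x. (?sC x)\<^sup>2 \<partial>lborel) + (\<integral>x. (?sS x)\<^sup>2 \<partial>lborel)))"
    by (rule sqrt_mult_add_le) simp_all
  \<comment> \<open>Pointwise on \<Omega>, the difference of the exponentials has squared modulus 4
    sin^2(x\<bullet>(\<eta> - \<xi>)/2), at most |x|^2 |\<eta> - \<xi>|^2, and their sum has squared
    modulus at most 4.\<close>
  also have "\<dots> \<le> sqrt (((norm (\<eta> - \<xi>))\<^sup>2 * I) * (4 * V))"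
  proof (intro real_sqrt_le_mono mult_mono)
    have trig: "(cos a - cos b)\<^sup>2 + (sin a - sin b)\<^sup>2 = 4 * (sin ((a - b) / 2))\<^sup>2" for a b :: real
    proof -
      have "(cos a - cos b)\<^sup>2 + (sin a - sin b)\<^sup>2 = ((sin a)\<^sup>2 + (cos a)\<^sup>2) + ((sin b)\<^sup>2 + (cos b)\<^sup>2) - 2 * (cos a * cos b + sin a * sin b)"
        by (simp only: power2_eq_square) (simp add: algebra_simps)
      also have "\<dots> = 2 - 2 * cos (2 * ((a - b) / 2))"
      proof -
        have "2 * ((a - b) / 2) = a - b" by simp
        then show ?thesis unfolding sin_cos_squared_add by (simp only: cos_diff)
      qed
      also have "\<dots> = 4 * (sin ((a - b) / 2))\<^sup>2" unfolding cos_double_sin by simp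
      finally show ?thesis .
    qed
    have "(\<integral>x. (?dC x)\<^sup>2 \<partial>lborel) + (\<integral>x. (?dS x)\<^sup>2 \<partial>lborel) = (\<integral>x. (?dC x)\<^sup>2 + (?dS x)\<^sup>2 \<partial>lborel)"
      using ii by simp
    also have "\<dots> \<le> (\<integral>x. (norm (\<eta> - \<xi>))\<^sup>2 * (indicator \<Omega> x * (norm x)\<^sup>2) \<partial>lborel)"
    proof (rule integral_mono)
      show "integrable lborel (\<lambda>x. (?dC x)\<^sup>2 + (?dS x)\<^sup>2)" using ii by simp
      show "integrable lborel (\<lambda>x. (norm (\<eta> - \<xi>))\<^sup>2 * (indicator \<Omega> x * (norm x)\<^sup>2))"
        using norm_square_integrable by (rule integrable_mult_right)
      fix x
      have "\<bar>sin (x \<bullet> (\<eta> - \<xi>) / 2)\<bar> \<le> \<bar>x \<bullet> (\<eta> - \<xi>) / 2\<bar>" by (rule abs_sin_x_le_abs_x)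
      also have "\<dots> \<le> norm x * norm (\<eta> - \<xi>) / 2" using Cauchy_Schwarz_ineq2[of x "\<eta> - \<xi>"] by simp
      finally have "\<bar>sin (x \<bullet> (\<eta> - \<xi>) / 2)\<bar>\<^sup>2 \<le> (norm x * norm (\<eta> - \<xi>) / 2)\<^sup>2" by (intro power_mono) auto
      then have "4 * (sin (x \<bullet> (\<eta> - \<xi>) / 2))\<^sup>2 \<le> (norm (\<eta> - \<xi>))\<^sup>2 * (norm x)\<^sup>2"
        by (simp add: power_divide power_mult_distrib mult.commute)
      then show "(?dC x)\<^sup>2 + (?dS x)\<^sup>2 \<le> (norm (\<eta> - \<xi>))\<^sup>2 * (indicator \<Omega> x * (norm x)\<^sup>2)"
        using trig[of "x \<bullet> \<eta>" "x \<bullet> \<xi>"] by (cases "x \<in> \<Omega>") (simp_all add: inner_diff_right)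
    qed
    also have "\<dots> = (norm (\<eta> - \<xi>))\<^sup>2 * I" by simp
    finally show "(\<integral>x. (?dC x)\<^sup>2 \<partial>lborel) + (\<integral>x. (?dS x)\<^sup>2 \<partial>lborel) \<le> (norm (\<eta> - \<xi>))\<^sup>2 * I" .
    have "(\<integral>x. (?sC x)\<^sup>2 \<partial>lborel) + (\<integral>x. (?sS x)\<^sup>2 \<partial>lborel) = (\<integral>x. (?sC x)\<^sup>2 + (?sS x)\<^sup>2 \<partial>lborel)"
      using ii by simp
    also have "\<dots> \<le> (\<integral>x. 4 * indicator \<Omega> x \<partial>lborel)"
    proof (rule integral_mono)
      show "integrable lborel (\<lambda>x. (?sC x)\<^sup>2 + (?sS x)\<^sup>2)" using ii by simp
      show "integrable lborel (\<lambda>x. 4 * indicator \<Omega> x :: real)" using \<Omega>_finite by simp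
      fix x
      have gen: "(a + b)\<^sup>2 + (c + d)\<^sup>2 + ((a - b)\<^sup>2 + (c - d)\<^sup>2) = 2 * (c\<^sup>2 + a\<^sup>2) + 2 * (d\<^sup>2 + b\<^sup>2)" for a b c d :: real
        by (simp add: power2_eq_square algebra_simps)
      have "(cos (x \<bullet> \<eta>) + cos (x \<bullet> \<xi>))\<^sup>2 + (sin (x \<bullet> \<eta>) + sin (x \<bullet> \<xi>))\<^sup>2 + ((cos (x \<bullet> \<eta>) - cos (x \<bullet> \<xi>))\<^sup>2 + (sin (x \<bullet> \<eta>) - sin (x \<bullet> \<xi>))\<^sup>2)
        = 2 * ((sin (x \<bullet> \<eta>))\<^sup>2 + (cos (x \<bullet> \<eta>))\<^sup>2) + 2 * ((sin (x \<bullet> \<xi>))\<^sup>2 + (cos (x \<bullet> \<xi>))\<^sup>2)"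
        by (rule gen)
      then have "(cos (x \<bullet> \<eta>) + cos (x \<bullet> \<xi>))\<^sup>2 + (sin (x \<bullet> \<eta>) + sin (x \<bullet> \<xi>))\<^sup>2 \<le> 4"
        unfolding sin_cos_squared_add
        using zero_le_power2[of "cos (x \<bullet> \<eta>) - cos (x \<bullet> \<xi>)"] zero_le_power2[of "sin (x \<bullet> \<eta>) - sin (x \<bullet> \<xi>)"] by linarith
      then show "(?sC x)\<^sup>2 + (?sS x)\<^sup>2 \<le> 4 * indicator \<Omega> x" by (cases "x \<in> \<Omega>") simp_all
    qed
    also have "\<dots> = 4 * V" by simp
    finally show "(\<integral>x. (?sC x)\<^sup>2 \<partial>lborel) + (\<integral>x. (?sS x)\<^sup>2 \<partial>lborel) \<le> 4 * V" .
  qed simp_all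
  also have "\<dots> = 2 * V * (sqrt (I / V) * norm (\<eta> - \<xi>))"
  proof -
    have "((norm (\<eta> - \<xi>))\<^sup>2 * I) * (4 * V) = (2 * V * norm (\<eta> - \<xi>))\<^sup>2 * (I / V)"
      using V_pos by (simp add: power2_eq_square)
    then have "sqrt (((norm (\<eta> - \<xi>))\<^sup>2 * I) * (4 * V)) = \<bar>2 * V * norm (\<eta> - \<xi>)\<bar> * sqrt (I / V)"
      by (simp only: real_sqrt_mult real_sqrt_abs)
    then show ?thesis using V_pos by (simp add: abs_mult)
  qed
  finally have "2 * V * \<bar>density \<Omega> U k \<eta> - density \<Omega> U k \<xi>\<bar> \<le> 2 * V * (sqrt (I / V) * norm (\<eta> - \<xi>))"
    using V_pos by (simp add: right_diff_distrib[symmetric] abs_mult)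
  then show ?thesis using V_pos by (subst (asm) mult_le_cancel_left_pos) auto
qed

lemma ft_pow_mass:
  assumes i: "i \<ge> 1"
  shows "(\<integral>\<^sup>+\<xi>. ennreal (ft_pow (U i) \<xi>) \<partial>lborel) = ennreal ((2 * pi) ^ CARD('n))"
proof -
  have "(\<integral>\<^sup>+\<xi>. ennreal (ft_pow (U i) \<xi>) \<partial>lborel) = ennreal ((2 * pi) ^ DIM(real^'n) * (\<integral>x. (U i x)\<^sup>2 \<partial>lborel))"
    by (rule plancherel_limit[OF U_integrable[OF i] U_square[OF i] test_function_facts(4)[OF \<Phi>_test[OF i]]
        test_function_facts(5)[OF \<Phi>_test[OF i]] test_function_facts(1)[OF \<Phi>_test[OF i]]
        test_function_facts(3)[OF \<Phi>_test[OF i]] \<Phi>_lim[OF i]])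
  then show ?thesis using U_orth[OF i i] by (simp add: power2_eq_square)
qed

text \<open>The restricted cosines and sines are square integrable, so convergence in L2 gives
  convergence of the transform at every single frequency.\<close>

lemma ft_pow_limit:
  assumes i: "i \<ge> 1"
  shows "(\<lambda>m. ft_pow (\<Phi> i m) \<xi>) \<longlonglongrightarrow> ft_pow (U i) \<xi>"
proof -
  note t = test_function_facts[OF \<Phi>_test[OF i]]
  have m: "\<Phi> i m \<in> borel_measurable lborel" "U i \<in> borel_measurable lborel" for m
    using t(2) U_measurable[OF i] by simp_all
  have "(\<lambda>m. \<integral>x. C \<xi> x * \<Phi> i m x \<partial>lborel) \<longlonglongrightarrow> (\<integral>x. C \<xi> x * U i x \<partial>lborel)"
    "(\<lambda>m. \<integral>x. S \<xi> x * \<Phi> i m x \<partial>lborel) \<longlonglongrightarrow> (\<integral>x. S \<xi> x * U i x \<partial>lborel)"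
    by (rule L2_limit_mult[OF m(1) t(5) m(2) U_square[OF i] _ _ \<Phi>_lim[OF i]]; rule CS_square_integrable)+
  then have "(\<lambda>m. (\<integral>x. \<Phi> i m x * C \<xi> x \<partial>lborel)\<^sup>2 + (\<integral>x. \<Phi> i m x * S \<xi> x \<partial>lborel)\<^sup>2)
     \<longlonglongrightarrow> (\<integral>x. U i x * C \<xi> x \<partial>lborel)\<^sup>2 + (\<integral>x. U i x * S \<xi> x \<partial>lborel)\<^sup>2"
    by (intro tendsto_intros) (simp_all only: mult.commute)
  moreover have "ft_pow (\<Phi> i m) \<xi> = (\<integral>x. \<Phi> i m x * C \<xi> x \<partial>lborel)\<^sup>2 + (\<integral>x. \<Phi> i m x * S \<xi> x \<partial>lborel)\<^sup>2" for m
    unfolding ft_pow_def using integral_CS[of "\<Phi> i m"] t(6) by simp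
  moreover have "ft_pow (U i) \<xi> = (\<integral>x. U i x * C \<xi> x \<partial>lborel)\<^sup>2 + (\<integral>x. U i x * S \<xi> x \<partial>lborel)\<^sup>2"
    unfolding ft_pow_def using integral_CS[of "U i"] U_outside[OF i] by simp
  ultimately show ?thesis by (simp only:)
qed

lemma \<Lambda>_nonneg: "i \<ge> 1 \<Longrightarrow> 0 \<le> \<Lambda> i"
  by (rule LIMSEQ_le_const[OF \<Phi>_energy]) (auto intro!: exI sum_nonneg)

text \<open>For the approximating test functions the moment is the sum of the squared transforms of
  their derivatives, bounded by the upper half of Plancherel's identity. Fatou's lemma and the
  convergence of the energies carry the bound to the eigenfunction.\<close>

lemma ft_pow_moment:
  assumes i: "i \<ge> 1"
  shows "(\<integral>\<^sup>+\<xi>. ennreal (norm \<xi> ^ (2 * l) * ft_pow (U i) \<xi>) \<partial>lborel) \<le> ennreal ((2 * pi) ^ CARD('n) * \<Lambda> i)"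
proof -
  let ?c = "(2 * pi) ^ CARD('n)"
  let ?E = "\<lambda>m. \<Sum>is | length is = l. \<integral>x. (partials is (\<Phi> i m) x)\<^sup>2 \<partial>lborel"
  have p: "partials is (\<Phi> i m) \<in> test_functions \<Omega>" for "is" m
    by (intro partials_test_function \<Phi>_test i)
  note [measurable] = ft_pow_measurable[OF test_function_facts(4)[OF \<Phi>_test[OF i]]] ft_pow_measurable[OF U_integrable[OF i]]
    ft_pow_measurable[OF test_function_facts(4)[OF p]]
  have "(\<integral>\<^sup>+\<xi>. ennreal (norm \<xi> ^ (2 * l) * ft_pow (U i) \<xi>) \<partial>lborel)
     = (\<integral>\<^sup>+\<xi>. liminf (\<lambda>m. ennreal (norm \<xi> ^ (2 * l) * ft_pow (\<Phi> i m) \<xi>)) \<partial>lborel)"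
    by (intro nn_integral_cong lim_imp_Liminf[symmetric] tendsto_ennrealI tendsto_mult tendsto_const ft_pow_limit i) simp
  also have "\<dots> \<le> liminf (\<lambda>m. \<integral>\<^sup>+\<xi>. ennreal (norm \<xi> ^ (2 * l) * ft_pow (\<Phi> i m) \<xi>) \<partial>lborel)"
    by (rule nn_integral_liminf) measurable
  also have "\<dots> \<le> liminf (\<lambda>m. ennreal (?c * ?E m))"
  proof (intro Liminf_mono always_eventually allI)
    fix m
    have "(\<integral>\<^sup>+\<xi>. ennreal (norm \<xi> ^ (2 * l) * ft_pow (\<Phi> i m) \<xi>) \<partial>lborel)
       = (\<integral>\<^sup>+\<xi>. (\<Sum>is | length is = l. ennreal (ft_pow (partials is (\<Phi> i m)) \<xi>)) \<partial>lborel)"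
      by (simp only: ft_pow_norm_power[OF \<Phi>_test[OF i]] sum_ennreal[OF ft_pow_nonneg])
    also have "\<dots> = (\<Sum>is | length is = l. \<integral>\<^sup>+\<xi>. ennreal (ft_pow (partials is (\<Phi> i m)) \<xi>) \<partial>lborel)"
      by (rule nn_integral_sum) measurable
    also have "\<dots> \<le> (\<Sum>is | length is = l. ennreal (?c * (\<integral>x. (partials is (\<Phi> i m) x)\<^sup>2 \<partial>lborel)))"
    proof (rule sum_mono)
      fix "is" :: "'n list"
      have "(\<integral>\<^sup>+\<xi>. ennreal (ft_pow (partials is (\<Phi> i m)) \<xi>) \<partial>lborel) \<le> ennreal ((2 * pi) ^ DIM(real^'n) * (\<integral>x. (partials is (\<Phi> i m) x)\<^sup>2 \<partial>lborel))"
        by (rule plancherel_le[OF test_function_facts(4)[OF p] test_function_facts(5)[OF p]])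
      then show "(\<integral>\<^sup>+\<xi>. ennreal (ft_pow (partials is (\<Phi> i m)) \<xi>) \<partial>lborel) \<le> ennreal (?c * (\<integral>x. (partials is (\<Phi> i m) x)\<^sup>2 \<partial>lborel))"
        by simp
    qed
    also have "\<dots> = ennreal (?c * ?E m)"
      unfolding sum_distrib_left by (rule sum_ennreal) simp
    finally show "(\<integral>\<^sup>+\<xi>. ennreal (norm \<xi> ^ (2 * l) * ft_pow (\<Phi> i m) \<xi>) \<partial>lborel) \<le> ennreal (?c * ?E m)" .
  qed
  also have "\<dots> = ennreal (?c * \<Lambda> i)"
    by (intro lim_imp_Liminf tendsto_ennrealI tendsto_mult tendsto_const \<Phi>_energy i) simp
  finally show ?thesis .
qed

lemma density_mass: "(\<integral>\<^sup>+\<xi>. ennreal (density \<Omega> U k \<xi>) \<partial>lborel) = ennreal (real k * (2 * pi) ^ CARD('n) / V)"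
proof -
  have m: "ft_pow (U i) \<in> borel_measurable borel" if "i \<in> {1..k}" for i
    using that by (intro ft_pow_measurable U_integrable) simp
  have "(\<integral>\<^sup>+\<xi>. ennreal (density \<Omega> U k \<xi>) \<partial>lborel) = (\<integral>\<^sup>+\<xi>. ennreal (1 / V) * (\<Sum>i=1..k. ennreal (ft_pow (U i) \<xi>)) \<partial>lborel)"
    by (intro nn_integral_cong) (simp add: density_def sum_ennreal ennreal_mult'[symmetric])
  also have "\<dots> = ennreal (1 / V) * (\<Sum>i=1..k. \<integral>\<^sup>+\<xi>. ennreal (ft_pow (U i) \<xi>) \<partial>lborel)"
  proof -
    have m': "(\<lambda>\<xi>. ennreal (ft_pow (U i) \<xi>)) \<in> borel_measurable lborel" if "i \<in> {1..k}" for i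
      using m[OF that] by measurable
    show ?thesis
      by (subst nn_integral_sum[OF m', symmetric], assumption, rule nn_integral_cmult) (intro borel_measurable_sum m')
  qed
  also have "\<dots> = ennreal (1 / V) * (\<Sum>i=1..k. ennreal ((2 * pi) ^ CARD('n)))"
    by (intro arg_cong2[where f="(*)"] refl sum.cong ft_pow_mass) simp
  also have "\<dots> = ennreal (real k * (2 * pi) ^ CARD('n) / V)"
    by (subst sum_ennreal) (simp_all add: ennreal_mult'[symmetric])
  finally show ?thesis .
qed

lemma density_moment:
  "(\<integral>\<^sup>+\<xi>. ennreal (norm \<xi> ^ (2 * l) * density \<Omega> U k \<xi>) \<partial>lborel) \<le> ennreal ((2 * pi) ^ CARD('n) / V * (\<Sum>i=1..k. \<Lambda> i))"
proof -
  have m: "ft_pow (U i) \<in> borel_measurable borel" if "i \<in> {1..k}" for i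
    using that by (intro ft_pow_measurable U_integrable) simp
  have "(\<integral>\<^sup>+\<xi>. ennreal (norm \<xi> ^ (2 * l) * density \<Omega> U k \<xi>) \<partial>lborel)
     = (\<integral>\<^sup>+\<xi>. ennreal (1 / V) * (\<Sum>i=1..k. ennreal (norm \<xi> ^ (2 * l) * ft_pow (U i) \<xi>)) \<partial>lborel)"
    by (intro nn_integral_cong) (simp add: density_def sum_ennreal ennreal_mult'[symmetric] sum_distrib_left sum_divide_distrib)
  also have "\<dots> = ennreal (1 / V) * (\<Sum>i=1..k. \<integral>\<^sup>+\<xi>. ennreal (norm \<xi> ^ (2 * l) * ft_pow (U i) \<xi>) \<partial>lborel)"
  proof -
    have m': "(\<lambda>\<xi>. ennreal (norm \<xi> ^ (2 * l) * ft_pow (U i) \<xi>)) \<in> borel_measurable lborel" if "i \<in> {1..k}" for i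
      using m[OF that] by measurable
    show ?thesis
      by (subst nn_integral_sum[OF m', symmetric], assumption, rule nn_integral_cmult) (intro borel_measurable_sum m')
  qed
  also have "\<dots> \<le> ennreal (1 / V) * (\<Sum>i=1..k. ennreal ((2 * pi) ^ CARD('n) * \<Lambda> i))"
    by (intro mult_left_mono sum_mono ft_pow_moment) auto
  also have "\<dots> = ennreal (1 / V * (\<Sum>i=1..k. (2 * pi) ^ CARD('n) * \<Lambda> i))"
    using \<Lambda>_nonneg by (subst sum_ennreal) (auto simp: ennreal_mult'[symmetric])
  also have "1 / V * (\<Sum>i=1..k. (2 * pi) ^ CARD('n) * \<Lambda> i) = (2 * pi) ^ CARD('n) / V * (\<Sum>i=1..k. \<Lambda> i)"
    by (simp add: sum_distrib_left[symmetric])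
  finally show ?thesis .
qed

end

section \<open>Dimension at least two\<close>

lemma unit_ball_vol_recurrence:
  assumes "0 \<le> x"
  shows "unit_ball_vol (x + 2) = 2 * pi / (x + 2) * unit_ball_vol x"
proof -
  have G: "Gamma ((x + 2) / 2 + 1) = ((x + 2) / 2) * Gamma (x / 2 + 1)"
  proof -
    have e: "(x + 2) / 2 + 1 = (x / 2 + 1) + 1" "(x + 2) / 2 = x / 2 + 1" by (simp_all add: field_simps)
    have "x / 2 + 1 \<notin> \<int>\<^sub>\<le>\<^sub>0" using assms by (auto elim!: nonpos_Ints_cases)
    then show ?thesis unfolding e by (rule Gamma_plus1)
  qed
  have p: "pi powr ((x + 2) / 2) = pi * pi powr (x / 2)"
    by (simp add: add_divide_distrib powr_add)
  have "Gamma (x / 2 + 1) > 0" using assms by (intro Gamma_real_pos) simp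
  then show ?thesis unfolding unit_ball_vol_def G p using assms by (simp add: field_simps)
qed

lemma unit_ball_vol_small:
  "unit_ball_vol 3 = 4 * pi / 3" "unit_ball_vol 4 = pi\<^sup>2 / 2" "unit_ball_vol 2 = pi"
  using unit_ball_vol_recurrence[of 1] unit_ball_vol_recurrence[of 2] unit_ball_vol_recurrence[of 0]
  by (simp_all add: power2_eq_square)

lemma pi_bounds: "157/50 \<le> pi" "pi \<le> 22/7"
  using pi_approx by simp_all

text \<open>From dimension 7 on, the factor 2\<pi>/n of the two-step recurrence is below 1, so
  dimensions 5 and 6 decide.\<close>

lemma unit_ball_vol_le_6: "5 \<le> n \<Longrightarrow> unit_ball_vol (real n) \<le> 6"
proof (induction n rule: less_induct)
  case (less n)
  have p3: "pi * pi * pi \<le> 32"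
  proof -
    have "pi * pi \<le> 22/7 * (22/7)" using pi_bounds by (intro mult_mono) auto
    then have "pi * pi * pi \<le> (22/7 * (22/7)) * (22/7)" using pi_bounds by (intro mult_mono) auto
    then show ?thesis by simp
  qed
  have p2: "pi * pi \<le> 10"
  proof -
    have "pi * pi \<le> 22/7 * (22/7)" using pi_bounds by (intro mult_mono) auto
    then show ?thesis by simp
  qed
  consider "n = 5" | "n = 6" | "7 \<le> n" using less.prems by linarith
  then show ?case
  proof cases
    case 1
    then have "unit_ball_vol (real n) = 2 * pi / 5 * unit_ball_vol 3" using unit_ball_vol_recurrence[of 3] by simp
    then show ?thesis using p2 by (simp add: unit_ball_vol_small)
  next
    case 2
    then have "unit_ball_vol (real n) = 2 * pi / 6 * unit_ball_vol 4" using unit_ball_vol_recurrence[of 4] by simp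
    then show ?thesis using p3 by (simp add: unit_ball_vol_small power2_eq_square)
  next
    case 3
    then have m0: "n = (n - 2) + 2" "5 \<le> n - 2" by simp_all
    then obtain m where m: "n = m + 2" "5 \<le> m" by (rule that)
    have "unit_ball_vol (real n) = 2 * pi / (real m + 2) * unit_ball_vol (real m)"
      using unit_ball_vol_recurrence[of "real m"] m by (simp add: add.commute)
    also have "\<dots> \<le> 1 * unit_ball_vol (real m)"
      using m pi_bounds by (intro mult_right_mono) (auto simp: divide_le_eq)
    also have "\<dots> \<le> 6" using less.IH[of m] m by simp
    finally show ?thesis .
  qed
qed

text \<open>Y stands for R t, where the ball of radius R has the volume of \<Omega>. The left-hand
  side is the bound for D^2 that the moment inequality gives in \<open>D_radius\<close>.\<close>

lemma D_bound_radius: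
  fixes Y \<omega> :: real
  assumes n: "2 \<le> n" and \<omega>: "\<omega> = unit_ball_vol (real n)" and Y: "0 < Y" "(2 * pi) ^ n / \<omega>\<^sup>2 \<le> Y ^ n"
  shows "(real n + 2) / (4 * real n * Y\<^sup>2) \<le> D_bound n"
proof -
  have main: "(real n + 2) / (4 * real n * Y\<^sup>2) \<le> B" if B: "(real n + 2) \<le> 4 * real n * (c * B)" "c \<le> Y\<^sup>2" "0 \<le> B" for B c
  proof -
    have "c * B \<le> Y\<^sup>2 * B" using B by (intro mult_right_mono)
    then have "4 * real n * (c * B) \<le> 4 * real n * (Y\<^sup>2 * B)" by (intro mult_left_mono) auto
    then have "real n + 2 \<le> B * (4 * real n * Y\<^sup>2)" using B(1) by (simp add: mult_ac)
    then show ?thesis using n Y by (simp add: divide_le_eq)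
  qed
  consider "n = 2" | "n = 3" | "n = 4" | "5 \<le> n" using n by linarith
  then show ?thesis
  proof cases
    case 1
    then have "4 \<le> Y\<^sup>2" using Y(2) \<omega> by (simp add: unit_ball_vol_small power_mult_distrib)
    then show ?thesis unfolding 1 by (intro main[of 4, unfolded 1]) (simp_all add: D_bound_def)
  next
    case 2
    have w: "\<omega> = 4 * pi / 3" using 2 \<omega> by (simp add: unit_ball_vol_small)
    have "(2 * pi) ^ 3 / \<omega>\<^sup>2 = 9/2 * pi" unfolding w by (simp add: power2_eq_square power3_eq_cube)
    then have "9/2 * pi \<le> Y ^ 3" using Y(2) 2 by simp
    then have Y3: "(1413/100) \<le> Y ^ 3" using pi_bounds by simp
    \<comment> \<open>A number slightly below 14.13^(2/3), compared through sixth powers of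
      Y.\<close>
    have "(1457/250) \<le> Y\<^sup>2"
    proof (rule ccontr)
      assume "\<not> (1457/250) \<le> Y\<^sup>2"
      then have "(Y\<^sup>2) ^ 3 < (1457/250) ^ 3" by (intro power_strict_mono) auto
      moreover have "((1413/100)::real)\<^sup>2 \<le> (Y ^ 3)\<^sup>2" using Y3 by (intro power_mono) auto
      moreover have "(Y ^ 3)\<^sup>2 = (Y\<^sup>2) ^ 3" by (simp add: power_mult[symmetric] mult.commute)
      ultimately show False by (simp add: power2_eq_square power3_eq_cube)
    qed
    then show ?thesis unfolding 2 by (intro main[of "(1457/250)", unfolded 2]) (simp_all add: D_bound_def)
  next
    case 3
    have w: "\<omega> = pi\<^sup>2 / 2" using 3 \<omega> by (simp add: unit_ball_vol_small)
    have "(2 * pi) ^ 4 / \<omega>\<^sup>2 = 64" unfolding w by (simp add: power2_eq_square power4_eq_xxxx)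
    then have "8\<^sup>2 \<le> (Y\<^sup>2)\<^sup>2" using Y(2) 3 by (simp add: power_mult[symmetric])
    then have "8 \<le> Y\<^sup>2" by (rule power2_le_imp_le) simp
    then show ?thesis unfolding 3 by (intro main[of 8, unfolded 3]) (simp_all add: D_bound_def)
  next
    case 4
    have w: "0 < \<omega>" "\<omega> \<le> 6" unfolding \<omega> using unit_ball_vol_le_6[OF 4] by simp_all
    \<comment> \<open>Otherwise Y^n would be too small already for n = 5, since (6.28/2.96)^5
      exceeds 36, the bound for the square of the volume; larger n only increase this power.\<close>
    have "(74/25) \<le> Y"
    proof (rule ccontr)
      assume "\<not> (74/25) \<le> Y"
      then have "Y ^ n \<le> (74/25) ^ n" using Y by (intro power_mono) auto
      moreover have "(157/25) ^ n / 36 \<le> (2 * pi) ^ n / \<omega>\<^sup>2"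
      proof (rule frac_le)
        show "(157/25) ^ n \<le> (2 * pi) ^ n" using pi_bounds by (intro power_mono) auto
        show "\<omega>\<^sup>2 \<le> 36" using power_mono[of \<omega> 6 2] w by simp
      qed (use w in auto)
      ultimately have "(157/25) ^ n / 36 \<le> ((74/25)::real) ^ n" using Y(2) by linarith
      then have "((157/25) / (74/25)) ^ n \<le> (36::real)" by (simp add: power_divide field_simps)
      moreover have "((157/25) / (74/25)) ^ 5 \<le> ((157/25) / (74/25) :: real) ^ n" using 4 by (intro power_increasing) auto
      ultimately have "((157/25) / (74/25)) ^ 5 \<le> (36::real)" by linarith
      then show False by (simp add: eval_nat_numeral)
    qed
    then have "(35/4) \<le> Y\<^sup>2" using power_mono[of "(74/25)" Y 2] by (simp add: power2_eq_square)
    then show ?thesis using 4 by (intro main[of "(35/4)"]) (simp_all add: D_bound_def)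
  qed
qed

text \<open>The j-th power of D = \<alpha>/(\<rho> t), times \<alpha> \<omega> t^(n+2l), has the
  exponents of the j-th term of the theorem. Here j <= n + 2l keeps the remaining exponent of t a
  natural number.\<close>

lemma powr_term:
  fixes \<omega> \<alpha> \<rho> \<kappa> :: real
  assumes n: "1 \<le> n" and j: "j \<le> n + 2 * l" and pos: "0 < \<omega>" "0 < \<alpha>" "0 < \<rho>" "0 < \<kappa>"
    and t: "t = (\<kappa> / \<omega> / \<alpha>) powr (1 / real n)"
  shows "\<alpha> * \<omega> * t ^ (n + 2 * l) * (\<alpha> / (\<rho> * t)) ^ j =
    \<omega> * \<alpha> powr ((real j * real n - 2 * real l + real j) / real n) / \<rho> ^ j * (\<kappa> / \<omega>) powr ((2 * real l + real n - real j) / real n)"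
proof -
  let ?x = "\<kappa> / \<omega>" and ?b = "(2 * real l + real n - real j) / real n"
  have x: "0 < ?x" using pos by simp
  have t0: "0 < t" unfolding t using x pos by simp
  have "t ^ (n + 2 * l) * (\<alpha> / (\<rho> * t)) ^ j = (\<alpha> ^ j / \<rho> ^ j) * t ^ (n + 2 * l - j)"
    using t0 j by (simp add: power_divide power_mult_distrib power_diff)
  also have "t ^ (n + 2 * l - j) = t powr real (n + 2 * l - j)" using t0 by (simp only: powr_realpow)
  also have "\<dots> = (?x / \<alpha>) powr ?b"
    unfolding t powr_powr using j by (simp add: of_nat_diff add_ac)
  also have "\<dots> = ?x powr ?b / \<alpha> powr ?b" by (rule powr_divide)
  finally have e: "t ^ (n + 2 * l) * (\<alpha> / (\<rho> * t)) ^ j = (\<alpha> ^ j / \<rho> ^ j) * (?x powr ?b / \<alpha> powr ?b)" .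
  have gen: "a * w * ((A / r) * (y / u)) = w * (a * A / u) / r * y" for a w A r y u :: real
    by (simp add: mult_ac)
  have "\<alpha> * \<omega> * (t ^ (n + 2 * l) * (\<alpha> / (\<rho> * t)) ^ j) = \<omega> * (\<alpha> * \<alpha> ^ j / \<alpha> powr ?b) / \<rho> ^ j * ?x powr ?b"
    unfolding e by (rule gen)
  also have "\<alpha> * \<alpha> ^ j / \<alpha> powr ?b = \<alpha> powr ((real j * real n - 2 * real l + real j) / real n)"
  proof -
    have "\<alpha> * \<alpha> ^ j = \<alpha> powr (1 + real j)" using pos by (simp add: powr_add powr_realpow)
    then have "\<alpha> * \<alpha> ^ j / \<alpha> powr ?b = \<alpha> powr (1 + real j - ?b)" using pos by (simp add: powr_diff)
    also have "1 + real j - ?b = (real j * real n - 2 * real l + real j) / real n"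
      using n by (simp add: field_simps)
    finally show ?thesis .
  qed
  finally show ?thesis by (simp only: mult.assoc)
qed

text \<open>The Berezin-Li-Yau term is the power j = 0, the corrections are j = 2, ..., 6. The
  condition 2l + n >= 6 makes \<open>powr_term\<close> applicable to all of them.\<close>

lemma bound_eq:
  fixes \<omega> \<alpha> \<rho> V :: real
  assumes n: "1 \<le> n" and nl: "6 \<le> 2 * l + n" and k: "1 \<le> k"
    and pos: "0 < \<omega>" "0 < V" "0 < \<rho>" and \<alpha>: "\<alpha> = V / (2 * pi) ^ n"
    and t: "t = (real k / \<omega> / \<alpha>) powr (1 / real n)"
  shows "n / (n + 2 * l) * ((2 * pi) ^ (2 * l) / (\<omega> * V) powr (2 * real l / n))
        * k powr ((2 * real l + n) / n)
    + 5 * l / (2 * (2 * real l + n) * \<rho> ^ 2) * \<omega> powr (- (2 * real l - 2) / n)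
        * \<alpha> powr ((2 * real n - 2 * real l + 2) / n) * k powr ((2 * real l + n - 2) / n)
    - 31 * l * \<omega> * \<alpha> powr ((3 * real n - 2 * real l + 3) / n) / (9 * (2 * real l + n) * \<rho> ^ 3)
        * (k / \<omega>) powr ((2 * real l + n - 3) / n)
    + 5 * l * \<omega> * \<alpha> powr ((4 * real n - 2 * real l + 4) / n) / (8 * (2 * real l + n) * \<rho> ^ 4)
        * (k / \<omega>) powr ((2 * real l + n - 4) / n)
    + 38 * l * \<omega> * \<alpha> powr ((5 * real n - 2 * real l + 5) / n) / (25 * (2 * real l + n) * \<rho> ^ 5)
        * (k / \<omega>) powr ((2 * real l + n - 5) / n)
    - 317 * l * \<omega> * \<alpha> powr ((6 * real n - 2 * real l + 6) / n) / (420 * (2 * real l + n) * \<rho> ^ 6)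
        * (k / \<omega>) powr ((2 * real l + n - 6) / n)
   = \<alpha> * (\<omega> * t ^ (n + 2 * l) * ((real n + real l * q_poly (\<alpha> / (\<rho> * t))) / (real n + 2 * real l)))"
    (is "?A0 + ?A2 - ?A3 + ?A4 + ?A5 - ?A6 = _")
proof -
  have \<alpha>0: "0 < \<alpha>" unfolding \<alpha> using pos by simp
  have k0: "0 < real k" using k by simp
  define T where "T = (\<lambda>j. \<alpha> * \<omega> * t ^ (n + 2 * l) * (\<alpha> / (\<rho> * t)) ^ j)"
  have T: "T j = \<omega> * \<alpha> powr ((real j * real n - 2 * real l + real j) / real n) / \<rho> ^ j * (real k / \<omega>) powr ((2 * real l + real n - real j) / real n)"
    if "j \<le> 6" for j
    unfolding T_def using that nl by (intro powr_term n pos \<alpha>0 k0 t) simp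
  define P where "P = 2 * real l + real n"
  have P: "0 < P" "real n + 2 * real l = P" using n by (auto simp: P_def)
  have A0: "?A0 = real n / P * T 0"
  proof -
    let ?e = "2 * real l / real n"
    have e1: "(2 * real l + real n) / real n = 1 + ?e" using n by (simp add: add_divide_distrib)
    have "T 0 = \<omega> * \<alpha> powr (- ?e) * (real k / \<omega>) powr (1 + ?e)"
    proof -
      have "T 0 = \<omega> * \<alpha> powr ((real 0 * real n - 2 * real l + real 0) / real n) / \<rho> ^ 0 * (real k / \<omega>) powr ((2 * real l + real n - real 0) / real n)"
        by (rule T) simp
      also have "(real 0 * real n - 2 * real l + real 0) / real n = - ?e" by simp
      also have "(2 * real l + real n - real 0) / real n = 1 + ?e" using e1 by simp
      finally show ?thesis by (simp only: power_0 div_by_1)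
    qed
    also have "(real k / \<omega>) powr (1 + ?e) = real k powr (1 + ?e) / \<omega> powr (1 + ?e)"
      by (rule powr_divide)
    also have "\<alpha> powr (- ?e) = (2 * pi) ^ (2 * l) / V powr ?e"
    proof -
      have "\<alpha> powr (- ?e) = 1 / \<alpha> powr ?e" by (simp add: powr_minus_divide)
      also have "\<alpha> powr ?e = V powr ?e / ((2 * pi) ^ n) powr ?e" unfolding \<alpha> by (rule powr_divide)
      also have "((2 * pi) ^ n) powr ?e = (2 * pi) powr (real n * ?e)"
      proof -
        have "(2 * pi) ^ n = (2 * pi) powr real n" by (rule powr_realpow[symmetric]) simp
        then show ?thesis by (simp only: powr_powr)
      qed
      also have "real n * ?e = real (2 * l)" using n by simp
      also have "(2 * pi) powr real (2 * l) = (2 * pi) ^ (2 * l)" by (rule powr_realpow) simp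
      finally show ?thesis by simp
    qed
    also have "\<omega> * ((2 * pi) ^ (2 * l) / V powr ?e) * (real k powr (1 + ?e) / \<omega> powr (1 + ?e))
      = (2 * pi) ^ (2 * l) / (\<omega> * V) powr ?e * real k powr (1 + ?e)"
    proof -
      have "(\<omega> * V) powr ?e = \<omega> powr ?e * V powr ?e" by (rule powr_mult)
      moreover have "\<omega> powr (1 + ?e) = \<omega> * \<omega> powr ?e" using pos by (simp only: powr_add powr_one less_imp_le)
      moreover have "w * (a / v) * (x / (w * u)) = a / (u * v) * x" if "w \<noteq> 0" for w a v x u :: real
        using that by simp
      moreover have "\<omega> \<noteq> 0" using pos by simp
      ultimately show ?thesis by (simp only:)
    qed
    finally have T0: "T 0 = (2 * pi) ^ (2 * l) / (\<omega> * V) powr ?e * real k powr (1 + ?e)" .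
    show ?thesis unfolding e1 T0 P_def by (simp only: add.commute mult.assoc of_nat_add of_nat_mult of_nat_numeral)
  qed
  have A2: "?A2 = real l / P * (5/2 * T 2)"
  proof -
    let ?b = "(2 * real l + real n - 2) / real n"
    have "\<omega> / \<omega> powr ?b = \<omega> powr (1 - ?b)" using pos by (simp add: powr_diff)
    also have "1 - ?b = - (2 * real l - 2) / real n" using n by (simp add: field_simps)
    finally have w: "\<omega> powr (- (2 * real l - 2) / real n) = \<omega> / \<omega> powr ?b" by simp
    have T2: "T 2 = \<omega> * \<alpha> powr ((2 * real n - 2 * real l + 2) / real n) / \<rho> ^ 2 * (real k powr ?b / \<omega> powr ?b)"
      using T[of 2] unfolding powr_divide by simp
    have gen: "5 * l' / (2 * P' * r) * (w / u) * a * x = l' / P' * (5/2 * (w * a / r * (x / u)))" for l' P' r w u a x :: real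
      by simp
    show ?thesis unfolding w T2 P_def by (rule gen)
  qed
  have T3: "T 3 = \<omega> * \<alpha> powr ((3 * real n - 2 * real l + 3) / real n) / \<rho> ^ 3 * (real k / \<omega>) powr ((2 * real l + real n - 3) / real n)"
    and T4: "T 4 = \<omega> * \<alpha> powr ((4 * real n - 2 * real l + 4) / real n) / \<rho> ^ 4 * (real k / \<omega>) powr ((2 * real l + real n - 4) / real n)"
    and T5: "T 5 = \<omega> * \<alpha> powr ((5 * real n - 2 * real l + 5) / real n) / \<rho> ^ 5 * (real k / \<omega>) powr ((2 * real l + real n - 5) / real n)"
    and T6: "T 6 = \<omega> * \<alpha> powr ((6 * real n - 2 * real l + 6) / real n) / \<rho> ^ 6 * (real k / \<omega>) powr ((2 * real l + real n - 6) / real n)"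
    using T[of 3] T[of 4] T[of 5] T[of 6] by simp_all
  have A3: "?A3 = real l / P * (31/9 * T 3)"
  proof -
    have gen: "31 * l' * w * a / (9 * P' * r) * x = l' / P' * (31/9 * (w * a / r * x))" for l' P' r w a x :: real
      by simp
    show ?thesis unfolding T3 P_def by (rule gen)
  qed
  have A4: "?A4 = real l / P * (5/8 * T 4)"
  proof -
    have gen: "5 * l' * w * a / (8 * P' * r) * x = l' / P' * (5/8 * (w * a / r * x))" for l' P' r w a x :: real
      by simp
    show ?thesis unfolding T4 P_def by (rule gen)
  qed
  have A5: "?A5 = real l / P * (38/25 * T 5)"
  proof -
    have gen: "38 * l' * w * a / (25 * P' * r) * x = l' / P' * (38/25 * (w * a / r * x))" for l' P' r w a x :: real
      by simp
    show ?thesis unfolding T5 P_def by (rule gen)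
  qed
  have A6: "?A6 = real l / P * (317/420 * T 6)"
  proof -
    have gen: "317 * l' * w * a / (420 * P' * r) * x = l' / P' * (317/420 * (w * a / r * x))" for l' P' r w a x :: real
      by simp
    show ?thesis unfolding T6 P_def by (rule gen)
  qed
  define c where "c = \<alpha> * \<omega> * t ^ (n + 2 * l)"
  define x where "x = \<alpha> / (\<rho> * t)"
  have "\<alpha> * (\<omega> * t ^ (n + 2 * l) * ((real n + real l * q_poly x) / P)) = c * ((real n + real l * q_poly x) / P)"
    by (simp add: c_def)
  also have "\<dots> = real n / P * (c * x ^ 0) + real l / P * (5/2 * (c * x ^ 2)) - real l / P * (31/9 * (c * x ^ 3))
    + real l / P * (5/8 * (c * x ^ 4)) + real l / P * (38/25 * (c * x ^ 5)) - real l / P * (317/420 * (c * x ^ 6))"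
  proof -
    have gen: "c * ((m + l' * (5/2 * a - 31/9 * b + 5/8 * d + 38/25 * e - 317/420 * f)) / P')
      = m / P' * (c * 1) + l' / P' * (5/2 * (c * a)) - l' / P' * (31/9 * (c * b)) + l' / P' * (5/8 * (c * d))
        + l' / P' * (38/25 * (c * e)) - l' / P' * (317/420 * (c * f))" for m l' P' a b d e f :: real
      by (simp add: add_divide_distrib diff_divide_distrib ring_distribs mult_ac)
    show ?thesis unfolding q_poly_def power_0 by (rule gen)
  qed
  also have "\<dots> = ?A0 + ?A2 - ?A3 + ?A4 + ?A5 - ?A6"
    unfolding A0 A2 A3 A4 A5 A6 T_def c_def x_def ..
  finally show ?thesis unfolding P(2) x_def ..
qed

context spectral_family
begin

text \<open>D is 1/(2Lt) with L = (I/V)^(1/2), so D^2 = V/(4 I t^2). If the ball of radius R has the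
  volume of \<Omega>, then I is at least n/(n+2) R^2 V; the witness is Y = R t.\<close>

lemma D_radius:
  fixes t \<alpha> \<rho> \<omega> :: real
  assumes k: "1 \<le> k" and \<omega>: "\<omega> = measure lborel (ball (0::real^'n) 1)"
    and \<alpha>: "\<alpha> = V / (2 * pi) ^ CARD('n)" and \<rho>: "\<rho> = 2 / (2 * pi) ^ CARD('n) * sqrt (V * I)"
    and t: "t = (real k / \<omega> / \<alpha>) powr (1 / real CARD('n))"
  obtains Y where "0 < \<omega>" "0 < t" "0 < sqrt (I / V)" "t ^ CARD('n) = real k / \<omega> / \<alpha>"
    "\<alpha> / (\<rho> * t) = 1 / (2 * sqrt (I / V) * t)"
    "0 < Y" "Y ^ CARD('n) = real k * ((2 * pi) ^ CARD('n) / \<omega>\<^sup>2)"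
    "(\<alpha> / (\<rho> * t))\<^sup>2 \<le> (real CARD('n) + 2) / (4 * real CARD('n) * Y\<^sup>2)"
proof -
  let ?n = "CARD('n)" and ?c = "(2 * pi) ^ CARD('n)"
  have \<omega>v: "\<omega> = unit_ball_vol (real ?n)" using content_ball[of 1 "0::real^'n"] by (simp add: \<omega>)
  have \<omega>0: "0 < \<omega>" by (simp add: \<omega>v)
  have \<alpha>0: "0 < \<alpha>" using V_pos by (simp add: \<alpha>)
  have x0: "0 < real k / \<omega> / \<alpha>" using k \<omega>0 \<alpha>0 by simp
  have t0: "0 < t" unfolding t powr_gt_zero by (rule less_imp_neq[OF x0, symmetric])
  have tn: "t ^ ?n = real k / \<omega> / \<alpha>"
  proof -
    have "t ^ ?n = t powr real ?n" using t0 by (simp only: powr_realpow)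
    also have "\<dots> = (real k / \<omega> / \<alpha>) powr 1" unfolding t powr_powr by simp
    also have "\<dots> = real k / \<omega> / \<alpha>" by (rule powr_one[OF less_imp_le[OF x0]])
    finally show ?thesis .
  qed
  define R where "R = (V / \<omega>) powr (1 / real ?n)"
  have Vw: "0 < V / \<omega>" using V_pos \<omega>0 by simp
  have R0: "0 < R" unfolding R_def powr_gt_zero by (rule less_imp_neq[OF Vw, symmetric])
  have Rn: "R ^ ?n = V / \<omega>"
  proof -
    have "R ^ ?n = R powr real ?n" using R0 by (simp only: powr_realpow)
    also have "\<dots> = (V / \<omega>) powr 1" unfolding R_def powr_powr by simp
    also have "\<dots> = V / \<omega>" by (rule powr_one[OF less_imp_le[OF Vw]])
    finally show ?thesis .
  qed
  have I_ge: "real ?n / (real ?n + 2) * R\<^sup>2 * V \<le> I"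
    using second_moment_ge[OF \<Omega>_borel \<Omega>_finite norm_square_integrable R0] \<omega>0 Rn by (simp add: \<omega>)
  have I0: "0 < I"
    by (rule less_le_trans[OF _ I_ge]) (use R0 V_pos in simp)
  let ?L = "sqrt (I / V)"
  let ?D = "1 / (2 * ?L * t)"
  have L0: "0 < ?L" using I0 V_pos by simp
  have D: "\<alpha> / (\<rho> * t) = ?D"
  proof -
    have "sqrt (V * I) = V * ?L"
    proof -
      have "V * I = V\<^sup>2 * (I / V)" using V_pos by (simp add: power2_eq_square)
      then show ?thesis using V_pos by (simp only: real_sqrt_mult real_sqrt_abs abs_of_pos)
    qed
    then show ?thesis unfolding \<alpha> \<rho> using V_pos L0 t0 by (simp add: field_simps)
  qed
  have "?D\<^sup>2 = V / (4 * I * t\<^sup>2)" using V_pos I0 by (simp add: power_divide power_mult_distrib)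
  also have "\<dots> \<le> V / (4 * (real ?n / (real ?n + 2) * R\<^sup>2 * V) * t\<^sup>2)"
    using I_ge I0 V_pos R0 t0 by (intro divide_left_mono mult_right_mono mult_left_mono mult_pos_pos divide_pos_pos) auto
  also have "\<dots> = (real ?n + 2) / (4 * real ?n * (R * t)\<^sup>2)"
    using V_pos by (simp add: power_mult_distrib)
  finally have D2: "(\<alpha> / (\<rho> * t))\<^sup>2 \<le> (real ?n + 2) / (4 * real ?n * (R * t)\<^sup>2)" unfolding D .
  have "0 < R * t" using R0 t0 by simp
  moreover have "(R * t) ^ ?n = real k * (?c / \<omega>\<^sup>2)"
    unfolding power_mult_distrib Rn tn \<alpha> using V_pos \<omega>0 by (simp add: power2_eq_square)
  ultimately show ?thesis by (rule that[OF \<omega>0 t0 L0 tn D _ _ D2])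
qed

lemma eigenvalue_sum_ge_dim2:
  fixes t \<alpha> \<rho> \<omega> :: real
  assumes n2: "2 \<le> CARD('n)" and l: "1 \<le> l" and nl: "6 \<le> 2 * l + CARD('n)" and k: "1 \<le> k"
    and \<omega>: "\<omega> = measure lborel (ball (0::real^'n) 1)"
    and \<alpha>: "\<alpha> = V / (2 * pi) ^ CARD('n)" and \<rho>: "\<rho> = 2 / (2 * pi) ^ CARD('n) * sqrt (V * I)"
    and t: "t = (real k / \<omega> / \<alpha>) powr (1 / real CARD('n))"
  shows "\<alpha> * (\<omega> * t ^ (CARD('n) + 2 * l) * ((real CARD('n) + real l * q_poly (\<alpha> / (\<rho> * t))) / (real CARD('n) + 2 * real l)))
    \<le> (\<Sum>i=1..k. \<Lambda> i)"
proof -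
  let ?n = "CARD('n)" and ?c = "(2 * pi) ^ CARD('n)"
  let ?L = "sqrt (I / V)"
  let ?D = "1 / (2 * ?L * t)"
  have \<omega>v: "\<omega> = unit_ball_vol (real ?n)" using content_ball[of 1 "0::real^'n"] by (simp add: \<omega>)
  have \<alpha>0: "0 < \<alpha>" using V_pos by (simp add: \<alpha>)
  obtain Y where \<omega>0: "0 < \<omega>" and t0: "0 < t" and L0: "0 < ?L" and tn: "t ^ ?n = real k / \<omega> / \<alpha>"
    and D: "\<alpha> / (\<rho> * t) = ?D" and Y: "0 < Y" "Y ^ ?n = real k * (?c / \<omega>\<^sup>2)"
    and D2: "(\<alpha> / (\<rho> * t))\<^sup>2 \<le> (real ?n + 2) / (4 * real ?n * Y\<^sup>2)"
    by (rule D_radius[OF k \<omega> \<alpha> \<rho> t])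
  \<comment> \<open>Y^n is proportional to k, so k = 1 is the worst case.\<close>
  have Db: "?D\<^sup>2 \<le> D_bound ?n"
  proof -
    have "?c / \<omega>\<^sup>2 \<le> Y ^ ?n" unfolding Y(2) using k mult_right_mono[of 1 "real k" "?c / \<omega>\<^sup>2"] by simp
    then have "(real ?n + 2) / (4 * real ?n * Y\<^sup>2) \<le> D_bound ?n" by (rule D_bound_radius[OF n2 \<omega>v Y(1)])
    then show ?thesis using D2 unfolding D by (rule order_trans[rotated])
  qed
  have M: "\<omega> * t ^ (?n + 2 * l) * ((real ?n + real l * q_poly ?D) / (real ?n + 2 * real l)) \<le> ?c / V * (\<Sum>i=1..k. \<Lambda> i)"
  proof (rule moment_ge[where 'a="real^'n", unfolded DIM_cart DIM_real mult_1_right, folded \<omega>, OF n2 l nl t0 L0, of "density \<Omega> U k" ?D])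
    show "?D\<^sup>2 \<le> D_bound ?n" by (rule Db)
    have "\<omega> * t ^ ?n = real k * ?c / V" unfolding tn \<alpha> using \<omega>0 by simp
    then show "(\<integral>\<^sup>+x. ennreal (density \<Omega> U k x) \<partial>lborel) = ennreal (\<omega> * t ^ ?n)"
      by (simp only: density_mass)
    show "(\<integral>\<^sup>+x. ennreal (norm x ^ (2 * l) * density \<Omega> U k x) \<partial>lborel) \<le> ennreal (?c / V * (\<Sum>i=1..k. \<Lambda> i))"
      by (rule density_moment)
    show "0 \<le> ?c / V * (\<Sum>i=1..k. \<Lambda> i)"
      using V_pos \<Lambda>_nonneg by (intro mult_nonneg_nonneg sum_nonneg) auto
  qed (rule density_bounds density_lipschitz density_measurable refl)+
  have "\<alpha> * (\<omega> * t ^ (?n + 2 * l) * ((real ?n + real l * q_poly ?D) / (real ?n + 2 * real l))) \<le> \<alpha> * (?c / V * (\<Sum>i=1..k. \<Lambda> i))"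
    using M \<alpha>0 by (intro mult_left_mono) auto
  also have "\<dots> = (\<Sum>i=1..k. \<Lambda> i)" using V_pos by (simp add: \<alpha>)
  finally show ?thesis unfolding D .
qed

end

section \<open>Dimension one\<close>

text \<open>The index type remains abstract, so the one-dimensional space is recognised by its
  one-element basis and identified with the real line along the basis vector.\<close>

lemma lborel_line:
  fixes e :: "'a::euclidean_space"
  assumes "Basis = {e}"
  shows "(lborel :: 'a measure) = distr lborel borel (\<lambda>s. s *\<^sub>R e)"
proof (rule lborel_eqI)
  fix l u :: 'a
  assume "\<And>b. b \<in> Basis \<Longrightarrow> l \<bullet> b \<le> u \<bullet> b"
  from this[of e] have le: "l \<bullet> e \<le> u \<bullet> e" by (simp add: assms)
  have ee: "e \<bullet> e = 1" by (rule inner_same_Basis) (simp add: assms)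
  have "(\<lambda>s. s *\<^sub>R e) -` box l u = {l \<bullet> e<..<u \<bullet> e}" by (auto simp: box_def assms ee)
  then show "emeasure (distr lborel borel (\<lambda>s. s *\<^sub>R e)) (box l u) = (\<Prod>b\<in>Basis. (u - l) \<bullet> b)"
    using le by (simp add: assms emeasure_distr inner_diff_left)
qed simp

lemma line_integral:
  fixes e :: "'a::euclidean_space" and F :: "real \<Rightarrow> real"
  assumes e: "Basis = {e}" and [measurable]: "F \<in> borel_measurable borel" and i: "has_bochner_integral lborel F y"
  shows "has_bochner_integral (lborel :: 'a measure) (\<lambda>x. F (x \<bullet> e)) y"
proof -
  have ee: "e \<bullet> e = 1" by (rule inner_same_Basis) (simp add: e)
  have "integrable (lborel :: 'a measure) (\<lambda>x. F (x \<bullet> e))"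
    using i by (subst lborel_line[OF e], subst integrable_distr_eq) (auto simp: ee has_bochner_integral_iff)
  moreover have "(\<integral>x. F (x \<bullet> e) \<partial>(lborel :: 'a measure)) = y"
    using i by (subst lborel_line[OF e], subst integral_distr) (auto simp: ee has_bochner_integral_iff)
  ultimately show ?thesis by (simp add: has_bochner_integral_iff)
qed

lemma trig_interval_integral:
  fixes a b :: real and m :: int
  assumes ab: "a < b"
  shows "has_bochner_integral lborel (\<lambda>s. indicator {a..b} s * cos (s * (2 * pi * m / (b - a)))) (if m = 0 then b - a else 0)"
    and "has_bochner_integral lborel (\<lambda>s. indicator {a..b} s * sin (s * (2 * pi * m / (b - a)))) 0"
proof -
  let ?r = "2 * pi * m / (b - a)"
  have per: "b * ?r = a * ?r + 2 * pi * of_int m" using ab by (simp add: field_simps)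
  have sc: "sin (b * ?r) = sin (a * ?r)" "cos (b * ?r) = cos (a * ?r)"
    unfolding per sin_add cos_add by (simp_all add: sin_int_2pin cos_int_2pin)
  have "continuous_on {a..b} (\<lambda>s. cos (s * ?r))" "continuous_on {a..b} (\<lambda>s. sin (s * ?r))"
    by (intro continuous_on_cos continuous_on_sin continuous_on_mult_right continuous_on_id)+
  from this[THEN borel_integrable_atLeastAtMost']
  have i: "integrable lborel (\<lambda>s. indicator {a..b} s * cos (s * ?r))" "integrable lborel (\<lambda>s. indicator {a..b} s * sin (s * ?r))"
    by (simp_all only: set_integrable_def real_scaleR_def)
  have "(\<integral>s. indicator {a..b} s * cos (s * ?r) \<partial>lborel) = (if m = 0 then b - a else 0)
      \<and> (\<integral>s. indicator {a..b} s * sin (s * ?r) \<partial>lborel) = 0"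
  proof (cases "m = 0")
    case True
    then show ?thesis using ab by simp
  next
    case False
    then have r: "?r \<noteq> 0" using ab by simp
    have "(\<integral>s. cos (s * ?r) * indicator {a..b} s \<partial>lborel) = sin (b * ?r) / ?r - sin (a * ?r) / ?r"
    proof (rule integral_FTC_Icc_real)
      show "((\<lambda>s. sin (s * ?r) / ?r) has_real_derivative cos (s * ?r)) (at s)" for s
        by (rule derivative_eq_intros refl | use r in simp)+
    qed (use ab in auto)
    moreover have "(\<integral>s. sin (s * ?r) * indicator {a..b} s \<partial>lborel) = - cos (b * ?r) / ?r - - cos (a * ?r) / ?r"
    proof (rule integral_FTC_Icc_real)
      show "((\<lambda>s. - cos (s * ?r) / ?r) has_real_derivative sin (s * ?r)) (at s)" for s
        by (rule derivative_eq_intros refl | use r in simp)+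
    qed (use ab in auto)
    ultimately show ?thesis using False unfolding sc by (simp add: mult.commute)
  qed
  then show "has_bochner_integral lborel (\<lambda>s. indicator {a..b} s * cos (s * ?r)) (if m = 0 then b - a else 0)"
    "has_bochner_integral lborel (\<lambda>s. indicator {a..b} s * sin (s * ?r)) 0"
    using i unfolding has_bochner_integral_iff by (simp_all only: simp_thms)
qed

text \<open>Bessel's inequality for exponentials with frequencies in a translated lattice, written with
  \<open>P + \<i> Q = \<Sum> (c - \<i> s) e\<^sup>i\<^sup>\<xi>\<^sup>x\<close>. Cosines and sines alone are not orthogonal for a general translation.\<close>

lemma bessel_exponentials:
  fixes f :: "'a::euclidean_space \<Rightarrow> real" and e :: 'a and M :: "int set"
  assumes e: "Basis = {e}" and ab: "a < b"
    and f [measurable]: "f \<in> borel_measurable borel" and f2: "integrable lborel (\<lambda>x. (f x)\<^sup>2)"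
    and f0: "\<And>x. x \<bullet> e \<notin> {a..b} \<Longrightarrow> f x = 0" and M: "finite M"
  shows "(\<Sum>m\<in>M. ft_pow f ((\<theta> + 2 * pi * m / (b - a)) *\<^sub>R e)) \<le> (b - a) * (\<integral>x. (f x)\<^sup>2 \<partial>lborel)"
proof -
  define \<xi> where "\<xi> = (\<lambda>m::int. \<theta> + 2 * pi * m / (b - a))"
  let ?J = "\<lambda>s. indicator {a..b} s :: real"
  define C where "C = (\<lambda>m s. ?J s * cos (s * \<xi> m))"
  define S where "S = (\<lambda>m s. ?J s * sin (s * \<xi> m))"
  have [measurable]: "C m \<in> borel_measurable borel" "S m \<in> borel_measurable borel" for m
    unfolding C_def S_def by measurable
  have sq: "integrable lborel (\<lambda>x::'a. (C m (x \<bullet> e))\<^sup>2)" "integrable lborel (\<lambda>x::'a. (S m (x \<bullet> e))\<^sup>2)" for m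
  proof -
    have "continuous_on {a..b} (\<lambda>s. (cos (s * \<xi> m))\<^sup>2)" "continuous_on {a..b} (\<lambda>s. (sin (s * \<xi> m))\<^sup>2)"
      by (intro continuous_intros)+
    from this[THEN borel_integrable_atLeastAtMost']
    have "integrable lborel (\<lambda>s. ?J s * (cos (s * \<xi> m))\<^sup>2)" "integrable lborel (\<lambda>s. ?J s * (sin (s * \<xi> m))\<^sup>2)"
      by (simp_all add: set_integrable_def)
    moreover have "(\<lambda>s. ?J s * (cos (s * \<xi> m))\<^sup>2) = (\<lambda>s. (C m s)\<^sup>2)" "(\<lambda>s. ?J s * (sin (s * \<xi> m))\<^sup>2) = (\<lambda>s. (S m s)\<^sup>2)"
      by (auto simp: C_def S_def fun_eq_iff indicator_def)
    ultimately have "integrable lborel (\<lambda>s. (C m s)\<^sup>2)" "integrable lborel (\<lambda>s. (S m s)\<^sup>2)" by simp_all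
    then show "integrable lborel (\<lambda>x::'a. (C m (x \<bullet> e))\<^sup>2)" "integrable lborel (\<lambda>x::'a. (S m (x \<bullet> e))\<^sup>2)"
      by (auto dest!: has_bochner_integral_integrable intro!: integrable.intros line_integral[OF e])
  qed
  define c where "c = (\<lambda>m. \<integral>x. f x * C m (x \<bullet> e) \<partial>lborel)"
  define s where "s = (\<lambda>m. \<integral>x. f x * S m (x \<bullet> e) \<partial>lborel)"
  define A where "A = (\<Sum>m\<in>M. (c m)\<^sup>2 + (s m)\<^sup>2)"
  have ft: "ft_pow f (\<xi> m *\<^sub>R e) = (c m)\<^sup>2 + (s m)\<^sup>2" for m
  proof -
    have "f x * cos (x \<bullet> (\<xi> m *\<^sub>R e)) = f x * C m (x \<bullet> e)" "f x * sin (x \<bullet> (\<xi> m *\<^sub>R e)) = f x * S m (x \<bullet> e)" for x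
      using f0[of x] by (auto simp: C_def S_def indicator_def mult.commute)
    then show ?thesis unfolding ft_pow_def c_def s_def by (simp only:)
  qed
  define P where "P = (\<lambda>x. \<Sum>m\<in>M. c m * C m x + s m * S m x)"
  define Q where "Q = (\<lambda>x. \<Sum>m\<in>M. c m * S m x - s m * C m x)"
  have h1: "has_bochner_integral lborel (\<lambda>x. f x * P (x \<bullet> e)) A"
  proof -
    have "integrable lborel (\<lambda>x. f x * C m (x \<bullet> e))" "integrable lborel (\<lambda>x. f x * S m (x \<bullet> e))" for m
      by (rule square_integrable_mult; simp add: f2 sq)+
    then have "has_bochner_integral lborel (\<lambda>x. f x * C m (x \<bullet> e)) (c m)" "has_bochner_integral lborel (\<lambda>x. f x * S m (x \<bullet> e)) (s m)" for m
      by (simp_all add: has_bochner_integral_iff c_def s_def)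
    then have "has_bochner_integral lborel (\<lambda>x. \<Sum>m\<in>M. c m * (f x * C m (x \<bullet> e)) + s m * (f x * S m (x \<bullet> e))) (\<Sum>m\<in>M. c m * c m + s m * s m)"
      by (intro has_bochner_integral_sum has_bochner_integral_add has_bochner_integral_mult_right)
    then show ?thesis unfolding A_def P_def by (simp add: sum_distrib_left power2_eq_square algebra_simps)
  qed
  have h2: "has_bochner_integral (lborel :: 'a measure) (\<lambda>x. (P (x \<bullet> e))\<^sup>2 + (Q (x \<bullet> e))\<^sup>2) ((b - a) * A)"
  proof -
    let ?K = "\<lambda>m x. ?J x * cos (x * (2 * pi * real_of_int m / (b - a)))" and ?L = "\<lambda>m x. ?J x * sin (x * (2 * pi * real_of_int m / (b - a)))"
    let ?R = "\<lambda>m m' x. (c m * c m' + s m * s m') * ?K (m - m') x + (s m * c m' - c m * s m') * ?L (m - m') x"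
    \<comment> \<open>The real part of the product of one exponential sum term with the conjugate of
      another depends on the difference of frequencies only. The translation \<theta> cancels, and a
      multiple of 2\<pi>/(b - a) remains, whose integral over the interval is known.\<close>
    have pq: "(c m * C m x + s m * S m x) * (c m' * C m' x + s m' * S m' x) + (c m * S m x - s m * C m x) * (c m' * S m' x - s m' * C m' x)
       = ?R m m' x" for m m' x
    proof -
      have d: "x * (2 * pi * real_of_int (m - m') / (b - a)) = x * \<xi> m - x * \<xi> m'"
        by (simp add: \<xi>_def algebra_simps diff_divide_distrib)
      show ?thesis unfolding d cos_diff sin_diff C_def S_def by (cases "x \<in> {a..b}") (simp_all add: algebra_simps)
    qed
    have "(P x)\<^sup>2 + (Q x)\<^sup>2 = (\<Sum>m\<in>M. \<Sum>m'\<in>M. ?R m m' x)" for x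
      unfolding pq[symmetric] P_def Q_def power2_eq_square sum_product sum.distrib[symmetric] ..
    moreover have "has_bochner_integral lborel (\<lambda>x. \<Sum>m\<in>M. \<Sum>m'\<in>M. ?R m m' x)
      (\<Sum>m\<in>M. \<Sum>m'\<in>M. (c m * c m' + s m * s m') * (if m - m' = 0 then b - a else 0) + (s m * c m' - c m * s m') * 0)"
      by (intro has_bochner_integral_sum has_bochner_integral_add has_bochner_integral_mult_right trig_interval_integral[OF ab])
    moreover have "(\<Sum>m\<in>M. \<Sum>m'\<in>M. (c m * c m' + s m * s m') * (if m - m' = 0 then b - a else 0) + (s m * c m' - c m * s m') * 0) = (b - a) * A"
      unfolding A_def sum_distrib_left
    proof (intro sum.cong refl)
      fix m assume m: "m \<in> M"
      have "(\<Sum>m'\<in>M. (c m * c m' + s m * s m') * (if m - m' = 0 then b - a else 0) + (s m * c m' - c m * s m') * 0)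
        = (\<Sum>m'\<in>M. if m = m' then (b - a) * ((c m)\<^sup>2 + (s m)\<^sup>2) else 0)"
        by (intro sum.cong refl) (auto simp: power2_eq_square)
      then show "(\<Sum>m'\<in>M. (c m * c m' + s m * s m') * (if m - m' = 0 then b - a else 0) + (s m * c m' - c m * s m') * 0)
        = (b - a) * ((c m)\<^sup>2 + (s m)\<^sup>2)"
        using M m by simp
    qed
    ultimately have h: "has_bochner_integral lborel (\<lambda>x. (P x)\<^sup>2 + (Q x)\<^sup>2) ((b - a) * A)" by simp
    show ?thesis
    proof (rule line_integral[OF e _ h])
      show "(\<lambda>x. (P x)\<^sup>2 + (Q x)\<^sup>2) \<in> borel_measurable borel" unfolding P_def Q_def by measurable
    qed
  qed
  have h0: "has_bochner_integral lborel (\<lambda>x. (f x)\<^sup>2) (\<integral>x. (f x)\<^sup>2 \<partial>lborel)" by (rule has_bochner_integral_integrable[OF f2])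
  \<comment> \<open>This integrand is ((b - a) f - P)^2 + Q^2, the squared distance of (b - a) f
    from P + iQ; its nonnegative integral is Bessel's inequality.\<close>
  have "has_bochner_integral lborel (\<lambda>x. ((b - a)\<^sup>2 * (f x)\<^sup>2 + (- 2 * (b - a)) * (f x * P (x \<bullet> e))) + ((P (x \<bullet> e))\<^sup>2 + (Q (x \<bullet> e))\<^sup>2))
    (((b - a)\<^sup>2 * (\<integral>x. (f x)\<^sup>2 \<partial>lborel) + (- 2 * (b - a)) * A) + (b - a) * A)"
    by (intro has_bochner_integral_add has_bochner_integral_mult_right h0 h1 h2)
  then have "((b - a)\<^sup>2 * (\<integral>x. (f x)\<^sup>2 \<partial>lborel) + (- 2 * (b - a)) * A) + (b - a) * A
     = (\<integral>x. ((b - a)\<^sup>2 * (f x)\<^sup>2 + (- 2 * (b - a)) * (f x * P (x \<bullet> e))) + ((P (x \<bullet> e))\<^sup>2 + (Q (x \<bullet> e))\<^sup>2) \<partial>lborel)"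
    by (rule has_bochner_integral_integral_eq[symmetric])
  also have "\<dots> \<ge> 0"
  proof (rule Bochner_Integration.integral_nonneg)
    fix x
    have "((b - a)\<^sup>2 * (f x)\<^sup>2 + (- 2 * (b - a)) * (f x * P (x \<bullet> e))) + ((P (x \<bullet> e))\<^sup>2 + (Q (x \<bullet> e))\<^sup>2)
      = ((b - a) * f x - P (x \<bullet> e))\<^sup>2 + (Q (x \<bullet> e))\<^sup>2" by (simp only: power2_eq_square) (simp add: algebra_simps)
    then show "0 \<le> ((b - a)\<^sup>2 * (f x)\<^sup>2 + (- 2 * (b - a)) * (f x * P (x \<bullet> e))) + ((P (x \<bullet> e))\<^sup>2 + (Q (x \<bullet> e))\<^sup>2)"
      by (simp only: zero_le_power2 add_nonneg_nonneg)
  qed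
  finally have "(b - a) * A \<le> (b - a) * ((b - a) * (\<integral>x. (f x)\<^sup>2 \<partial>lborel))" by (simp add: power2_eq_square algebra_simps)
  then have "A \<le> (b - a) * (\<integral>x. (f x)\<^sup>2 \<partial>lborel)" using ab by simp
  then show ?thesis using ft by (simp add: A_def \<xi>_def)
qed

section \<open>Trapezoidal sums of even powers\<close>

text \<open>The difference of the two sides vanishes at \<open>x = 0\<close>, and its derivative reduces \<open>q\<close> by one.\<close>

lemma power_trapezoid:
  fixes x :: real
  assumes "0 \<le> x"
  shows "q * ((x + 1) ^ (q - 1) - (x - 1) ^ (q - 1)) \<le> (q + 1) * ((x + 1) ^ q + (x - 1) ^ q) - ((x + 1) ^ (q + 1) - (x - 1) ^ (q + 1))"
  using assms
proof (induction q arbitrary: x)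
  case 0
  then show ?case by simp
next
  case (Suc q)
  let ?d = "\<lambda>n y. (y + 1) ^ n - (y - 1) ^ n :: real" and ?s = "\<lambda>n y. (y + 1) ^ n + (y - 1) ^ n :: real"
  let ?E = "\<lambda>y. (real q + 2) * ?s (q + 1) y - ?d (q + 2) y - (real q + 1) * ?d q y"
  let ?E' = "\<lambda>y. (real q + 2) * ((real q + 1) * ?s q y) - (real q + 2) * ?d (q + 1) y - (real q + 1) * (real q * ?d (q - 1) y)"
  have "?E 0 \<le> ?E x"
  proof (rule DERIV_nonneg_imp_nondecreasing[OF Suc.prems])
    fix y :: real
    assume y: "0 \<le> y" "y \<le> x"
    have "(?E has_real_derivative ?E' y) (at y)"
      by (rule derivative_eq_intros refl)+ (simp add: algebra_simps)
    moreover have "0 \<le> ?E' y"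
    proof -
      have "\<bar>y - 1\<bar> \<le> y + 1" using y by auto
      then have "\<bar>y - 1\<bar> ^ (q - 1) \<le> (y + 1) ^ (q - 1)" by (intro power_mono) auto
      then have d0: "0 \<le> ?d (q - 1) y" using abs_ge_self[of "(y - 1) ^ (q - 1)"] by (simp add: power_abs)
      have "real q * ?d (q - 1) y \<le> (real q + 1) * ?s q y - ?d (q + 1) y"
        using Suc.IH[OF y(1)] by (simp add: add.commute)
      then have "(real q + 2) * (real q * ?d (q - 1) y) \<le> (real q + 2) * ((real q + 1) * ?s q y - ?d (q + 1) y)"
        by (intro mult_left_mono) auto
      moreover have "(real q + 1) * (real q * ?d (q - 1) y) \<le> (real q + 2) * (real q * ?d (q - 1) y)"
        using d0 by (intro mult_right_mono) auto
      ultimately show ?thesis by (simp only: right_diff_distrib)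
    qed
    ultimately show "\<exists>y'. (?E has_real_derivative y') (at y) \<and> 0 \<le> y'" by blast
  qed
  moreover have "?E 0 = 0" by (cases "even q") simp_all
  ultimately show ?case by (simp add: add_ac)
qed

text \<open>The sum is twice symmetric up to one end point, hence a trapezoidal sum with step 2 over
  [-k, k]. Passing from k to k + 2 adds one trapezoid at either end, estimated by
  \<open>power_trapezoid\<close> at k + 1; therefore the induction has step 2 and two starting
  values.\<close>

lemma even_power_trapezoid_sum_ge:
  fixes c :: real
  assumes l: "2 \<le> l" and c: "0 \<le> c" "c \<le> 1"
  shows "real k ^ (2 * l + 1) / (2 * real l + 1) + c * l / (2 * real l + 1) * real k ^ (2 * l - 1)
    \<le> (\<Sum>i=1..k. (real k - 2 * real i) ^ (2 * l))"
proof (induction k rule: induct_nat_012)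
  case 0
  then show ?case using l by (simp add: zero_power)
next
  case 1
  have "c * real l \<le> 1 * real l" using c by (intro mult_right_mono) auto
  then have "1 + c * real l \<le> 2 * real l + 1" using c l by simp
  then show ?case by (simp add: add_divide_distrib[symmetric])
next
  case (ge2 k)
  let ?p = "2 * real l + 1" and ?k = "real k"
  let ?f = "\<lambda>y::real. y ^ (2 * l + 1) / ?p + c * l / ?p * y ^ (2 * l - 1)"
  have "c * l * ((?k + 2) ^ (2 * l - 1) - ?k ^ (2 * l - 1)) \<le> (2 * real l) * ((?k + 2) ^ (2 * l - 1) - ?k ^ (2 * l - 1))"
  proof (rule mult_right_mono)
    show "c * real l \<le> 2 * real l" using c by (intro mult_right_mono) auto
    show "0 \<le> (?k + 2) ^ (2 * l - 1) - ?k ^ (2 * l - 1)" using power_mono[of ?k "?k + 2" "2 * l - 1"] by simp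
  qed
  also have "\<dots> \<le> ?p * ((?k + 2) ^ (2 * l) + ?k ^ (2 * l)) - ((?k + 2) ^ (2 * l + 1) - ?k ^ (2 * l + 1))"
    using power_trapezoid[of "?k + 1" "2 * l"] by (simp add: add_ac)
  finally have "(?k + 2) ^ (2 * l + 1) + c * l * (?k + 2) ^ (2 * l - 1) \<le>
     (?k ^ (2 * l + 1) + c * l * ?k ^ (2 * l - 1)) + ?p * ((?k + 2) ^ (2 * l) + ?k ^ (2 * l))"
    by (simp only: right_diff_distrib)
  then have "((?k + 2) ^ (2 * l + 1) + c * l * (?k + 2) ^ (2 * l - 1)) / ?p \<le>
     ((?k ^ (2 * l + 1) + c * l * ?k ^ (2 * l - 1)) + ?p * ((?k + 2) ^ (2 * l) + ?k ^ (2 * l))) / ?p"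
    by (rule divide_right_mono) simp
  also have "\<dots> = ?f ?k + ((?k + 2) ^ (2 * l) + ?k ^ (2 * l))"
    by (simp add: add_divide_distrib)
  also have "\<dots> \<le> (\<Sum>i=1..k. (?k - 2 * real i) ^ (2 * l)) + ((?k + 2) ^ (2 * l) + ?k ^ (2 * l))"
    using ge2(1) by (rule add_right_mono)
  \<comment> \<open>The new terms are those of i = 0 and i = k + 1 for the old k; shifting i by one
    turns k - 2i into (k + 2) - 2i.\<close>
  also have "\<dots> = (\<Sum>i=0..Suc k. (?k - 2 * real i) ^ (2 * l))"
  proof -
    have "(?k - 2 * real (Suc k)) ^ (2 * l) = (?k + 2) ^ (2 * l)"
    proof -
      have "?k - 2 * real (Suc k) = - (?k + 2)" by simp
      then show ?thesis by (simp only: power_minus_even even_mult_iff even_numeral simp_thms)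
    qed
    then show ?thesis by (simp add: sum.atLeast_Suc_atMost)
  qed
  also have "\<dots> = (\<Sum>i=1..Suc (Suc k). (real (Suc (Suc k)) - 2 * real i) ^ (2 * l))"
    unfolding One_nat_def sum.atLeast_Suc_atMost_Suc_shift by (simp add: algebra_simps)
  finally show ?case by (simp add: add_divide_distrib add_ac)
qed

section \<open>The density on translated lattices\<close>

context spectral_family
begin

text \<open>A bounded connected subset of the line lies between its infimum and supremum and
  contains everything strictly between them, so its length is its volume.\<close>

lemma line_interval:
  fixes e :: "real^'n"
  assumes e: "Basis = {e}"
  obtains a b where "a < b" "b - a = V" "\<And>x. x \<in> \<Omega> \<Longrightarrow> x \<bullet> e \<in> {a..b}"
proof -
  have ee: "e \<bullet> e = 1" by (rule inner_same_Basis) (simp add: e)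
  have rep: "(x \<bullet> e) *\<^sub>R e = x" for x using euclidean_representation[of x] by (simp add: e)
  define T where "T = (\<lambda>x. x \<bullet> e) ` \<Omega>"
  define a where "a = Inf T"
  define b where "b = Sup T"
  have T: "T = (\<lambda>s. s *\<^sub>R e) -` \<Omega>"
  proof (intro set_eqI iffI)
    fix s assume "s \<in> (\<lambda>s. s *\<^sub>R e) -` \<Omega>"
    then show "s \<in> T" unfolding T_def by (intro image_eqI[of _ _ "s *\<^sub>R e"]) (simp_all add: ee)
  qed (auto simp: T_def rep)
  have c: "connected T" unfolding T_def
    using dom by (intro connected_continuous_image continuous_intros) (simp add: bounded_domain_def)
  have ne: "T \<noteq> {}" using dom by (simp add: T_def bounded_domain_def)
  have "bounded T" unfolding T_def
    using dom by (intro bounded_linear_image bounded_linear_inner_left) (simp add: bounded_domain_def)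
  then have bdd: "bdd_above T" "bdd_below T" by (simp_all add: bounded_imp_bdd_above bounded_imp_bdd_below)
  have up: "T \<subseteq> {a..b}" unfolding a_def b_def using bdd by (auto intro: cInf_lower cSup_upper)
  have low: "{a<..<b} \<subseteq> T"
  proof
    fix s assume s: "s \<in> {a<..<b}"
    then obtain y z where "y \<in> T" "y < s" "z \<in> T" "s < z"
      using cInf_less_iff[OF ne bdd(2)] less_cSup_iff[OF ne bdd(1)] by (auto simp: a_def b_def)
    then show "s \<in> T" using connectedD_interval[OF c, of y z s] by simp
  qed
  have ab: "a \<le> b" using ne up by auto
  have [measurable]: "T \<in> sets borel"
  proof -
    have "open T" unfolding T using dom by (intro open_vimage continuous_intros) (simp add: bounded_domain_def)
    then show ?thesis by simp
  qed
  have "emeasure lborel \<Omega> = emeasure lborel T"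
    by (subst lborel_line[OF e], subst emeasure_distr) (simp_all add: T)
  then have V: "V = measure lborel T" by (simp add: measure_def)
  have "measure lborel {a<..<b} \<le> measure lborel T"
  proof (rule measure_mono_fmeasurable[OF low])
    have "emeasure lborel T \<le> emeasure lborel {a..b}" by (intro emeasure_mono up) simp
    also have "\<dots> < \<infinity>" using ab by simp
    finally show "T \<in> fmeasurable lborel" by (intro fmeasurableI) simp_all
  qed simp
  moreover have "measure lborel T \<le> measure lborel {a..b}"
    by (rule measure_mono_fmeasurable[OF up]) (use ab in \<open>auto intro: fmeasurableI\<close>)
  ultimately have "b - a = V" using ab by (simp add: V)
  then show ?thesis using V_pos up by (intro that[of a b]) (auto simp: T_def)
qed

text \<open>Bessel's inequality is applied to each eigenfunction and, for the energy, to the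
  derivatives of its approximating test functions. As M is finite, the limit is taken term by
  term.\<close>

lemma lattice_sums:
  fixes M :: "int set" and \<theta> :: real and e :: "real^'n"
  assumes e: "Basis = {e}" and M: "finite M"
  defines "\<xi> \<equiv> \<lambda>m::int. \<theta> + 2 * pi * m / V"
  shows "(\<Sum>m\<in>M. density \<Omega> U k (\<xi> m *\<^sub>R e)) \<le> k"
    and "(\<Sum>m\<in>M. \<xi> m ^ (2 * l) * density \<Omega> U k (\<xi> m *\<^sub>R e)) \<le> (\<Sum>i=1..k. \<Lambda> i)"
proof -
  obtain a b where ab: "a < b" "b - a = V" "\<And>x. x \<in> \<Omega> \<Longrightarrow> x \<bullet> e \<in> {a..b}" by (rule line_interval[OF e]) (rule that)
  have bessel: "(\<Sum>m\<in>M. ft_pow f (\<xi> m *\<^sub>R e)) \<le> V * (\<integral>x. (f x)\<^sup>2 \<partial>lborel)"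
    if "f \<in> borel_measurable borel" "integrable lborel (\<lambda>x. (f x)\<^sup>2)" "\<And>x. x \<notin> \<Omega> \<Longrightarrow> f x = 0" for f
    using bessel_exponentials[OF e ab(1) that(1,2) _ M, of \<theta>] that(3) ab(3) unfolding ab(2) \<xi>_def by blast
  have swap: "(\<Sum>m\<in>M. w m * density \<Omega> U k (\<xi> m *\<^sub>R e)) = (\<Sum>i=1..k. (\<Sum>m\<in>M. w m * ft_pow (U i) (\<xi> m *\<^sub>R e)) / V)" for w
    unfolding density_def by (subst sum_divide_distrib[symmetric], subst sum.swap) (simp add: sum_distrib_left sum_divide_distrib)
  have "(\<Sum>m\<in>M. 1 * density \<Omega> U k (\<xi> m *\<^sub>R e)) \<le> (\<Sum>i=1..k. 1)"
    unfolding swap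
  proof (rule sum_mono)
    fix i assume "i \<in> {1..k}"
    then have i: "i \<ge> 1" by simp
    have "(\<Sum>m\<in>M. ft_pow (U i) (\<xi> m *\<^sub>R e)) \<le> V * (\<integral>x. (U i x)\<^sup>2 \<partial>lborel)"
      by (rule bessel[OF U_measurable[OF i] U_square[OF i] U_outside[OF i]])
    also have "(\<integral>x. (U i x)\<^sup>2 \<partial>lborel) = 1" using U_orth[OF i i] by (simp add: power2_eq_square)
    finally show "(\<Sum>m\<in>M. 1 * ft_pow (U i) (\<xi> m *\<^sub>R e)) / V \<le> 1" using V_pos by simp
  qed
  then show "(\<Sum>m\<in>M. density \<Omega> U k (\<xi> m *\<^sub>R e)) \<le> k" by simp
  have e1: "norm e = 1" by (rule norm_Basis) (simp add: e)
  show "(\<Sum>m\<in>M. \<xi> m ^ (2 * l) * density \<Omega> U k (\<xi> m *\<^sub>R e)) \<le> (\<Sum>i=1..k. \<Lambda> i)"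
    unfolding swap
  proof (rule sum_mono)
    fix i assume "i \<in> {1..k}"
    then have i: "i \<ge> 1" by simp
    have "(\<Sum>m\<in>M. \<xi> m ^ (2 * l) * ft_pow (\<Phi> i j) (\<xi> m *\<^sub>R e)) \<le> V * (\<Sum>is | length is = l. \<integral>x. (partials is (\<Phi> i j) x)\<^sup>2 \<partial>lborel)" for j
    proof -
      have "\<xi> m ^ (2 * l) * ft_pow (\<Phi> i j) (\<xi> m *\<^sub>R e) = (\<Sum>is | length is = l. ft_pow (partials is (\<Phi> i j)) (\<xi> m *\<^sub>R e))" for m
        using ft_pow_norm_power[OF \<Phi>_test[OF i], of "\<xi> m *\<^sub>R e" l j] by (simp add: e1 power_mult)
      then have "(\<Sum>m\<in>M. \<xi> m ^ (2 * l) * ft_pow (\<Phi> i j) (\<xi> m *\<^sub>R e)) = (\<Sum>is | length is = l. \<Sum>m\<in>M. ft_pow (partials is (\<Phi> i j)) (\<xi> m *\<^sub>R e))"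
        by (simp only:) (rule sum.swap)
      also have "\<dots> \<le> (\<Sum>is | length is = l. V * (\<integral>x. (partials is (\<Phi> i j) x)\<^sup>2 \<partial>lborel))"
      proof (rule sum_mono)
        fix "is" :: "'n list"
        note p = partials_test_function[OF \<Phi>_test[OF i], of "is" j]
        show "(\<Sum>m\<in>M. ft_pow (partials is (\<Phi> i j)) (\<xi> m *\<^sub>R e)) \<le> V * (\<integral>x. (partials is (\<Phi> i j) x)\<^sup>2 \<partial>lborel)"
          by (rule bessel[OF test_function_facts(2,5,6)[OF p]])
      qed
      finally show ?thesis by (simp only: sum_distrib_left)
    qed
    moreover have "(\<lambda>j. \<Sum>m\<in>M. \<xi> m ^ (2 * l) * ft_pow (\<Phi> i j) (\<xi> m *\<^sub>R e)) \<longlonglongrightarrow> (\<Sum>m\<in>M. \<xi> m ^ (2 * l) * ft_pow (U i) (\<xi> m *\<^sub>R e))"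
      by (intro tendsto_intros ft_pow_limit i)
    moreover have "(\<lambda>j. V * (\<Sum>is | length is = l. \<integral>x. (partials is (\<Phi> i j) x)\<^sup>2 \<partial>lborel)) \<longlonglongrightarrow> V * \<Lambda> i"
      by (intro tendsto_mult tendsto_const \<Phi>_energy i)
    ultimately have "(\<Sum>m\<in>M. \<xi> m ^ (2 * l) * ft_pow (U i) (\<xi> m *\<^sub>R e)) \<le> V * \<Lambda> i"
      by (intro LIMSEQ_le) auto
    then show "(\<Sum>m\<in>M. \<xi> m ^ (2 * l) * ft_pow (U i) (\<xi> m *\<^sub>R e)) / V \<le> \<Lambda> i"
      using V_pos by (simp add: divide_le_eq mult.commute)
  qed
qed

text \<open>The mass of the density on almost every translate of the lattice \<open>(2\<pi>/V) \<int>\<close> is \<open>k\<close>, because it is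
  at most \<open>k\<close> by Bessel and has mean \<open>k\<close> by Plancherel. Only the translate by \<open>k \<pi> / V\<close> is of
  interest, and continuity reaches it from nearby ones.\<close>

lemma eigenvalue_sum_ge_trapezoid:
  fixes e :: "real^'n"
  assumes e: "Basis = {e}" and k: "1 \<le> k"
  shows "(pi / V) ^ (2 * l) * (\<Sum>i=1..k. (real k - 2 * real i) ^ (2 * l)) \<le> (\<Sum>i=1..k. \<Lambda> i)"
proof (rule ccontr)
  let ?E = "\<Sum>i=1..k. \<Lambda> i"
  \<comment> \<open>T is the lattice spacing and k T is twice the translation kT/2, so the points
    with indices -k, ..., 0 form the symmetric set (\<pi>/V)(k - 2i), i = 0, ..., k.\<close>
  define T where "T = 2 * pi / V"
  define \<theta>\<^sub>0 where "\<theta>\<^sub>0 = real k * pi / V"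
  define c where "c = \<theta>\<^sub>0 ^ (2 * l)"
  \<comment> \<open>The discrete bathtub has level c, the value of s^(2l) at the outermost of these
    points, where \<open>h\<close> therefore vanishes.\<close>
  define h where "h = (\<lambda>s::real. max 0 (c - s ^ (2 * l)))"
  define G where "G = (\<lambda>\<theta>. \<Sum>m\<in>{- int k..0}. h (\<theta> + m * T))"
  define \<psi> where "\<psi> = (\<lambda>s. density \<Omega> U k (s *\<^sub>R e))"
  define F where "F = (\<lambda>N \<theta>. \<Sum>m\<in>{- int N..int N}. \<psi> (\<theta> + m * T))"
  have T0: "0 < T" and \<theta>0: "0 < \<theta>\<^sub>0" using V_pos k by (simp_all add: T_def \<theta>\<^sub>0_def)
  have kT: "\<theta>\<^sub>0 = real k * T / 2" by (simp add: T_def \<theta>\<^sub>0_def)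
  have c0: "0 < c" using \<theta>0 by (simp add: c_def)
  have \<psi>01: "0 \<le> \<psi> s" "\<psi> s \<le> 1" for s using density_bounds by (auto simp: \<psi>_def)
  have [measurable]: "\<psi> \<in> borel_measurable borel" unfolding \<psi>_def by measurable
  have lat: "\<theta> + 2 * pi * real_of_int m / V = \<theta> + m * T" for \<theta> m by (simp add: T_def)
  have F_le: "F N \<theta> \<le> k" and energy: "(\<Sum>m\<in>{- int N..int N}. (\<theta> + m * T) ^ (2 * l) * \<psi> (\<theta> + m * T)) \<le> ?E" for N \<theta>
    using lattice_sums[OF e, where M="{- int N..int N}" and \<theta>=\<theta> and k=k] unfolding F_def \<psi>_def lat by simp_all
  have F0: "0 \<le> F N \<theta>" for N \<theta> unfolding F_def by (intro sum_nonneg \<psi>01)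
  \<comment> \<open>The bathtub principle on one lattice: a point contributes at most
    \<open>h\<close>. For \<theta> within one period to the right of
    \<open>\<theta>\<^sub>0\<close>, all points of positive \<open>h\<close> have index in -k, ...,
    0, whatever N is.\<close>
  have key: "c * F N \<theta> \<le> ?E + G \<theta>" if \<theta>: "\<theta>\<^sub>0 \<le> \<theta>" "\<theta> < \<theta>\<^sub>0 + T" for N \<theta>
  proof -
    let ?I = "{- int N..int N}" and ?K = "{- int k..0}"
    have "c * F N \<theta> - ?E \<le> c * F N \<theta> - (\<Sum>m\<in>?I. (\<theta> + m * T) ^ (2 * l) * \<psi> (\<theta> + m * T))"
      using energy by simp
    also have "\<dots> = (\<Sum>m\<in>?I. (c - (\<theta> + m * T) ^ (2 * l)) * \<psi> (\<theta> + m * T))"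
      by (simp add: F_def sum_distrib_left sum_subtractf left_diff_distrib)
    also have "\<dots> \<le> (\<Sum>m\<in>?I. if m \<in> ?K then h (\<theta> + m * T) else 0)"
    proof (rule sum_mono)
      fix m :: int
      let ?s = "\<theta> + m * T"
      have "(c - ?s ^ (2 * l)) * \<psi> ?s \<le> h ?s * \<psi> ?s" unfolding h_def by (intro mult_right_mono \<psi>01) simp
      also have "\<dots> \<le> h ?s" using \<psi>01 by (intro mult_left_le) (auto simp: h_def)
      finally have 1: "(c - ?s ^ (2 * l)) * \<psi> ?s \<le> h ?s" .
      have "h ?s = 0" if m: "m \<notin> ?K"
      proof -
        have "\<theta>\<^sub>0 \<le> \<bar>?s\<bar>"
        proof (cases "0 < m")
          case True
          then have "0 \<le> m * T" using T0 by simp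
          then show ?thesis using \<theta> by simp
        next
          case False
          then have "m \<le> - int k - 1" using m by simp
          then have "real_of_int m \<le> - real k - 1" by linarith
          then have "m * T \<le> (- real k - 1) * T" using T0 by (intro mult_right_mono) auto
          then have "m * T \<le> - (2 * \<theta>\<^sub>0) - T" by (simp add: kT algebra_simps)
          then show ?thesis using \<theta> by simp
        qed
        then have "\<theta>\<^sub>0 ^ (2 * l) \<le> \<bar>?s\<bar> ^ (2 * l)" using \<theta>0 by (intro power_mono) auto
        then show ?thesis by (simp add: h_def c_def power_even_abs)
      qed
      with 1 show "(c - ?s ^ (2 * l)) * \<psi> ?s \<le> (if m \<in> ?K then h ?s else 0)" by auto
    qed
    also have "\<dots> = (\<Sum>m\<in>?I \<inter> ?K. h (\<theta> + m * T))" by (rule sum.inter_restrict[symmetric]) simp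
    also have "\<dots> \<le> G \<theta>" unfolding G_def by (rule sum_mono2) (auto simp: h_def)
    finally show ?thesis by simp
  qed
  \<comment> \<open>The sum runs over k + 1 points, one more than the multiplicity of c; the end
    point i = 0 has value c and balances this.\<close>
  have G\<theta>: "c * k - G \<theta>\<^sub>0 = (pi / V) ^ (2 * l) * (\<Sum>i=1..k. (real k - 2 * real i) ^ (2 * l))"
  proof -
    let ?g = "\<lambda>i. (real k - 2 * real i) ^ (2 * l)"
    have cc: "c = (pi / V) ^ (2 * l) * real k ^ (2 * l)"
      by (simp add: c_def \<theta>\<^sub>0_def power_mult_distrib power_divide)
    have "G \<theta>\<^sub>0 = (\<Sum>i\<in>{0..k}. h (\<theta>\<^sub>0 + real_of_int (- int i) * T))"
      unfolding G_def
      by (rule sum.reindex_bij_witness[of _ "\<lambda>i. - int i" "\<lambda>m. nat (- m)"]) auto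
    also have "\<dots> = (\<Sum>i\<in>{0..k}. c - (pi / V) ^ (2 * l) * ?g i)"
    proof (intro sum.cong refl)
      fix i assume "i \<in> {0..k}"
      then have i: "\<bar>real k - 2 * real i\<bar> \<le> real k" by auto
      have s: "\<theta>\<^sub>0 + real_of_int (- int i) * T = (pi / V) * (real k - 2 * real i)"
        by (simp add: \<theta>\<^sub>0_def T_def algebra_simps diff_divide_distrib)
      have "?g i \<le> real k ^ (2 * l)"
        using power_mono[OF i, of "2 * l"] by (simp add: power_even_abs)
      then have "(pi / V) ^ (2 * l) * ?g i \<le> c" unfolding cc using V_pos by (intro mult_left_mono) auto
      then show "h (\<theta>\<^sub>0 + real_of_int (- int i) * T) = c - (pi / V) ^ (2 * l) * ?g i"
        unfolding s h_def power_mult_distrib by simp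
    qed
    also have "\<dots> = (real k + 1) * c - (pi / V) ^ (2 * l) * (\<Sum>i\<in>{0..k}. ?g i)"
      by (simp add: sum_subtractf sum_distrib_left add.commute)
    also have "(\<Sum>i\<in>{0..k}. ?g i) = real k ^ (2 * l) + (\<Sum>i=1..k. ?g i)"
      by (simp add: sum.atLeast_Suc_atMost)
    also have "(pi / V) ^ (2 * l) * \<dots> = c + (pi / V) ^ (2 * l) * (\<Sum>i=1..k. ?g i)"
      by (simp only: distrib_left cc)
    also have "(real k + 1) * c = c * k + c" by (simp add: algebra_simps)
    finally show ?thesis by simp
  qed
  assume "\<not> ?thesis"
  then have "?E < c * k - G \<theta>\<^sub>0" unfolding G\<theta> by simp
  \<comment> \<open>Half of the gap. Continuity of \<open>G\<close> keeps the other half on a short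
    interval to the right of \<open>\<theta>\<^sub>0\<close>, where \<open>key\<close> then forces
    the lattice mass below k by a fixed amount \<eta>.\<close>
  define \<delta> where "\<delta> = (c * k - G \<theta>\<^sub>0 - ?E) / 2"
  have \<delta>: "0 < \<delta>" "?E + G \<theta>\<^sub>0 + 2 * \<delta> = c * k"
    using \<open>?E < c * k - G \<theta>\<^sub>0\<close> by (simp_all add: \<delta>_def field_simps)
  have "isCont G \<theta>\<^sub>0" unfolding G_def h_def by (intro continuous_intros)
  then obtain d where d: "0 < d" "\<And>\<theta>. \<bar>\<theta> - \<theta>\<^sub>0\<bar> < d \<Longrightarrow> \<bar>G \<theta> - G \<theta>\<^sub>0\<bar> < \<delta>"
    using \<delta>(1) unfolding continuous_at_eps_delta dist_real_def by (metis)
  define r where "r = min (d / 2) (T / 2)"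
  have r: "0 < r" "r < d" "r < T" using d(1) T0 by (auto simp: r_def)
  define \<eta> where "\<eta> = \<delta> / c"
  have \<eta>: "0 < \<eta>" using \<delta>(1) c0 by (simp add: \<eta>_def)
  \<comment> \<open>A majorant of all lattice masses over one period, uniform in N. Its integral
    falls short of k T by \<eta> r, whereas k T is the total mass of the density.\<close>
  define w where "w = (\<lambda>\<theta>. real k * indicator {\<theta>\<^sub>0..<\<theta>\<^sub>0 + T} \<theta> - \<eta> * indicator {\<theta>\<^sub>0..\<theta>\<^sub>0 + r} \<theta>)"
  have w: "F N \<theta> * indicator {\<theta>\<^sub>0..<\<theta>\<^sub>0 + T} \<theta> \<le> w \<theta>" for N \<theta>
  proof (cases "\<theta> \<in> {\<theta>\<^sub>0..\<theta>\<^sub>0 + r}")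
    case True
    then have "\<bar>G \<theta> - G \<theta>\<^sub>0\<bar> < \<delta>" using r by (intro d(2)) auto
    moreover have "c * F N \<theta> \<le> ?E + G \<theta>" using True r by (intro key) auto
    ultimately have "c * F N \<theta> \<le> c * k - \<delta>" using \<delta>(2) by linarith
    also have "\<dots> = c * (k - \<eta>)" using c0 by (simp add: \<eta>_def right_diff_distrib)
    finally have "F N \<theta> \<le> k - \<eta>" using c0 by (simp only: mult_le_cancel_left_pos)
    then show ?thesis using True r by (simp add: w_def)
  next
    case False
    then show ?thesis using F_le by (auto simp: w_def indicator_def)
  qed
  have wi: "integrable lborel w" "(\<integral>\<theta>. w \<theta> \<partial>lborel) = real k * T - \<eta> * r"
    unfolding w_def using T0 r by simp_all
  have w0: "0 \<le> w \<theta>" for \<theta>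
    by (rule order_trans[OF mult_nonneg_nonneg w[of 0 \<theta>]]) (simp_all add: F0)
  have cell: "\<lfloor>(s - \<theta>\<^sub>0) / T\<rfloor> = m \<longleftrightarrow> s - m * T \<in> {\<theta>\<^sub>0..<\<theta>\<^sub>0 + T}" for s m
    using T0 by (auto simp: floor_eq_iff le_divide_eq divide_less_eq algebra_simps)
  \<comment> \<open>The union of the periods with index from -N to N; folding it into one period
    turns the integral of \<open>\<psi>\<close> into that of \<open>F N\<close>.\<close>
  let ?B = "\<lambda>N. {s. \<bar>\<lfloor>(s - \<theta>\<^sub>0) / T\<rfloor>\<bar> \<le> int N}"
  have [measurable]: "?B N \<in> sets borel" for N
  proof -
    have "(\<bar>z\<bar> \<le> int N) = (\<bar>real_of_int z\<bar> \<le> real N)" for z :: int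
      using of_int_le_iff[of "\<bar>z\<bar>" "int N", where 'a=real] by simp
    then show ?thesis by (simp only:) measurable
  qed
  have part: "(\<integral>\<^sup>+s. ennreal (\<psi> s * indicator (?B N) s) \<partial>lborel) \<le> ennreal (real k * T - \<eta> * r)" for N
  proof -
    let ?I = "{- int N..int N}"
    have "(\<integral>\<^sup>+s. ennreal (\<psi> s * indicator (?B N) s) \<partial>lborel)
      = (\<integral>\<^sup>+s. (\<Sum>m\<in>?I. ennreal (\<psi> s * indicator {\<theta>\<^sub>0..<\<theta>\<^sub>0 + T} (s - m * T))) \<partial>lborel)"
    proof (intro nn_integral_cong)
      fix s
      have "(\<Sum>m\<in>?I. \<psi> s * indicator {\<theta>\<^sub>0..<\<theta>\<^sub>0 + T} (s - m * T)) = (\<Sum>m\<in>?I. if \<lfloor>(s - \<theta>\<^sub>0) / T\<rfloor> = m then \<psi> s else 0)"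
        unfolding cell by (intro sum.cong refl) simp
      also have "\<dots> = \<psi> s * indicator (?B N) s" by (auto simp: indicator_def abs_le_iff)
      finally have q: "(\<Sum>m\<in>?I. \<psi> s * indicator {\<theta>\<^sub>0..<\<theta>\<^sub>0 + T} (s - m * T)) = \<psi> s * indicator (?B N) s" .
      show "ennreal (\<psi> s * indicator (?B N) s) = (\<Sum>m\<in>?I. ennreal (\<psi> s * indicator {\<theta>\<^sub>0..<\<theta>\<^sub>0 + T} (s - m * T)))"
        unfolding q[symmetric] by (rule sum_ennreal[symmetric]) (simp add: \<psi>01)
    qed
    also have "\<dots> = (\<Sum>m\<in>?I. \<integral>\<^sup>+s. ennreal (\<psi> s * indicator {\<theta>\<^sub>0..<\<theta>\<^sub>0 + T} (s - m * T)) \<partial>lborel)"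
      by (rule nn_integral_sum) measurable
    also have "\<dots> = (\<Sum>m\<in>?I. \<integral>\<^sup>+\<theta>. ennreal (\<psi> (\<theta> + m * T) * indicator {\<theta>\<^sub>0..<\<theta>\<^sub>0 + T} \<theta>) \<partial>lborel)"
    proof (intro sum.cong refl)
      fix m :: int
      show "(\<integral>\<^sup>+s. ennreal (\<psi> s * indicator {\<theta>\<^sub>0..<\<theta>\<^sub>0 + T} (s - m * T)) \<partial>lborel)
        = (\<integral>\<^sup>+\<theta>. ennreal (\<psi> (\<theta> + m * T) * indicator {\<theta>\<^sub>0..<\<theta>\<^sub>0 + T} \<theta>) \<partial>lborel)"
        by (subst nn_integral_real_affine[where c=1 and t="m * T"]) (simp_all add: add.commute)
    qed
    also have "\<dots> = (\<integral>\<^sup>+\<theta>. (\<Sum>m\<in>?I. ennreal (\<psi> (\<theta> + m * T) * indicator {\<theta>\<^sub>0..<\<theta>\<^sub>0 + T} \<theta>)) \<partial>lborel)"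
      by (rule nn_integral_sum[symmetric]) measurable
    also have "\<dots> = (\<integral>\<^sup>+\<theta>. ennreal (F N \<theta> * indicator {\<theta>\<^sub>0..<\<theta>\<^sub>0 + T} \<theta>) \<partial>lborel)"
      unfolding F_def sum_distrib_right by (intro nn_integral_cong sum_ennreal mult_nonneg_nonneg \<psi>01) simp
    also have "\<dots> \<le> (\<integral>\<^sup>+\<theta>. ennreal (w \<theta>) \<partial>lborel)" by (intro nn_integral_mono ennreal_leI w)
    also have "\<dots> = ennreal (real k * T - \<eta> * r)" using nn_integral_eq_integral[OF wi(1)] w0 wi(2) by simp
    finally show ?thesis .
  qed
  have card: "CARD('n) = 1"
  proof -
    have "DIM(real^'n) = 1" by (simp only: e) simp
    then show ?thesis by simp
  qed
  have "ennreal (real k * T) = (\<integral>\<^sup>+\<xi>. ennreal (density \<Omega> U k \<xi>) \<partial>lborel)"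
    unfolding density_mass card by (simp add: T_def)
  also have "\<dots> = (\<integral>\<^sup>+s. ennreal (\<psi> s) \<partial>lborel)"
    unfolding \<psi>_def by (subst lborel_line[OF e], subst nn_integral_distr) simp_all
  also have "\<dots> = (\<integral>\<^sup>+s. (SUP N. ennreal (\<psi> s * indicator (?B N) s)) \<partial>lborel)"
  proof (intro nn_integral_cong antisym)
    fix s
    show "ennreal (\<psi> s) \<le> (SUP N. ennreal (\<psi> s * indicator (?B N) s))"
      by (rule SUP_upper2[of "nat \<bar>\<lfloor>(s - \<theta>\<^sub>0) / T\<rfloor>\<bar>"]) simp_all
    show "(SUP N. ennreal (\<psi> s * indicator (?B N) s)) \<le> ennreal (\<psi> s)"
      by (intro SUP_least ennreal_leI) (auto simp: indicator_def \<psi>01)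
  qed
  also have "\<dots> = (SUP N. \<integral>\<^sup>+s. ennreal (\<psi> s * indicator (?B N) s) \<partial>lborel)"
  proof (rule nn_integral_monotone_convergence_SUP)
    show "incseq (\<lambda>N s. ennreal (\<psi> s * indicator (?B N) s))"
      by (intro monoI le_funI ennreal_leI mult_left_mono \<psi>01) (auto simp: indicator_def)
  qed measurable
  also have "\<dots> \<le> ennreal (real k * T - \<eta> * r)" by (intro SUP_least part)
  finally show False using k T0 \<eta> r by (auto simp: ennreal_le_iff2 mult_le_0_iff)
qed

text \<open>Here t = k \<pi>/V, so the leading term is the integral part of the trapezoidal sum, and
  the correction only has to be compared with the excess of that sum.\<close>

lemma eigenvalue_sum_ge_dim1:
  fixes t \<alpha> \<rho> \<omega> :: real
  assumes n1: "CARD('n) = 1" and nl: "6 \<le> 2 * l + CARD('n)" and k: "1 \<le> k"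
    and \<omega>: "\<omega> = measure lborel (ball (0::real^'n) 1)"
    and \<alpha>: "\<alpha> = V / (2 * pi) ^ CARD('n)" and \<rho>: "\<rho> = 2 / (2 * pi) ^ CARD('n) * sqrt (V * I)"
    and t: "t = (real k / \<omega> / \<alpha>) powr (1 / real CARD('n))"
  shows "\<alpha> * (\<omega> * t ^ (CARD('n) + 2 * l) * ((real CARD('n) + real l * q_poly (\<alpha> / (\<rho> * t))) / (real CARD('n) + 2 * real l)))
    \<le> (\<Sum>i=1..k. \<Lambda> i)"
proof -
  let ?D = "\<alpha> / (\<rho> * t)" and ?p = "2 * real l + 1"
  have l: "3 \<le> l" using nl n1 by simp
  have "card (Basis :: (real^'n) set) = 1" using n1 by simp
  then obtain e :: "real^'n" where e: "Basis = {e}" by (rule card_1_singletonE)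
  have w2: "\<omega> = 2"
  proof -
    have "unit_ball_vol (1::real) = 2" by simp
    then show ?thesis using content_ball[of 1 "0::real^'n"] n1 by (simp add: \<omega>)
  qed
  obtain Y where t0: "0 < t" and L0: "0 < sqrt (I / V)" and tn: "t ^ CARD('n) = real k / \<omega> / \<alpha>"
    and D: "?D = 1 / (2 * sqrt (I / V) * t)" and Y: "Y ^ CARD('n) = real k * ((2 * pi) ^ CARD('n) / \<omega>\<^sup>2)"
    and D2: "?D\<^sup>2 \<le> (real CARD('n) + 2) / (4 * real CARD('n) * Y\<^sup>2)"
    by (rule D_radius[OF k \<omega> \<alpha> \<rho> t])
  have Yk: "Y = real k * pi / 2" using Y by (simp add: n1 w2)
  have tk: "t = pi / V * real k" using tn V_pos by (simp add: n1 w2 \<alpha>)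
  \<comment> \<open>As Y = k \<pi>/2, D^2 is at most 3/(k \<pi>)^2, so (5/2) D^2 is at most c/k^2.
    Nothing but c <= 1 is asked of the constant.\<close>
  define c where "c = 15 / (2 * pi\<^sup>2)"
  have c: "0 \<le> c" "c \<le> 1"
  proof -
    have "(157/50)\<^sup>2 \<le> pi\<^sup>2" using pi_bounds by (intro power_mono) auto
    then show "c \<le> 1" by (simp add: c_def divide_le_eq power2_eq_square)
  qed (simp add: c_def)
  have Dc: "5/2 * ?D\<^sup>2 \<le> c / real k ^ 2"
  proof -
    have "5/2 * ?D\<^sup>2 \<le> 5/2 * (3 / (4 * Y\<^sup>2))" using D2 by (intro mult_left_mono) (simp_all add: n1)
    also have "\<dots> = c / real k ^ 2" by (simp add: c_def Yk power_divide power_mult_distrib)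
    finally show ?thesis .
  qed
  have D01: "0 \<le> ?D" "?D \<le> 1"
  proof -
    show "0 \<le> ?D" unfolding D using t0 L0 by (intro divide_nonneg_nonneg mult_nonneg_nonneg) auto
    have "c / real k ^ 2 \<le> 1" using c k by (simp add: divide_le_eq one_le_power order_trans[of c 1])
    then have "?D\<^sup>2 \<le> 1" using Dc zero_le_power2[of ?D] by linarith
    then have "?D\<^sup>2 \<le> 1\<^sup>2" by (simp only: one_power2)
    then show "?D \<le> 1" by (rule power2_le_imp_le) simp
  qed
  have q: "q_poly ?D \<le> c / real k ^ 2" using q_poly_le(1)[OF D01] Dc by (rule order_trans)
  have "\<alpha> * (\<omega> * t ^ (CARD('n) + 2 * l) * ((real CARD('n) + real l * q_poly ?D) / (real CARD('n) + 2 * real l)))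
    = (pi / V) ^ (2 * l) * (real k ^ (2 * l + 1) * ((1 + real l * q_poly ?D) / ?p))"
  proof -
    have "\<alpha> * (\<omega> * t ^ (1 + 2 * l)) = (pi / V) ^ (2 * l) * real k ^ (2 * l + 1)"
      unfolding tk \<alpha> w2 n1 power_mult_distrib power_add using V_pos by simp
    then have "\<alpha> * (\<omega> * t ^ (1 + 2 * l)) * ((1 + real l * q_poly ?D) / ?p)
      = (pi / V) ^ (2 * l) * real k ^ (2 * l + 1) * ((1 + real l * q_poly ?D) / ?p)" by (simp only:)
    then show ?thesis by (simp only: n1 of_nat_1 mult.assoc add.commute)
  qed
  also have "\<dots> \<le> (pi / V) ^ (2 * l) * (real k ^ (2 * l + 1) * ((1 + real l * (c / real k ^ 2)) / ?p))"
    using V_pos q by (intro mult_left_mono divide_right_mono add_left_mono) auto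
  also have "real k ^ (2 * l + 1) * ((1 + real l * (c / real k ^ 2)) / ?p)
    = real k ^ (2 * l + 1) / ?p + c * l / ?p * real k ^ (2 * l - 1)"
  proof -
    have "real k ^ (2 * l + 1) = real k ^ (2 * l - 1) * real k ^ 2"
      using l by (simp only: power_add[symmetric]) (simp add: numeral_2_eq_2)
    moreover have "x * ((1 + y * (c / z)) / u) = x / u + c * y / u * v" if "x = v * z" "z \<noteq> 0" for x y z u v :: real
      using that by (simp add: add_divide_distrib distrib_left)
    ultimately show ?thesis using k by simp
  qed
  also have "(pi / V) ^ (2 * l) * \<dots> \<le> (pi / V) ^ (2 * l) * (\<Sum>i=1..k. (real k - 2 * real i) ^ (2 * l))"
    using V_pos l by (intro mult_left_mono even_power_trapezoid_sum_ge c) auto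
  also have "\<dots> \<le> (\<Sum>i=1..k. \<Lambda> i)" by (rule eigenvalue_sum_ge_trapezoid[OF e k])
  finally show ?thesis .
qed

end

theorem theorem1p2:
  fixes \<Omega> :: "(real^'n) set"
    and n l k :: nat
    and ev :: "nat \<Rightarrow> real"
    and V \<omega> I \<alpha> \<rho> :: real
  assumes n: "n = CARD('n)"
    and l: "l \<ge> 1"
    and ln: "2 * l + n \<ge> 6"
    and dom: "bounded_domain \<Omega>"
    and ev: "dirichlet_eigenvalues l \<Omega> ev"
    and k: "k \<ge> 1"
    and V: "V = measure lebesgue \<Omega>"
    and \<omega>: "\<omega> = measure lebesgue (ball (0 :: real^'n) 1)"
    and I: "I = (\<integral>x. (norm x)\<^sup>2 \<partial>lebesgue_on \<Omega>)"
    and \<alpha>: "\<alpha> = V / (2 * pi) ^ n"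
    and \<rho>: "\<rho> = 2 / (2 * pi) ^ n * sqrt (V * I)"
  shows "(\<Sum>i = 1..k. ev i) \<ge>
      n / (n + 2 * l) * ((2 * pi) ^ (2 * l) / (\<omega> * V) powr (2 * real l / n))
        * k powr ((2 * real l + n) / n)
    + 5 * l / (2 * (2 * real l + n) * \<rho> ^ 2) * \<omega> powr (- (2 * real l - 2) / n)
        * \<alpha> powr ((2 * real n - 2 * real l + 2) / n) * k powr ((2 * real l + n - 2) / n)
    - 31 * l * \<omega> * \<alpha> powr ((3 * real n - 2 * real l + 3) / n) / (9 * (2 * real l + n) * \<rho> ^ 3)
        * (k / \<omega>) powr ((2 * real l + n - 3) / n)
    + 5 * l * \<omega> * \<alpha> powr ((4 * real n - 2 * real l + 4) / n) / (8 * (2 * real l + n) * \<rho> ^ 4)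
        * (k / \<omega>) powr ((2 * real l + n - 4) / n)
    + 38 * l * \<omega> * \<alpha> powr ((5 * real n - 2 * real l + 5) / n) / (25 * (2 * real l + n) * \<rho> ^ 5)
        * (k / \<omega>) powr ((2 * real l + n - 5) / n)
    - 317 * l * \<omega> * \<alpha> powr ((6 * real n - 2 * real l + 6) / n) / (420 * (2 * real l + n) * \<rho> ^ 6)
        * (k / \<omega>) powr ((2 * real l + n - 6) / n)"
proof -
  obtain U \<Phi> where UP: "spectral_family \<Omega> l ev U \<Phi>"
    by (rule spectral_data[OF dom ev]) (rule that, rule spectral_family.intro, rule dom, assumption+)
  interpret S: spectral_family \<Omega> l ev U \<Phi> by (rule UP)
  let ?V = "measure lborel \<Omega>" and ?I = "\<integral>x. indicator \<Omega> x * (norm x)\<^sup>2 \<partial>lborel"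
  have V': "V = ?V" by (simp add: V measure_completion)
  have \<omega>': "\<omega> = measure lborel (ball (0 :: real^'n) 1)" by (simp add: \<omega> measure_completion)
  have I': "I = ?I"
  proof -
    have "I = (\<integral>x. indicator \<Omega> x * (norm x)\<^sup>2 \<partial>lebesgue_on \<Omega>)"
      unfolding I by (intro Bochner_Integration.integral_cong) auto
    also have "\<dots> = ?I" by (rule integral_lebesgue_on_lborel(1)) auto
    finally show ?thesis .
  qed
  have \<alpha>': "\<alpha> = ?V / (2 * pi) ^ CARD('n)" by (simp add: \<alpha> n V')
  have \<rho>': "\<rho> = 2 / (2 * pi) ^ CARD('n) * sqrt (?V * ?I)" by (simp add: \<rho> n V' I')
  have V0: "0 < V" using S.V_pos by (simp add: V')
  have n1: "1 \<le> n" unfolding n by (simp add: Suc_leI)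
  \<comment> \<open>The radius at which \<omega> t^n equals k (2\<pi>)^n / V, the mass of the
    density.\<close>
  define t where "t = (real k / \<omega> / \<alpha>) powr (1 / real n)"
  have t': "t = (real k / \<omega> / \<alpha>) powr (1 / real CARD('n))" by (simp add: t_def n)
  have \<omega>0: "0 < \<omega>" and IV: "0 < sqrt (?I / ?V)"
    by (rule S.D_radius[OF k \<omega>' \<alpha>' \<rho>' t']; assumption)+
  have "0 < ?I" using IV S.V_pos by (simp add: zero_less_divide_iff)
  then have \<rho>0: "0 < \<rho>" using S.V_pos by (simp add: \<rho>')
  have main: "\<alpha> * (\<omega> * t ^ (n + 2 * l) * ((real n + real l * q_poly (\<alpha> / (\<rho> * t))) / (real n + 2 * real l))) \<le> (\<Sum>i=1..k. ev i)"
  proof (cases "n = 1")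
    case True
    show ?thesis
      using S.eigenvalue_sum_ge_dim1[OF _ _ k \<omega>' \<alpha>' \<rho>' t'] True ln unfolding n by simp
  next
    case False
    then have "2 \<le> n" using n1 by linarith
    then have "2 \<le> CARD('n)" by (simp only: n)
    from S.eigenvalue_sum_ge_dim2[OF this l _ k \<omega>' \<alpha>' \<rho>' t'] ln show ?thesis unfolding n by simp
  qed
  show ?thesis using bound_eq[OF n1 ln k \<omega>0 V0 \<rho>0 \<alpha> t_def] main
    by (simp only: of_nat_add of_nat_mult of_nat_numeral)
qed

end
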